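(* Let $H$ be a real Hilbert space and let $A$ be a self-adjoint linear operator on $H$ with dense domain $D(A)$. Let $(u_0,u_1)\in D(A)\times D(A^{1/2})$, let $p\in[0,1]$, and let $m:[0,+\infty)\to(0,+\infty)$ be a locally Lipschitz continuous function. Assume that $$\mu:=\inf\{m(\sigma):\sigma\ge 0\}>0,\qquad \nu:=\inf\{\langle Au,u\rangle: u\in D(A),\ |u|=1\}>0 .$$ Then there exists $\varepsilon_0>0$ such that, for every $\varepsilon\in(0,\varepsilon_0)$, the Cauchy problem $$\varepsilon u_\varepsilon''(t)+\frac{1}{(1+t)^p}u_\varepsilon'(t)+m\left(|A^{1/2}u_\varepsilon(t)|^2\right)Au_\varepsilon(t)=0\quad\forall t\ge 0,\qquad u_\varepsilon(0)=u_0,\quad u_\varepsilon'(0)=u_1,$$ has a unique global solution $$u_\varepsilon\in C^2([0,+\infty);H)\cap C^1([0,+\infty);D(A^{1/2}))\cap C^0([0,+\infty);D(A)).$$ Moreover the function $$\Gamma_\varepsilon(t):=|u_\varepsilon(t)|^2+|A^{1/2}u_\varepsilon(t)|^2+|Au_\varepsilon(t)|^2+|u_\varepsilon'(t)|^2+\varepsilon|A^{1/2}u_\varepsilon'(t)|^2$$ satisfies the following decay estimates. - If $p=0$: for every $\beta<2\mu\nu$ there exist $\varepsilon_1\in(0,\varepsilon_0]$ and $C$ such that $\Gamma_\varepsilon(t)\le Ce^{-\beta t}$ for all $t\ge 0$ and all $\varepsilon\in(0,\varepsilon_1)$. - If $p\in(0,1)$: for every $\beta>0$ there exist $\varepsilon_1\in(0,\varepsilon_0]$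 and $C$ such that $\Gamma_\varepsilon(t)\le Ce^{-\beta(1+t)^{1-p}}$ for all $t\ge 0$ and all $\varepsilon\in(0,\varepsilon_1)$. - If $p=1$: for every $\beta>0$ there exist $\varepsilon_1\in(0,\varepsilon_0]$ and $C$ such that $\Gamma_\varepsilon(t)\le \dfrac{C}{(1+t)^\beta}$ for all $t\ge 0$ and all $\varepsilon\in(0,\varepsilon_1)$. (The constants $C$ and $\varepsilon_1$ may depend on $\beta$; $C$ does not depend on $\varepsilon$ or $t$.)
   Context: $|x|$ and $\langle x,y\rangle$ denote the norm and scalar product of $H$. The operator $A$ may be unbounded; since it is self-adjoint and nonnegative, the powers $A^\alpha$ ($\alpha\ge 0$) are defined by the spectral theorem on domains $D(A^\alpha)$, which are endowed with the graph norm. *)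

theory Defs
  imports "HOL-Analysis.Analysis"
begin

text \<open>An operator on a real Hilbert space is given by its domain \<open>D\<close> and a total function \<open>A\<close>
  of which only the values on \<open>D\<close> matter.\<close>

definition linear_operator_on :: "'h::real_inner set \<Rightarrow> ('h \<Rightarrow> 'h) \<Rightarrow> bool" where
  "linear_operator_on D A \<longleftrightarrow> subspace D \<and>
     (\<forall>x\<in>D. \<forall>y\<in>D. A (x + y) = A x + A y) \<and>
     (\<forall>c. \<forall>x\<in>D. A (c *\<^sub>R x) = c *\<^sub>R A x)"

definition adjoint_dom :: "'h::real_inner set \<Rightarrow> ('h \<Rightarrow> 'h) \<Rightarrow> 'h set" where
  "adjoint_dom D A = {y. \<exists>z. \<forall>x\<in>D. A x \<bullet> y = x \<bullet> z}"

definition adjoint_op :: "'h::real_inner set \<Rightarrow> ('h \<Rightarrow> 'h) \<Rightarrow> 'h \<Rightarrow> 'h" where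
  "adjoint_op D A y = (THE z. \<forall>x\<in>D. A x \<bullet> y = x \<bullet> z)"

definition self_adjoint_operator :: "'h::real_inner set \<Rightarrow> ('h \<Rightarrow> 'h) \<Rightarrow> bool" where
  "self_adjoint_operator D A \<longleftrightarrow> linear_operator_on D A \<and> closure D = UNIV \<and>
     adjoint_dom D A = D \<and> (\<forall>x\<in>D. adjoint_op D A x = A x)"


text \<open>Projection-valued measures on the Borel sets of the real line. The values of \<open>E\<close> on
  non-Borel sets are irrelevant.\<close>

definition projection_valued_measure ::
    "(real set \<Rightarrow> 'h::{real_inner,complete_space} \<Rightarrow> 'h) \<Rightarrow> bool" where
  "projection_valued_measure E \<longleftrightarrow>
     (\<forall>S\<in>sets borel. bounded_linear (E S) \<and> (\<forall>x. E S (E S x) = E S x) \<and>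
                     (\<forall>x y. E S x \<bullet> y = x \<bullet> E S y)) \<and>
     (\<forall>x. E UNIV x = x) \<and>
     (\<forall>S\<in>sets borel. \<forall>T\<in>sets borel. \<forall>x. E (S \<inter> T) x = E S (E T x)) \<and>
     (\<forall>F. range F \<subseteq> sets borel \<longrightarrow> disjoint_family F \<longrightarrow>
          (\<forall>x. (\<lambda>n. E (F n) x) sums E (\<Union>n::nat. F n) x))"

definition scalar_spectral_measure ::
    "(real set \<Rightarrow> 'h::{real_inner,complete_space} \<Rightarrow> 'h) \<Rightarrow> 'h \<Rightarrow> real measure" where
  "scalar_spectral_measure E x = measure_of UNIV (sets borel) (\<lambda>S. ennreal (E S x \<bullet> x))"

definition spectral_integral_dom ::
    "(real set \<Rightarrow> 'h::{real_inner,complete_space} \<Rightarrow> 'h) \<Rightarrow> (real \<Rightarrow> real) \<Rightarrow> 'h set" where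
  "spectral_integral_dom E f = {x. integrable (scalar_spectral_measure E x) (\<lambda>s. (f s)\<^sup>2)}"

text \<open>The operator \<open>\<integral> f dE\<close>. The right-hand side is the integral of \<open>f\<close> against the signed measure
  \<open>S \<mapsto> \<langle>E S x, y\<rangle>\<close>, written by polarization. As the domain is dense, testing against its elements
  determines the vector \<open>z\<close>.\<close>

definition spectral_integral ::
    "(real set \<Rightarrow> 'h::{real_inner,complete_space} \<Rightarrow> 'h) \<Rightarrow> (real \<Rightarrow> real) \<Rightarrow> 'h \<Rightarrow> 'h" where
  "spectral_integral E f x = (THE z. \<forall>y\<in>spectral_integral_dom E f.
     z \<bullet> y = ((LINT s|scalar_spectral_measure E (x + y). f s)
            - (LINT s|scalar_spectral_measure E (x - y). f s)) / 4)"

definition is_spectral_measure_of ::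
    "(real set \<Rightarrow> 'h::{real_inner,complete_space} \<Rightarrow> 'h) \<Rightarrow> 'h set \<Rightarrow> ('h \<Rightarrow> 'h) \<Rightarrow> bool" where
  "is_spectral_measure_of E D A \<longleftrightarrow> projection_valued_measure E \<and>
     D = spectral_integral_dom E (\<lambda>s. s) \<and> (\<forall>x\<in>D. A x = spectral_integral E (\<lambda>s. s) x)"

text \<open>For self-adjoint \<open>A\<close> the spectral theorem gives existence of a spectral measure, unique on
  Borel sets, so the constructions below do not depend on the choice.\<close>

definition spectral_measure_of ::
    "'h::{real_inner,complete_space} set \<Rightarrow> ('h \<Rightarrow> 'h) \<Rightarrow> real set \<Rightarrow> 'h \<Rightarrow> 'h" where
  "spectral_measure_of D A = (SOME E. is_spectral_measure_of E D A)"

text \<open>The power \<open>A\<close> to the \<open>1/2\<close>. The operator is meant to be nonnegative, so that the negative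
  half-line, where \<open>sqrt\<close> takes negative values, is a null set of the spectral measure.\<close>

definition op_sqrt_dom ::
    "'h::{real_inner,complete_space} set \<Rightarrow> ('h \<Rightarrow> 'h) \<Rightarrow> 'h set" where
  "op_sqrt_dom D A = spectral_integral_dom (spectral_measure_of D A) sqrt"

definition op_sqrt ::
    "'h::{real_inner,complete_space} set \<Rightarrow> ('h \<Rightarrow> 'h) \<Rightarrow> 'h \<Rightarrow> 'h" where
  "op_sqrt D A = spectral_integral (spectral_measure_of D A) sqrt"


text \<open>Regularity on the half-line \<open>[0, \<infinity>)\<close>; derivatives at \<open>0\<close> are one-sided. Domains of
  operators carry the graph norm.\<close>

definition dt :: "(real \<Rightarrow> 'h::real_normed_vector) \<Rightarrow> real \<Rightarrow> 'h" where
  "dt u t = vector_derivative u (at t within {0..})"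

definition C2_half_line :: "(real \<Rightarrow> 'h::real_normed_vector) \<Rightarrow> bool" where
  "C2_half_line u \<longleftrightarrow>
     (\<forall>t\<ge>0. u differentiable (at t within {0..})) \<and>
     (\<forall>t\<ge>0. dt u differentiable (at t within {0..})) \<and>
     continuous_on {0..} (dt (dt u))"

definition graph_norm :: "('h::real_inner \<Rightarrow> 'h) \<Rightarrow> 'h \<Rightarrow> real" where
  "graph_norm B x = sqrt ((norm x)\<^sup>2 + (norm (B x))\<^sup>2)"

definition C0_graph :: "'h::real_inner set \<Rightarrow> ('h \<Rightarrow> 'h) \<Rightarrow> (real \<Rightarrow> 'h) \<Rightarrow> bool" where
  "C0_graph D B u \<longleftrightarrow> (\<forall>t\<ge>0. u t \<in> D) \<and>
     (\<forall>t\<ge>0. ((\<lambda>s. graph_norm B (u s - u t)) \<longlongrightarrow> 0) (at t within {0..}))"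

definition C1_graph :: "'h::real_inner set \<Rightarrow> ('h \<Rightarrow> 'h) \<Rightarrow> (real \<Rightarrow> 'h) \<Rightarrow> bool" where
  "C1_graph D B u \<longleftrightarrow> (\<forall>t\<ge>0. u t \<in> D) \<and>
     (\<exists>v. C0_graph D B v \<and>
        (\<forall>t\<ge>0. ((\<lambda>s. graph_norm B ((u s - u t) /\<^sub>R (s - t) - v t)) \<longlongrightarrow> 0)
                  (at t within {0..})))"


definition locally_lipschitz_on :: "real set \<Rightarrow> (real \<Rightarrow> real) \<Rightarrow> bool" where
  "locally_lipschitz_on X f \<longleftrightarrow> (\<forall>x\<in>X. \<exists>r>0. \<exists>L. L-lipschitz_on (cball x r \<inter> X) f)"

definition kirchhoff_solution ::
    "'h::{real_inner,complete_space} set \<Rightarrow> ('h \<Rightarrow> 'h) \<Rightarrow> (real \<Rightarrow> real) \<Rightarrow> real \<Rightarrow> 'h \<Rightarrow> 'h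
      \<Rightarrow> real \<Rightarrow> (real \<Rightarrow> 'h) \<Rightarrow> bool" where
  "kirchhoff_solution D A m p u0 u1 \<epsilon> u \<longleftrightarrow>
     C2_half_line u \<and> C1_graph (op_sqrt_dom D A) (op_sqrt D A) u \<and> C0_graph D A u \<and>
     (\<forall>t\<ge>0. \<epsilon> *\<^sub>R dt (dt u) t + (1 / (1 + t) powr p) *\<^sub>R dt u t
              + m ((norm (op_sqrt D A (u t)))\<^sup>2) *\<^sub>R A (u t) = 0) \<and>
     u 0 = u0 \<and> dt u 0 = u1"

definition Gamma_energy ::
    "'h::{real_inner,complete_space} set \<Rightarrow> ('h \<Rightarrow> 'h) \<Rightarrow> real \<Rightarrow> (real \<Rightarrow> 'h) \<Rightarrow> real \<Rightarrow> real" where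
  "Gamma_energy D A \<epsilon> u t =
     (norm (u t))\<^sup>2 + (norm (op_sqrt D A (u t)))\<^sup>2 + (norm (A (u t)))\<^sup>2
     + (norm (dt u t))\<^sup>2 + \<epsilon> * (norm (op_sqrt D A (dt u t)))\<^sup>2"

end

theory Submission
  imports Defs "HOL-Probability.Helly_Selection" "HOL-Real_Asymp.Real_Asymp"
begin

text \<open>The equation is solved on the ranges of the spectral projections \<open>P n = E [-n, n]\<close>, where it is an
  ordinary differential equation with locally Lipschitz nonlinearity. As long as
  \<open>2 \<epsilon> L |Au| |u'| \<le> \<mu> (1 + t)\<^bsup>-p\<^esup>\<close>, the damping absorbs the derivative of the coefficient
  \<open>1 / c\<close>, \<open>c(t) = m(|A\<^bsup>1/2\<^esup> u|\<^sup>2)\<close>, and the energy \<open>F = |Au|\<^sup>2 + \<epsilon> |A\<^bsup>1/2\<^esup> u'|\<^sup>2 / c\<close> does not increase.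
  Adding a multiple of \<open>(K + t)\<^bsup>-p\<^esup> (2 \<epsilon> \<langle>Au, u'\<rangle> + (1 + t)\<^bsup>-p\<^esup> |A\<^bsup>1/2\<^esup> u|\<^sup>2)\<close> turns this into the decay
  \<open>F \<le> C exp (- \<beta> Q)\<close> with \<open>Q' = (K + t)\<^bsup>-p\<^esup>\<close>, which for small \<open>\<epsilon>\<close> reproduces the condition with strict inequality;
  so it holds for all times. The same energy of the components above the \<open>j\<close>-th spectral projection is
  small uniformly in \<open>n\<close>, so the truncated solutions converge in \<open>D(A)\<close>, and the estimates
  pass to the limit.

  The spectral theorem is obtained for the contraction \<open>\<nu> A\<^bsup>-1\<^esup>\<close> by representing its moments
  \<open>\<langle>T\<^sup>k x, x\<rangle>\<close> as in the Hausdorff moment problem.\<close>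

section \<open>Projections and the Riesz representation\<close>

text \<open>The data give no meaning to \<open>A u'\<close> or to the square root of
  \<open>A\<close> applied to \<open>u''\<close>; on the range of \<open>P n\<close> both operators
  are bounded and energies may be differentiated. A second obstacle is that \<open>m\<close> is only
  Lipschitz, so \<open>1/c\<close> has no derivative: one-sided majorants replace it. The root of
  \<open>A\<close> is defined through an arbitrarily chosen spectral measure, so one must exist
  before anything about the root is known, and only properties derived for every spectral measure of
  \<open>A\<close> can be used. Smallness of epsilon is imposed twice: with a fixed rate, which
  yields existence independently of the wanted \<open>\<beta>\<close>, and again with
  \<open>\<beta>\<close>. For \<open>p = 0\<close> the inequality
  \<open>\<beta> (1 + \<gamma> / \<nu>) + 1 \<le> 2 \<gamma> \<mu>\<close> has a solution
  \<open>\<gamma>\<close> exactly when \<open>\<beta> < 2 \<mu> \<nu>\<close>; for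
  \<open>p > 0\<close> the shift \<open>K\<close> makes the term with
  \<open>\<gamma> / \<nu>\<close> as small as desired and no threshold remains. The norm of
  \<open>u'\<close> is controlled only after multiplication by the damping; two extra units of decay
  recover the lost weight.\<close>

lemma minimizing_sequence_Cauchy:
  fixes h :: "'h::real_inner"
  assumes R: "subspace R" and r: "\<And>n. r n \<in> R"
    and d: "\<And>y. y \<in> R \<Longrightarrow> d \<le> (norm (y - h))\<^sup>2"
    and lim: "(\<lambda>n. (norm (r n - h))\<^sup>2) \<longlonglongrightarrow> d"
  shows "Cauchy r"
proof (rule CauchyI)
  fix e :: real assume e: "0 < e"
  define e' where "e' = e\<^sup>2 / 4"
  have e': "e' > 0" using e by (simp add: e'_def)
  obtain N where N: "\<And>n. n \<ge> N \<Longrightarrow> \<bar>(norm (r n - h))\<^sup>2 - d\<bar> < e'"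
    using LIMSEQ_D[OF lim e'] by auto
  show "\<exists>M. \<forall>m\<ge>M. \<forall>n\<ge>M. norm (r m - r n) < e"
  proof (intro exI allI impI)
    fix m n assume mn: "m \<ge> N" "n \<ge> N"
    have "(1/2) *\<^sub>R (r m + r n) \<in> R"
      using R r by (simp add: subspace_add subspace_mul)
    then have "d \<le> (norm ((1/2) *\<^sub>R (r m + r n) - h))\<^sup>2" by (rule d)
    \<comment> \<open>Parallelogram identity for \<open>r m - h\<close> and \<open>r n - h\<close>.
      The midpoint lies in \<open>R\<close>, so its squared distance is at least \<open>d\<close>;
      the other two terms exceed \<open>d\<close> by less than \<open>e'\<close> each, which leaves
      \<open>4 * e'\<close>.\<close>
    moreover have "(norm (r m - r n))\<^sup>2 =
       2 * (norm (r m - h))\<^sup>2 + 2 * (norm (r n - h))\<^sup>2 - 4 * (norm ((1/2) *\<^sub>R (r m + r n) - h))\<^sup>2"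
      by (simp add: power2_norm_eq_inner inner_diff_left inner_diff_right inner_add_left
          inner_add_right inner_commute algebra_simps)
    ultimately have "(norm (r m - r n))\<^sup>2 < e\<^sup>2"
      using N[OF mn(1)] N[OF mn(2)] e'_def unfolding abs_less_iff by linarith
    then show "norm (r m - r n) < e" using e by (simp add: power_less_imp_less_base)
  qed
qed

lemma orthogonal_projection_exists:
  fixes h :: "'h::{real_inner,complete_space}"
  assumes R: "subspace R" and cl: "closed R"
  obtains r where "r \<in> R" "\<And>y. y \<in> R \<Longrightarrow> (h - r) \<bullet> y = 0"
proof -
  define d where "d = (INF y\<in>R. (norm (y - h))\<^sup>2)"
  have ne: "R \<noteq> {}" using R subspace_0 by blast
  have bdd: "bdd_below ((\<lambda>y. (norm (y - h))\<^sup>2) ` R)" by (rule bdd_belowI[of _ 0]) auto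
  have d: "d \<le> (norm (y - h))\<^sup>2" if "y \<in> R" for y
    unfolding d_def by (rule cINF_lower[OF bdd that])
  have "\<exists>y\<in>R. (norm (y - h))\<^sup>2 < d + 1 / Suc n" for n
    using cINF_less_iff[OF ne bdd, of "d + 1 / Suc n"] by (simp add: d_def)
  then obtain r where r: "\<And>n. r n \<in> R" and rd: "\<And>n. (norm (r n - h))\<^sup>2 < d + 1 / Suc n"
    by metis
  have l1: "(\<lambda>n. d + 1 / real (Suc n)) \<longlonglongrightarrow> d + 0"
    by (intro tendsto_intros LIMSEQ_Suc lim_1_over_n)
  have lim: "(\<lambda>n. (norm (r n - h))\<^sup>2) \<longlonglongrightarrow> d"
    by (rule tendsto_sandwich[OF _ _ tendsto_const l1[simplified]])
       (auto intro!: always_eventually d r less_imp_le[OF rd, simplified])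
  obtain z where z: "r \<longlonglongrightarrow> z"
    using minimizing_sequence_Cauchy[OF R r d lim] Cauchy_convergent convergent_def by blast
  have zR: "z \<in> R" using cl r z closed_sequentially by blast
  have "(\<lambda>n. (norm (r n - h))\<^sup>2) \<longlonglongrightarrow> (norm (z - h))\<^sup>2" by (intro tendsto_intros z)
  then have zd: "(norm (z - h))\<^sup>2 = d" using lim LIMSEQ_unique by blast
  have "(h - z) \<bullet> y = 0" if y: "y \<in> R" for y
  proof (cases "y = 0")
    case False
    \<comment> \<open>The value minimizing the squared norm of \<open>z + c y - h\<close>; since
      \<open>z\<close> is already optimal, the gain, a multiple of the squared inner product, must
      vanish.\<close>
    define c where "c = ((h - z) \<bullet> y) / (y \<bullet> y)"
    have "z + c *\<^sub>R y \<in> R" using R zR y by (simp add: subspace_add subspace_mul)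
    then have "d \<le> (norm (z + c *\<^sub>R y - h))\<^sup>2" by (rule d)
    also have "\<dots> = (norm (z - h))\<^sup>2 - 2 * c * ((h - z) \<bullet> y) + c\<^sup>2 * (y \<bullet> y)"
      unfolding power2_norm_eq_inner
      by (simp add: inner_diff_left inner_diff_right inner_add_left
          inner_add_right inner_commute algebra_simps power2_eq_square)
    also have "\<dots> = d - ((h - z) \<bullet> y)\<^sup>2 / (y \<bullet> y)"
      unfolding zd using False by (simp add: c_def power2_eq_square field_simps)
    finally have "((h - z) \<bullet> y)\<^sup>2 / (y \<bullet> y) \<le> 0" by simp
    moreover have "y \<bullet> y > 0" using False by simp
    ultimately show ?thesis by (simp add: divide_le_0_iff)
  qed simp
  then show ?thesis using that zR by blast
qed

text \<open>The kernel is a closed hyperplane. The part of a vector \<open>e\<close> outside the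
  kernel that is orthogonal to it spans the complement, and a multiple of it represents the
  functional.\<close>

lemma riesz_representation:
  fixes \<Lambda> :: "'h::{real_inner,complete_space} \<Rightarrow> real"
  assumes "bounded_linear \<Lambda>"
  shows "\<exists>z. \<forall>y. z \<bullet> y = \<Lambda> y"
proof (cases "\<forall>y. \<Lambda> y = 0")
  case True then show ?thesis by (intro exI[of _ 0]) simp
next
  case False
  then obtain e where e: "\<Lambda> e \<noteq> 0" by blast
  interpret \<Lambda>: bounded_linear \<Lambda> by fact
  define R where "R = {y. \<Lambda> y = 0}"
  have R: "subspace R" by (auto simp: R_def subspace_def \<Lambda>.add \<Lambda>.scaleR)
  have cl: "closed R" unfolding R_def
    by (intro closed_Collect_eq continuous_intros \<Lambda>.continuous_on)
  obtain r where r: "r \<in> R" "\<And>y. y \<in> R \<Longrightarrow> (e - r) \<bullet> y = 0"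
    using orthogonal_projection_exists[OF R cl] by blast
  define n where "n = e - r"
  have n: "\<Lambda> n = \<Lambda> e" using r by (simp add: n_def \<Lambda>.diff R_def)
  have n0: "n \<bullet> n \<noteq> 0" using n e by auto
  have "((\<Lambda> n / (n \<bullet> n)) *\<^sub>R n) \<bullet> y = \<Lambda> y" for y
  proof -
    have "y - (\<Lambda> y / \<Lambda> n) *\<^sub>R n \<in> R" using e n by (simp add: R_def \<Lambda>.diff \<Lambda>.scaleR)
    then have "n \<bullet> (y - (\<Lambda> y / \<Lambda> n) *\<^sub>R n) = 0" using r n_def by blast
    then show ?thesis using n0 e n by (simp add: inner_diff_right field_simps)
  qed
  then show ?thesis by blast
qed

lemma eq_by_inner: "(\<And>y. x \<bullet> y = z \<bullet> y) \<Longrightarrow> x = (z :: 'h::real_inner)"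
  by (metis inner_commute vector_eq_rdot)

section \<open>Functionals continuous under bounded pointwise convergence\<close>

definition bfun :: "(real \<Rightarrow> real) \<Rightarrow> bool" where
  "bfun f \<longleftrightarrow> f \<in> borel_measurable borel \<and> (\<exists>c. \<forall>s. \<bar>f s\<bar> \<le> c)"

lemma bfun_meas[measurable_dest]: "bfun f \<Longrightarrow> f \<in> borel_measurable borel" by (simp add: bfun_def)

lemma bfunI: "f \<in> borel_measurable borel \<Longrightarrow> (\<And>s. \<bar>f s\<bar> \<le> c) \<Longrightarrow> bfun f" by (auto simp: bfun_def)

lemma bfun_bound: assumes "bfun f" shows "\<exists>c\<ge>0. \<forall>s. \<bar>f s\<bar> \<le> c"
proof -
  obtain c where c: "\<And>s. \<bar>f s\<bar> \<le> c" using assms by (auto simp: bfun_def)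
  then show ?thesis using order_trans[OF abs_ge_zero c[of 0]] by auto
qed

lemma bfun_const[simp, intro]: "bfun (\<lambda>s. c)" by (rule bfunI[of _ "\<bar>c\<bar>"]) auto

lemma bfun_ind[simp, intro]: "S \<in> sets borel \<Longrightarrow> bfun (indicator S)"
  by (rule bfunI[of _ 1]) (auto simp: indicator_def)

lemma bfun_add[intro]: assumes "bfun f" "bfun g" shows "bfun (\<lambda>s. f s + g s)"
proof -
  obtain c where "\<And>s. \<bar>f s\<bar> \<le> c" using bfun_bound[OF assms(1)] by auto
  moreover obtain d where "\<And>s. \<bar>g s\<bar> \<le> d" using bfun_bound[OF assms(2)] by auto
  ultimately have "\<bar>f s + g s\<bar> \<le> c + d" for s by (meson abs_triangle_ineq add_mono order_trans)
  moreover have "(\<lambda>s. f s + g s) \<in> borel_measurable borel"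
    using assms[THEN bfun_meas] by measurable
  ultimately show ?thesis by (rule bfunI[rotated])
qed

lemma bfun_mult[intro]: assumes "bfun f" "bfun g" shows "bfun (\<lambda>s. f s * g s)"
proof -
  obtain c where c: "c \<ge> 0" "\<And>s. \<bar>f s\<bar> \<le> c" using bfun_bound[OF assms(1)] by auto
  obtain d where d: "\<And>s. \<bar>g s\<bar> \<le> d" using bfun_bound[OF assms(2)] by auto
  have "\<bar>f s * g s\<bar> \<le> c * d" for s unfolding abs_mult by (intro mult_mono c d abs_ge_zero)
  moreover have "(\<lambda>s. f s * g s) \<in> borel_measurable borel"
    using assms[THEN bfun_meas] by measurable
  ultimately show ?thesis by (rule bfunI[rotated])
qed

lemma bfun_diff[intro]: assumes "bfun f" "bfun g" shows "bfun (\<lambda>s. f s - g s)"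
  using bfun_add[OF assms(1) bfun_mult[OF bfun_const[of "-1"] assms(2)]] by simp

lemma bfun_sum[intro]: "(\<And>i. i \<in> I \<Longrightarrow> bfun (f i)) \<Longrightarrow> bfun (\<lambda>s. \<Sum>i\<in>I. f i s)"
  by (induction I rule: infinite_finite_induct) auto

text \<open>These functionals stand in for finite signed Borel measures. Polarized quadratic forms
  are differences of integrals, and linearity together with bounded pointwise convergence is all
  that the measure-theoretic arguments below require.\<close>

definition bcts :: "((real \<Rightarrow> real) \<Rightarrow> real) \<Rightarrow> bool" where
  "bcts \<Lambda> \<longleftrightarrow> (\<forall>f g. bfun f \<longrightarrow> bfun g \<longrightarrow> \<Lambda> (\<lambda>s. f s + g s) = \<Lambda> f + \<Lambda> g) \<and>
     (\<forall>c f. bfun f \<longrightarrow> \<Lambda> (\<lambda>s. c * f s) = c * \<Lambda> f) \<and>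
     (\<forall>f g c. (\<forall>n::nat. bfun (f n)) \<longrightarrow> (\<forall>n s. \<bar>f n s\<bar> \<le> c) \<longrightarrow> (\<forall>s. (\<lambda>n. f n s) \<longlonglongrightarrow> g s)
        \<longrightarrow> (\<lambda>n. \<Lambda> (f n)) \<longlonglongrightarrow> \<Lambda> g)"

lemma bfun_lim:
  assumes "\<And>n::nat. bfun (f n)" "\<And>n s. \<bar>f n s\<bar> \<le> c" "\<And>s. (\<lambda>n. f n s) \<longlonglongrightarrow> g s"
  shows "bfun g"
proof (rule bfunI)
  show "g \<in> borel_measurable borel"
    by (rule borel_measurable_LIMSEQ_real[of _ f]) (use assms in \<open>auto simp: bfun_def\<close>)
  show "\<bar>g s\<bar> \<le> c" for s
    by (rule LIMSEQ_le_const2[OF tendsto_rabs[OF assms(3)]]) (use assms in auto)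
qed

lemma bcts_addD: "bcts \<Lambda> \<Longrightarrow> bfun f \<Longrightarrow> bfun g \<Longrightarrow> \<Lambda> (\<lambda>s. f s + g s) = \<Lambda> f + \<Lambda> g"
  and bcts_scaleD: "bcts \<Lambda> \<Longrightarrow> bfun f \<Longrightarrow> \<Lambda> (\<lambda>s. c * f s) = c * \<Lambda> f"
  and bcts_limD: "bcts \<Lambda> \<Longrightarrow> (\<And>n::nat. bfun (f' n)) \<Longrightarrow> (\<And>n s. \<bar>f' n s\<bar> \<le> c) \<Longrightarrow>
      (\<And>s. (\<lambda>n. f' n s) \<longlonglongrightarrow> g s) \<Longrightarrow> (\<lambda>n. \<Lambda> (f' n)) \<longlonglongrightarrow> \<Lambda> g"
  unfolding bcts_def by blast+

lemma bcts_sumD: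
  assumes "bcts \<Lambda>" "finite I" "\<And>i. i \<in> I \<Longrightarrow> bfun (f i)"
  shows "\<Lambda> (\<lambda>s. \<Sum>i\<in>I. c i * f i s) = (\<Sum>i\<in>I. c i * \<Lambda> (f i))"
  using assms(2,3)
proof (induction I rule: finite_induct)
  case empty
  have "\<Lambda> (\<lambda>s. 0 * (0::real)) = 0 * \<Lambda> (\<lambda>s. 0)" using assms(1) by (intro bcts_scaleD) auto
  then show ?case by simp
next
  case (insert i I)
  then have "\<Lambda> (\<lambda>s. c i * f i s + (\<Sum>i\<in>I. c i * f i s)) = \<Lambda> (\<lambda>s. c i * f i s) + \<Lambda> (\<lambda>s. \<Sum>i\<in>I. c i * f i s)"
    by (intro bcts_addD assms(1) bfun_sum bfun_mult bfun_const) auto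
  then show ?case using insert bcts_scaleD[OF assms(1), of "f i" "c i"] by simp
qed

lemma bcts_integral:
  assumes "finite_measure M" "sets M = sets borel"
  shows "bcts (\<lambda>f. \<integral>s. f s \<partial>M)"
proof -
  interpret finite_measure M by fact
  note [measurable_cong] = assms(2)
  have int: "integrable M f" if "bfun f" for f
  proof -
    obtain c where "\<And>s. \<bar>f s\<bar> \<le> c" using bfun_bound[OF \<open>bfun f\<close>] by auto
    then show ?thesis using \<open>bfun f\<close> by (intro integrable_const_bound[of _ c]) auto
  qed
  show ?thesis unfolding bcts_def
  proof (intro conjI allI impI)
    fix f :: "nat \<Rightarrow> real \<Rightarrow> real" and g c
    assume f: "\<forall>n. bfun (f n)" and c: "\<forall>n s. \<bar>f n s\<bar> \<le> c" and l: "\<forall>s. (\<lambda>n. f n s) \<longlonglongrightarrow> g s"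
    have "bfun g" using bfun_lim f c l by blast
    moreover have "f n \<in> borel_measurable M" for n using bfun_meas[of "f n"] f by (simp add: measurable_cong_sets[OF assms(2) refl])
    ultimately show "(\<lambda>n. \<integral>s. f n s \<partial>M) \<longlonglongrightarrow> (\<integral>s. g s \<partial>M)"
      using c l by (intro integral_dominated_convergence[where w="\<lambda>s. c"]) auto
  qed (auto simp: int)
qed

lemma integrable_bfun:
  assumes "finite_measure M" "sets M = sets borel" "bfun f"
  shows "integrable M f"
proof -
  interpret finite_measure M by fact
  note [measurable_cong] = assms(2)
  obtain c where "\<And>s. \<bar>f s\<bar> \<le> c" using bfun_bound[OF \<open>bfun f\<close>] by auto
  then show ?thesis using \<open>bfun f\<close> by (intro integrable_const_bound[of _ c]) auto
qed

lemma bcts_plus: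
  assumes "bcts \<Lambda>" "bcts \<Lambda>'" shows "bcts (\<lambda>f. \<Lambda> f + \<Lambda>' f)"
  unfolding bcts_def
proof (intro conjI allI impI)
  fix f g and c :: real
  assume f: "\<forall>n::nat. bfun (f n)" "\<forall>n s. \<bar>f n s\<bar> \<le> c" "\<forall>s. (\<lambda>n. f n s) \<longlonglongrightarrow> g s"
  note f' = f(1)[THEN spec] f(2)[THEN spec, THEN spec] f(3)[THEN spec]
  have "(\<lambda>n. \<Lambda> (f n)) \<longlonglongrightarrow> \<Lambda> g" "(\<lambda>n. \<Lambda>' (f n)) \<longlonglongrightarrow> \<Lambda>' g"
    by (rule bcts_limD[OF assms(1) f'], rule bcts_limD[OF assms(2) f'])
  then show "(\<lambda>n. \<Lambda> (f n) + \<Lambda>' (f n)) \<longlonglongrightarrow> \<Lambda> g + \<Lambda>' g"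
    by (rule tendsto_add)
qed (simp_all add: bcts_addD[OF assms(1)] bcts_addD[OF assms(2)] bcts_scaleD[OF assms(1)]
      bcts_scaleD[OF assms(2)] algebra_simps)

lemma bcts_cmult:
  assumes "bcts \<Lambda>" shows "bcts (\<lambda>f. c * \<Lambda> f)"
  unfolding bcts_def
proof (intro conjI allI impI)
  fix f g and d :: real
  assume f: "\<forall>n::nat. bfun (f n)" "\<forall>n s. \<bar>f n s\<bar> \<le> d" "\<forall>s. (\<lambda>n. f n s) \<longlonglongrightarrow> g s"
  have "(\<lambda>n. \<Lambda> (f n)) \<longlonglongrightarrow> \<Lambda> g"
    by (rule bcts_limD[OF assms f(1)[THEN spec] f(2)[THEN spec, THEN spec] f(3)[THEN spec]])
  then show "(\<lambda>n. c * \<Lambda> (f n)) \<longlonglongrightarrow> c * \<Lambda> g"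
    by (rule tendsto_mult_left)
qed (simp_all add: bcts_addD[OF assms] bcts_scaleD[OF assms] algebra_simps)

lemma bcts_minus:
  assumes "bcts \<Lambda>" "bcts \<Lambda>'" shows "bcts (\<lambda>f. \<Lambda> f - \<Lambda>' f)"
  using bcts_plus[OF assms(1) bcts_cmult[OF assms(2), of "-1"]] by simp

lemma bcts_divide:
  assumes "bcts \<Lambda>" shows "bcts (\<lambda>f. \<Lambda> f / c)"
  using bcts_cmult[OF assms, of "inverse c"] by (simp add: divide_inverse mult.commute)

text \<open>Corresponds to passing to the measure with bounded density \<open>q\<close>. In the
  proofs of multiplicativity it holds one factor fixed while the other varies.\<close>

lemma bcts_premult:
  assumes "bcts \<Lambda>" "bfun q" shows "bcts (\<lambda>f. \<Lambda> (\<lambda>s. q s * f s))"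
  unfolding bcts_def
proof (intro conjI allI impI)
  fix f g :: "real \<Rightarrow> real" assume "bfun f" "bfun g"
  then have "\<Lambda> (\<lambda>s. q s * f s + q s * g s) = \<Lambda> (\<lambda>s. q s * f s) + \<Lambda> (\<lambda>s. q s * g s)"
    using assms by (intro bcts_addD) auto
  then show "\<Lambda> (\<lambda>s. q s * (f s + g s)) = \<Lambda> (\<lambda>s. q s * f s) + \<Lambda> (\<lambda>s. q s * g s)"
    by (simp add: algebra_simps)
next
  fix c and f :: "real \<Rightarrow> real" assume "bfun f"
  then have "\<Lambda> (\<lambda>s. c * (q s * f s)) = c * \<Lambda> (\<lambda>s. q s * f s)"
    using assms by (intro bcts_scaleD) auto
  then show "\<Lambda> (\<lambda>s. q s * (c * f s)) = c * \<Lambda> (\<lambda>s. q s * f s)" by (simp add: algebra_simps)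
next
  fix f :: "nat \<Rightarrow> real \<Rightarrow> real" and g c
  assume f: "\<forall>n. bfun (f n)" and c: "\<forall>n s. \<bar>f n s\<bar> \<le> c" and l: "\<forall>s. (\<lambda>n. f n s) \<longlonglongrightarrow> g s"
  obtain d where d: "d \<ge> 0" "\<And>s. \<bar>q s\<bar> \<le> d" using bfun_bound[OF assms(2)] by auto
  have "\<bar>q s * f n s\<bar> \<le> d * c" for n s
    using d c by (auto simp: abs_mult intro!: mult_mono)
  then show "(\<lambda>n. \<Lambda> (\<lambda>s. q s * f n s)) \<longlonglongrightarrow> \<Lambda> (\<lambda>s. q s * g s)"
    using assms f l by (intro bcts_limD[OF assms(1)]) (auto intro!: tendsto_mult_left)
qed

text \<open>Simple functions converging to \<open>f\<close> can be chosen with absolute value at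
  most twice that of \<open>f\<close>, so the convergence is bounded and passes through the
  functional.\<close>

lemma bcts_zero_on_bfun:
  assumes \<Lambda>: "bcts \<Lambda>" and ind: "\<And>S. S \<in> sets borel \<Longrightarrow> \<Lambda> (indicator S) = 0" and f: "bfun f"
  shows "\<Lambda> f = 0"
proof -
  have simp_fun: "\<Lambda> g = 0" if g: "simple_function borel g" for g
  proof -
    have fin: "finite (range g)" using g by (simp add: simple_function_def)
    have "g = (\<lambda>s. \<Sum>c\<in>range g. c * indicator (g -` {c}) s)"
    proof
      fix s
      have "(\<Sum>c\<in>range g. c * indicator (g -` {c}) s) = (\<Sum>c\<in>range g. if c = g s then c else 0)"
        by (intro sum.cong) (auto simp: indicator_def)
      then show "g s = (\<Sum>c\<in>range g. c * indicator (g -` {c}) s)" using fin by simp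
    qed
    moreover have meas: "g -` {c} \<in> sets borel" for c
      using measurable_sets[OF borel_measurable_simple_function[OF g], of "{c}"] by simp
    ultimately have "\<Lambda> g = (\<Sum>c\<in>range g. c * \<Lambda> (indicator (g -` {c})))"
      using bcts_sumD[OF \<Lambda> fin, of "\<lambda>c. indicator (g -` {c})" "\<lambda>c. c"] by (metis bfun_ind)
    then show ?thesis using ind meas by simp
  qed
  obtain F where F: "\<And>i. simple_function borel (F i)" "\<And>s. (\<lambda>i. F i s) \<longlonglongrightarrow> f s"
     "\<And>i s. dist (F i s) 0 \<le> 2 * dist (f s) 0"
    using borel_measurable_implies_sequence_metric[OF bfun_meas[OF f], of 0] by auto
  obtain c where c: "\<And>s. \<bar>f s\<bar> \<le> c" using bfun_bound[OF f] by auto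
  have b: "\<bar>F i s\<bar> \<le> 2 * c" for i s using F(3)[of i s] c[of s] by (simp add: dist_real_def)
  have "bfun (F i)" for i
    by (rule bfunI[OF _ b]) (use F(1) borel_measurable_simple_function in auto)
  then have "(\<lambda>i. \<Lambda> (F i)) \<longlonglongrightarrow> \<Lambda> f" using b F(2) by (intro bcts_limD[OF \<Lambda>])
  then show ?thesis using simp_fun[OF F(1)] by (simp add: LIMSEQ_const_iff)
qed

lemma bcts_eq_indicator:
  assumes "bcts \<Lambda>" "bcts \<Lambda>'" "\<And>S. S \<in> sets borel \<Longrightarrow> \<Lambda> (indicator S) = \<Lambda>' (indicator S)" "bfun f"
  shows "\<Lambda> f = \<Lambda>' f"
  using bcts_zero_on_bfun[OF bcts_minus[OF assms(1,2)] _ assms(4)] assms(3) by simp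

section \<open>Uniqueness in the moment problem on \<open>[0, 1]\<close>\<close>

definition clamp01 :: "real \<Rightarrow> real" where "clamp01 s = max 0 (min 1 s)"

lemma clamp01_range: "0 \<le> clamp01 s" "clamp01 s \<le> 1" by (auto simp: clamp01_def)
lemma clamp01_id: "0 \<le> s \<Longrightarrow> s \<le> 1 \<Longrightarrow> clamp01 s = s" by (auto simp: clamp01_def)
lemma clamp01_meas[measurable]: "clamp01 \<in> borel_measurable borel"
  unfolding clamp01_def[abs_def] by measurable
lemma clamp01_cont[continuous_intros]: "continuous_on S f \<Longrightarrow> continuous_on S (\<lambda>x. clamp01 (f x))"
  unfolding clamp01_def by (intro continuous_intros)

lemma bfun_clamp_pow[simp, intro]: "bfun (\<lambda>s. clamp01 s ^ k)"
proof (rule bfunI)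
  show "\<bar>clamp01 s ^ k\<bar> \<le> 1" for s
    using clamp01_range[of s] by (simp add: power_le_one)
qed measurable

lemma bfun_one_minus_clamp_pow[simp, intro]: "bfun (\<lambda>s. clamp01 s ^ j * (1 - clamp01 s) ^ k)"
proof (rule bfun_mult[OF bfun_clamp_pow bfunI])
  show "\<bar>(1 - clamp01 s) ^ k\<bar> \<le> 1" for s
    using clamp01_range[of s] by (simp add: power_le_one)
qed measurable

text \<open>Invariance under \<open>clamp01\<close> expresses that a functional is carried by
  \<open>[0, 1]\<close>, and powers of \<open>clamp01\<close> stay bounded on the whole line.
  Equality spreads from polynomials to continuous functions by Bernstein approximation, to
  half-lines by continuous ramps, to Borel sets by a pi-lambda argument, and finally to bounded
  Borel functions.\<close>

lemma bcts_eq_moments: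
  assumes L1: "bcts \<Lambda>1" and L2: "bcts \<Lambda>2"
    and cl: "\<And>f. bfun f \<Longrightarrow> \<Lambda>1 f = \<Lambda>1 (\<lambda>s. f (clamp01 s))" "\<And>f. bfun f \<Longrightarrow> \<Lambda>2 f = \<Lambda>2 (\<lambda>s. f (clamp01 s))"
    and mom: "\<And>k. \<Lambda>1 (\<lambda>s. clamp01 s ^ k) = \<Lambda>2 (\<lambda>s. clamp01 s ^ k)" and f: "bfun f"
  shows "\<Lambda>1 f = \<Lambda>2 f"
proof -
  define \<Lambda> where "\<Lambda> f = \<Lambda>1 f - \<Lambda>2 f" for f
  have L: "bcts \<Lambda>" unfolding \<Lambda>_def[abs_def] by (rule bcts_minus[OF L1 L2])
  have clL: "\<Lambda> f = \<Lambda> (\<lambda>s. f (clamp01 s))" if "bfun f" for f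
    using cl[OF that] by (simp add: \<Lambda>_def)
  have m0: "\<Lambda> (\<lambda>s. clamp01 s ^ k) = 0" for k using mom by (simp add: \<Lambda>_def)
  \<comment> \<open>Expanding one factor \<open>1 - clamp01 s\<close> raises \<open>j\<close>, hence
    the induction on \<open>k\<close> with \<open>j\<close> arbitrary; Bernstein polynomials are
    combinations of these products.\<close>
  have bern: "\<Lambda> (\<lambda>s. clamp01 s ^ j * (1 - clamp01 s) ^ k) = 0" for j k
  proof (induction k arbitrary: j)
    case 0 then show ?case using m0 by simp
  next
    case (Suc k)
    let ?f = "\<lambda>s. clamp01 s ^ j * (1 - clamp01 s) ^ k"
    let ?g = "\<lambda>s. clamp01 s ^ Suc j * (1 - clamp01 s) ^ k"
    have e: "(\<lambda>s. clamp01 s ^ j * (1 - clamp01 s) ^ Suc k) = (\<lambda>s. ?f s + (-1) * ?g s)"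
      by (auto simp: algebra_simps fun_eq_iff)
    have "\<Lambda> (\<lambda>s. ?f s + (-1) * ?g s) = \<Lambda> ?f + \<Lambda> (\<lambda>s. (-1) * ?g s)"
      by (rule bcts_addD[OF L bfun_one_minus_clamp_pow bfun_mult[OF bfun_const bfun_one_minus_clamp_pow]])
    moreover have "\<Lambda> (\<lambda>s. (-1) * ?g s) = (-1) * \<Lambda> ?g"
      by (rule bcts_scaleD[OF L bfun_one_minus_clamp_pow])
    ultimately show ?case unfolding e by (simp only: Suc.IH mult_zero_right add_0_right)
  qed
  have contf: "\<Lambda> g = 0" if g: "continuous_on {0..1} g" "bfun g" for g
  proof -
    have "\<exists>N. \<forall>n x. N \<le> n \<and> x \<in> {0..1} \<longrightarrow> \<bar>g x - (\<Sum>k\<le>n. g (k/n) * Bernstein n k x)\<bar> < 1 / Suc j" for j :: nat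
      by (rule Bernstein_Weierstrass[OF g(1)]) simp
    then obtain N where N: "\<And>j n x. N j \<le> n \<Longrightarrow> x \<in> {0..1} \<Longrightarrow> \<bar>g x - (\<Sum>k\<le>n. g (k/n) * Bernstein n k x)\<bar> < 1 / Suc j"
      by metis
    define F where "F j s = (\<Sum>k\<le>N j. g (k / N j) * real (N j choose k) * (clamp01 s ^ k * (1 - clamp01 s) ^ (N j - k)))" for j s
    have FN: "\<bar>g (clamp01 s) - F j s\<bar> < 1 / Suc j" for j s
      using N[of j "N j" "clamp01 s"] clamp01_range[of s] unfolding F_def Bernstein_def by (simp add: mult_ac)
    have LF: "\<Lambda> (F j) = 0" for j
      unfolding F_def using bern by (subst bcts_sumD[OF L]) auto
    obtain c where c: "\<And>s. \<bar>g s\<bar> \<le> c" using bfun_bound[OF g(2)] by auto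
    have "\<bar>F j s\<bar> \<le> c + 1" for j s
    proof -
      have "1 / real (Suc j) \<le> 1" by simp
      then show ?thesis using FN[of s j] c[of "clamp01 s"] by linarith
    qed
    moreover have "bfun (F j)" for j unfolding F_def
      by (rule bfun_sum, rule bfun_mult[OF bfun_const bfun_one_minus_clamp_pow])
    moreover have "(\<lambda>j. F j s) \<longlonglongrightarrow> g (clamp01 s)" for s
    proof -
      have l0: "(\<lambda>j. 1 / real (Suc j)) \<longlonglongrightarrow> 0" using LIMSEQ_Suc[OF lim_1_over_n] by simp
      have "norm (F j s - g (clamp01 s)) \<le> 1 / real (Suc j)" for j
        using FN[of s j] unfolding real_norm_def by (subst abs_minus_commute) (rule less_imp_le)
      then have "\<forall>j. norm (F j s - g (clamp01 s)) \<le> 1 / real (Suc j)" by blast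
      then have "(\<lambda>j. F j s - g (clamp01 s)) \<longlonglongrightarrow> 0"
        by (rule Lim_null_comparison[OF always_eventually l0])
      then show ?thesis by (simp add: LIM_zero_iff)
    qed
    ultimately have "(\<lambda>j. \<Lambda> (F j)) \<longlonglongrightarrow> \<Lambda> (\<lambda>s. g (clamp01 s))" by (intro bcts_limD[OF L])
    then show ?thesis using LF clL[OF g(2)] by (simp add: LIMSEQ_const_iff)
  qed
  have half: "\<Lambda> (indicator {..a}) = 0" for a :: real
  proof -
    \<comment> \<open>For positive \<open>n\<close> a ramp that falls from 1 to 0 on
      \<open>[a, a + 1/n]\<close>; these decrease to the indicator of the half-line.\<close>
    define F where "F n s = max 0 (min 1 (1 - real n * (s - a)))" for n s
    have b: "\<bar>F n s\<bar> \<le> 1" for n s by (auto simp: F_def)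
    have bf: "bfun (F n)" for n by (rule bfunI[OF _ b]) (simp add: F_def[abs_def])
    have lim: "(\<lambda>n. F n s) \<longlonglongrightarrow> indicator {..a} s" for s
    proof (cases "s \<le> a")
      case True
      then have "real n * (s - a) \<le> 0" for n by (simp add: mult_nonneg_nonpos)
      then have "F n s = 1" for n unfolding F_def by (simp add: max_def min_def)
      then show ?thesis using True by simp
    next
      case False
      obtain n0 where n0: "1 / (s - a) < real n0" using reals_Archimedean2 by blast
      have "F n s = 0" if "n \<ge> n0" for n
      proof -
        have "1 / (s - a) < real n" using n0 that by linarith
        then have "1 < real n * (s - a)" using False by (simp add: field_simps)
        then show ?thesis by (auto simp: F_def)
      qed
      then have "eventually (\<lambda>n. F n s = indicator {..a} s) sequentially"
        using False by (auto simp: eventually_sequentially)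
      then show ?thesis by (rule tendsto_eventually)
    qed
    have "(\<lambda>n. \<Lambda> (F n)) \<longlonglongrightarrow> \<Lambda> (indicator {..a})"
      by (rule bcts_limD[OF L bf b lim])
    moreover have "\<Lambda> (F n) = 0" for n
      by (rule contf[OF _ bf]) (auto simp: F_def intro!: continuous_intros)
    ultimately show ?thesis by (simp add: LIMSEQ_const_iff)
  qed
  have ind: "\<Lambda> (indicator S) = 0" if "S \<in> sets borel" for S :: "real set"
  proof -
    have "Int_stable (range (\<lambda>a::real. {..a}))"
      by (auto simp: Int_stable_def)
    moreover have "range (\<lambda>a::real. {..a}) \<subseteq> Pow UNIV" by simp
    moreover have S: "S \<in> sigma_sets UNIV (range (\<lambda>a::real. {..a}))"
      using that by (simp add: borel_eq_atMost)
    ultimately show ?thesis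
    proof (induction rule: sigma_sets_induct_disjoint)
      case (basic A) then show ?case using half by auto
    next
      case empty
      show ?case using bcts_scaleD[OF L, of "\<lambda>s. 0" 0] by (simp add: indicator_def[abs_def])
    next
      case (compl A)
      then have A: "A \<in> sets borel" by (simp add: borel_eq_atMost)
      have "\<Lambda> (\<lambda>s. 1 + (-1) * indicator A s) = \<Lambda> (\<lambda>s. 1) + \<Lambda> (\<lambda>s. (-1) * indicator A s)"
        by (rule bcts_addD[OF L bfun_const bfun_mult[OF bfun_const bfun_ind[OF A]]])
      moreover have "\<Lambda> (\<lambda>s. (-1) * indicator A s) = - 1 * \<Lambda> (indicator A)" by (rule bcts_scaleD[OF L bfun_ind[OF A]])
      moreover have "(\<lambda>s. 1 + (-1) * indicator A s) = (indicator (UNIV - A) :: real \<Rightarrow> real)"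
        by (auto simp: indicator_def)
      ultimately show ?case using m0[of 0] compl by simp
    next
      case (union A)
      then have A: "A i \<in> sets borel" for i by (auto simp: borel_eq_atMost)
      define F where "F n s = (\<Sum>i<n. 1 * indicator (A i) s :: real)" for n s
      have FI: "F n s = indicator (\<Union>i<n. A i) s" for n s
        unfolding F_def using union(1)
        by (subst indicator_UN_disjoint) (auto simp: disjoint_family_on_def)
      have "(\<lambda>n. \<Lambda> (F n)) \<longlonglongrightarrow> \<Lambda> (indicator (\<Union>i. A i))"
      proof (rule bcts_limD[OF L, of _ 1])
        show "bfun (F n)" for n unfolding F_def
          by (rule bfun_sum, rule bfun_mult[OF bfun_const bfun_ind[OF A]])
        show "\<bar>F n s\<bar> \<le> 1" for n s unfolding FI by (auto simp: indicator_def)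
        show "(\<lambda>n. F n s) \<longlonglongrightarrow> indicator (\<Union>i. A i) s" for s
          unfolding FI by (rule LIMSEQ_indicator_UN)
      qed
      moreover have "\<Lambda> (F n) = 0" for n
        unfolding F_def bcts_sumD[OF L finite_lessThan bfun_ind[OF A], where c="\<lambda>_. 1"] using union by simp
      ultimately show ?case by (simp add: LIMSEQ_const_iff)
    qed
  qed
  show ?thesis using bcts_zero_on_bfun[OF L ind f] by (simp add: \<Lambda>_def)
qed

section \<open>The moment functionals of a positive contraction\<close>

text \<open>The two form inequalities place the spectrum of \<open>T\<close> in
  \<open>[0, 1]\<close>, so that the numbers \<open>(T ^^ k) x \<bullet> x\<close> are candidates
  for the moments of a measure there.\<close>

locale positive_contraction =
  fixes T :: "'h::{real_inner,complete_space} \<Rightarrow> 'h"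
  assumes bl: "bounded_linear T" and sym: "T x \<bullet> y = x \<bullet> T y"
    and pos: "0 \<le> T x \<bullet> x" and le1: "T x \<bullet> x \<le> x \<bullet> x"
begin

sublocale bounded_linear T by (rule bl)

definition U where "U x = x - T x"

lemma TU: "T (U x) = U (T x)" by (simp add: U_def diff)
lemma U_sym: "U x \<bullet> y = x \<bullet> U y" by (simp add: U_def inner_diff_left inner_diff_right sym)
lemma U_pos: "0 \<le> U x \<bullet> x" using le1[of x] by (simp add: U_def inner_diff_left)
lemma T_pow_linear: "linear (T ^^ k)"
proof (induction k)
  case 0 then show ?case by (simp add: linear_id[unfolded id_def])
next
  case (Suc k) then show ?case using linear_compose[OF Suc linear_axioms] by (simp add: comp_def)
qed

lemma TU_pow: "T ((U ^^ k) x) = (U ^^ k) (T x)"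
  by (induction k arbitrary: x) (simp_all add: TU)

lemma UT_pow: "U ((T ^^ k) x) = (T ^^ k) (U x)"
  by (induction k arbitrary: x) (simp_all add: TU[symmetric])

text \<open>The Bernstein weights \<open>\<langle>W n j x, x\<rangle>\<close> put mass at \<open>j / n\<close>; the limit measure has moments \<open>\<langle>T\<^sup>k x, x\<rangle>\<close>.\<close>

definition V where "V j k x = (T ^^ j) ((U ^^ k) x)"

lemma V_Suc1: "V (Suc j) k x = T (V j k x)" by (simp add: V_def)
lemma V_Suc1': "V (Suc j) k x = V j k (T x)" by (simp add: V_def funpow_swap1 TU_pow)
lemma V_Suc2: "V j (Suc k) x = U (V j k x)" by (simp add: V_def UT_pow)
lemma V_Suc2': "V j (Suc k) x = V j k (U x)" by (simp add: V_def funpow_swap1)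
lemma V_0: "V 0 0 x = x" by (simp add: V_def)

text \<open>Hausdorff's positivity condition for the moments. Moving one factor \<open>T\<close> or
  \<open>U\<close> across the inner product lowers an exponent by two and replaces \<open>x\<close>
  by \<open>T x\<close> or \<open>U x\<close>; only exponents 0 and 1 remain, and the mixed one uses
  \<open>T + U = 1\<close>.\<close>

lemma V_pos: "0 \<le> V j k x \<bullet> x"
proof (induction "j + k" arbitrary: j k x rule: less_induct)
  case less
  consider j' where "j = Suc (Suc j')" | k' where "k = Suc (Suc k')" | "j \<le> 1" "k \<le> 1"
    by (cases j; cases "j - 1"; cases k; cases "k - 1") auto
  then show ?case
  proof cases
    case 1
    then have "0 \<le> V j' k (T x) \<bullet> T x" by (intro less) simp
    also have "\<dots> = V j k x \<bullet> x" unfolding 1 by (metis V_Suc1 V_Suc1' sym)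
    finally show ?thesis .
  next
    case 2
    then have "0 \<le> V j k' (U x) \<bullet> U x" by (intro less) simp
    also have "\<dots> = V j k x \<bullet> x" unfolding 2 by (metis V_Suc2 V_Suc2' U_sym)
    finally show ?thesis .
  next
    case 3
    then consider "j = 0" "k = 0" | "j = Suc 0" "k = 0" | "j = 0" "k = Suc 0" | "j = Suc 0" "k = Suc 0"
      by linarith
    then show ?thesis
    proof cases
      case 1 then show ?thesis by (simp add: V_0)
    next
      case 2 then show ?thesis by (simp add: V_Suc1 V_0 pos)
    next
      case 3 then show ?thesis by (simp add: V_Suc2 V_0 U_pos)
    next
      case 4
      \<comment> \<open>\<open>TU = TUT + UTU\<close> since \<open>T + U = 1\<close>\<close>
      have "V j k x \<bullet> x = T (U x) \<bullet> (T x + U x)" by (simp add: 4 V_Suc1 V_Suc2 V_0 U_def diff)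
      also have "\<dots> = U (T x) \<bullet> T x + T (U x) \<bullet> U x" by (simp add: inner_add_right TU)
      also have "\<dots> \<ge> 0" by (intro add_nonneg_nonneg U_pos pos)
      finally show ?thesis .
    qed
  qed
qed

definition W where "W n j x = real (n choose j) *\<^sub>R V j (n - j) x"

lemma W_pos: "0 \<le> W n j x \<bullet> x" by (simp add: W_def V_pos)

text \<open>Pascal's rule in summed form; the part coming from \<open>n choose (j - 1)\<close> is
  reindexed.\<close>

lemma binomial_sum_Suc:
  fixes f :: "nat \<Rightarrow> 'b::real_vector"
  shows "(\<Sum>j\<le>Suc n. real (Suc n choose j) *\<^sub>R f j) = (\<Sum>j\<le>n. real (n choose j) *\<^sub>R (f (Suc j) + f j))"
proof -
  have "(\<Sum>j\<le>Suc n. real (n choose j) *\<^sub>R f j) = (\<Sum>j\<le>n. real (n choose j) *\<^sub>R f j)"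
    by (simp add: binomial_eq_0)
  moreover have "(\<Sum>j\<le>Suc n. real (n choose j) *\<^sub>R f j) = f 0 + (\<Sum>j\<le>n. real (n choose Suc j) *\<^sub>R f (Suc j))"
    by (subst sum.atMost_Suc_shift) simp
  moreover have "(\<Sum>j\<le>Suc n. real (Suc n choose j) *\<^sub>R f j)
     = f 0 + (\<Sum>j\<le>n. real (n choose j) *\<^sub>R f (Suc j)) + (\<Sum>j\<le>n. real (n choose Suc j) *\<^sub>R f (Suc j))"
    by (subst sum.atMost_Suc_shift) (simp add: scaleR_add_left sum.distrib)
  ultimately show ?thesis by (simp add: scaleR_add_right sum.distrib del: sum.atMost_Suc)
qed

text \<open>Binomial expansion of the \<open>n\<close>-th power of \<open>T + U\<close>, which is
  the identity. Hence the Bernstein weights have total mass \<open>x \<bullet> x\<close>.\<close>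

lemma sum_W: "(\<Sum>j\<le>n. W n j x) = x"
proof (induction n)
  case 0 then show ?case by (simp add: W_def V_0)
next
  case (Suc n)
  have "(\<Sum>j\<le>Suc n. W (Suc n) j x) = (\<Sum>j\<le>n. real (n choose j) *\<^sub>R (V (Suc j) (Suc n - Suc j) x + V j (Suc n - j) x))"
    unfolding W_def by (rule binomial_sum_Suc)
  also have "\<dots> = (\<Sum>j\<le>n. W n j x)"
  proof (rule sum.cong[OF refl])
    fix j assume "j \<in> {..n}"
    then have "V j (Suc n - j) x = U (V j (n - j) x)" by (simp add: Suc_diff_le V_Suc2)
    then show "real (n choose j) *\<^sub>R (V (Suc j) (Suc n - Suc j) x + V j (Suc n - j) x) = W n j x"
      by (simp add: V_Suc1 W_def U_def)
  qed
  finally show ?case using Suc by simp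
qed

text \<open>Induction on \<open>k\<close> through the absorption identity: a factor \<open>j\<close>
  in front of \<open>W (Suc n) j\<close> turns into \<open>Suc n\<close> and \<open>T\<close>
  applied to \<open>W n (j - 1)\<close>. Reindexing shifts numerator and denominator of the nodes by
  one, which is why arbitrary shifts \<open>i\<close> and \<open>l\<close> are carried
  along.\<close>

lemma bernstein_moments:
  "(\<lambda>n. \<Sum>j\<le>n. ((real j + real i) / (real n + real l)) ^ k *\<^sub>R W n j x) \<longlonglongrightarrow> (T ^^ k) x"
proof (induction k arbitrary: i l x)
  case 0 then show ?case by (simp add: sum_W)
next
  case (Suc k)
  let ?c = "\<lambda>n j. (real j + real i) / (real (Suc n) + real l)"
  have eq: "(\<Sum>j\<le>Suc n. ?c n j ^ Suc k *\<^sub>R W (Suc n) j x)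
     = (real (Suc n) / (real (Suc n) + real l)) *\<^sub>R T (\<Sum>j\<le>n. ((real j + real (Suc i)) / (real n + real (Suc l))) ^ k *\<^sub>R W n j x)
     + (real i / (real (Suc n) + real l)) *\<^sub>R (\<Sum>j\<le>Suc n. ?c n j ^ k *\<^sub>R W (Suc n) j x)" for n
  proof -
    have "(\<Sum>j\<le>Suc n. ?c n j ^ Suc k *\<^sub>R W (Suc n) j x) =
       (\<Sum>j\<le>Suc n. (?c n j ^ k * (real j / (real (Suc n) + real l))) *\<^sub>R W (Suc n) j x)
       + (\<Sum>j\<le>Suc n. (?c n j ^ k * (real i / (real (Suc n) + real l))) *\<^sub>R W (Suc n) j x)"
      unfolding sum.distrib[symmetric] scaleR_add_left[symmetric] distrib_left[symmetric] add_divide_distrib[symmetric]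
      by (simp only: power_Suc2)
    also have "(\<Sum>j\<le>Suc n. (?c n j ^ k * (real j / (real (Suc n) + real l))) *\<^sub>R W (Suc n) j x)
       = (\<Sum>j\<le>n. (?c n (Suc j) ^ k * (real (Suc j) / (real (Suc n) + real l))) *\<^sub>R W (Suc n) (Suc j) x)"
      by (subst sum.atMost_Suc_shift) simp
    also have "\<dots> = (\<Sum>j\<le>n. (real (Suc n) / (real (Suc n) + real l)) *\<^sub>R T (((real j + real (Suc i)) / (real n + real (Suc l))) ^ k *\<^sub>R W n j x))"
    proof (rule sum.cong[OF refl])
      fix j
      have "real (Suc j) * real (Suc n choose Suc j) = real (Suc n) * real (n choose j)"
        using Suc_times_binomial[of j n] by (metis of_nat_mult)
      then have *: "real (Suc j) / (real (Suc n) + real l) * real (Suc n choose Suc j)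
           = real (Suc n) / (real (Suc n) + real l) * real (n choose j)"
        by (simp only: times_divide_eq_left)
      have c: "?c n (Suc j) = (real j + real (Suc i)) / (real n + real (Suc l))"
        by (simp add: add_ac)
      show "(?c n (Suc j) ^ k * (real (Suc j) / (real (Suc n) + real l))) *\<^sub>R W (Suc n) (Suc j) x
        = (real (Suc n) / (real (Suc n) + real l)) *\<^sub>R T (((real j + real (Suc i)) / (real n + real (Suc l))) ^ k *\<^sub>R W n j x)"
        unfolding c W_def diff_Suc_Suc V_Suc1 scaleR scaleR_scaleR mult.assoc *
        by (simp only: mult_ac)
    qed
    also have "\<dots> = (real (Suc n) / (real (Suc n) + real l)) *\<^sub>R T (\<Sum>j\<le>n. ((real j + real (Suc i)) / (real n + real (Suc l))) ^ k *\<^sub>R W n j x)"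
      unfolding sum scaleR_sum_right ..
    also have "(\<Sum>j\<le>Suc n. (?c n j ^ k * (real i / (real (Suc n) + real l))) *\<^sub>R W (Suc n) j x)
       = (real i / (real (Suc n) + real l)) *\<^sub>R (\<Sum>j\<le>Suc n. ?c n j ^ k *\<^sub>R W (Suc n) j x)"
      unfolding scaleR_sum_right scaleR_scaleR by (simp only: mult.commute)
    finally show ?thesis .
  qed
  \<comment> \<open>Only the first summand of \<open>eq\<close> survives in the limit; the
    contribution of the shift \<open>i\<close> is divided by \<open>n\<close> and
    disappears.\<close>
  have a: "(\<lambda>n. real (Suc n) / (real (Suc n) + real l)) \<longlonglongrightarrow> 1" by real_asymp
  have b: "(\<lambda>n. real i / (real (Suc n) + real l)) \<longlonglongrightarrow> 0" by real_asymp
  have "(\<lambda>n. \<Sum>j\<le>Suc n. ?c n j ^ Suc k *\<^sub>R W (Suc n) j x) \<longlonglongrightarrow> 1 *\<^sub>R T ((T ^^ k) x) + 0 *\<^sub>R (T ^^ k) x"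
    unfolding eq
    by (intro tendsto_add tendsto_scaleR a b tendsto[OF Suc.IH] LIMSEQ_Suc[OF Suc.IH])
  then show ?case by (subst filterlim_sequentially_Suc[symmetric]) simp
qed

text \<open>The weights at the nodes \<open>j / n\<close> form probability measures on
  \<open>[0, 1]\<close>, hence a tight family. A weak limit along a subsequence, tested with the
  bounded continuous functions \<open>clamp01 s ^ k\<close>, has the moments computed in
  \<open>bernstein_moments\<close>.\<close>

lemma moment_functional_unit:
  assumes x: "norm x = 1"
  shows "\<exists>M. real_distribution M \<and> (\<forall>k. (\<integral>s. clamp01 s ^ k \<partial>M) = (T ^^ k) x \<bullet> x)"
proof -
  define P where "P n = point_measure {..n} (\<lambda>j. W n j x \<bullet> x)" for n
  define \<mu> where "\<mu> n = distr (P n) borel (\<lambda>j. real j / real n)" for n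
  have Pp: "prob_space (P n)" for n
  proof
    have "emeasure (P n) {..n} = (\<Sum>j\<le>n. ennreal (W n j x \<bullet> x))"
      unfolding P_def by (rule emeasure_point_measure_finite) auto
    also have "\<dots> = ennreal ((\<Sum>j\<le>n. W n j x) \<bullet> x)"
      by (simp add: inner_sum_left W_pos)
    also have "\<dots> = 1" using x by (simp add: sum_W norm_eq_sqrt_inner)
    finally show "emeasure (P n) (space (P n)) = 1" by (simp add: P_def space_point_measure)
  qed
  have Pm: "(\<lambda>j. real j / real n) \<in> measurable (P n) borel" for n
    unfolding P_def by (simp add: measurable_point_measure_eq1)
  have rd: "real_distribution (\<mu> n)" for n
    unfolding \<mu>_def by (rule prob_space.real_distribution_distr[OF Pp Pm])
  have int: "(\<integral>s. f s \<partial>\<mu> n) = (\<Sum>j\<le>n. W n j x \<bullet> x * f (real j / real n))"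
    if "f \<in> borel_measurable borel" for f :: "real \<Rightarrow> real" and n
  proof -
    have "(\<integral>s. f s \<partial>\<mu> n) = (\<integral>j. f (real j / real n) \<partial>P n)"
      unfolding \<mu>_def by (rule integral_distr[OF Pm that])
    also have "\<dots> = (\<Sum>j\<le>n. (W n j x \<bullet> x) *\<^sub>R f (real j / real n))"
      unfolding P_def by (rule lebesgue_integral_point_measure_finite) (auto simp: W_pos)
    finally show ?thesis by simp
  qed
  have tight: "tight \<mu>"
    unfolding tight_def
  proof (intro conjI allI impI rd)
    fix e :: real assume e: "0 < e"
    \<comment> \<open>Tightness is tested on half-open intervals; this one contains all nodes, also
      for \<open>n = 0\<close>, where division yields 0.\<close>
    have "measure (\<mu> n) {-1<..2} = 1" for n
    proof -
      interpret prob_space "P n" by (rule Pp)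
      have "(\<lambda>j. real j / real n) -` {-1<..2} \<inter> space (P n) = space (P n)"
      proof -
        have "real j / real n \<le> 2" "- 1 < real j / real n" if "j \<le> n" for j
        proof -
          have "real j / real n \<le> 1" using that by (auto simp: divide_le_eq_1)
          then show "real j / real n \<le> 2" by simp
          have "0 \<le> real j / real n" by simp
          then show "- 1 < real j / real n" by linarith
        qed
        then show ?thesis by (auto simp: P_def space_point_measure)
      qed
      then show ?thesis unfolding \<mu>_def by (subst measure_distr[OF Pm]) (auto simp: prob_space)
    qed
    then show "\<exists>a b. a < b \<and> (\<forall>n. 1 - e < measure (\<mu> n) {a<..b})" using e
      by (intro exI[of _ "-1"] exI[of _ 2]) simp
  qed
  obtain r M where r: "strict_mono (r :: nat \<Rightarrow> nat)" and M: "real_distribution M"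
     and w: "weak_conv_m (\<mu> \<circ> id \<circ> r) M"
    using tight_imp_convergent_subsubsequence[OF tight, of id] by (auto simp: strict_mono_id)
  have "(\<integral>s. clamp01 s ^ k \<partial>M) = (T ^^ k) x \<bullet> x" for k
  proof -
    have cont: "isCont (\<lambda>s. clamp01 s ^ k) s" for s
      using continuous_on_eq_continuous_at[of UNIV "\<lambda>s. clamp01 s ^ k"]
      by (simp add: continuous_intros)
    have bd: "norm (clamp01 s ^ k) \<le> 1" for s using clamp01_range[of s] by (simp add: power_le_one)
    have l1: "(\<lambda>n. \<integral>s. clamp01 s ^ k \<partial>(\<mu> \<circ> id \<circ> r) n) \<longlonglongrightarrow> (\<integral>s. clamp01 s ^ k \<partial>M)"
    proof -
      have rds: "real_distribution ((\<mu> \<circ> id \<circ> r) n)" for n using rd by simp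
      show ?thesis
        by (rule weak_conv_imp_integral_bdd_continuous_conv[OF rds M w cont bd])
    qed
    have "(\<integral>s. clamp01 s ^ k \<partial>\<mu> n) = (\<Sum>j\<le>n. ((real j + real 0) / (real n + real 0)) ^ k *\<^sub>R W n j x) \<bullet> x" for n
    proof -
      have "(\<integral>s. clamp01 s ^ k \<partial>\<mu> n) = (\<Sum>j\<le>n. W n j x \<bullet> x * clamp01 (real j / real n) ^ k)"
        by (rule int) measurable
      also have "\<dots> = (\<Sum>j\<le>n. W n j x \<bullet> x * (real j / real n) ^ k)"
      proof (rule sum.cong[OF refl])
        fix j assume "j \<in> {..n}"
        then have "real j / real n \<le> 1" by (auto simp: divide_le_eq_1)
        then show "W n j x \<bullet> x * clamp01 (real j / real n) ^ k = W n j x \<bullet> x * (real j / real n) ^ k"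
          by (simp add: clamp01_id)
      qed
      finally show ?thesis by (simp add: inner_sum_left mult.commute)
    qed
    then have "(\<lambda>n. \<integral>s. clamp01 s ^ k \<partial>\<mu> n) \<longlonglongrightarrow> (T ^^ k) x \<bullet> x"
      using tendsto_inner[OF bernstein_moments[where i=0 and l=0 and k=k and x=x] tendsto_const[of x]] by simp
    from LIMSEQ_subseq_LIMSEQ[OF this r] have "(\<lambda>n. \<integral>s. clamp01 s ^ k \<partial>(\<mu> \<circ> id \<circ> r) n) \<longlonglongrightarrow> (T ^^ k) x \<bullet> x"
      by (simp add: comp_def)
    then show ?thesis using l1 LIMSEQ_unique by blast
  qed
  then show ?thesis using M by blast
qed

text \<open>Homogeneity reduces the claim to unit vectors. Pushing the measure forward under
  \<open>clamp01\<close> makes it carried by \<open>[0, 1]\<close> and leaves the clamped moments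
  unchanged.\<close>

lemma moment_functional:
  "\<exists>q. bcts q \<and> (\<forall>f. bfun f \<longrightarrow> (\<forall>s. 0 \<le> f s) \<longrightarrow> 0 \<le> q f) \<and> (\<forall>f. bfun f \<longrightarrow> q f = q (\<lambda>s. f (clamp01 s)))
     \<and> (\<forall>k. q (\<lambda>s. clamp01 s ^ k) = (T ^^ k) x \<bullet> x)"
proof (cases "x = 0")
  case True
  have "bcts (\<lambda>f. 0)" by (simp add: bcts_def)
  moreover have "(T ^^ k) x \<bullet> x = 0" for k using True by simp
  ultimately show ?thesis by (intro exI[of _ "\<lambda>f. 0"]) simp
next
  case False
  define y where "y = x /\<^sub>R norm x"
  have xy: "x = norm x *\<^sub>R y" using False by (simp add: y_def)
  have "norm y = 1" using False by (simp add: y_def)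
  then obtain M where M: "real_distribution M" and mom: "\<And>k. (\<integral>s. clamp01 s ^ k \<partial>M) = (T ^^ k) y \<bullet> y"
    using moment_functional_unit by blast
  interpret M: real_distribution M by (rule M)
  define q where "q f = (norm x)\<^sup>2 * (\<integral>s. f s \<partial>distr M borel clamp01)" for f :: "real \<Rightarrow> real"
  have "bcts (\<lambda>f. \<integral>s. f s \<partial>distr M borel clamp01)"
    by (rule bcts_integral) (auto intro!: M.finite_measure_distr)
  then have "bcts q" unfolding q_def[abs_def] by (rule bcts_cmult)
  moreover have qd: "q f = (norm x)\<^sup>2 * (\<integral>s. f (clamp01 s) \<partial>M)" if "f \<in> borel_measurable borel" for f
    unfolding q_def using that by (subst integral_distr) auto
  moreover have "q f = q (\<lambda>s. f (clamp01 s))" if "bfun f" for f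
    using bfun_meas[OF that] by (simp add: qd clamp01_id clamp01_range)
  moreover have "0 \<le> q f" if "\<forall>s. 0 \<le> f s" for f
    unfolding q_def using that by (intro mult_nonneg_nonneg integral_nonneg) auto
  moreover have "q (\<lambda>s. clamp01 s ^ k) = (T ^^ k) x \<bullet> x" for k
  proof -
    have "(T ^^ k) x = norm x *\<^sub>R (T ^^ k) y"
      by (subst xy) (rule linear_scale[OF T_pow_linear])
    then have "(T ^^ k) x \<bullet> x = norm x * ((T ^^ k) y \<bullet> (norm x *\<^sub>R y))"
      using xy by (metis inner_scaleR_left)
    also have "\<dots> = (norm x)\<^sup>2 * ((T ^^ k) y \<bullet> y)" by (simp add: power2_eq_square)
    finally show ?thesis unfolding mom[symmetric] by (simp add: qd clamp01_id clamp01_range)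
  qed
  ultimately show ?thesis by blast
qed

end

section \<open>Bounded functional calculus\<close>

definition polar :: "('h::real_inner \<Rightarrow> (real \<Rightarrow> real) \<Rightarrow> real) \<Rightarrow> (real \<Rightarrow> real) \<Rightarrow> 'h \<Rightarrow> 'h \<Rightarrow> real" where
  "polar q f x y = (q (x + y) f - q (x - y) f) / 4"

lemma bfun_clamp: assumes "bfun f" shows "bfun (\<lambda>s. f (clamp01 s))"
proof -
  obtain c where "\<And>s. \<bar>f s\<bar> \<le> c" using bfun_bound[OF assms] by auto
  moreover have "(\<lambda>s. f (clamp01 s)) \<in> borel_measurable borel" using bfun_meas[OF assms] by measurable
  ultimately show ?thesis by (rule bfunI[rotated])
qed

lemma clamp01_idem: "clamp01 (clamp01 s) = clamp01 s"
  by (simp add: clamp01_id clamp01_range)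

lemma indicator_01_bounded: "\<bar>indicator S s :: real\<bar> \<le> 1" by (auto simp: indicator_def)

text \<open>\<open>q x f\<close> stands for \<open>\<integral> f d\<langle>E x, x\<rangle>\<close>.\<close>

locale spectral_calculus =
  fixes q :: "'h::{real_inner,complete_space} \<Rightarrow> (real \<Rightarrow> real) \<Rightarrow> real"
  assumes bcts: "bcts (q x)"
    and q_pos: "bfun f \<Longrightarrow> (\<And>s. 0 \<le> f s) \<Longrightarrow> 0 \<le> q x f"
    and q_one: "q x (\<lambda>s. 1) = x \<bullet> x"
    and polar_add: "bfun f \<Longrightarrow> polar q f (x + x') y = polar q f x y + polar q f x' y"
    and polar_scale: "bfun f \<Longrightarrow> polar q f (c *\<^sub>R x) y = c * polar q f x y"
    and polar_sym: "bfun f \<Longrightarrow> polar q f x y = polar q f y x"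
    and polar_same: "bfun f \<Longrightarrow> polar q f x x = q x f"
begin

lemma bcts_polar: "bcts (\<lambda>f. polar q f x y)"
  unfolding polar_def by (intro bcts_divide bcts_minus bcts)

lemma q_bound:
  assumes f: "bfun f" and c: "\<And>s. \<bar>f s\<bar> \<le> c" shows "\<bar>q x f\<bar> \<le> c * (x \<bullet> x)"
proof -
  have cc: "q x (\<lambda>s. c * 1) = c * q x (\<lambda>s. 1)" by (rule bcts_scaleD[OF bcts bfun_const])
  have mf: "q x (\<lambda>s. (-1) * f s) = (-1) * q x f" by (rule bcts_scaleD[OF bcts f])
  have "0 \<le> q x (\<lambda>s. c * 1 + (-1) * f s)"
    by (rule q_pos[OF bfun_add[OF bfun_const bfun_mult[OF bfun_const f]]]) (use c in \<open>simp add: abs_le_iff\<close>)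
  then have 1: "0 \<le> c * (x \<bullet> x) + - q x f"
    using bcts_addD[OF bcts bfun_const bfun_mult[OF bfun_const f], of x "c*1" "-1"] cc mf q_one by simp
  have "0 \<le> q x (\<lambda>s. c * 1 + f s)"
  proof (rule q_pos[OF bfun_add[OF bfun_const f]])
    show "0 \<le> c * 1 + f s" for s using c[of s] by (simp add: abs_le_iff)
  qed
  then have 2: "0 \<le> c * (x \<bullet> x) + q x f"
    using bcts_addD[OF bcts bfun_const f, of x "c*1"] cc q_one by simp
  show ?thesis using 1 2 by (simp add: abs_le_iff)
qed

lemma polar_add2: "bfun f \<Longrightarrow> polar q f x (y + y') = polar q f x y + polar q f x y'"
  using polar_add[of f y y' x] polar_sym[of f] by simp

lemma polar_scale2: "bfun f \<Longrightarrow> polar q f x (c *\<^sub>R y) = c * polar q f x y"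
  using polar_scale[of f c y x] polar_sym[of f] by simp

lemma polar_bound:
  assumes f: "bfun f" and c: "\<And>s. \<bar>f s\<bar> \<le> c" shows "\<bar>polar q f x y\<bar> \<le> c * norm x * norm y"
proof (cases "y = 0")
  case True
  then show ?thesis using polar_scale2[OF f, of x 0 y] by simp
next
  case y: False
  have weak: "\<bar>polar q f a b\<bar> \<le> c * ((norm a)\<^sup>2 + (norm b)\<^sup>2) / 2" for a b
  proof -
    have "\<bar>polar q f a b\<bar> \<le> (\<bar>q (a + b) f\<bar> + \<bar>q (a - b) f\<bar>) / 4"
      unfolding polar_def by simp
    also have "\<dots> \<le> (c * ((a + b) \<bullet> (a + b)) + c * ((a - b) \<bullet> (a - b))) / 4"
      using q_bound[OF f c, of "a + b"] q_bound[OF f c, of "a - b"] by simp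
    also have "\<dots> = c * ((norm a)\<^sup>2 + (norm b)\<^sup>2) / 2"
      by (simp add: power2_norm_eq_inner inner_add_left inner_add_right inner_diff_left inner_diff_right
          inner_commute algebra_simps)
    finally show ?thesis .
  qed
  have c0: "c \<ge> 0" using c[of 0] by (rule order_trans[OF abs_ge_zero])
  show ?thesis
  proof (cases "x = 0")
    case True
    then show ?thesis using polar_scale[OF f, of 0 x y] by simp
  next
    case x: False
    \<comment> \<open>The scaling gives \<open>t *\<^sub>R y\<close> the norm of \<open>x\<close>.
      For vectors of equal norm the bound \<open>weak\<close> by half the sum of squares is already
      the bound by the product.\<close>
    define t where "t = norm x / norm y"
    have t: "t > 0" using x y by (simp add: t_def)
    have ny: "norm (t *\<^sub>R y) = norm x" using y t by (simp add: t_def)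
    have "t * \<bar>polar q f x y\<bar> = \<bar>polar q f x (t *\<^sub>R y)\<bar>"
      using polar_scale2[OF f, of x t y] t by (simp add: abs_mult)
    also have "\<dots> \<le> c * (norm x)\<^sup>2" using weak[of x "t *\<^sub>R y"] unfolding ny by simp
    also have "\<dots> = t * (c * norm x * norm y)" using y by (simp add: t_def power2_eq_square)
    finally show ?thesis using t by simp
  qed
qed

definition \<Phi> where "\<Phi> f x = (SOME z. \<forall>y. z \<bullet> y = polar q f x y)"

lemma Phi_inner: assumes f: "bfun f" shows "\<Phi> f x \<bullet> y = polar q f x y"
proof -
  obtain c where c: "\<And>s. \<bar>f s\<bar> \<le> c" using bfun_bound[OF f] by auto
  have "bounded_linear (polar q f x)"
  proof (rule bounded_linear_intro)
    show "polar q f x (y + y') = polar q f x y + polar q f x y'" for y y' by (rule polar_add2[OF f])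
    show "polar q f x (r *\<^sub>R y) = r *\<^sub>R polar q f x y" for r y using polar_scale2[OF f] by simp
    show "norm (polar q f x y) \<le> norm y * (c * norm x)" for y
      using polar_bound[OF f c, of x y] by (simp add: mult_ac)
  qed
  then have "\<exists>z. \<forall>y. z \<bullet> y = polar q f x y" by (rule riesz_representation)
  from someI_ex[OF this] show ?thesis unfolding \<Phi>_def by blast
qed

lemma Phi_eqI: "bfun f \<Longrightarrow> (\<And>y. z \<bullet> y = polar q f x y) \<Longrightarrow> \<Phi> f x = z"
  by (rule eq_by_inner) (simp add: Phi_inner)

lemma Phi_sym: "bfun f \<Longrightarrow> \<Phi> f x \<bullet> y = x \<bullet> \<Phi> f y"
  by (metis Phi_inner inner_commute polar_sym)

lemma Phi_norm: assumes f: "bfun f" and c: "\<And>s. \<bar>f s\<bar> \<le> c" shows "norm (\<Phi> f x) \<le> c * norm x"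
proof (cases "\<Phi> f x = 0")
  case True
  have "c \<ge> 0" using c[of 0] by (rule order_trans[OF abs_ge_zero])
  then show ?thesis using True by simp
next
  case False
  have "norm (\<Phi> f x) * norm (\<Phi> f x) = polar q f x (\<Phi> f x)"
    unfolding Phi_inner[OF f, symmetric] by (simp add: power2_norm_eq_inner[symmetric] power2_eq_square)
  also have "\<dots> \<le> c * norm x * norm (\<Phi> f x)"
    using polar_bound[OF f c, of x "\<Phi> f x"] by simp
  finally show ?thesis using False by simp
qed

lemma Phi_bounded_linear: assumes f: "bfun f" shows "bounded_linear (\<Phi> f)"
proof -
  obtain c where c: "\<And>s. \<bar>f s\<bar> \<le> c" using bfun_bound[OF f] by auto
  show ?thesis
  proof (rule bounded_linear_intro)
    show "\<Phi> f (x + y) = \<Phi> f x + \<Phi> f y" for x y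
      by (rule Phi_eqI[OF f]) (simp add: inner_add_left Phi_inner[OF f] polar_add[OF f])
    show "\<Phi> f (r *\<^sub>R x) = r *\<^sub>R \<Phi> f x" for r x
      by (rule Phi_eqI[OF f]) (simp add: Phi_inner[OF f] polar_scale[OF f])
    show "norm (\<Phi> f x) \<le> norm x * c" for x using Phi_norm[OF f c, of x] by (simp add: mult.commute)
  qed
qed

lemma Phi_diff:
  assumes "bfun f" "bfun g" shows "\<Phi> (\<lambda>s. f s - g s) x = \<Phi> f x - \<Phi> g x"
proof (rule Phi_eqI[OF bfun_diff[OF assms]])
  fix y
  have "polar q (\<lambda>s. f s + (-1) * g s) x y = polar q f x y + polar q (\<lambda>s. (-1) * g s) x y"
    by (rule bcts_addD[OF bcts_polar assms(1) bfun_mult[OF bfun_const assms(2)]])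
  moreover have "polar q (\<lambda>s. (-1) * g s) x y = (-1) * polar q g x y"
    by (rule bcts_scaleD[OF bcts_polar assms(2)])
  ultimately show "(\<Phi> f x - \<Phi> g x) \<bullet> y = polar q (\<lambda>s. f s - g s) x y"
    by (simp add: inner_diff_left Phi_inner assms)
qed

lemma Phi_scale:
  assumes "bfun f" shows "\<Phi> (\<lambda>s. c * f s) x = c *\<^sub>R \<Phi> f x"
proof (rule Phi_eqI[OF bfun_mult[OF bfun_const assms]])
  show "(c *\<^sub>R \<Phi> f x) \<bullet> y = polar q (\<lambda>s. c * f s) x y" for y
    using bcts_scaleD[OF bcts_polar[of x y] assms, of c] by (simp add: Phi_inner assms)
qed

lemma Phi_one: "\<Phi> (\<lambda>s. 1) x = x"
  by (rule Phi_eqI[OF bfun_const])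
     (simp add: polar_def q_one inner_add_left inner_add_right inner_diff_left inner_diff_right inner_commute)

end

text \<open>Multiplicativity is kept apart because it is reached differently: by moments for a
  contraction, by indicators for a given projection-valued measure. It is what makes the images of
  indicators projections.\<close>

locale spectral_calculus_mult = spectral_calculus +
  assumes Phi_mult: "bfun f \<Longrightarrow> bfun g \<Longrightarrow> \<Phi> f (\<Phi> g x) = \<Phi> (\<lambda>s. f s * g s) x"
begin

lemma Phi_norm_sq: assumes f: "bfun f" shows "(norm (\<Phi> f x))\<^sup>2 = q x (\<lambda>s. (f s)\<^sup>2)"
proof -
  have "(norm (\<Phi> f x))\<^sup>2 = \<Phi> (\<lambda>s. f s * f s) x \<bullet> x"
    by (simp add: power2_norm_eq_inner Phi_sym[OF f, symmetric] Phi_mult f inner_commute)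
  also have "\<dots> = q x (\<lambda>s. f s * f s)" by (simp add: Phi_inner polar_same bfun_mult f)
  finally show ?thesis by (simp add: power2_eq_square)
qed

text \<open>Multiplicativity turns the squared norm of the difference into \<open>q x\<close> of the
  squared difference of the functions, and \<open>q x\<close> respects bounded pointwise
  convergence.\<close>

lemma Phi_lim:
  assumes f: "\<And>n::nat. bfun (f n)" and c: "\<And>n s. \<bar>f n s\<bar> \<le> c" and l: "\<And>s. (\<lambda>n. f n s) \<longlonglongrightarrow> g s"
  shows "(\<lambda>n. \<Phi> (f n) x) \<longlonglongrightarrow> \<Phi> g x"
proof -
  have g: "bfun g" by (rule bfun_lim[OF f c l])
  have gc: "\<bar>g s\<bar> \<le> c" for s
    by (rule LIMSEQ_le_const2[OF tendsto_rabs[OF l]]) (use c in auto)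
  have n: "(norm (\<Phi> (f n) x - \<Phi> g x))\<^sup>2 = q x (\<lambda>s. (f n s - g s) * (f n s - g s))" for n
    using Phi_norm_sq[OF bfun_diff[OF f[of n] g], of x] by (simp add: Phi_diff[OF f g] power2_eq_square)
  have "(\<lambda>n. q x (\<lambda>s. (f n s - g s) * (f n s - g s))) \<longlonglongrightarrow> q x (\<lambda>s. 0)"
  proof (rule bcts_limD[OF bcts])
    show "bfun (\<lambda>s. (f n s - g s) * (f n s - g s))" for n by (intro bfun_mult bfun_diff f g)
    have d: "\<bar>f n s - g s\<bar> \<le> 2 * c" for n s using c[of n s] gc[of s] by linarith
    show "\<bar>(f n s - g s) * (f n s - g s)\<bar> \<le> (2 * c) * (2 * c)" for n s
      unfolding abs_mult by (rule mult_mono[OF d d]) (use d[of n s] in auto)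
    have "(\<lambda>n. f n s - g s) \<longlonglongrightarrow> 0" for s using l[of s] by (rule LIM_zero)
    then show "(\<lambda>n. (f n s - g s) * (f n s - g s)) \<longlonglongrightarrow> 0" for s using tendsto_mult_zero by blast
  qed
  moreover have "q x (\<lambda>s. 0) = 0" using bcts_scaleD[OF bcts[of x] bfun_const[of 0], of 0] by simp
  ultimately have "(\<lambda>n. (norm (\<Phi> (f n) x - \<Phi> g x))\<^sup>2) \<longlonglongrightarrow> 0" using n by simp
  then have "(\<lambda>n. norm (\<Phi> (f n) x - \<Phi> g x)) \<longlonglongrightarrow> 0"
    using tendsto_real_sqrt by fastforce
  then show ?thesis using tendsto_norm_zero_iff LIM_zero_iff by blast
qed

lemma pvm_of_calculus: "projection_valued_measure (\<lambda>S. \<Phi> (indicator S))"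
  unfolding projection_valued_measure_def
proof (intro conjI ballI allI impI)
  fix S :: "real set" assume S: "S \<in> sets borel"
  show "bounded_linear (\<Phi> (indicator S))" by (rule Phi_bounded_linear[OF bfun_ind[OF S]])
  show "\<Phi> (indicator S) (\<Phi> (indicator S) x) = \<Phi> (indicator S) x" for x
    unfolding Phi_mult[OF bfun_ind[OF S] bfun_ind[OF S]] indicator_inter_arith[symmetric] by simp
  show "\<Phi> (indicator S) x \<bullet> y = x \<bullet> \<Phi> (indicator S) y" for x y
    by (rule Phi_sym[OF bfun_ind[OF S]])
next
  show "\<Phi> (indicator UNIV) x = x" for x using Phi_one[of x] by (simp add: indicator_def[abs_def])
next
  fix S R :: "real set" and x assume S: "S \<in> sets borel" and R: "R \<in> sets borel"
  show "\<Phi> (indicator (S \<inter> R)) x = \<Phi> (indicator S) (\<Phi> (indicator R) x)"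
    unfolding Phi_mult[OF bfun_ind[OF S] bfun_ind[OF R]] indicator_inter_arith ..
next
  fix F :: "nat \<Rightarrow> real set" and x assume r: "range F \<subseteq> sets borel" and d: "disjoint_family F"
  have F: "F n \<in> sets borel" for n using r by blast
  have U: "(\<Union>i<n. F i) \<in> sets borel" for n using F by auto
  have part: "(\<Sum>i<n. \<Phi> (indicator (F i)) x) = \<Phi> (indicator (\<Union>i<n. F i)) x" for n
  proof (rule sym, rule Phi_eqI[OF bfun_ind[OF U]])
    fix y
    have "(\<lambda>s. \<Sum>i<n. 1 * indicator (F i) s :: real) = indicator (\<Union>i<n. F i)"
    proof
      show "(\<Sum>i<n. 1 * indicator (F i) s :: real) = indicator (\<Union>i<n. F i) s" for s
        using d by (subst indicator_UN_disjoint) (auto simp: disjoint_family_on_def)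
    qed
    moreover have "polar q (\<lambda>s. \<Sum>i<n. 1 * indicator (F i) s) x y = (\<Sum>i<n. 1 * polar q (indicator (F i)) x y)"
      by (rule bcts_sumD[OF bcts_polar finite_lessThan bfun_ind[OF F]])
    ultimately show "(\<Sum>i<n. \<Phi> (indicator (F i)) x) \<bullet> y = polar q (indicator (\<Union>i<n. F i)) x y"
      by (simp add: inner_sum_left Phi_inner[OF bfun_ind[OF F]])
  qed
  show "(\<lambda>n. \<Phi> (indicator (F n)) x) sums \<Phi> (indicator (\<Union>n. F n)) x"
    unfolding sums_def part
    by (rule Phi_lim[OF bfun_ind[OF U] indicator_01_bounded LIMSEQ_indicator_UN])
qed

end

context positive_contraction begin

text \<open>Each axiom of the calculus equates two functionals of \<open>f\<close> that are carried
  by \<open>[0, 1]\<close>. By \<open>bcts_eq_moments\<close> it suffices to compare moments, where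
  the axioms become algebra of the powers of \<open>T\<close>.\<close>

theorem calculus_exists:
  "\<exists>q. spectral_calculus_mult q \<and> (\<forall>x. spectral_calculus.\<Phi> q clamp01 x = T x)
     \<and> (\<forall>x f. bfun f \<longrightarrow> q x f = q x (\<lambda>s. f (clamp01 s)))"
proof -
  obtain q where q: "\<And>x. bcts (q x)" and q_pos: "\<And>x f. bfun f \<Longrightarrow> \<forall>s. 0 \<le> f s \<Longrightarrow> 0 \<le> q x f"
    and cl: "\<And>x f. bfun f \<Longrightarrow> q x f = q x (\<lambda>s. f (clamp01 s))"
    and mom: "\<And>x k. q x (\<lambda>s. clamp01 s ^ k) = (T ^^ k) x \<bullet> x"
    using moment_functional by metis
  have bp: "bcts (\<lambda>f. polar q f x y)" for x y
    unfolding polar_def by (intro bcts_divide bcts_minus q)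
  have clp: "polar q f x y = polar q (\<lambda>s. f (clamp01 s)) x y" if "bfun f" for f x y
    unfolding polar_def using cl[OF that] by simp
  have Tsym: "(T ^^ k) x \<bullet> y = x \<bullet> (T ^^ k) y" for k x y
    by (induction k arbitrary: x y) (simp_all add: sym funpow_swap1)
  note lin = linear_add[OF T_pow_linear] linear_diff[OF T_pow_linear] linear_scale[OF T_pow_linear]
  have pmom: "polar q (\<lambda>s. clamp01 s ^ k) x y = (T ^^ k) x \<bullet> y" for k x y
    unfolding polar_def mom using Tsym[of k x y] inner_commute[of "(T ^^ k) y" x]
    by (simp add: lin inner_add_left inner_add_right inner_diff_left inner_diff_right)
  have S: "spectral_calculus q"
  proof
    show "bcts (q x)" for x by (rule q)
    show "0 \<le> q x f" if "bfun f" "\<And>s. 0 \<le> f s" for x f using q_pos that by blast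
    show "q x (\<lambda>s. 1) = x \<bullet> x" for x using mom[of x 0] by simp
    fix f :: "real \<Rightarrow> real" assume f: "bfun f"
    show "polar q f (x + x') y = polar q f x y + polar q f x' y" for x x' y
      by (rule bcts_eq_moments[OF bp bcts_plus[OF bp bp] _ _ _ f, of _ _ x y x' y])
         (simp_all add: clp[symmetric] pmom lin inner_add_left)
    show "polar q f (c *\<^sub>R x) y = c * polar q f x y" for c x y
      by (rule bcts_eq_moments[OF bp bcts_cmult[OF bp] _ _ _ f])
         (simp_all add: clp[symmetric] pmom lin)
    show "polar q f x y = polar q f y x" for x y
      by (rule bcts_eq_moments[OF bp bp _ _ _ f])
         (simp_all add: clp[symmetric] pmom, metis Tsym inner_commute)
    show "polar q f x x = q x f" for x
      by (rule bcts_eq_moments[OF bp q _ _ _ f])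
         (simp_all add: clp[symmetric] cl[symmetric] pmom mom)
  qed
  interpret spectral_calculus q by (rule S)
  \<comment> \<open>Multiplicativity when one factor is a monomial: the moments in \<open>f\<close>
    of both sides come from \<open>T ^^ (k + j)\<close>.\<close>
  have step1: "polar q f ((T ^^ k) x) y = polar q (\<lambda>s. clamp01 s ^ k * f s) x y" if f: "bfun f" for f k x y
  proof (rule bcts_eq_moments[OF bp bcts_premult[OF bp bfun_clamp_pow] _ _ _ f])
    fix g :: "real \<Rightarrow> real" assume g: "bfun g"
    show "polar q g ((T ^^ k) x) y = polar q (\<lambda>s. g (clamp01 s)) ((T ^^ k) x) y" by (rule clp[OF g])
    show "polar q (\<lambda>s. clamp01 s ^ k * g s) x y = polar q (\<lambda>s. clamp01 s ^ k * g (clamp01 s)) x y"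
      by (rule clp[OF bfun_mult[OF bfun_clamp_pow g], unfolded clamp01_idem])
  next
    fix j
    have "(T ^^ j) ((T ^^ k) x) = (T ^^ (k + j)) x" by (simp add: add.commute[of k j] funpow_add)
    then show "polar q (\<lambda>s. clamp01 s ^ j) ((T ^^ k) x) y = polar q (\<lambda>s. clamp01 s ^ k * clamp01 s ^ j) x y"
      unfolding pmom power_add[symmetric] by simp
  qed
  \<comment> \<open>Now \<open>g\<close> is fixed and \<open>f\<close> varies. Testing with
    monomials for \<open>f\<close> and moving \<open>\<Phi> g\<close> across the inner product leads
    back to \<open>step1\<close>.\<close>
  have step2: "polar q f x (\<Phi> g y) = polar q (\<lambda>s. g s * f s) x y" if f: "bfun f" and g: "bfun g" for f g x y
  proof (rule bcts_eq_moments[OF bp bcts_premult[OF bp g] _ _ _ f])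
    fix h :: "real \<Rightarrow> real" assume h: "bfun h"
    show "polar q h x (\<Phi> g y) = polar q (\<lambda>s. h (clamp01 s)) x (\<Phi> g y)" by (rule clp[OF h])
    show "polar q (\<lambda>s. g s * h s) x y = polar q (\<lambda>s. g s * h (clamp01 s)) x y"
      by (rule trans[OF clp[OF bfun_mult[OF g h]]
            HOL.sym[OF clp[OF bfun_mult[OF g bfun_clamp[OF h]], unfolded clamp01_idem]]])
  next
    fix k
    have "polar q (\<lambda>s. clamp01 s ^ k) x (\<Phi> g y) = \<Phi> g y \<bullet> (T ^^ k) x"
      unfolding pmom by (rule inner_commute)
    also have "\<dots> = polar q g ((T ^^ k) x) y" by (simp only: Phi_inner[OF g] polar_sym[OF g])
    also have "\<dots> = polar q (\<lambda>s. clamp01 s ^ k * g s) x y" by (rule step1[OF g])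
    finally show "polar q (\<lambda>s. clamp01 s ^ k) x (\<Phi> g y) = polar q (\<lambda>s. g s * clamp01 s ^ k) x y"
      by (simp only: mult.commute)
  qed
  have "spectral_calculus_mult q"
  proof (unfold_locales, rule eq_by_inner)
    fix f g x y assume f: "bfun f" and g: "bfun g"
    have "\<Phi> f (\<Phi> g x) \<bullet> y = polar q f y (\<Phi> g x)" by (simp only: Phi_inner[OF f] polar_sym[OF f])
    also have "\<dots> = polar q (\<lambda>s. g s * f s) y x" by (rule step2[OF f g])
    also have "\<dots> = polar q (\<lambda>s. g s * f s) x y" by (rule polar_sym[OF bfun_mult[OF g f]])
    also have "\<dots> = polar q (\<lambda>s. f s * g s) x y" by (simp only: mult.commute)
    also have "\<dots> = \<Phi> (\<lambda>s. f s * g s) x \<bullet> y" by (rule Phi_inner[OF bfun_mult[OF f g], symmetric])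
    finally show "\<Phi> f (\<Phi> g x) \<bullet> y = \<Phi> (\<lambda>s. f s * g s) x \<bullet> y" .
  qed
  moreover have "\<Phi> clamp01 x = T x" for x
    by (rule Phi_eqI) (use bfun_clamp_pow[of 1] pmom[of 1] in simp_all)
  ultimately show ?thesis using cl by blast
qed

end

section \<open>The calculus of a projection-valued measure\<close>

locale pvm =
  fixes E :: "real set \<Rightarrow> 'h::{real_inner,complete_space} \<Rightarrow> 'h"
  assumes pvm: "projection_valued_measure E"
begin

abbreviation \<mu> where "\<mu> x \<equiv> scalar_spectral_measure E x"

lemma E_bl: "S \<in> sets borel \<Longrightarrow> bounded_linear (E S)"
  and E_idem: "S \<in> sets borel \<Longrightarrow> E S (E S x) = E S x"
  and E_sym: "S \<in> sets borel \<Longrightarrow> E S x \<bullet> y = x \<bullet> E S y"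
  and E_UNIV: "E UNIV x = x"
  and E_Int: "S \<in> sets borel \<Longrightarrow> R \<in> sets borel \<Longrightarrow> E (S \<inter> R) x = E S (E R x)"
  and E_sums: "range F \<subseteq> sets borel \<Longrightarrow> disjoint_family F \<Longrightarrow> (\<lambda>n::nat. E (F n) x) sums E (\<Union>n. F n) x"
  using pvm unfolding projection_valued_measure_def by simp_all

lemma E_nonneg: "S \<in> sets borel \<Longrightarrow> 0 \<le> E S x \<bullet> x"
  by (metis E_idem E_sym inner_ge_zero)

lemma sets_mu[simp, measurable_cong]: "sets (\<mu> x) = sets borel"
  unfolding scalar_spectral_measure_def using sets.sigma_sets_eq[of borel] by (simp add: sets_measure_of)

lemma space_mu[simp]: "space (\<mu> x) = UNIV"
  unfolding scalar_spectral_measure_def by (simp add: space_measure_of)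

text \<open>\<open>measure_of\<close> returns the prescribed values only for a countably additive
  set function, so this has to be settled before integrals against the measure mean anything. Strong
  additivity of \<open>E\<close> is paired with \<open>x\<close>.\<close>

lemma emeasure_mu: assumes S: "S \<in> sets borel" shows "emeasure (\<mu> x) S = ennreal (E S x \<bullet> x)"
proof (rule emeasure_measure_of[OF scalar_spectral_measure_def])
  show "S \<in> sets (\<mu> x)" using S by simp
  \<comment> \<open>The constant sequence of empty sets is disjoint; a convergent series of constant
    terms has zero terms.\<close>
  have e: "E {} x = 0"
  proof -
    have "(\<lambda>n::nat. E {} x) sums E (\<Union>n::nat. {}) x"
      by (rule E_sums[of "\<lambda>_. {}"]) (auto simp: disjoint_family_on_def)
    then have "(\<lambda>n::nat. E {} x) \<longlonglongrightarrow> 0" using sums_summable summable_LIMSEQ_zero by blast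
    then show ?thesis by (simp add: LIMSEQ_const_iff)
  qed
  show "positive (sets (\<mu> x)) (\<lambda>S. ennreal (E S x \<bullet> x))" by (simp add: positive_def e)
  show "countably_additive (sets (\<mu> x)) (\<lambda>S. ennreal (E S x \<bullet> x))"
  proof (rule countably_additiveI)
    fix F :: "nat \<Rightarrow> real set" assume F: "range F \<subseteq> sets (\<mu> x)" "disjoint_family F"
    then have "(\<lambda>n. E (F n) x) sums E (\<Union>n. F n) x" by (intro E_sums) simp_all
    then have "(\<lambda>n. E (F n) x \<bullet> x) sums (E (\<Union>n. F n) x \<bullet> x)"
      by (rule bounded_linear.sums[OF bounded_linear_inner_left])
    then show "(\<Sum>n. ennreal (E (F n) x \<bullet> x)) = ennreal (E (\<Union>n. F n) x \<bullet> x)"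
      using F by (intro suminf_ennreal_eq E_nonneg) auto
  qed
qed simp

lemma finite_mu: "finite_measure (\<mu> x)"
  by (rule finite_measureI) (simp add: emeasure_mu)

sublocale finite_mu: finite_measure "\<mu> x" for x by (rule finite_mu)

lemma measure_mu: "S \<in> sets borel \<Longrightarrow> measure (\<mu> x) S = E S x \<bullet> x"
  by (simp add: measure_def emeasure_mu E_nonneg)

definition Q where "Q x f = (\<integral>s. f s \<partial>\<mu> x)"

lemma bcts_Q: "bcts (Q x)" unfolding Q_def[abs_def] by (rule bcts_integral[OF finite_mu sets_mu])

lemma Q_ind: "S \<in> sets borel \<Longrightarrow> Q x (indicator S) = E S x \<bullet> x"
  unfolding Q_def by (simp add: measure_mu)

lemma bcts_polar_Q: "bcts (\<lambda>f. polar Q f x y)"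
  unfolding polar_def by (intro bcts_divide bcts_minus bcts_Q)

lemma polar_Q_ind: assumes S: "S \<in> sets borel" shows "polar Q (indicator S) x y = E S x \<bullet> y"
proof -
  interpret bounded_linear "E S" by (rule E_bl[OF S])
  show ?thesis unfolding polar_def Q_ind[OF S] using E_sym[OF S, of x y] inner_commute[of "E S y" x]
    by (simp add: add diff inner_add_left inner_add_right inner_diff_left inner_diff_right)
qed

text \<open>The axioms are linear and continuous in \<open>f\<close>, so indicators suffice; there
  they express linearity and symmetry of the projections.\<close>

lemma calculus: "spectral_calculus Q"
proof
  show "bcts (Q x)" for x by (rule bcts_Q)
  show "0 \<le> Q x f" if "bfun f" "\<And>s. 0 \<le> f s" for x f unfolding Q_def by (rule Bochner_Integration.integral_nonneg) (rule that(2))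
  have "(indicator UNIV :: real \<Rightarrow> real) = (\<lambda>s. 1)" by auto
  then show "Q x (\<lambda>s. 1) = x \<bullet> x" for x using Q_ind[of UNIV x] E_UNIV[of x] by simp
  fix f :: "real \<Rightarrow> real" assume f: "bfun f"
  show "polar Q f (x + x') y = polar Q f x y + polar Q f x' y" for x x' y
    by (rule bcts_eq_indicator[OF bcts_polar_Q bcts_plus[OF bcts_polar_Q bcts_polar_Q] _ f])
       (simp add: polar_Q_ind linear_add[OF bounded_linear.linear[OF E_bl]] inner_add_left)
  show "polar Q f (c *\<^sub>R x) y = c * polar Q f x y" for c x y
    by (rule bcts_eq_indicator[OF bcts_polar_Q bcts_cmult[OF bcts_polar_Q] _ f])
       (simp add: polar_Q_ind linear_scale[OF bounded_linear.linear[OF E_bl]])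
  show "polar Q f x y = polar Q f y x" for x y
    by (rule bcts_eq_indicator[OF bcts_polar_Q bcts_polar_Q _ f]) (simp add: polar_Q_ind, metis E_sym inner_commute)
  show "polar Q f x x = Q x f" for x
    by (rule bcts_eq_indicator[OF bcts_polar_Q bcts_Q _ f]) (simp add: polar_Q_ind Q_ind)
qed

sublocale spectral_calculus Q by (rule calculus)

lemma Phi_ind: "S \<in> sets borel \<Longrightarrow> \<Phi> (indicator S) x = E S x"
  by (rule Phi_eqI[OF bfun_ind]) (simp_all add: polar_Q_ind)

lemma calculus_mult: "spectral_calculus_mult Q"
proof (unfold_locales, rule eq_by_inner)
  fix f g x y assume f: "bfun f" and g: "bfun g"
  have step1: "polar Q h (E S x) y = polar Q (\<lambda>s. indicator S s * h s) x y"
    if h: "bfun h" and S: "S \<in> sets borel" for h S x y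
  proof (rule bcts_eq_indicator[OF bcts_polar_Q bcts_premult[OF bcts_polar_Q bfun_ind[OF S]] _ h])
    fix R :: "real set" assume R: "R \<in> sets borel"
    have SR: "S \<inter> R \<in> sets borel" using S R by simp
    have "polar Q (indicator R) (E S x) y = E (R \<inter> S) x \<bullet> y"
      using R S by (simp add: polar_Q_ind E_Int)
    also have "\<dots> = polar Q (\<lambda>s. indicator S s * indicator R s) x y"
      unfolding indicator_inter_arith[symmetric] polar_Q_ind[OF SR] by (simp add: Int_commute)
    finally show "polar Q (indicator R) (E S x) y = polar Q (\<lambda>s. indicator S s * indicator R s) x y" .
  qed
  have "polar Q g x (\<Phi> f y) = polar Q (\<lambda>s. f s * g s) x y"
  proof (rule bcts_eq_indicator[OF bcts_polar_Q bcts_premult[OF bcts_polar_Q f] _ g])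
    fix S :: "real set" assume S: "S \<in> sets borel"
    have "polar Q (indicator S) x (\<Phi> f y) = \<Phi> f y \<bullet> E S x"
      unfolding polar_Q_ind[OF S] by (rule inner_commute)
    also have "\<dots> = polar Q f (E S x) y" by (simp only: Phi_inner[OF f] polar_sym[OF f])
    also have "\<dots> = polar Q (\<lambda>s. indicator S s * f s) x y" by (rule step1[OF f S])
    finally show "polar Q (indicator S) x (\<Phi> f y) = polar Q (\<lambda>s. f s * indicator S s) x y"
      by (simp only: mult.commute)
  qed
  moreover have "\<Phi> f (\<Phi> g x) \<bullet> y = polar Q g x (\<Phi> f y)"
    by (simp only: Phi_sym[OF f] Phi_inner[OF g])
  ultimately show "\<Phi> f (\<Phi> g x) \<bullet> y = \<Phi> (\<lambda>s. f s * g s) x \<bullet> y"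
    by (simp only: Phi_inner[OF bfun_mult[OF f g]])
qed

sublocale spectral_calculus_mult Q by (rule calculus_mult)

end

section \<open>Spectral integrals of unbounded functions\<close>

text \<open>The cut-off intervals are those of the projections \<open>P n\<close>, so that a
  spectral integral composed with \<open>P n\<close> becomes the bounded calculus of a truncated
  function.\<close>

definition trunc :: "nat \<Rightarrow> (real \<Rightarrow> real) \<Rightarrow> real \<Rightarrow> real" where
  "trunc N f s = indicator {- real N..real N} s * f s"

definition locally_bounded :: "(real \<Rightarrow> real) \<Rightarrow> bool" where
  "locally_bounded f \<longleftrightarrow> f \<in> borel_measurable borel \<and> (\<forall>N::nat. \<exists>c. \<forall>s\<in>{- real N..real N}. \<bar>f s\<bar> \<le> c)"

lemma bfun_trunc: assumes f: "locally_bounded f" shows "bfun (trunc N f)"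
proof -
  obtain c where c: "\<forall>s\<in>{- real N..real N}. \<bar>f s\<bar> \<le> c" using f by (auto simp: locally_bounded_def)
  have fm: "f \<in> borel_measurable borel" using f by (simp add: locally_bounded_def)
  have "trunc N f \<in> borel_measurable borel"
    unfolding trunc_def[abs_def] using fm by measurable
  moreover have "\<bar>trunc N f s\<bar> \<le> max c 0" for s
    using c by (auto simp: trunc_def indicator_def le_max_iff_disj)
  ultimately show ?thesis by (rule bfunI)
qed

lemma trunc_trunc: "n \<le> m \<Longrightarrow> indicator {- real n..real n} s * trunc m f s = trunc n f s"
  by (auto simp: trunc_def indicator_def)

lemma trunc_trunc': "m \<le> n \<Longrightarrow> indicator {- real n..real n} s * trunc m f s = trunc m f s"
  by (auto simp: trunc_def indicator_def)

lemma trunc_lim: "(\<lambda>n. trunc n f s) \<longlonglongrightarrow> f s"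
proof -
  obtain N :: nat where N: "\<bar>s\<bar> \<le> real N" using real_arch_simple by blast
  have "trunc n f s = f s" if "n \<ge> N" for n
  proof -
    have "\<bar>s\<bar> \<le> real n" using N that by linarith
    then show ?thesis by (auto simp: trunc_def indicator_def abs_le_iff)
  qed
  then have "eventually (\<lambda>n. trunc n f s = f s) sequentially" unfolding eventually_sequentially by blast
  then show ?thesis by (rule tendsto_eventually)
qed

context spectral_calculus_mult begin

lemma q_diff:
  assumes "bfun f" "bfun g" shows "q x (\<lambda>s. f s - g s) = q x f - q x g"
proof -
  have "q x (\<lambda>s. f s + (-1) * g s) = q x f + q x (\<lambda>s. (-1) * g s)"
    by (rule bcts_addD[OF bcts assms(1) bfun_mult[OF bfun_const assms(2)]])
  moreover have "q x (\<lambda>s. (-1) * g s) = (-1) * q x g" by (rule bcts_scaleD[OF bcts assms(2)])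
  ultimately show ?thesis by simp
qed

text \<open>The difference equals itself times \<open>indicator S\<close>, and multiplicativity
  routes it through the zero projection of \<open>S\<close>. Applied to the half-line below
  \<open>\<nu>\<close>.\<close>

lemma Phi_cong_null:
  assumes f: "bfun f" and g: "bfun g" and S: "S \<in> sets borel" and null: "\<And>x. \<Phi> (indicator S) x = 0"
    and eq: "\<And>s. s \<notin> S \<Longrightarrow> f s = g s"
  shows "\<Phi> f x = \<Phi> g x"
proof -
  have "(\<lambda>s. (f s - g s) * indicator S s) = (\<lambda>s. f s - g s)"
    using eq by (auto simp: indicator_def fun_eq_iff)
  then have "\<Phi> (\<lambda>s. f s - g s) x = \<Phi> (\<lambda>s. f s - g s) (\<Phi> (indicator S) x)"
    using Phi_mult[OF bfun_diff[OF f g] bfun_ind[OF S]] by simp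
  also have "\<dots> = 0" unfolding null using Phi_bounded_linear[OF bfun_diff[OF f g]] by (rule linear_simps)
  finally show ?thesis by (simp add: Phi_diff[OF f g])
qed

end

section \<open>Projections of bounded intervals, and spectral integrals as strong limits\<close>

context pvm begin

definition P where "P n = E {- real n..real n}"

lemma ball_sets[simp]: "{- real n..real n} \<in> sets borel" by simp

lemma P_Phi: "P n x = \<Phi> (indicator {- real n..real n}) x" by (simp add: P_def Phi_ind)

lemma P_bl: "bounded_linear (P n)" unfolding P_def by (rule E_bl) simp
lemma P_sym: "P n x \<bullet> y = x \<bullet> P n y" unfolding P_def by (rule E_sym) simp
lemma P_P: "P n (P k x) = P (min n k) x"
proof -
  have "{- real n..real n} \<inter> {- real k..real k} = {- real (min n k)..real (min n k)}" by (auto simp: min_def)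
  then show ?thesis unfolding P_def by (simp add: E_Int[symmetric])
qed
lemma P_norm: "norm (P n x) \<le> norm x"
  using Phi_norm[OF bfun_ind[OF ball_sets] indicator_01_bounded, of n x] by (simp add: P_Phi)

lemma P_lim: "(\<lambda>n. P n x) \<longlonglongrightarrow> x"
proof -
  have "(\<lambda>n. \<Phi> (indicator {- real n..real n}) x) \<longlonglongrightarrow> \<Phi> (\<lambda>s. 1) x"
  proof (rule Phi_lim[OF bfun_ind[OF ball_sets] indicator_01_bounded])
    show "(\<lambda>n. indicator {- real n..real n} s) \<longlonglongrightarrow> (1::real)" for s
      using trunc_lim[of "\<lambda>s. 1" s] by (simp add: trunc_def[abs_def])
  qed
  then show ?thesis by (simp add: P_Phi Phi_one)
qed

lemma P_trunc: assumes f: "locally_bounded f"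
  shows "\<Phi> (trunc m f) (P n x) = \<Phi> (trunc (min n m) f) x" "P n (\<Phi> (trunc m f) x) = \<Phi> (trunc (min n m) f) x"
proof -
  have *: "indicator {- real n..real n} s * trunc m f s = trunc (min n m) f s" for s
    by (cases "n \<le> m") (simp_all add: trunc_trunc trunc_trunc' min_def)
  show "\<Phi> (trunc m f) (P n x) = \<Phi> (trunc (min n m) f) x"
    unfolding P_Phi Phi_mult[OF bfun_trunc[OF f] bfun_ind[OF ball_sets]] using *
    by (simp add: mult.commute)
  show "P n (\<Phi> (trunc m f) x) = \<Phi> (trunc (min n m) f) x"
    unfolding P_Phi Phi_mult[OF bfun_ind[OF ball_sets] bfun_trunc[OF f]] using * by simp
qed

text \<open>The squared norms are the integrals of the squared truncations, which increase to the
  square of \<open>f\<close>; monotone convergence turns a bound on them into integrability.\<close>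

lemma dom_iff: assumes f: "locally_bounded f"
  shows "x \<in> spectral_integral_dom E f \<longleftrightarrow> (\<exists>C. \<forall>n. norm (\<Phi> (trunc n f) x) \<le> C)"
proof -
  have fm: "f \<in> borel_measurable borel" using f by (simp add: locally_bounded_def)
  have int: "integrable (\<mu> x) (\<lambda>s. (trunc n f s)\<^sup>2)" for n
    using integrable_bfun[OF finite_mu sets_mu bfun_mult[OF bfun_trunc[OF f, of n] bfun_trunc[OF f, of n]]]
    by (simp add: power2_eq_square)
  have norm: "(norm (\<Phi> (trunc n f) x))\<^sup>2 = (\<integral>s. (trunc n f s)\<^sup>2 \<partial>\<mu> x)" for n
    using Phi_norm_sq[OF bfun_trunc[OF f]] by (simp add: Q_def)
  have le: "(trunc n f s)\<^sup>2 \<le> (f s)\<^sup>2" for n s by (auto simp: trunc_def indicator_def)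
  show ?thesis
  proof
    assume "x \<in> spectral_integral_dom E f"
    then have i: "integrable (\<mu> x) (\<lambda>s. (f s)\<^sup>2)" by (simp add: spectral_integral_dom_def)
    have "(norm (\<Phi> (trunc n f) x))\<^sup>2 \<le> (\<integral>s. (f s)\<^sup>2 \<partial>\<mu> x)" for n
      unfolding norm by (rule integral_mono[OF int i le])
    then have "norm (\<Phi> (trunc n f) x) \<le> sqrt (\<integral>s. (f s)\<^sup>2 \<partial>\<mu> x)" for n
      by (rule real_le_rsqrt)
    then show "\<exists>C. \<forall>n. norm (\<Phi> (trunc n f) x) \<le> C" by blast
  next
    assume "\<exists>C. \<forall>n. norm (\<Phi> (trunc n f) x) \<le> C"
    then obtain C where C: "\<And>n. norm (\<Phi> (trunc n f) x) \<le> C" by blast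
    have mono: "(trunc n f s)\<^sup>2 \<le> (trunc m f s)\<^sup>2" if "n \<le> m" for n m s
      using that by (auto simp: trunc_def indicator_def)
    have inc: "incseq (\<lambda>n. \<integral>s. (trunc n f s)\<^sup>2 \<partial>\<mu> x)"
      by (intro incseq_SucI integral_mono int mono) simp
    have "(\<integral>s. (trunc n f s)\<^sup>2 \<partial>\<mu> x) \<le> C\<^sup>2" for n
      unfolding norm[symmetric] by (intro power_mono C) simp
    then obtain L where L: "(\<lambda>n. \<integral>s. (trunc n f s)\<^sup>2 \<partial>\<mu> x) \<longlonglongrightarrow> L"
      using incseq_convergent[OF inc] by blast
    have "integrable (\<mu> x) (\<lambda>s. (f s)\<^sup>2)"
    proof (rule integrable_monotone_convergence[OF int _ _ L])
      show "AE s in \<mu> x. mono (\<lambda>n. (trunc n f s)\<^sup>2)" by (simp add: mono_def mono)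
      show "AE s in \<mu> x. (\<lambda>n. (trunc n f s)\<^sup>2) \<longlonglongrightarrow> (f s)\<^sup>2"
        by (simp add: tendsto_power trunc_lim)
      show "(\<lambda>s. (f s)\<^sup>2) \<in> borel_measurable (\<mu> x)" using fm by simp
    qed
    then show "x \<in> spectral_integral_dom E f" by (simp add: spectral_integral_dom_def)
  qed
qed

lemma dom_P: assumes f: "locally_bounded f" shows "P n x \<in> spectral_integral_dom E f"
proof -
  obtain c where c: "\<And>s. \<bar>trunc n f s\<bar> \<le> c" using bfun_bound[OF bfun_trunc[OF f, of n]] by auto
  have "\<bar>trunc m f s\<bar> \<le> c" if "m \<le> n" for m s
    using c[of s] that by (auto simp: trunc_def indicator_def split: if_splits)
  then have "norm (\<Phi> (trunc m f) (P n x)) \<le> c * norm x" for m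
    unfolding P_trunc[OF f] by (intro Phi_norm[OF bfun_trunc[OF f]]) simp
  then show ?thesis unfolding dom_iff[OF f] by blast
qed

lemma dom_add: assumes f: "locally_bounded f" and x: "x \<in> spectral_integral_dom E f" and y: "y \<in> spectral_integral_dom E f"
  shows "x + y \<in> spectral_integral_dom E f" "x - y \<in> spectral_integral_dom E f"
proof -
  obtain C where C: "\<And>n. norm (\<Phi> (trunc n f) x) \<le> C" using x unfolding dom_iff[OF f] by blast
  obtain D where D: "\<And>n. norm (\<Phi> (trunc n f) y) \<le> D" using y unfolding dom_iff[OF f] by blast
  have "norm (\<Phi> (trunc n f) (x + y)) \<le> C + D" for n
    unfolding linear_add[OF bounded_linear.linear[OF Phi_bounded_linear[OF bfun_trunc[OF f]]]]
    by (rule norm_triangle_mono[OF C D])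
  moreover have "norm (\<Phi> (trunc n f) (x - y)) \<le> C + D" for n
    unfolding linear_diff[OF bounded_linear.linear[OF Phi_bounded_linear[OF bfun_trunc[OF f]]]]
    by (rule order_trans[OF norm_triangle_ineq4 add_mono[OF C D]])
  ultimately show "x + y \<in> spectral_integral_dom E f" "x - y \<in> spectral_integral_dom E f"
    unfolding dom_iff[OF f] by blast+
qed

text \<open>The increments of the truncations live on disjoint sets, so squared norms add as in
  Pythagoras. A bounded increasing sequence of squared norms is Cauchy, and so are the
  vectors.\<close>

lemma Phi_trunc_convergent:
  assumes f: "locally_bounded f" and x: "x \<in> spectral_integral_dom E f"
  shows "convergent (\<lambda>n. \<Phi> (trunc n f) x)"
proof -
  let ?a = "\<lambda>n. (norm (\<Phi> (trunc n f) x))\<^sup>2"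
  have bf: "bfun (trunc n f)" for n by (rule bfun_trunc[OF f])
  have bf2: "bfun (\<lambda>s. trunc n f s * trunc n f s)" for n by (rule bfun_mult[OF bf bf])
  have diff: "(norm (\<Phi> (trunc m f) x - \<Phi> (trunc n f) x))\<^sup>2 = ?a m - ?a n" if "n \<le> m" for n m
  proof -
    have e: "(trunc m f s - trunc n f s)\<^sup>2 = trunc m f s * trunc m f s - trunc n f s * trunc n f s" for s
      using that by (auto simp: trunc_def indicator_def power2_eq_square)
    have "(norm (\<Phi> (trunc m f) x - \<Phi> (trunc n f) x))\<^sup>2 = Q x (\<lambda>s. (trunc m f s - trunc n f s)\<^sup>2)"
      using Phi_norm_sq[OF bfun_diff[OF bf bf], of m n x] by (simp only: Phi_diff[OF bf bf])
    also have "\<dots> = ?a m - ?a n"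
      unfolding e q_diff[OF bf2 bf2] Phi_norm_sq[OF bf] by (simp add: power2_eq_square)
    finally show ?thesis .
  qed
  have inc: "incseq ?a" unfolding incseq_def using diff zero_le_power2 by (metis diff_ge_0_iff_ge)
  obtain C where C: "\<And>n. norm (\<Phi> (trunc n f) x) \<le> C" using x unfolding dom_iff[OF f] by blast
  have "?a n \<le> C\<^sup>2" for n by (intro power_mono C) simp
  then have "convergent ?a" using incseq_convergent[OF inc] convergent_def by blast
  then have ca: "Cauchy ?a" by (rule convergent_Cauchy)
  have "Cauchy (\<lambda>n. \<Phi> (trunc n f) x)"
  proof (rule CauchyI)
    fix e :: real assume e: "0 < e"
    then have "e\<^sup>2 > 0" by simp
    then obtain N where N: "\<And>m n. m \<ge> N \<Longrightarrow> n \<ge> N \<Longrightarrow> norm (?a m - ?a n) < e\<^sup>2"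
      using CauchyD[OF ca] by blast
    have *: "norm (\<Phi> (trunc m f) x - \<Phi> (trunc n f) x) < e" if "n \<ge> N" "n \<le> m" for m n
    proof -
      have "(norm (\<Phi> (trunc m f) x - \<Phi> (trunc n f) x))\<^sup>2 < e\<^sup>2"
        unfolding diff[OF that(2)] using N[of m n] that by simp
      then show ?thesis using e by (simp add: power_less_imp_less_base)
    qed
    show "\<exists>M. \<forall>m\<ge>M. \<forall>n\<ge>M. norm (\<Phi> (trunc m f) x - \<Phi> (trunc n f) x) < e"
    proof (intro exI[of _ N] allI impI)
      fix m n assume "m \<ge> N" "n \<ge> N"
      then show "norm (\<Phi> (trunc m f) x - \<Phi> (trunc n f) x) < e"
        using *[of n m] *[of m n] norm_minus_commute[of "\<Phi> (trunc m f) x"] by (cases "n \<le> m") auto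
    qed
  qed
  then show ?thesis by (rule Cauchy_convergent)
qed

text \<open>Links the polarized definition with the bounded calculus. The strong limit satisfies the
  defining identity by dominated convergence, and it is the only such vector because the domain
  contains every \<open>P n y\<close>.\<close>

lemma spectral_integral_lim:
  assumes f: "locally_bounded f" and x: "x \<in> spectral_integral_dom E f"
  shows "(\<lambda>n. \<Phi> (trunc n f) x) \<longlonglongrightarrow> spectral_integral E f x"
proof -
  obtain z where z: "(\<lambda>n. \<Phi> (trunc n f) x) \<longlonglongrightarrow> z"
    using Phi_trunc_convergent[OF f x] convergent_def by blast
  have fm: "f \<in> borel_measurable borel" using f by (simp add: locally_bounded_def)
  have lim: "(\<lambda>n. \<integral>s. trunc n f s \<partial>\<mu> y) \<longlonglongrightarrow> (\<integral>s. f s \<partial>\<mu> y)" if y: "y \<in> spectral_integral_dom E f" for y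
  proof (rule integral_dominated_convergence[where w="\<lambda>s. \<bar>f s\<bar>"])
    have "integrable (\<mu> y) f"
      by (rule finite_mu.square_integrable_imp_integrable)
         (use y fm in \<open>auto simp: spectral_integral_dom_def\<close>)
    then show "integrable (\<mu> y) (\<lambda>s. \<bar>f s\<bar>)" by simp
    show "trunc n f \<in> borel_measurable (\<mu> y)" for n using bfun_meas[OF bfun_trunc[OF f]] by simp
    show "f \<in> borel_measurable (\<mu> y)" using fm by simp
    show "AE s in \<mu> y. (\<lambda>n. trunc n f s) \<longlonglongrightarrow> f s" by (simp add: trunc_lim)
    show "AE s in \<mu> y. norm (trunc n f s) \<le> \<bar>f s\<bar>" for n by (auto simp: trunc_def indicator_def)
  qed
  let ?R = "\<lambda>y. ((LINT s|\<mu> (x + y). f s) - (LINT s|\<mu> (x - y). f s)) / 4"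
  have zy: "z \<bullet> y = ?R y" if y: "y \<in> spectral_integral_dom E f" for y
  proof (rule LIMSEQ_unique)
    show "(\<lambda>n. \<Phi> (trunc n f) x \<bullet> y) \<longlonglongrightarrow> z \<bullet> y" by (intro tendsto_intros z)
    show "(\<lambda>n. \<Phi> (trunc n f) x \<bullet> y) \<longlonglongrightarrow> ?R y"
      unfolding Phi_inner[OF bfun_trunc[OF f]] polar_def Q_def
      by (intro tendsto_intros lim dom_add[OF f x y]) simp
  qed
  have "spectral_integral E f x = z"
    unfolding spectral_integral_def
  proof (rule the_equality)
    show "\<forall>y\<in>spectral_integral_dom E f. z \<bullet> y = ?R y" using zy by blast
    fix z' assume z': "\<forall>y\<in>spectral_integral_dom E f. z' \<bullet> y = ?R y"
    have "(z' - z) \<bullet> P n (z' - z) = 0" for n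
      unfolding inner_diff_left using trans[OF bspec[OF z' dom_P[OF f]] zy[OF dom_P[OF f], symmetric]]
      by (simp only: diff_self)
    moreover have "(\<lambda>n. (z' - z) \<bullet> P n (z' - z)) \<longlonglongrightarrow> (z' - z) \<bullet> (z' - z)"
      by (intro tendsto_intros P_lim)
    ultimately have "(z' - z) \<bullet> (z' - z) = 0" by (simp add: LIMSEQ_const_iff)
    then show "z' = z" by simp
  qed
  then show ?thesis using z by simp
qed

lemma spectral_integral_P:
  assumes f: "locally_bounded f" shows "spectral_integral E f (P n x) = \<Phi> (trunc n f) x"
proof -
  have "(\<lambda>m. \<Phi> (trunc m f) (P n x)) \<longlonglongrightarrow> \<Phi> (trunc n f) x"
  proof (rule tendsto_eventually)
    show "eventually (\<lambda>m. \<Phi> (trunc m f) (P n x) = \<Phi> (trunc n f) x) sequentially"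
      unfolding eventually_sequentially P_trunc[OF f] by (rule exI[of _ n]) (simp add: min_def)
  qed
  then show ?thesis using spectral_integral_lim[OF f dom_P[OF f]] LIMSEQ_unique by blast
qed

lemma P_spectral_integral:
  assumes f: "locally_bounded f" and x: "x \<in> spectral_integral_dom E f"
  shows "P n (spectral_integral E f x) = \<Phi> (trunc n f) x"
proof -
  have "(\<lambda>m. P n (\<Phi> (trunc m f) x)) \<longlonglongrightarrow> P n (spectral_integral E f x)"
    by (rule bounded_linear.tendsto[OF P_bl spectral_integral_lim[OF f x]])
  moreover have "(\<lambda>m. P n (\<Phi> (trunc m f) x)) \<longlonglongrightarrow> \<Phi> (trunc n f) x"
  proof (rule tendsto_eventually)
    show "eventually (\<lambda>m. P n (\<Phi> (trunc m f) x) = \<Phi> (trunc n f) x) sequentially"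
      unfolding eventually_sequentially P_trunc[OF f] by (rule exI[of _ n]) (simp add: min_def)
  qed
  ultimately show ?thesis using LIMSEQ_unique by blast
qed

lemma spectral_integral_sym:
  assumes f: "locally_bounded f" and x: "x \<in> spectral_integral_dom E f" and y: "y \<in> spectral_integral_dom E f"
  shows "spectral_integral E f x \<bullet> y = x \<bullet> spectral_integral E f y"
proof (rule LIMSEQ_unique)
  show "(\<lambda>n. \<Phi> (trunc n f) x \<bullet> y) \<longlonglongrightarrow> spectral_integral E f x \<bullet> y"
    by (intro tendsto_intros spectral_integral_lim[OF f x])
  show "(\<lambda>n. \<Phi> (trunc n f) x \<bullet> y) \<longlonglongrightarrow> x \<bullet> spectral_integral E f y"
    unfolding Phi_sym[OF bfun_trunc[OF f]] by (intro tendsto_intros spectral_integral_lim[OF f y])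
qed

end

lemma locally_bounded_id: "locally_bounded (\<lambda>s. s)"
  by (auto simp: locally_bounded_def abs_le_iff intro!: exI)

lemma locally_bounded_sqrt: "locally_bounded sqrt"
  unfolding locally_bounded_def
proof (intro conjI allI)
  fix N :: nat
  have "\<bar>sqrt s\<bar> \<le> sqrt (real N)" if "s \<in> {- real N..real N}" for s
    using that unfolding abs_le_iff real_sqrt_minus[symmetric] by simp
  then show "\<exists>c. \<forall>s\<in>{- real N..real N}. \<bar>sqrt s\<bar> \<le> c" by blast
qed simp

section \<open>The spectral measure of a coercive self-adjoint operator\<close>

locale coercive_operator =
  fixes D :: "'h::{real_inner,complete_space} set" and A :: "'h \<Rightarrow> 'h" and \<nu> :: real
  assumes sa: "self_adjoint_operator D A" and nu_pos: "0 < \<nu>"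
    and coer: "x \<in> D \<Longrightarrow> \<nu> * (x \<bullet> x) \<le> A x \<bullet> x"
begin

lemma D_sub: "subspace D" and A_add: "x \<in> D \<Longrightarrow> y \<in> D \<Longrightarrow> A (x + y) = A x + A y"
  and A_scale: "x \<in> D \<Longrightarrow> A (c *\<^sub>R x) = c *\<^sub>R A x" and D_dense: "closure D = UNIV"
  and D_adj: "adjoint_dom D A = D" and A_adj: "x \<in> D \<Longrightarrow> adjoint_op D A x = A x"
  using sa unfolding self_adjoint_operator_def linear_operator_on_def by simp_all

lemma A_diff: assumes "x \<in> D" "y \<in> D" shows "A (x - y) = A x - A y"
  using A_add[OF assms(1) subspace_mul[OF D_sub assms(2), of "-1"]] A_scale[OF assms(2), of "-1"] by simp

lemma dense_orthogonal: assumes "\<And>x. x \<in> D \<Longrightarrow> x \<bullet> z = 0" shows "z = 0"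
proof -
  have "z \<in> closure D" using D_dense by simp
  then obtain x where x: "\<And>n. x n \<in> D" "x \<longlonglongrightarrow> z" unfolding closure_sequential by blast
  have "(\<lambda>n. x n \<bullet> z) \<longlonglongrightarrow> z \<bullet> z" by (intro tendsto_intros x)
  then have "z \<bullet> z = 0" using assms x by (simp add: LIMSEQ_const_iff)
  then show ?thesis by simp
qed

text \<open>The form in which self-adjointness is used: a weak solution \<open>y\<close> of
  \<open>A y = z\<close> lies in the domain and solves the equation.\<close>

lemma adjoint_mem: assumes "\<And>x. x \<in> D \<Longrightarrow> A x \<bullet> y = x \<bullet> z" shows "y \<in> D" "A y = z"
proof -
  show y: "y \<in> D" using assms D_adj unfolding adjoint_dom_def by blast
  have "adjoint_op D A y = z" unfolding adjoint_op_def
  proof (rule the_equality)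
    fix w assume w: "\<forall>x\<in>D. A x \<bullet> y = x \<bullet> w"
    have "w - z = 0" by (rule dense_orthogonal) (use w assms in \<open>simp add: inner_diff_right\<close>)
    then show "w = z" by simp
  qed (use assms in blast)
  then show "A y = z" using A_adj[OF y] by simp
qed

lemma A_sym: assumes "x \<in> D" "y \<in> D" shows "A x \<bullet> y = x \<bullet> A y"
proof -
  obtain z where z: "\<And>x. x \<in> D \<Longrightarrow> A x \<bullet> y = x \<bullet> z" using assms(2) D_adj unfolding adjoint_dom_def by blast
  show ?thesis using z[OF assms(1)] adjoint_mem(2)[OF z] by simp
qed

lemma A_lower: assumes "x \<in> D" shows "\<nu> * norm x \<le> norm (A x)"
proof (cases "x = 0")
  case False
  have "(\<nu> * norm x) * norm x \<le> A x \<bullet> x"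
    using coer[OF assms] by (simp add: power2_norm_eq_inner[symmetric] power2_eq_square)
  also have "\<dots> \<le> norm (A x) * norm x" by (rule norm_cauchy_schwarz)
  finally show ?thesis using False by simp
qed simp

lemma A_inj: assumes "x \<in> D" "y \<in> D" "A x = A y" shows "x = y"
proof -
  have "\<nu> * norm (x - y) \<le> norm (A (x - y))" by (rule A_lower[OF subspace_diff[OF D_sub assms(1,2)]])
  then have "\<nu> * norm (x - y) \<le> 0" using A_diff[OF assms(1,2)] assms(3) by simp
  then show ?thesis using nu_pos by (simp add: mult_le_0_iff)
qed

text \<open>By the lower bound, preimages of a Cauchy sequence are Cauchy, so the range is closed. A
  vector orthogonal to the range lies in the kernel of the adjoint, which is \<open>A\<close> itself
  and is injective.\<close>

lemma A_surj: "\<exists>x\<in>D. A x = h"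
proof -
  have R: "subspace (A ` D)"
    unfolding subspace_def
  proof (intro conjI ballI allI)
    have "A 0 = 0" using A_scale[OF subspace_0[OF D_sub], of 0] by simp
    then show "0 \<in> A ` D" using subspace_0[OF D_sub] by (metis imageI)
    fix u v assume "u \<in> A ` D" "v \<in> A ` D"
    then show "u + v \<in> A ` D" using A_add subspace_add[OF D_sub] by (metis (no_types, lifting) imageE imageI)
  next
    fix c u assume "u \<in> A ` D"
    then show "c *\<^sub>R u \<in> A ` D" using A_scale subspace_mul[OF D_sub] by (metis (no_types, lifting) imageE imageI)
  qed
  have cl: "closed (A ` D)"
    unfolding closed_sequential_limits
  proof (intro allI impI, elim conjE)
    fix v l assume v: "\<forall>n. v n \<in> A ` D" and l: "v \<longlonglongrightarrow> l"
    then have "\<forall>n. \<exists>x. x \<in> D \<and> v n = A x" by blast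
    then obtain x where x: "\<And>n. x n \<in> D" "\<And>n. v n = A (x n)" by metis
    have "Cauchy v" using l LIMSEQ_imp_Cauchy by blast
    have "Cauchy x"
    proof (rule CauchyI)
      fix e :: real assume "0 < e"
      then have "0 < \<nu> * e" using nu_pos by simp
      then obtain M where M: "\<And>m n. m \<ge> M \<Longrightarrow> n \<ge> M \<Longrightarrow> norm (v m - v n) < \<nu> * e"
        using CauchyD[OF \<open>Cauchy v\<close>] by blast
      have "norm (x m - x n) < e" if "m \<ge> M" "n \<ge> M" for m n
      proof -
        have "\<nu> * norm (x m - x n) \<le> norm (v m - v n)"
          using A_lower[OF subspace_diff[OF D_sub x(1) x(1)], of m n] by (simp add: x(2) A_diff[OF x(1) x(1)])
        also have "\<dots> < \<nu> * e" by (rule M[OF that])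
        finally show ?thesis using nu_pos by simp
      qed
      then show "\<exists>M. \<forall>m\<ge>M. \<forall>n\<ge>M. norm (x m - x n) < e" by blast
    qed
    then obtain z where z: "x \<longlonglongrightarrow> z" using Cauchy_convergent convergent_def by blast
    have "A w \<bullet> z = w \<bullet> l" if w: "w \<in> D" for w
    proof (rule LIMSEQ_unique)
      show "(\<lambda>n. A w \<bullet> x n) \<longlonglongrightarrow> A w \<bullet> z" by (intro tendsto_intros z)
      show "(\<lambda>n. A w \<bullet> x n) \<longlonglongrightarrow> w \<bullet> l"
        unfolding A_sym[OF w x(1)] x(2)[symmetric] by (intro tendsto_intros l)
    qed
    from adjoint_mem[OF this] show "l \<in> A ` D" by blast
  qed
  obtain r where r: "r \<in> A ` D" "\<And>y. y \<in> A ` D \<Longrightarrow> (h - r) \<bullet> y = 0"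
    using orthogonal_projection_exists[OF R cl] by blast
  have "A x \<bullet> (h - r) = x \<bullet> 0" if "x \<in> D" for x using r(2)[of "A x"] that by (simp add: inner_commute)
  from adjoint_mem[OF this] have "h - r \<in> D" "A (h - r) = 0" by simp_all
  then have "h - r = 0" using A_lower[of "h - r"] nu_pos by (simp add: mult_le_0_iff)
  then show ?thesis using r(1) by auto
qed

text \<open>The calculus of the positive contraction \<open>T = \<nu> A\<^bsup>-1\<^esup>\<close> becomes that of \<open>A\<close> under \<open>s \<mapsto> \<nu> / s\<close>.\<close>

definition T where "T y = \<nu> *\<^sub>R (THE x. x \<in> D \<and> A x = y)"

lemma T_A: assumes "x \<in> D" shows "T (A x) = \<nu> *\<^sub>R x"
proof -
  have "(THE x'. x' \<in> D \<and> A x' = A x) = x" using A_inj assms by (intro the_equality) blast+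
  then show ?thesis by (simp add: T_def)
qed

lemma T_contraction: "positive_contraction T"
proof (rule positive_contraction.intro)
  have sur: "\<And>y. \<exists>x. x \<in> D \<and> y = A x" using A_surj by metis
  show "bounded_linear T"
  proof (rule bounded_linear_intro[where K=1])
    fix y z
    obtain a b where ab: "a \<in> D" "y = A a" "b \<in> D" "z = A b" using sur by metis
    show "T (y + z) = T y + T z"
      unfolding ab(2,4) A_add[OF ab(1,3), symmetric] T_A[OF ab(1)] T_A[OF ab(3)] T_A[OF subspace_add[OF D_sub ab(1,3)]]
      by (rule scaleR_add_right)
    show "T (c *\<^sub>R y) = c *\<^sub>R T y" for c
      unfolding ab(2) A_scale[OF ab(1), symmetric] T_A[OF ab(1)] T_A[OF subspace_mul[OF D_sub ab(1)]] by simp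
    show "norm (T y) \<le> norm y * 1" unfolding ab(2) T_A[OF ab(1)] using A_lower[OF ab(1)] nu_pos by simp
  qed
  fix y z
  obtain a b where ab: "a \<in> D" "y = A a" "b \<in> D" "z = A b" using sur by metis
  show "T y \<bullet> z = y \<bullet> T z"
    unfolding ab(2,4) T_A[OF ab(1)] T_A[OF ab(3)] using A_sym[OF ab(1,3)] by simp
  have "0 \<le> \<nu> * (a \<bullet> a)" using nu_pos by simp
  also have "\<dots> \<le> A a \<bullet> a" by (rule coer[OF ab(1)])
  finally show "0 \<le> T y \<bullet> y" unfolding ab(2) T_A[OF ab(1)] using nu_pos by (simp add: inner_commute)
  have "\<nu> * (a \<bullet> A a) \<le> \<nu> * (norm a * norm (A a))" using nu_pos by (simp add: norm_cauchy_schwarz)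
  also have "\<dots> \<le> norm (A a) * norm (A a)" using A_lower[OF ab(1)] by (simp add: mult.assoc[symmetric] mult_right_mono)
  also have "\<dots> = A a \<bullet> A a" by (simp add: power2_norm_eq_inner[symmetric] power2_eq_square)
  finally show "T y \<bullet> y \<le> y \<bullet> y" unfolding ab(2) T_A[OF ab(1)] by simp
qed

lemma T_inj: assumes "T y = 0" shows "y = 0"
proof -
  obtain x where x: "x \<in> D" "A x = y" using A_surj by blast
  have "x = 0" using T_A[OF x(1)] x(2) assms nu_pos by simp
  then show ?thesis using x A_scale[OF subspace_0[OF D_sub], of 0] by simp
qed

theorem spectral_measure_exists: "\<exists>E. is_spectral_measure_of E D A"
proof -
  interpret T: positive_contraction T by (rule T_contraction)
  obtain q where q: "spectral_calculus_mult q" and qT: "\<And>x. spectral_calculus.\<Phi> q clamp01 x = T x"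
    and qcl: "\<And>x f. bfun f \<Longrightarrow> q x f = q x (\<lambda>s. f (clamp01 s))"
    using T.calculus_exists by blast
  interpret q: spectral_calculus_mult q by (rule q)
  \<comment> \<open>An involution on the whole line, also at 0 because division by 0 yields 0;
    functions can therefore be transferred back and forth.\<close>
  define \<phi> where "\<phi> s = \<nu> / s" for s :: real
  have phi_phi: "\<phi> (\<phi> s) = s" for s using nu_pos by (simp add: \<phi>_def)
  have phi_m[measurable]: "\<phi> \<in> borel_measurable borel" unfolding \<phi>_def[abs_def] by measurable
  define E where "E S = q.\<Phi> (indicator (\<phi> -` S))" for S
  have vim: "\<phi> -` S \<in> sets borel" if "S \<in> sets borel" for S using measurable_sets[OF phi_m that] by simp
  have E: "projection_valued_measure E"
    using q.pvm_of_calculus unfolding projection_valued_measure_def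
  proof (elim conjE, intro conjI)
    assume *: "\<forall>S\<in>sets borel. bounded_linear (q.\<Phi> (indicator S)) \<and>
        (\<forall>x. q.\<Phi> (indicator S) (q.\<Phi> (indicator S) x) = q.\<Phi> (indicator S) x) \<and>
        (\<forall>x y. q.\<Phi> (indicator S) x \<bullet> y = x \<bullet> q.\<Phi> (indicator S) y)"
    show "\<forall>S\<in>sets borel. bounded_linear (E S) \<and> (\<forall>x. E S (E S x) = E S x) \<and> (\<forall>x y. E S x \<bullet> y = x \<bullet> E S y)"
      unfolding E_def using * vim by blast
  next
    assume "\<forall>x. q.\<Phi> (indicator UNIV) x = x"
    then show "\<forall>x. E UNIV x = x" unfolding E_def by simp
  next
    assume *: "\<forall>S\<in>sets borel. \<forall>T\<in>sets borel. \<forall>x. q.\<Phi> (indicator (S \<inter> T)) x = q.\<Phi> (indicator S) (q.\<Phi> (indicator T) x)"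
    show "\<forall>S\<in>sets borel. \<forall>T\<in>sets borel. \<forall>x. E (S \<inter> T) x = E S (E T x)"
      unfolding E_def vimage_Int using * vim by blast
  next
    assume *: "\<forall>F. range F \<subseteq> sets borel \<longrightarrow> disjoint_family F \<longrightarrow>
       (\<forall>x. (\<lambda>n. q.\<Phi> (indicator (F n)) x) sums q.\<Phi> (indicator (\<Union>n::nat. F n)) x)"
    show "\<forall>F. range F \<subseteq> sets borel \<longrightarrow> disjoint_family F \<longrightarrow> (\<forall>x. (\<lambda>n. E (F n) x) sums E (\<Union>n::nat. F n) x)"
    proof (intro allI impI)
      fix F :: "nat \<Rightarrow> real set" and x assume F: "range F \<subseteq> sets borel" "disjoint_family F"
      have "range (\<lambda>n. \<phi> -` F n) \<subseteq> sets borel" using F vim by blast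
      moreover have "disjoint_family (\<lambda>n. \<phi> -` F n)" using F(2) unfolding disjoint_family_on_def by blast
      ultimately have "(\<lambda>n. q.\<Phi> (indicator (\<phi> -` F n)) x) sums q.\<Phi> (indicator (\<Union>n. \<phi> -` F n)) x" using * by blast
      then show "(\<lambda>n. E (F n) x) sums E (\<Union>n. F n) x" unfolding E_def vimage_UN .
    qed
  qed
  interpret E: pvm E by unfold_locales (rule E)
  have bph: "bfun (\<lambda>s. f (\<phi> s))" if f: "bfun f" for f
  proof -
    obtain c where "\<And>s. \<bar>f s\<bar> \<le> c" using bfun_bound[OF f] by auto
    moreover have "(\<lambda>s. f (\<phi> s)) \<in> borel_measurable borel" using bfun_meas[OF f] by measurable
    ultimately show ?thesis by (rule bfunI[rotated])
  qed
  have transfer: "E.\<Phi> f x = q.\<Phi> (\<lambda>s. f (\<phi> s)) x" if f: "bfun f" for f x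
  proof (rule E.Phi_eqI[OF f])
    fix y
    have b: "bcts (\<lambda>f. polar q (\<lambda>s. f (\<phi> s)) x y)"
      unfolding bcts_def
    proof (intro conjI allI impI)
      show "polar q (\<lambda>s. f (\<phi> s) + g (\<phi> s)) x y = polar q (\<lambda>s. f (\<phi> s)) x y + polar q (\<lambda>s. g (\<phi> s)) x y"
        if "bfun f" "bfun g" for f g by (rule bcts_addD[OF q.bcts_polar bph[OF that(1)] bph[OF that(2)]])
      show "polar q (\<lambda>s. c * f (\<phi> s)) x y = c * polar q (\<lambda>s. f (\<phi> s)) x y"
        if "bfun f" for f c by (rule bcts_scaleD[OF q.bcts_polar bph[OF that]])
      fix f :: "nat \<Rightarrow> real \<Rightarrow> real" and g and c :: real
      assume f: "\<forall>n. bfun (f n)" "\<forall>n s. \<bar>f n s\<bar> \<le> c" "\<forall>s. (\<lambda>n. f n s) \<longlonglongrightarrow> g s"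
      show "(\<lambda>n. polar q (\<lambda>s. f n (\<phi> s)) x y) \<longlonglongrightarrow> polar q (\<lambda>s. g (\<phi> s)) x y"
        by (rule bcts_limD[OF q.bcts_polar bph[OF spec[OF f(1)]], of _ c]) (use f in auto)
    qed
    have "polar E.Q f x y = polar q (\<lambda>s. f (\<phi> s)) x y"
    proof (rule bcts_eq_indicator[OF E.bcts_polar b _ f])
      fix S :: "real set" assume S: "S \<in> sets borel"
      have "(\<lambda>s. indicator S (\<phi> s) :: real) = indicator (\<phi> -` S)" by (auto simp: indicator_def)
      then show "polar E.Q (indicator S) x y = polar q (\<lambda>s. indicator S (\<phi> s)) x y"
        unfolding E.polar_Q_ind[OF S] E_def q.Phi_inner[OF bfun_ind[OF vim[OF S]]] by simp
    qed
    then show "q.\<Phi> (\<lambda>s. f (\<phi> s)) x \<bullet> y = polar E.Q f x y" by (simp add: q.Phi_inner[OF bph[OF f]])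
  qed
  have bc: "bfun clamp01" using bfun_clamp_pow[of 1] by simp
  define h where "h s = clamp01 (\<phi> s)" for s
  have bh: "bfun h" unfolding h_def by (rule bph[OF bc])
  have Th: "E.\<Phi> h x = T x" for x
    unfolding transfer[OF bh] unfolding h_def phi_phi by (rule qT)
  \<comment> \<open>The calculus of \<open>T\<close> only sees \<open>[0, 1]\<close>. On
    \<open>(0, 1]\<close> the value \<open>\<nu> / s\<close> is at least \<open>\<nu>\<close>; at 0
    the factor \<open>clamp01\<close> vanishes, and this factor may be inserted because
    \<open>T\<close> is injective.\<close>
  have low: "E {..<\<nu>} x = 0" for x
  proof (rule T_inj)
    have S: "{..<\<nu>} \<in> sets borel" by simp
    let ?R = "\<phi> -` {..<\<nu>}"
    have bR: "bfun (indicator ?R)" by (rule bfun_ind[OF vim[OF S]])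
    have b: "bfun (\<lambda>s. clamp01 s * indicator ?R s)" by (rule bfun_mult[OF bc bR])
    have z: "clamp01 (clamp01 s) * indicator ?R (clamp01 s) = 0" for s
    proof (cases "clamp01 s = 0")
      case True then show ?thesis by (simp add: clamp01_def)
    next
      case False
      then have "0 < clamp01 s" "clamp01 s \<le> 1" using clamp01_range[of s] by auto
      then have "\<nu> \<le> \<phi> (clamp01 s)" using nu_pos by (simp add: \<phi>_def field_simps)
      then show ?thesis by (simp add: indicator_def)
    qed
    have "T (E {..<\<nu>} x) = q.\<Phi> (\<lambda>s. clamp01 s * indicator ?R s) x"
      unfolding E_def qT[symmetric] by (rule q.Phi_mult[OF bc bR])
    also have "\<dots> = 0"
    proof (rule q.Phi_eqI[OF b])
      fix y
      have "polar q (\<lambda>s. clamp01 s * indicator ?R s) x y = polar q (\<lambda>s. 0) x y"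
        unfolding polar_def using qcl[OF b] z by simp
      also have "\<dots> = 0" using bcts_scaleD[OF q.bcts_polar[of x y] bfun_const[of 0], of 0] by simp
      finally show "0 \<bullet> y = polar q (\<lambda>s. clamp01 s * indicator ?R s) x y" by simp
    qed
    finally show "T (E {..<\<nu>} x) = 0" .
  qed
  note lb = locally_bounded_id
  \<comment> \<open>On \<open>[\<nu>, \<infinity>)\<close> the function \<open>h\<close>
    representing \<open>T\<close> is \<open>\<nu> / s\<close>, so \<open>s * h s = \<nu>\<close>.
    Applying the truncated identity to \<open>T (A x) = \<nu> *\<^sub>R x\<close> thus produces
    \<open>\<nu>\<close> times \<open>P n (A x)\<close>.\<close>
  have key: "E.\<Phi> (trunc n (\<lambda>s. s)) x = E.P n (A x)" if x: "x \<in> D" for n x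
  proof -
    have "\<nu> *\<^sub>R E.\<Phi> (trunc n (\<lambda>s. s)) x = E.\<Phi> (trunc n (\<lambda>s. s)) (E.\<Phi> h (A x))"
      unfolding Th T_A[OF x] using E.Phi_bounded_linear[OF bfun_trunc[OF lb]] by (simp add: linear_simps)
    also have "\<dots> = E.\<Phi> (\<lambda>s. trunc n (\<lambda>s. s) s * h s) (A x)" by (rule E.Phi_mult[OF bfun_trunc[OF lb] bh])
    also have "\<dots> = E.\<Phi> (\<lambda>s. \<nu> * indicator {- real n..real n} s) (A x)"
    proof (rule E.Phi_cong_null[OF bfun_mult[OF bfun_trunc[OF lb] bh] bfun_mult[OF bfun_const bfun_ind]])
      show "{..<\<nu>} \<in> sets borel" by simp
      show "E.\<Phi> (indicator {..<\<nu>}) x = 0" for x using low by (simp add: E.Phi_ind)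
      fix s assume "s \<notin> {..<\<nu>}"
      then have s: "s \<ge> \<nu>" by simp
      then have "0 \<le> \<phi> s" "\<phi> s \<le> 1" using nu_pos by (auto simp: \<phi>_def)
      then have "s * h s = \<nu>" using s nu_pos unfolding h_def by (simp add: clamp01_id \<phi>_def)
      then show "trunc n (\<lambda>s. s) s * h s = \<nu> * indicator {- real n..real n} s" by (simp add: trunc_def indicator_def)
    qed simp
    also have "\<dots> = \<nu> *\<^sub>R E.P n (A x)" unfolding E.P_Phi by (rule E.Phi_scale[OF bfun_ind]) simp
    finally show ?thesis using nu_pos by simp
  qed
  have D_dom: "x \<in> spectral_integral_dom E (\<lambda>s. s)" if x: "x \<in> D" for x
    unfolding E.dom_iff[OF lb] key[OF x] using E.P_norm by blast
  have AF: "A x = spectral_integral E (\<lambda>s. s) x" if x: "x \<in> D" for x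
    using E.spectral_integral_lim[OF lb D_dom[OF x]] E.P_lim[of "A x"] unfolding key[OF x] using LIMSEQ_unique by blast
  \<comment> \<open>The spectral integral is a symmetric extension of \<open>A\<close>, and a
    self-adjoint operator has no proper one.\<close>
  have "x \<in> D" if x: "x \<in> spectral_integral_dom E (\<lambda>s. s)" for x
    by (rule adjoint_mem(1)[where z="spectral_integral E (\<lambda>s. s) x"])
       (simp only: AF E.spectral_integral_sym[OF lb D_dom x])
  then have "is_spectral_measure_of E D A"
    unfolding is_spectral_measure_of_def using E D_dom AF by blast
  then show ?thesis by blast
qed

end

section \<open>A coercive operator and its square root\<close>

text \<open>The interface to spectral theory: \<open>S\<close> is meant to be the square root,
  \<open>P n\<close> the spectral projections, and the estimates for the evolution equation rest on
  these facts alone. Linearity and closedness of \<open>A\<close> and \<open>S\<close> are recovered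
  from the bounded operators obtained with \<open>P n\<close>.\<close>

locale coercive_sqrt =
  fixes D DS :: "'h::{real_inner,complete_space} set" and A S :: "'h \<Rightarrow> 'h"
    and P :: "nat \<Rightarrow> 'h \<Rightarrow> 'h" and \<nu> :: real
  assumes nu_pos: "0 < \<nu>"
    and P_D: "P n x \<in> D" and D_DS: "D \<subseteq> DS"
    and P_bl: "bounded_linear (P n)" and P_sym: "P n x \<bullet> y = x \<bullet> P n y"
    and P_P: "P n (P k x) = P (min n k) x" and P_lim: "(\<lambda>n. P n x) \<longlonglongrightarrow> x"
    and P_norm: "norm (P n x) \<le> norm x"
    and AP_bl: "bounded_linear (\<lambda>x. A (P n x))" and SP_bl: "bounded_linear (\<lambda>x. S (P n x))"
    and AP: "x \<in> D \<Longrightarrow> A (P n x) = P n (A x)" and SP: "x \<in> DS \<Longrightarrow> S (P n x) = P n (S x)"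
    and SSP: "S (S (P n x)) = A (P n x)" and SP_sym: "S (P n x) \<bullet> y = x \<bullet> S (P n y)"
    and SP_lower: "\<nu> * (norm (P n x))\<^sup>2 \<le> (norm (S (P n x)))\<^sup>2"
    and D_criterion: "(\<And>n. norm (A (P n x)) \<le> C) \<Longrightarrow> x \<in> D"
    and DS_criterion: "(\<And>n. norm (S (P n x)) \<le> C) \<Longrightarrow> x \<in> DS"

context coercive_operator begin

text \<open>The measure selected in the definition of the root need not be the constructed one. Its
  concentration on \<open>[\<nu>, \<infinity>)\<close> is therefore derived anew, from
  coercivity.\<close>

theorem coercive_sqrt_exists:
  "\<exists>P. coercive_sqrt D (op_sqrt_dom D A) A (op_sqrt D A) P \<nu>"
proof -
  define E where "E = spectral_measure_of D A"
  have isE: "is_spectral_measure_of E D A"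
    unfolding E_def spectral_measure_of_def by (rule someI_ex[OF spectral_measure_exists])
  interpret pvm E by unfold_locales (use isE in \<open>simp add: is_spectral_measure_of_def\<close>)
  note lb = locally_bounded_id
  note ls = locally_bounded_sqrt
  have D: "D = spectral_integral_dom E (\<lambda>s. s)" using isE by (simp add: is_spectral_measure_of_def)
  have A: "A x = spectral_integral E (\<lambda>s. s) x" if "x \<in> D" for x
    using isE that by (simp add: is_spectral_measure_of_def)
  have PD: "P n x \<in> D" for n x unfolding D by (rule dom_P[OF lb])
  have AP: "A (P n x) = \<Phi> (trunc n (\<lambda>s. s)) x" for n x
    unfolding A[OF PD] by (rule spectral_integral_P[OF lb])
  define S where "S = op_sqrt D A"
  define DS where "DS = op_sqrt_dom D A"
  have S: "S = spectral_integral E sqrt" unfolding S_def op_sqrt_def E_def ..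
  have DS: "DS = spectral_integral_dom E sqrt" unfolding DS_def op_sqrt_dom_def E_def ..
  have SP: "S (P n x) = \<Phi> (trunc n sqrt) x" for n x unfolding S by (rule spectral_integral_P[OF ls])
  \<comment> \<open>Bounded sets exhausting the half-line below \<open>\<nu>\<close>: boundedness
    puts the range of \<open>E (R k)\<close> into \<open>D\<close>, and the gap
    \<open>1 / Suc k\<close> contradicts coercivity on any nonzero vector of that range.\<close>
  define R where "R k = {- real (Suc k)..\<nu> - 1 / real (Suc k)}" for k
  have Rs: "R k \<in> sets borel" for k by (simp add: R_def)
  have ER: "E (R k) y = 0" for k y
  proof -
    define x where "x = E (R k) y"
    have xR: "E (R k) x = x" unfolding x_def by (rule E_idem[OF Rs])
    obtain n :: nat where n: "real (Suc k) + \<nu> \<le> real n" using real_arch_simple by blast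
    have "\<nu> - 1 / real (Suc k) \<le> \<nu>" by simp
    then have "\<nu> - 1 / real (Suc k) \<le> real n" "- real n \<le> - real (Suc k)" using n nu_pos by linarith+
    then have "R k \<subseteq> {- real n..real n}" unfolding R_def by auto
    then have "{- real n..real n} \<inter> R k = R k" by (rule Int_absorb1)
    then have Px: "P n x = x" unfolding P_def x_def using E_Int[OF ball_sets Rs, of n k y] by simp
    have xD: "x \<in> D" using PD[of n x] Px by simp
    have "\<nu> * (x \<bullet> x) \<le> A x \<bullet> x" by (rule coer[OF xD])
    also have "A x = \<Phi> (trunc n (\<lambda>s. s)) (\<Phi> (indicator (R k)) x)"
      using AP[of n x] Px xR by (simp add: Phi_ind[OF Rs])
    also have "\<dots> = \<Phi> (\<lambda>s. trunc n (\<lambda>s. s) s * indicator (R k) s) x"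
      by (rule Phi_mult[OF bfun_trunc[OF lb] bfun_ind[OF Rs]])
    also have "\<dots> \<bullet> x = Q x (\<lambda>s. trunc n (\<lambda>s. s) s * indicator (R k) s)"
      unfolding Phi_inner[OF bfun_mult[OF bfun_trunc[OF lb] bfun_ind[OF Rs]]]
      by (rule polar_same[OF bfun_mult[OF bfun_trunc[OF lb] bfun_ind[OF Rs]]])
    \<comment> \<open>The form of \<open>A\<close> on this range is an integral over
      \<open>R k\<close>, where \<open>s\<close> stays below \<open>\<nu>\<close> by the
      gap.\<close>
    also have "\<dots> \<le> Q x (\<lambda>s. (\<nu> - 1 / real (Suc k)) * indicator (R k) s)"
      unfolding Q_def
    proof (rule integral_mono)
      show "integrable (\<mu> x) (\<lambda>s. trunc n (\<lambda>s. s) s * indicator (R k) s)"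
        by (rule integrable_bfun[OF finite_mu sets_mu bfun_mult[OF bfun_trunc[OF lb] bfun_ind[OF Rs]]])
      show "integrable (\<mu> x) (\<lambda>s. (\<nu> - 1 / real (Suc k)) * indicator (R k) s)"
        by (rule integrable_bfun[OF finite_mu sets_mu bfun_mult[OF bfun_const bfun_ind[OF Rs]]])
      fix s :: real
      have "s \<in> R k \<Longrightarrow> \<bar>s\<bar> \<le> real n"
      proof -
        assume "s \<in> R k"
        then have "- real (Suc k) \<le> s" "s \<le> \<nu> - 1 / real (Suc k)" unfolding R_def by auto
        moreover have "0 < 1 / real (Suc k)" by simp
        ultimately show ?thesis using n nu_pos unfolding abs_le_iff by linarith
      qed
      then show "trunc n (\<lambda>s. s) s * indicator (R k) s \<le> (\<nu> - 1 / real (Suc k)) * indicator (R k) s"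
        by (cases "s \<in> R k") (auto simp: trunc_def indicator_def R_def)
    qed
    also have "\<dots> = (\<nu> - 1 / real (Suc k)) * (E (R k) x \<bullet> x)"
      using bcts_scaleD[OF bcts_Q bfun_ind[OF Rs]] Q_ind[OF Rs] by simp
    finally have "\<nu> * (x \<bullet> x) \<le> (\<nu> - 1 / real (Suc k)) * (x \<bullet> x)" unfolding xR .
    then have "(1 / real (Suc k)) * (x \<bullet> x) \<le> 0" by (simp add: left_diff_distrib)
    then have "x \<bullet> x \<le> 0" by (simp add: field_simps)
    then show ?thesis unfolding x_def[symmetric] using inner_ge_zero[of x] by (simp add: order_antisym_conv)
  qed
  have low: "\<Phi> (indicator {..<\<nu>}) x = 0" for x
  proof -
    have "(\<lambda>k. \<Phi> (indicator (R k)) x) \<longlonglongrightarrow> \<Phi> (indicator {..<\<nu>}) x"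
    proof (rule Phi_lim[OF bfun_ind[OF Rs] indicator_01_bounded])
      fix s :: real
      show "(\<lambda>k. indicator (R k) s) \<longlonglongrightarrow> (indicator {..<\<nu>} s :: real)"
      proof (cases "s < \<nu>")
        case True
        obtain N1 :: nat where N1: "- s \<le> real N1" using real_arch_simple by blast
        obtain N2 :: nat where N2: "1 / (\<nu> - s) \<le> real N2" using real_arch_simple by blast
        have "s \<in> R k" if "k \<ge> max N1 N2" for k
        proof -
          have "1 / (\<nu> - s) \<le> real (Suc k)" "- s \<le> real (Suc k)" using that N1 N2 by auto
          then show ?thesis using True unfolding R_def by (simp add: field_simps)
        qed
        then have "eventually (\<lambda>k. indicator (R k) s = (indicator {..<\<nu>} s :: real)) sequentially"
          unfolding eventually_sequentially using True by (intro exI[of _ "max N1 N2"]) (simp add: indicator_def)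
        then show ?thesis by (rule tendsto_eventually)
      next
        case False
        have "s \<notin> R k" for k
        proof -
          have "0 < 1 / real (Suc k)" by simp
          then have "\<not> s \<le> \<nu> - 1 / real (Suc k)" using False by linarith
          then show ?thesis unfolding R_def by simp
        qed
        then show ?thesis using False by (simp add: indicator_def)
      qed
    qed
    then show ?thesis by (simp add: Phi_ind[OF Rs] ER LIMSEQ_const_iff)
  qed
  have Sb: "{..<\<nu>} \<in> sets borel" by simp
  have lowE: "E {..<\<nu>} x = 0" for x using low by (simp add: Phi_ind)
  \<comment> \<open>For negative \<open>s\<close> the square of \<open>sqrt s\<close> is
    \<open>- s\<close>, so the identity holds only off a set that \<open>low\<close> shows to be
    null.\<close>
  have SS: "\<Phi> (\<lambda>s. trunc n sqrt s * trunc n sqrt s) x = \<Phi> (trunc n (\<lambda>s. s)) x" for n x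
    by (rule Phi_cong_null[OF bfun_mult[OF bfun_trunc[OF ls] bfun_trunc[OF ls]] bfun_trunc[OF lb] Sb low])
       (use nu_pos in \<open>simp add: trunc_def indicator_def\<close>)
  have "coercive_sqrt D DS A S P \<nu>"
  proof (rule coercive_sqrt.intro)
    show "0 < \<nu>" by (rule nu_pos)
    show "P n x \<in> D" for n x by (rule PD)
    show "bounded_linear (P n)" for n by (rule P_bl)
    show "P n x \<bullet> y = x \<bullet> P n y" for n x y by (rule P_sym)
    show "P n (P k x) = P (min n k) x" for n k x by (rule P_P)
    show "(\<lambda>n. P n x) \<longlonglongrightarrow> x" for x by (rule P_lim)
    show "norm (P n x) \<le> norm x" for n x by (rule P_norm)
    show "bounded_linear (\<lambda>x. A (P n x))" for n unfolding AP using Phi_bounded_linear[OF bfun_trunc[OF lb], of n] by simp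
    show "bounded_linear (\<lambda>x. S (P n x))" for n unfolding SP using Phi_bounded_linear[OF bfun_trunc[OF ls], of n] by simp
    show "A (P n x) = P n (A x)" if "x \<in> D" for n x
      unfolding AP A[OF that] using P_spectral_integral[OF lb that[unfolded D]] by simp
    show "S (P n x) = P n (S x)" if "x \<in> DS" for n x
      unfolding SP unfolding S using P_spectral_integral[OF ls that[unfolded DS]] by simp
    show "S (S (P n x)) = A (P n x)" for n x
    proof -
      have e: "S (P n x) = P n (S (P n x))" unfolding SP P_trunc[OF ls] by simp
      have "S (S (P n x)) = \<Phi> (trunc n sqrt) (S (P n x))" by (subst e) (rule SP)
      also have "\<dots> = A (P n x)" unfolding SP Phi_mult[OF bfun_trunc[OF ls] bfun_trunc[OF ls]] SS AP ..
      finally show ?thesis .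
    qed
    show "S (P n x) \<bullet> y = x \<bullet> S (P n y)" for n x y unfolding SP by (rule Phi_sym[OF bfun_trunc[OF ls]])
    show "\<nu> * (norm (P n x))\<^sup>2 \<le> (norm (S (P n x)))\<^sup>2" for n x
    proof -
      have "\<nu> * (norm (P n x))\<^sup>2 = \<nu> * (P n x \<bullet> P n x)" by (simp add: power2_norm_eq_inner)
      also have "\<dots> \<le> A (P n x) \<bullet> P n x" by (rule coer[OF PD])
      also have "\<dots> = P n (A (P n x)) \<bullet> x" by (simp add: P_sym)
      also have "\<dots> = \<Phi> (trunc n sqrt) (\<Phi> (trunc n sqrt) x) \<bullet> x"
        unfolding AP P_trunc[OF lb] Phi_mult[OF bfun_trunc[OF ls] bfun_trunc[OF ls]] SS by simp
      also have "\<dots> = S (P n x) \<bullet> S (P n x)" unfolding SP by (rule Phi_sym[OF bfun_trunc[OF ls]])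
      finally show ?thesis by (simp add: power2_norm_eq_inner)
    qed
    show "x \<in> D" if "\<And>n. norm (A (P n x)) \<le> C" for x C
      unfolding D dom_iff[OF lb] using that unfolding AP by blast
    show DSc: "x \<in> DS" if "\<And>n. norm (S (P n x)) \<le> C" for x C
      unfolding DS dom_iff[OF ls] using that unfolding SP by blast
    \<comment> \<open>The squared norm of \<open>S (P n x)\<close> is
      \<open>P n (A x) \<bullet> x\<close>, which is bounded uniformly in \<open>n\<close>.\<close>
    show "D \<subseteq> DS"
    proof
      fix x assume x: "x \<in> D"
      have "norm (S (P n x)) \<le> sqrt (norm (A x) * norm x)" for n
      proof (rule real_le_rsqrt)
        have "(norm (S (P n x)))\<^sup>2 = \<Phi> (trunc n (\<lambda>s. s)) x \<bullet> x"
          unfolding SP SS[symmetric] Phi_mult[OF bfun_trunc[OF ls] bfun_trunc[OF ls], symmetric]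
          by (simp only: Phi_sym[OF bfun_trunc[OF ls]] power2_norm_eq_inner inner_commute)
        also have "\<dots> = P n (A x) \<bullet> x"
          unfolding A[OF x] using P_spectral_integral[OF lb x[unfolded D]] by simp
        also have "\<dots> \<le> norm (P n (A x)) * norm x" by (rule norm_cauchy_schwarz)
        also have "\<dots> \<le> norm (A x) * norm x" by (intro mult_right_mono P_norm) simp
        finally show "(norm (S (P n x)))\<^sup>2 \<le> norm (A x) * norm x" .
      qed
      then show "x \<in> DS" by (rule DSc)
    qed
  qed
  then show ?thesis unfolding S_def DS_def by blast
qed

end

section \<open>Global solutions of Lipschitz differential equations\<close>

text \<open>The fixed point is taken for \<open>t \<mapsto> exp (- 2 \<Lambda> t) x t\<close>, on which the integral operator contracts by \<open>1/2\<close>.\<close>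

lemma picard_lindelof_global_banach:
  fixes G :: "real \<Rightarrow> 'a::banach \<Rightarrow> 'a"
  assumes cont: "continuous_on ({0..} \<times> UNIV) (\<lambda>(t, x). G t x)"
    and lip: "\<And>t x y. 0 \<le> t \<Longrightarrow> norm (G t x - G t y) \<le> \<Lambda> * norm (x - y)"
    and g0: "\<And>t. 0 \<le> t \<Longrightarrow> norm (G t 0) \<le> g0" and Lpos: "0 < \<Lambda>"
  shows "\<exists>x. x 0 = x0 \<and> (\<forall>t\<ge>0. (x has_vector_derivative G t (x t)) (at t within {0..}))"
proof -
  let ?l = "2 * \<Lambda>"
  have g0': "0 \<le> g0" using g0[of 0] norm_ge_zero order_trans by blast
  define H where "H y s = G s (exp (?l * s) *\<^sub>R apply_bcontfun y s)" for y :: "real \<Rightarrow>\<^sub>C 'a" and s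
  have Hc: "continuous_on {0..} (H y)" for y
  proof -
    have "continuous_on {0..} (\<lambda>s. (\<lambda>(t, x). G t x) (s, exp (?l * s) *\<^sub>R apply_bcontfun y s))"
      by (rule continuous_on_compose2[OF cont]) (auto intro!: continuous_intros)
    then show ?thesis unfolding H_def[abs_def] by simp
  qed
  define J where "J y t = integral {0..t} (H y)" for y t
  have Hi: "H y integrable_on {0..t}" for y t
    by (rule integrable_continuous_real[OF continuous_on_subset[OF Hc]]) auto
  have J_deriv: "(J y has_vector_derivative H y t) (at t within {0..})" if t: "0 \<le> t" for y t
  proof -
    have "((\<lambda>u. integral {0..u} (H y)) has_vector_derivative H y t) (at t within {0..t+1})"
      by (rule integral_has_vector_derivative[OF continuous_on_subset[OF Hc]]) (use t in auto)
    moreover have "at t within {0..t+1} = at t within {0..}"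
      by (rule at_within_nhd[of _ "{t-1<..<t+1}"]) (use t in auto)
    ultimately show ?thesis unfolding J_def[abs_def] by simp
  qed
  have J_cont: "continuous_on {0..} (J y)" for y
    unfolding continuous_on_eq_continuous_within
    using has_vector_derivative_continuous[OF J_deriv] by auto
  have expint: "((\<lambda>s. exp (?l * s)) has_integral (exp (?l * t) - 1) / ?l) {0..t}" if t: "0 \<le> t" for t
  proof -
    have "((\<lambda>s. exp (?l * s)) has_integral (exp (?l * t) / ?l - exp (?l * 0) / ?l)) {0..t}"
      by (rule fundamental_theorem_of_calculus[OF t])
         (use Lpos in \<open>auto intro!: derivative_eq_intros simp flip: has_real_derivative_iff_has_vector_derivative\<close>)
    then show ?thesis by (simp add: diff_divide_distrib)
  qed
  \<comment> \<open>Freezing the integral at negative times extends it to the whole line, so that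
    the fixed point can be sought among bounded continuous functions on the reals.\<close>
  define K where "K y t = exp (- ?l * max 0 t) *\<^sub>R (x0 + J y (max 0 t))" for y t
  have Kb: "norm (K y t) \<le> norm x0 + g0 / ?l + norm y" for y :: "real \<Rightarrow>\<^sub>C 'a" and t
  proof -
    define \<tau> where "\<tau> = max 0 t"
    have tau: "0 \<le> \<tau>" unfolding \<tau>_def by (rule max.cobounded1)
    have b: "norm (apply_bcontfun y s) \<le> norm y" for s by (rule norm_bounded)
    have e: "1 \<le> exp (?l * s)" if "0 \<le> s" for s using that Lpos by simp
    have "norm (J y \<tau>) \<le> integral {0..\<tau>} (\<lambda>s. (g0 + \<Lambda> * norm y) * exp (?l * s))"
      unfolding J_def
    proof (rule integral_norm_bound_integral[OF Hi])
      show "(\<lambda>s. (g0 + \<Lambda> * norm y) * exp (?l * s)) integrable_on {0..\<tau>}"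
        by (intro integrable_continuous_real continuous_intros)
      fix s assume s: "s \<in> {0..\<tau>}"
      have "norm (H y s) \<le> norm (H y s - G s 0) + norm (G s 0)" by norm
      also have "\<dots> \<le> \<Lambda> * norm (exp (?l * s) *\<^sub>R apply_bcontfun y s) + g0"
        using lip[of s "exp (?l * s) *\<^sub>R apply_bcontfun y s" 0] g0[of s] s unfolding H_def by simp
      also have "\<dots> \<le> \<Lambda> * (exp (?l * s) * norm y) + g0 * exp (?l * s)"
        using b[of s] Lpos e[of s] s g0' mult_left_mono[OF e[of s] g0'] by (intro add_mono) (auto intro!: mult_left_mono)
      finally show "norm (H y s) \<le> (g0 + \<Lambda> * norm y) * exp (?l * s)" by (simp add: algebra_simps)
    qed
    also have "\<dots> = (g0 + \<Lambda> * norm y) * ((exp (?l * \<tau>) - 1) / ?l)"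
      using has_integral_mult_right[OF expint[OF tau], of "g0 + \<Lambda> * norm y"] by (rule integral_unique)
    also have "\<dots> \<le> (g0 + \<Lambda> * norm y) * (exp (?l * \<tau>) / ?l)"
      using g0' Lpos by (intro mult_left_mono divide_right_mono) auto
    finally have J: "norm (J y \<tau>) \<le> exp (?l * \<tau>) * ((g0 + \<Lambda> * norm y) / ?l)" by (simp add: mult.commute)
    have "norm (K y t) \<le> exp (- ?l * \<tau>) * (norm x0 + exp (?l * \<tau>) * ((g0 + \<Lambda> * norm y) / ?l))"
      unfolding K_def \<tau>_def[symmetric]
      using norm_triangle_mono[OF order_refl J, of x0] by simp
    also have "\<dots> = exp (- ?l * \<tau>) * norm x0 + (exp (- ?l * \<tau>) * exp (?l * \<tau>)) * ((g0 + \<Lambda> * norm y) / ?l)"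
      by (simp only: distrib_left mult.assoc)
    also have "\<dots> = exp (- ?l * \<tau>) * norm x0 + (g0 + \<Lambda> * norm y) / ?l"
      by (simp only: exp_add[symmetric]) simp
    also have "\<dots> \<le> 1 * norm x0 + (g0 + \<Lambda> * norm y) / ?l"
      using tau Lpos by (intro add_right_mono mult_right_mono) auto
    also have "\<dots> \<le> norm x0 + g0 / ?l + norm y" using Lpos by (simp add: add_divide_distrib)
    finally show ?thesis .
  qed
  have Kmem: "K y \<in> bcontfun" for y
  proof -
    have "continuous_on UNIV (\<lambda>t. J y (max 0 t))"
      by (rule continuous_on_compose2[OF J_cont]) (auto intro!: continuous_intros)
    then have "continuous_on UNIV (K y)" unfolding K_def[abs_def] by (intro continuous_intros)
    moreover have "bounded (range (K y))" using Kb by (auto intro!: boundedI)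
    ultimately show ?thesis by (simp add: bcontfun_def)
  qed
  define \<Psi> where "\<Psi> y = Bcontfun (K y)" for y
  have Psi: "apply_bcontfun (\<Psi> y) = K y" for y unfolding \<Psi>_def by (rule Bcontfun_inverse[OF Kmem])
  have "\<exists>!y. \<Psi> y = y"
  proof (rule banach_fix_type[of "1/2"])
    show "\<forall>y z. dist (\<Psi> y) (\<Psi> z) \<le> 1/2 * dist y z"
    proof (intro allI dist_bound)
      fix y z :: "real \<Rightarrow>\<^sub>C 'a" and t :: real
      define \<tau> where "\<tau> = max 0 t"
      have tau: "0 \<le> \<tau>" unfolding \<tau>_def by (rule max.cobounded1)
      have "norm (J y \<tau> - J z \<tau>) = norm (integral {0..\<tau>} (\<lambda>s. H y s - H z s))"
        unfolding J_def using integral_diff[OF Hi[of y \<tau>] Hi[of z \<tau>]] by simp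
      also have "\<dots> \<le> integral {0..\<tau>} (\<lambda>s. (\<Lambda> * dist y z) * exp (?l * s))"
      proof (rule integral_norm_bound_integral[OF integrable_diff[OF Hi Hi]])
        show "(\<lambda>s. (\<Lambda> * dist y z) * exp (?l * s)) integrable_on {0..\<tau>}"
          by (intro integrable_continuous_real continuous_intros)
        fix s assume s: "s \<in> {0..\<tau>}"
        have "norm (H y s - H z s) \<le> \<Lambda> * norm (exp (?l * s) *\<^sub>R (apply_bcontfun y s - apply_bcontfun z s))"
          unfolding H_def scaleR_diff_right by (rule lip) (use s in simp)
        also have "\<dots> = \<Lambda> * (exp (?l * s) * dist (apply_bcontfun y s) (apply_bcontfun z s))" by (simp add: dist_norm)
        also have "\<dots> \<le> \<Lambda> * (exp (?l * s) * dist y z)"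
          using Lpos by (intro mult_left_mono dist_bounded) auto
        finally show "norm (H y s - H z s) \<le> (\<Lambda> * dist y z) * exp (?l * s)" by (simp add: mult_ac)
      qed
      also have "\<dots> = (\<Lambda> * dist y z) * ((exp (?l * \<tau>) - 1) / ?l)"
        using has_integral_mult_right[OF expint[OF tau], of "\<Lambda> * dist y z"] by (rule integral_unique)
      also have "\<dots> \<le> (\<Lambda> * dist y z) * (exp (?l * \<tau>) / ?l)"
        using Lpos by (intro mult_left_mono divide_right_mono) auto
      \<comment> \<open>The weight grows at twice the Lipschitz rate;
        \<open>\<Lambda> / (2 * \<Lambda>)\<close> is the contraction factor.\<close>
      also have "\<dots> = exp (?l * \<tau>) * (1/2 * dist y z)" using Lpos by simp
      finally have J: "norm (J y \<tau> - J z \<tau>) \<le> exp (?l * \<tau>) * (1/2 * dist y z)" .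
      have "dist (K y t) (K z t) = exp (- ?l * \<tau>) * norm (J y \<tau> - J z \<tau>)"
        unfolding K_def \<tau>_def[symmetric] dist_norm by (simp add: scaleR_diff_right[symmetric])
      also have "\<dots> \<le> exp (- ?l * \<tau>) * (exp (?l * \<tau>) * (1/2 * dist y z))" by (rule mult_left_mono[OF J]) simp
      also have "\<dots> = 1/2 * dist y z" by (simp only: mult.assoc[symmetric] exp_add[symmetric]) simp
      finally show "dist (apply_bcontfun (\<Psi> y) t) (apply_bcontfun (\<Psi> z) t) \<le> 1/2 * dist y z" unfolding Psi .
    qed
  qed auto
  then obtain y where y: "\<Psi> y = y" by blast
  define x where "x t = x0 + J y t" for t
  have x: "exp (?l * t) *\<^sub>R apply_bcontfun y t = x t" if "0 \<le> t" for t
  proof -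
    have "apply_bcontfun y t = exp (- ?l * t) *\<^sub>R x t"
      using Psi[of y] that unfolding y by (simp add: K_def x_def max_def)
    then show ?thesis by (simp add: exp_add[symmetric])
  qed
  have "(x has_vector_derivative G t (x t)) (at t within {0..})" if t: "0 \<le> t" for t
  proof -
    have "(x has_vector_derivative 0 + H y t) (at t within {0..})"
      unfolding x_def[abs_def] by (intro has_vector_derivative_add has_vector_derivative_const J_deriv t)
    then show ?thesis unfolding H_def x[OF t] by simp
  qed
  moreover have "x 0 = x0" by (simp add: x_def J_def)
  ultimately show ?thesis by blast
qed

text \<open>A complete normed space of sort \<open>{real_normed_vector, complete_space}\<close> is not formally of class
  \<open>banach\<close>, which the integration theory requires; the following copy of the type is.\<close>

typedef (overloaded) 'a bcopy = "UNIV :: 'a set" by simp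

lemma bcopy_eq_iff: "x = y \<longleftrightarrow> Rep_bcopy x = Rep_bcopy y" by (simp add: Rep_bcopy_inject)
lemma Rep_Abs[simp]: "Rep_bcopy (Abs_bcopy x) = x" by (simp add: Abs_bcopy_inverse)

instantiation bcopy :: (real_normed_vector) real_vector
begin
definition zero_bcopy :: "'a bcopy" where "0 = Abs_bcopy 0"
definition plus_bcopy :: "'a bcopy \<Rightarrow> 'a bcopy \<Rightarrow> 'a bcopy" where "x + y = Abs_bcopy (Rep_bcopy x + Rep_bcopy y)"
definition minus_bcopy :: "'a bcopy \<Rightarrow> 'a bcopy \<Rightarrow> 'a bcopy" where "x - y = Abs_bcopy (Rep_bcopy x - Rep_bcopy y)"
definition uminus_bcopy :: "'a bcopy \<Rightarrow> 'a bcopy" where "- x = Abs_bcopy (- Rep_bcopy x)"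
definition scaleR_bcopy :: "real \<Rightarrow> 'a bcopy \<Rightarrow> 'a bcopy" where "c *\<^sub>R x = Abs_bcopy (c *\<^sub>R Rep_bcopy x)"
instance
  by standard
     (auto simp: bcopy_eq_iff zero_bcopy_def plus_bcopy_def minus_bcopy_def uminus_bcopy_def scaleR_bcopy_def
        scaleR_add_right scaleR_add_left)
end

instantiation bcopy :: (real_normed_vector) real_normed_vector
begin
definition norm_bcopy :: "'a bcopy \<Rightarrow> real" where "norm x = norm (Rep_bcopy x)"
definition sgn_bcopy :: "'a bcopy \<Rightarrow> 'a bcopy" where "sgn_bcopy x = x /\<^sub>R norm x"
definition dist_bcopy :: "'a bcopy \<Rightarrow> 'a bcopy \<Rightarrow> real" where "dist_bcopy x y = norm (x - y)"
definition uniformity_bcopy :: "('a bcopy \<times> 'a bcopy) filter"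
  where "uniformity_bcopy = (INF e\<in>{0<..}. principal {(x, y). dist x y < e})"
definition open_bcopy :: "'a bcopy set \<Rightarrow> bool"
  where "open_bcopy U \<longleftrightarrow> (\<forall>x\<in>U. eventually (\<lambda>(x', y). x' = x \<longrightarrow> y \<in> U) uniformity)"
instance
  by standard
     (auto simp: bcopy_eq_iff zero_bcopy_def plus_bcopy_def minus_bcopy_def uminus_bcopy_def scaleR_bcopy_def
        norm_bcopy_def sgn_bcopy_def dist_bcopy_def uniformity_bcopy_def open_bcopy_def norm_triangle_ineq
        scaleR_add_right scaleR_add_left)
end

lemma bounded_linear_Rep_bcopy: "bounded_linear Rep_bcopy"
  by (rule bounded_linear_intro[where K=1]) (auto simp: plus_bcopy_def scaleR_bcopy_def norm_bcopy_def)

lemma bounded_linear_Abs_bcopy: "bounded_linear Abs_bcopy"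
  by (rule bounded_linear_intro[where K=1]) (auto simp: plus_bcopy_def scaleR_bcopy_def norm_bcopy_def)

instance bcopy :: ("{real_normed_vector,complete_space}") banach
proof
  fix X :: "nat \<Rightarrow> 'a bcopy" assume "Cauchy X"
  then have "Cauchy (\<lambda>n. Rep_bcopy (X n))" by (rule bounded_linear.Cauchy[OF bounded_linear_Rep_bcopy])
  then obtain l where "(\<lambda>n. Rep_bcopy (X n)) \<longlonglongrightarrow> l" using Cauchy_convergent convergent_def by blast
  from bounded_linear.tendsto[OF bounded_linear_Abs_bcopy this]
  have "X \<longlonglongrightarrow> Abs_bcopy l" by (simp add: Rep_bcopy_inverse)
  then show "convergent X" by (auto simp: convergent_def)
qed

text \<open>The preceding theorem transported through the linear isometry
  \<open>Abs_bcopy\<close>.\<close>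

theorem picard_lindelof_global:
  fixes G :: "real \<Rightarrow> 'a::{real_normed_vector,complete_space} \<Rightarrow> 'a"
  assumes cont: "continuous_on ({0..} \<times> UNIV) (\<lambda>(t, x). G t x)"
    and lip: "\<And>t x y. 0 \<le> t \<Longrightarrow> norm (G t x - G t y) \<le> \<Lambda> * norm (x - y)"
    and g0: "\<And>t. 0 \<le> t \<Longrightarrow> norm (G t 0) \<le> g0" and Lpos: "0 < \<Lambda>"
  shows "\<exists>x. x 0 = x0 \<and> (\<forall>t\<ge>0. (x has_vector_derivative G t (x t)) (at t within {0..}))"
proof -
  define F where "F t x = Abs_bcopy (G t (Rep_bcopy x))" for t x
  have nA: "norm (Abs_bcopy x) = norm x" for x :: 'a by (simp add: norm_bcopy_def)
  have "\<exists>x. x 0 = Abs_bcopy x0 \<and> (\<forall>t\<ge>0. (x has_vector_derivative F t (x t)) (at t within {0..}))"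
  proof (rule picard_lindelof_global_banach[OF _ _ _ Lpos])
    have "continuous_on ({0..} \<times> UNIV) (\<lambda>(t, x). G t (Rep_bcopy x))"
    proof -
      have "continuous_on ({0..} \<times> UNIV) (\<lambda>z. (\<lambda>(t, x). G t x) (fst z, Rep_bcopy (snd z)))"
        by (rule continuous_on_compose2[OF cont])
           (auto intro!: continuous_intros bounded_linear.continuous_on[OF bounded_linear_Rep_bcopy])
      then show ?thesis by (simp add: case_prod_beta')
    qed
    then have "continuous_on ({0..} \<times> UNIV) (\<lambda>z. Abs_bcopy ((\<lambda>(t, x). G t (Rep_bcopy x)) z))"
      by (rule bounded_linear.continuous_on[OF bounded_linear_Abs_bcopy])
    then show "continuous_on ({0..} \<times> UNIV) (\<lambda>(t, x). F t x)" unfolding F_def by (simp add: case_prod_beta')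
    fix t :: real and x y assume t: "0 \<le> t"
    have "norm (F t x - F t y) = norm (G t (Rep_bcopy x) - G t (Rep_bcopy y))"
      by (simp add: F_def norm_bcopy_def minus_bcopy_def)
    also have "\<dots> \<le> \<Lambda> * norm (Rep_bcopy x - Rep_bcopy y)" by (rule lip[OF t])
    finally show "norm (F t x - F t y) \<le> \<Lambda> * norm (x - y)" by (simp add: norm_bcopy_def minus_bcopy_def)
    show "norm (F t 0) \<le> g0" using g0[OF t] by (simp add: F_def nA zero_bcopy_def)
  qed
  then obtain x where x: "x 0 = Abs_bcopy x0"
    "\<And>t. 0 \<le> t \<Longrightarrow> (x has_vector_derivative F t (x t)) (at t within {0..})" by blast
  have "((\<lambda>t. Rep_bcopy (x t)) has_vector_derivative G t (Rep_bcopy (x t))) (at t within {0..})" if t: "0 \<le> t" for t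
    using bounded_linear.has_vector_derivative[OF bounded_linear_Rep_bcopy x(2)[OF t]] by (simp add: F_def)
  then show ?thesis using x(1) by (intro exI[of _ "\<lambda>t. Rep_bcopy (x t)"]) simp
qed

section \<open>Differential inequalities with Lipschitz coefficients\<close>

text \<open>A one-sided derivative of a majorant touching \<open>f\<close> at \<open>t\<close> replaces the derivative of \<open>f\<close>, which need
  not exist when a coefficient is only Lipschitz continuous.\<close>

lemma majorant_nonincreasing:
  fixes f :: "real \<Rightarrow> real"
  assumes ab: "a \<le> b" and cont: "continuous_on {a..b} f"
    and maj: "\<And>t. a \<le> t \<Longrightarrow> t < b \<Longrightarrow> \<exists>r d. (r has_real_derivative d) (at t within {t..}) \<and> d \<le> 0
        \<and> r t = f t \<and> (\<forall>s\<in>{t..b}. f s \<le> r s)"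
  shows "f b \<le> f a"
proof (rule ccontr)
  assume "\<not> f b \<le> f a"
  then have lt: "f a < f b" by simp
  then have "a < b" using ab by (cases "a = b") auto
  define l where "l = b - a"
  have l: "l > 0" using \<open>a < b\<close> by (simp add: l_def)
  \<comment> \<open>Half the mean slope of \<open>f\<close>: subtracting it leaves \<open>g\<close>
    larger at \<open>b\<close> than at \<open>a\<close>, and it is positive, so a majorant with
    right derivative at most 0 stays below this slope for a while.\<close>
  define \<eta> where "\<eta> = (f b - f a) / (2 * l)"
  have eta: "\<eta> > 0" using lt l by (simp add: \<eta>_def)
  define g where "g s = f s - \<eta> * (s - a)" for s
  have "\<eta> * l = (f b - f a) / 2" using l by (simp add: \<eta>_def)
  then have "\<eta> * (b - a) = (f b - f a) / 2" by (simp only: l_def)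
  then have gb: "g a < g b" using lt by (simp add: g_def)
  define Z where "Z = {s \<in> {a..b}. g s \<le> g a}"
  have gc: "continuous_on {a..b} g" unfolding g_def[abs_def] by (intro continuous_intros cont)
  have Zc: "closed Z" unfolding Z_def by (rule continuous_on_closed_Collect_le[OF gc continuous_on_const]) simp
  have Za: "a \<in> Z" using ab by (simp add: Z_def)
  have Zb: "bdd_above Z" unfolding Z_def by (rule bdd_aboveI[of _ b]) simp
  \<comment> \<open>The last time with \<open>g t \<le> g a\<close>. The majorant at
    \<open>t\<close> forces \<open>g s < g t\<close> for some later \<open>s\<close>, against the
    choice of \<open>t\<close>.\<close>
  define t where "t = Sup Z"
  have tZ: "t \<in> Z" unfolding t_def using closed_contains_Sup[OF _ Zb Zc] Za by blast
  have tb: "t < b" using tZ gb unfolding Z_def by (cases "t = b") auto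
  have after: "g s > g a" if "t < s" "s \<le> b" for s
  proof (rule ccontr)
    assume "\<not> g s > g a"
    then have "s \<in> Z" using that tZ by (simp add: Z_def)
    then have "s \<le> t" unfolding t_def by (rule cSup_upper[OF _ Zb])
    then show False using that by simp
  qed
  obtain r d where r: "(r has_real_derivative d) (at t within {t..})" "d \<le> 0" "r t = f t"
      "\<forall>s\<in>{t..b}. f s \<le> r s" using maj[of t] tZ tb unfolding Z_def by auto
  have "((\<lambda>s. (r s - r t) / (s - t)) \<longlongrightarrow> d) (at t within {t..})"
    using r(1) by (simp add: has_field_derivative_iff)
  then have "eventually (\<lambda>s. (r s - r t) / (s - t) < \<eta>) (at t within {t..})"
    by (rule order_tendstoD(2)) (use r(2) eta in simp)
  then obtain \<delta> where \<delta>: "\<delta> > 0" "\<And>s. s \<in> {t..} \<Longrightarrow> s \<noteq> t \<Longrightarrow> dist s t < \<delta> \<Longrightarrow> (r s - r t) / (s - t) < \<eta>"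
    unfolding eventually_at by blast
  define s where "s = t + min (\<delta> / 2) (b - t)"
  have s: "t < s" "s \<le> b" "dist s t < \<delta>" using \<delta>(1) tb by (auto simp: s_def dist_real_def min_def)
  have "(r s - r t) / (s - t) < \<eta>" using s by (intro \<delta>(2)) auto
  then have "r s - r t < \<eta> * (s - t)" using s(1) by (simp add: divide_less_eq)
  moreover have "f s \<le> r s" using r(4) s by simp
  ultimately have "f s < f t + \<eta> * (s - t)" using r(3) by simp
  then have "g s < g t" by (simp add: g_def algebra_simps)
  moreover have "g t \<le> g a" using tZ by (simp add: Z_def)
  ultimately show False using after[OF s(1,2)] by simp
qed

text \<open>The difference quotient of the absolute value of an increment starting at
  \<open>t\<close> is, to the right of \<open>t\<close>, the absolute value of a difference
  quotient.\<close>

lemma abs_increment_right_derivative: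
  fixes k :: "real \<Rightarrow> real"
  assumes "(k has_real_derivative D) (at t within {t..})"
  shows "((\<lambda>s. \<bar>k s - k t\<bar>) has_real_derivative \<bar>D\<bar>) (at t within {t..})"
proof -
  have "((\<lambda>s. \<bar>(k s - k t) / (s - t)\<bar>) \<longlongrightarrow> \<bar>D\<bar>) (at t within {t..})"
    using assms by (intro tendsto_rabs) (simp add: has_field_derivative_iff)
  moreover have "eventually (\<lambda>s. \<bar>(k s - k t) / (s - t)\<bar> = (\<bar>k s - k t\<bar> - \<bar>k t - k t\<bar>) / (s - t)) (at t within {t..})"
    unfolding eventually_at by (rule exI[of _ 1]) (simp add: abs_divide)
  ultimately have "((\<lambda>s. (\<bar>k s - k t\<bar> - \<bar>k t - k t\<bar>) / (s - t)) \<longlongrightarrow> \<bar>D\<bar>) (at t within {t..})"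
    by (rule Lim_transform_eventually)
  then show ?thesis by (simp add: has_field_derivative_iff)
qed

text \<open>The coefficient \<open>\<psi>\<close> need not be differentiable. Near each
  \<open>t\<close> it lies below \<open>\<psi> t\<close> plus a multiple of the increment of
  \<open>k\<close>, and inserting this gives a majorant of the energy that touches it at
  \<open>t\<close>; \<open>ineq\<close> says that its right derivative is nonpositive.\<close>

lemma energy_nonincreasing:
  fixes ga gb k \<psi> \<phi> :: "real \<Rightarrow> real"
  assumes T: "0 \<le> T"
    and d0: "\<And>t. 0 \<le> t \<Longrightarrow> (ga has_real_derivative ga' t) (at t within {0..})"
    and d1: "\<And>t. 0 \<le> t \<Longrightarrow> (gb has_real_derivative gb' t) (at t within {0..})"
    and dk: "\<And>t. 0 \<le> t \<Longrightarrow> (k has_real_derivative k' t) (at t within {0..})"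
    and d\<phi>: "\<And>t. 0 \<le> t \<Longrightarrow> (\<phi> has_real_derivative \<phi>' t) (at t within {0..})"
    and gb: "\<And>t. 0 \<le> t \<Longrightarrow> 0 \<le> gb t" and \<phi>: "\<And>t. 0 \<le> t \<Longrightarrow> 0 < \<phi> t"
    and \<psi>c: "continuous_on {0..T} \<psi>"
    and \<psi>: "\<And>t s. 0 \<le> t \<Longrightarrow> t \<le> s \<Longrightarrow> s \<le> T \<Longrightarrow> \<psi> s \<le> \<psi> t + lp t * \<bar>k s - k t\<bar>"
    and ineq: "\<And>t. 0 \<le> t \<Longrightarrow> t < T \<Longrightarrow>
        (ga' t + \<psi> t * gb' t + lp t * \<bar>k' t\<bar> * gb t) * \<phi> t + (ga t + \<psi> t * gb t) * \<phi>' t \<le> 0"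
  shows "(ga T + \<psi> T * gb T) * \<phi> T \<le> (ga 0 + \<psi> 0 * gb 0) * \<phi> 0"
proof (rule majorant_nonincreasing[OF T])
  have c: "continuous_on {0..} h" if "\<And>t. 0 \<le> t \<Longrightarrow> (h has_real_derivative h' t) (at t within {0..})" for h h' :: "real \<Rightarrow> real"
    unfolding continuous_on_eq_continuous_within using DERIV_continuous[OF that] by auto
  have sT: "continuous_on {0..T} h" if "continuous_on {0..} h" for h :: "real \<Rightarrow> real"
    by (rule continuous_on_subset[OF that]) auto
  show "continuous_on {0..T} (\<lambda>t. (ga t + \<psi> t * gb t) * \<phi> t)"
    by (intro continuous_intros \<psi>c sT c[OF d0] c[OF d1] c[OF d\<phi>])
  fix t assume t: "0 \<le> t" "t < T"
  define r where "r s = (ga s + (\<psi> t + lp t * \<bar>k s - k t\<bar>) * gb s) * \<phi> s" for s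
  have sub: "(h has_real_derivative h') (at t within {t..})" if "(h has_real_derivative h') (at t within {0..})"
    for h h' by (rule has_field_derivative_subset[OF that]) (use t in auto)
  note ds = sub[OF d0[OF t(1)]] sub[OF d1[OF t(1)]] sub[OF d\<phi>[OF t(1)]]
     abs_increment_right_derivative[OF sub[OF dk[OF t(1)]]]
  have "(r has_real_derivative (ga' t + ((\<psi> t + lp t * \<bar>k t - k t\<bar>) * gb' t + (lp t * \<bar>k' t\<bar>) * gb t)) * \<phi> t
      + (ga t + (\<psi> t + lp t * \<bar>k t - k t\<bar>) * gb t) * \<phi>' t) (at t within {t..})"
    unfolding r_def[abs_def] by (auto intro!: derivative_eq_intros ds)
  moreover have "(ga' t + ((\<psi> t + lp t * \<bar>k t - k t\<bar>) * gb' t + (lp t * \<bar>k' t\<bar>) * gb t)) * \<phi> t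
      + (ga t + (\<psi> t + lp t * \<bar>k t - k t\<bar>) * gb t) * \<phi>' t \<le> 0"
    using ineq[OF t] by (simp add: add.assoc)
  moreover have "r t = (ga t + \<psi> t * gb t) * \<phi> t" by (simp add: r_def)
  moreover have "(ga s + \<psi> s * gb s) * \<phi> s \<le> r s" if "s \<in> {t..T}" for s
    unfolding r_def using \<psi>[of t s] gb[of s] \<phi>[of s] t that
    by (intro mult_right_mono add_left_mono) auto
  ultimately show "\<exists>r d. (r has_real_derivative d) (at t within {t..}) \<and> d \<le> 0
        \<and> r t = (ga t + \<psi> t * gb t) * \<phi> t \<and> (\<forall>s\<in>{t..T}. (ga s + \<psi> s * gb s) * \<phi> s \<le> r s)"
    by blast
qed

text \<open>At the first time where the strict inequality fails, the weak one holds at all earlier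
  times, and \<open>step\<close> contradicts the failure. For \<open>T = 0\<close> the premise of
  \<open>step\<close> is empty, so the initial condition is part of it.\<close>

lemma continuation_principle:
  fixes h k :: "real \<Rightarrow> real"
  assumes hc: "continuous_on {0..} h" and kc: "continuous_on {0..} k"
    and step: "\<And>T. 0 \<le> T \<Longrightarrow> (\<And>t. 0 \<le> t \<Longrightarrow> t < T \<Longrightarrow> h t \<le> k t) \<Longrightarrow> h T < k T"
    and t: "0 \<le> t"
  shows "h t < k t"
proof (rule ccontr)
  assume n: "\<not> h t < k t"
  define Z where "Z = {s \<in> {0..}. k s \<le> h s}"
  have Zc: "closed Z" unfolding Z_def by (rule continuous_on_closed_Collect_le[OF kc hc]) simp
  have Z0: "t \<in> Z" using n t by (simp add: Z_def)
  have Zb: "bdd_below Z" unfolding Z_def by (rule bdd_belowI[of _ 0]) simp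
  have Zd: "0 \<le> s" "k s \<le> h s" if "s \<in> Z" for s using that by (simp_all add: Z_def)
  have iZ: "Inf Z \<in> Z" using closed_contains_Inf[OF _ Zb Zc] Z0 by blast
  have "h s \<le> k s" if "0 \<le> s" "s < Inf Z" for s
  proof (rule ccontr)
    assume "\<not> h s \<le> k s"
    then have "s \<in> Z" using that by (simp add: Z_def)
    then show False using cInf_lower[OF _ Zb] that by fastforce
  qed
  then have "h (Inf Z) < k (Inf Z)" by (rule step[OF Zd(1)[OF iZ]])
  then show False using Zd(2)[OF iZ] by simp
qed

lemma inner_has_real_derivative:
  fixes f g :: "real \<Rightarrow> 'h::real_inner"
  assumes "(f has_vector_derivative f') (at t within X)" "(g has_vector_derivative g') (at t within X)"
  shows "((\<lambda>t. f t \<bullet> g t) has_real_derivative (f t \<bullet> g' + f' \<bullet> g t)) (at t within X)"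
  using bounded_bilinear.has_vector_derivative[OF bounded_bilinear_inner assms]
  by (simp add: has_real_derivative_iff_has_vector_derivative)

lemma norm_sq_has_real_derivative:
  fixes f :: "real \<Rightarrow> 'h::real_inner"
  assumes "(f has_vector_derivative f') (at t within X)"
  shows "((\<lambda>t. (norm (f t))\<^sup>2) has_real_derivative (2 * (f t \<bullet> f'))) (at t within X)"
  using inner_has_real_derivative[OF assms assms] by (simp add: power2_norm_eq_inner inner_commute)

lemma inner_le_norms: "\<bar>x \<bullet> y\<bar> \<le> norm x * norm y"
  by (rule Cauchy_Schwarz_ineq2)

section \<open>Closedness, linearity and form bounds for \<open>A\<close> and
  \<open>S\<close>\<close>

context coercive_sqrt begin

lemma P_linear: "linear (P n)" by (rule bounded_linear.linear[OF P_bl])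

lemma A_lim: assumes "x \<in> D" shows "(\<lambda>n. A (P n x)) \<longlonglongrightarrow> A x"
  unfolding AP[OF assms] by (rule P_lim)

lemma S_lim: assumes "x \<in> DS" shows "(\<lambda>n. S (P n x)) \<longlonglongrightarrow> S x"
  unfolding SP[OF assms] by (rule P_lim)

text \<open>Each \<open>A (P k x)\<close> is bounded in \<open>x\<close>, so the limit satisfies
  \<open>A (P k l) = P k y\<close>. This is bounded by \<open>norm y\<close> uniformly in
  \<open>k\<close>, which gives membership, and it converges to \<open>y\<close>.\<close>

lemma D_closed:
  assumes "\<And>n. x n \<in> D" "x \<longlonglongrightarrow> l" "(\<lambda>n. A (x n)) \<longlonglongrightarrow> y" shows "l \<in> D" "A l = y"
proof -
  have *: "A (P k l) = P k y" for k
  proof (rule LIMSEQ_unique)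
    show "(\<lambda>n. A (P k (x n))) \<longlonglongrightarrow> A (P k l)" by (rule bounded_linear.tendsto[OF AP_bl assms(2)])
    show "(\<lambda>n. A (P k (x n))) \<longlonglongrightarrow> P k y"
      unfolding AP[OF assms(1)] by (rule bounded_linear.tendsto[OF P_bl assms(3)])
  qed
  show l: "l \<in> D" by (rule D_criterion[of _ "norm y"]) (simp add: * P_norm)
  show "A l = y" using A_lim[OF l] P_lim[of y] unfolding * using LIMSEQ_unique by blast
qed

lemma DS_closed:
  assumes "\<And>n. x n \<in> DS" "x \<longlonglongrightarrow> l" "(\<lambda>n. S (x n)) \<longlonglongrightarrow> y" shows "l \<in> DS" "S l = y"
proof -
  have *: "S (P k l) = P k y" for k
  proof (rule LIMSEQ_unique)
    show "(\<lambda>n. S (P k (x n))) \<longlonglongrightarrow> S (P k l)" by (rule bounded_linear.tendsto[OF SP_bl assms(2)])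
    show "(\<lambda>n. S (P k (x n))) \<longlonglongrightarrow> P k y"
      unfolding SP[OF assms(1)] by (rule bounded_linear.tendsto[OF P_bl assms(3)])
  qed
  show l: "l \<in> DS" by (rule DS_criterion[of _ "norm y"]) (simp add: * P_norm)
  show "S l = y" using S_lim[OF l] P_lim[of y] unfolding * using LIMSEQ_unique by blast
qed

text \<open>Linearity is known only after truncation by \<open>P n\<close>; closedness carries it to
  the limit together with membership in the domain.\<close>

lemma A_lin:
  assumes "x \<in> D" "y \<in> D"
  shows "x + c *\<^sub>R y \<in> D" "A (x + c *\<^sub>R y) = A x + c *\<^sub>R A y"
proof -
  have "A (P n (x + c *\<^sub>R y)) = A (P n x) + c *\<^sub>R A (P n y)" for n
    using linear_add[OF bounded_linear.linear[OF AP_bl[of n]], of x "c *\<^sub>R y"]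
      linear_scale[OF bounded_linear.linear[OF AP_bl[of n]], of c y] by simp
  then have "(\<lambda>n. A (P n (x + c *\<^sub>R y))) \<longlonglongrightarrow> A x + c *\<^sub>R A y"
    by (simp only:) (intro tendsto_intros A_lim assms)
  from D_closed[OF P_D P_lim this] show "x + c *\<^sub>R y \<in> D" "A (x + c *\<^sub>R y) = A x + c *\<^sub>R A y" by blast+
qed

lemma S_lin:
  assumes "x \<in> DS" "y \<in> DS"
  shows "x + c *\<^sub>R y \<in> DS" "S (x + c *\<^sub>R y) = S x + c *\<^sub>R S y"
proof -
  have "S (P n (x + c *\<^sub>R y)) = S (P n x) + c *\<^sub>R S (P n y)" for n
    using linear_add[OF bounded_linear.linear[OF SP_bl[of n]], of x "c *\<^sub>R y"]
      linear_scale[OF bounded_linear.linear[OF SP_bl[of n]], of c y] by simp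
  then have "(\<lambda>n. S (P n (x + c *\<^sub>R y))) \<longlonglongrightarrow> S x + c *\<^sub>R S y"
    by (simp only:) (intro tendsto_intros S_lim assms)
  from DS_closed[OF subsetD[OF D_DS P_D] P_lim this]
  show "x + c *\<^sub>R y \<in> DS" "S (x + c *\<^sub>R y) = S x + c *\<^sub>R S y" by blast+
qed

lemma A_diff: assumes "x \<in> D" "y \<in> D" shows "x - y \<in> D" "A (x - y) = A x - A y"
  using A_lin[OF assms, of "-1"] by simp_all

lemma S_diff: assumes "x \<in> DS" "y \<in> DS" shows "x - y \<in> DS" "S (x - y) = S x - S y"
  using S_lin[OF assms, of "-1"] by simp_all

lemma DDS: "x \<in> D \<Longrightarrow> x \<in> DS" using D_DS by blast

lemma A_inner: assumes x: "x \<in> D" and y: "y \<in> DS" shows "A x \<bullet> y = S x \<bullet> S y"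
proof (rule LIMSEQ_unique)
  have "A (P n x) \<bullet> y = S x \<bullet> S (P n y)" for n
    by (simp add: SSP[symmetric] SP[OF DDS[OF x]] SP_sym[symmetric])
  then show "(\<lambda>n. A (P n x) \<bullet> y) \<longlonglongrightarrow> S x \<bullet> S y" by (simp only:) (intro tendsto_intros S_lim y)
  show "(\<lambda>n. A (P n x) \<bullet> y) \<longlonglongrightarrow> A x \<bullet> y" by (intro tendsto_intros A_lim x)
qed

lemma S_lower: assumes x: "x \<in> DS" shows "\<nu> * (norm x)\<^sup>2 \<le> (norm (S x))\<^sup>2"
proof (rule LIMSEQ_le)
  show "(\<lambda>n. \<nu> * (norm (P n x))\<^sup>2) \<longlonglongrightarrow> \<nu> * (norm x)\<^sup>2" by (intro tendsto_intros P_lim)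
  show "(\<lambda>n. (norm (S (P n x)))\<^sup>2) \<longlonglongrightarrow> (norm (S x))\<^sup>2" by (intro tendsto_intros S_lim x)
qed (use SP_lower in blast)

text \<open>From \<open>A x \<bullet> x\<close>, which is the squared norm of \<open>S x\<close>,
  Cauchy-Schwarz and \<open>S_lower\<close> bound the fourth power of \<open>norm (S x)\<close>; one
  square is then cancelled.\<close>

lemma A_lower: assumes x: "x \<in> D" shows "\<nu> * (norm (S x))\<^sup>2 \<le> (norm (A x))\<^sup>2"
proof (cases "norm (S x) = 0")
  case False
  have "(norm (S x))\<^sup>2 = A x \<bullet> x" unfolding A_inner[OF x DDS[OF x]] by (rule power2_norm_eq_inner)
  also have "\<dots> \<le> norm (A x) * norm x" by (rule norm_cauchy_schwarz)
  finally have "((norm (S x))\<^sup>2)\<^sup>2 \<le> (norm (A x) * norm x)\<^sup>2" by (rule power_mono) simp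
  then have "\<nu> * ((norm (S x))\<^sup>2)\<^sup>2 \<le> \<nu> * (norm (A x) * norm x)\<^sup>2" using nu_pos by simp
  also have "\<dots> = (norm (A x))\<^sup>2 * (\<nu> * (norm x)\<^sup>2)" by (simp add: power_mult_distrib)
  also have "\<dots> \<le> (norm (A x))\<^sup>2 * (norm (S x))\<^sup>2" by (intro mult_left_mono S_lower DDS x) simp
  finally have "(\<nu> * (norm (S x))\<^sup>2) * (norm (S x))\<^sup>2 \<le> (norm (A x))\<^sup>2 * (norm (S x))\<^sup>2"
    by (simp add: power2_eq_square mult.assoc)
  then show ?thesis using False by simp
qed simp

lemma norm_le_S: "x \<in> DS \<Longrightarrow> (norm x)\<^sup>2 \<le> (norm (S x))\<^sup>2 / \<nu>"
  using S_lower[of x] nu_pos by (simp add: field_simps)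

lemma S_le_A: "x \<in> D \<Longrightarrow> (norm (S x))\<^sup>2 \<le> (norm (A x))\<^sup>2 / \<nu>"
  using A_lower[of x] nu_pos by (simp add: field_simps)

end

section \<open>A priori estimates for spectrally truncated solutions\<close>

text \<open>Here \<open>x = |Au|\<close>, \<open>y = |A\<^bsup>1/2\<^esup>u'|\<close>, \<open>z = |u'|\<close>, \<open>nn = |A\<^bsup>1/2\<^esup>u|\<^sup>2\<close>, \<open>a = \<langle>Au, u'\<rangle>\<close>, \<open>aa = \<langle>Au, Au'\<rangle>\<close>, and \<open>q\<close> is the
  derivative of the exponent of decay.\<close>

lemma decay_inequality:
  fixes x y z nn a aa b b' q q' c \<epsilon> \<gamma> \<beta> \<eta> \<kappa> M \<mu> \<nu> L :: real
  assumes pos: "0 \<le> x" "0 \<le> y" "0 \<le> z" "0 \<le> nn" "0 < \<epsilon>" "0 < \<gamma>" "0 \<le> \<beta>" "0 < \<eta>" "0 < \<mu>" "0 < \<nu>" "0 \<le> L"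
    and a: "\<bar>a\<bar> \<le> x * z" and nn: "nn \<le> x\<^sup>2 / \<nu>" and z: "z\<^sup>2 \<le> y\<^sup>2 / \<nu>"
    and q: "0 < q" "q \<le> b" "b \<le> 1" "b * q \<le> \<kappa>" "b' \<le> 0" "q' \<le> 0" "- q \<le> q'"
    and c: "\<mu> \<le> c" "c \<le> M"
    and H: "2 * \<epsilon> * L * (x * z) \<le> \<mu> * b"
    and gm: "\<beta> * (1 + \<gamma> * \<kappa> / \<nu>) + \<eta> \<le> 2 * \<gamma> * \<mu>"
    and e1: "\<epsilon> \<le> 1" and e2: "\<epsilon> * (2 * \<gamma> * M + \<beta> + M * (\<gamma> * (1 + \<beta>))\<^sup>2 / (\<eta> * \<nu>)) \<le> 1"
  shows "(2 * aa + \<gamma> * (q' * (2 * \<epsilon> * a + b * nn) + q * (2 * \<epsilon> * y\<^sup>2 + 2 * (- b * a - c * x\<^sup>2) + b' * nn + 2 * b * a)))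
     + (1 / c) * (2 * (- b * y\<^sup>2 - c * aa)) + (L / (\<mu> * c)) * \<bar>2 * a\<bar> * (\<epsilon> * y\<^sup>2)
     + \<beta> * q * (x\<^sup>2 + \<gamma> * (q * (2 * \<epsilon> * a + b * nn)) + (1 / c) * (\<epsilon> * y\<^sup>2)) \<le> 0"
proof -
  have c0: "0 < c" using c(1) pos by simp
  have b0: "0 < b" using q by simp
  have xz: "0 \<le> x * z" using pos by simp
  have y2: "0 \<le> y\<^sup>2 / c" using c0 by simp
  \<comment> \<open>The condition \<open>H\<close> limits the price of the nondifferentiable
    coefficient to half of the dissipation \<open>2 * b * (y\<^sup>2 / c)\<close>.\<close>
  have s1: "(L / (\<mu> * c)) * \<bar>2 * a\<bar> * (\<epsilon> * y\<^sup>2) \<le> b * (y\<^sup>2 / c)"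
  proof -
    have "2 * \<epsilon> * L * \<bar>a\<bar> \<le> 2 * \<epsilon> * L * (x * z)" using a pos by (intro mult_left_mono) auto
    also note H
    finally have "2 * \<epsilon> * L * \<bar>a\<bar> / \<mu> \<le> b" using pos by (simp add: divide_le_eq mult.commute)
    then have "(2 * \<epsilon> * L * \<bar>a\<bar> / \<mu>) * (y\<^sup>2 / c) \<le> b * (y\<^sup>2 / c)" by (rule mult_right_mono[OF _ y2])
    then show ?thesis by (simp add: abs_mult mult_ac)
  qed
  have s2: "(1 / c) * (2 * (- b * y\<^sup>2 - c * aa)) = - 2 * b * (y\<^sup>2 / c) - 2 * aa"
    using c0 by (simp add: field_simps)
  have qy: "q * (y\<^sup>2 / c) \<le> b * (y\<^sup>2 / c)" by (rule mult_right_mono[OF q(2) y2])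
  have s3: "\<gamma> * (q' * (2 * \<epsilon> * a + b * nn)) \<le> 2 * \<gamma> * \<epsilon> * q * (x * z)"
  proof -
    have "q' * (b * nn) \<le> 0" using q(6) b0 pos by (intro mult_nonpos_nonneg) auto
    moreover have "q' * a \<le> q * (x * z)"
    proof -
      have "q' * a \<le> \<bar>q'\<bar> * \<bar>a\<bar>" by (metis abs_ge_self abs_mult)
      also have "\<dots> \<le> q * (x * z)" using q a by (intro mult_mono) auto
      finally show ?thesis .
    qed
    then have "2 * \<epsilon> * (q' * a) \<le> 2 * \<epsilon> * (q * (x * z))" using pos by (intro mult_left_mono) auto
    ultimately have "q' * (2 * \<epsilon> * a + b * nn) \<le> 2 * \<epsilon> * (q * (x * z))" by (simp add: algebra_simps)
    then have "\<gamma> * (q' * (2 * \<epsilon> * a + b * nn)) \<le> \<gamma> * (2 * \<epsilon> * (q * (x * z)))" using pos by (intro mult_left_mono) auto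
    then show ?thesis by (simp add: mult_ac)
  qed
  have s4: "\<gamma> * (q * (2 * \<epsilon> * y\<^sup>2 + 2 * (- b * a - c * x\<^sup>2) + b' * nn + 2 * b * a)) \<le> 2 * \<gamma> * \<epsilon> * q * y\<^sup>2 - 2 * \<gamma> * \<mu> * q * x\<^sup>2"
  proof -
    have "b' * nn \<le> 0" using q pos by (intro mult_nonpos_nonneg) auto
    moreover have "\<mu> * x\<^sup>2 \<le> c * x\<^sup>2" using c by (intro mult_right_mono) auto
    ultimately have "2 * \<epsilon> * y\<^sup>2 + 2 * (- b * a - c * x\<^sup>2) + b' * nn + 2 * b * a \<le> 2 * \<epsilon> * y\<^sup>2 - 2 * (\<mu> * x\<^sup>2)" by simp
    then have "(\<gamma> * q) * (2 * \<epsilon> * y\<^sup>2 + 2 * (- b * a - c * x\<^sup>2) + b' * nn + 2 * b * a) \<le> (\<gamma> * q) * (2 * \<epsilon> * y\<^sup>2 - 2 * (\<mu> * x\<^sup>2))"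
      using pos q by (intro mult_left_mono) auto
    then show ?thesis by (simp add: algebra_simps)
  qed
  \<comment> \<open>The part of the multiplier proportional to \<open>nn\<close> contributes
    \<open>\<beta> * \<gamma> * \<kappa> / \<nu>\<close>, the term that limits the possible rate in
    \<open>gm\<close>.\<close>
  have s5: "\<beta> * q * (x\<^sup>2 + \<gamma> * (q * (2 * \<epsilon> * a + b * nn)) + (1 / c) * (\<epsilon> * y\<^sup>2))
     \<le> q * (\<beta> * x\<^sup>2 + 2 * \<beta> * \<gamma> * \<epsilon> * (x * z) + \<beta> * \<gamma> * \<kappa> / \<nu> * x\<^sup>2 + \<beta> * \<epsilon> * (y\<^sup>2 / c))"
  proof -
    have "q * a \<le> 1 * (x * z)"
    proof -
      have "q * a \<le> q * (x * z)" using a q by (intro mult_left_mono) auto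
      also have "\<dots> \<le> 1 * (x * z)" using q xz by (intro mult_right_mono) auto
      finally show ?thesis .
    qed
    then have "2 * \<epsilon> * (q * a) \<le> 2 * \<epsilon> * (x * z)" using pos by (intro mult_left_mono) auto
    moreover have "b * q * nn \<le> \<kappa> * (x\<^sup>2 / \<nu>)"
    proof -
      have bq: "0 < b * q" using b0 q by simp
      then have "0 \<le> \<kappa>" using q(4) by linarith
      then show ?thesis by (rule mult_mono[OF q(4) nn _ pos(4)])
    qed
    ultimately have "q * (2 * \<epsilon> * a + b * nn) \<le> 2 * \<epsilon> * (x * z) + \<kappa> * (x\<^sup>2 / \<nu>)" by (simp add: algebra_simps)
    then have "\<gamma> * (q * (2 * \<epsilon> * a + b * nn)) \<le> \<gamma> * (2 * \<epsilon> * (x * z) + \<kappa> * (x\<^sup>2 / \<nu>))" using pos by (intro mult_left_mono) auto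
    then have "\<beta> * q * (x\<^sup>2 + \<gamma> * (q * (2 * \<epsilon> * a + b * nn)) + (1 / c) * (\<epsilon> * y\<^sup>2))
       \<le> \<beta> * q * (x\<^sup>2 + \<gamma> * (2 * \<epsilon> * (x * z) + \<kappa> * (x\<^sup>2 / \<nu>)) + (1 / c) * (\<epsilon> * y\<^sup>2))"
      using pos q by (intro mult_left_mono add_right_mono add_left_mono) auto
    then show ?thesis by (simp add: algebra_simps)
  qed
  \<comment> \<open>Young's inequality for the cross terms: \<open>\<eta>\<close> is the margin
    reserved in \<open>gm\<close>, and the rest is charged to \<open>y\<close> because
    \<open>z\<^sup>2 \<le> y\<^sup>2 / \<nu>\<close>.\<close>
  have s6: "2 * \<gamma> * \<epsilon> * (1 + \<beta>) * (x * z) \<le> \<eta> * x\<^sup>2 + (\<gamma> * \<epsilon> * (1 + \<beta>))\<^sup>2 / (\<eta> * \<nu>) * y\<^sup>2"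
  proof -
    let ?g = "\<gamma> * \<epsilon> * (1 + \<beta>)"
    have "0 \<le> (\<eta> * x - ?g * z)\<^sup>2 / \<eta>" using pos by simp
    also have "\<dots> = \<eta> * x\<^sup>2 - 2 * ?g * (x * z) + ?g\<^sup>2 / \<eta> * z\<^sup>2"
      using pos by (simp add: power2_eq_square field_simps)
    finally have "2 * ?g * (x * z) \<le> \<eta> * x\<^sup>2 + ?g\<^sup>2 / \<eta> * z\<^sup>2" by simp
    moreover have "?g\<^sup>2 / \<eta> * z\<^sup>2 \<le> ?g\<^sup>2 / \<eta> * (y\<^sup>2 / \<nu>)" using pos z by (intro mult_left_mono) auto
    ultimately show ?thesis by (simp add: mult_ac)
  qed
  \<comment> \<open>All terms in \<open>y\<close> carry a factor \<open>\<epsilon>\<close> after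
    multiplication by \<open>c\<close>; the bound \<open>e2\<close> lets the remaining dissipation
    absorb their sum.\<close>
  have s7: "2 * \<gamma> * \<epsilon> * y\<^sup>2 + \<beta> * \<epsilon> * (y\<^sup>2 / c) + (\<gamma> * \<epsilon> * (1 + \<beta>))\<^sup>2 / (\<eta> * \<nu>) * y\<^sup>2 \<le> y\<^sup>2 / c"
  proof -
    let ?h = "(\<gamma> * (1 + \<beta>))\<^sup>2 / (\<eta> * \<nu>)"
    have h0: "0 \<le> ?h" using pos by simp
    have "\<epsilon>\<^sup>2 \<le> \<epsilon>" using e1 pos by (simp add: power2_eq_square mult_left_le)
    then have "\<epsilon>\<^sup>2 * ?h \<le> \<epsilon> * ?h" using h0 by (rule mult_right_mono)
    then have "c * (\<epsilon>\<^sup>2 * ?h) \<le> c * (\<epsilon> * ?h)" using c0 by (intro mult_left_mono) auto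
    also have "\<dots> \<le> M * (\<epsilon> * ?h)" using c h0 pos by (intro mult_right_mono) auto
    finally have 1: "c * (\<epsilon>\<^sup>2 * ?h) \<le> \<epsilon> * (M * ?h)" by (simp add: mult_ac)
    have 2: "2 * \<gamma> * \<epsilon> * c \<le> 2 * \<gamma> * \<epsilon> * M" using c pos by (intro mult_left_mono) auto
    have "2 * \<gamma> * \<epsilon> * c + \<beta> * \<epsilon> + c * (\<epsilon>\<^sup>2 * ?h) \<le> \<epsilon> * (2 * \<gamma> * M + \<beta> + M * ?h)"
      using 1 2 by (simp add: algebra_simps)
    also have "\<dots> \<le> 1" using e2 by simp
    finally have fin: "(2 * \<gamma> * \<epsilon> * c + \<beta> * \<epsilon> + c * (\<epsilon>\<^sup>2 * ?h)) * (y\<^sup>2 / c) \<le> 1 * (y\<^sup>2 / c)"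
      by (rule mult_right_mono[OF _ y2])
    have gen: "(2 * \<gamma> * \<epsilon> * c + \<beta> * \<epsilon> + c * h) * (y\<^sup>2 / c)
        = 2 * \<gamma> * \<epsilon> * y\<^sup>2 + \<beta> * \<epsilon> * (y\<^sup>2 / c) + h * y\<^sup>2" for h
      using c0 by (simp add: field_simps)
    have eh: "\<epsilon>\<^sup>2 * ?h = (\<gamma> * \<epsilon> * (1 + \<beta>))\<^sup>2 / (\<eta> * \<nu>)" by (simp add: power_mult_distrib mult_ac)
    show ?thesis using fin unfolding gen eh by (simp only: mult_1)
  qed
  have s8: "\<beta> * x\<^sup>2 + \<beta> * \<gamma> * \<kappa> / \<nu> * x\<^sup>2 + \<eta> * x\<^sup>2 \<le> 2 * \<gamma> * \<mu> * x\<^sup>2"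
    using mult_right_mono[OF gm, of "x\<^sup>2"] by (simp add: algebra_simps)
  \<comment> \<open>The dissipation left over by \<open>s1\<close> is weakened from \<open>b\<close>
    to \<open>q\<close>; then every remaining term has the factor \<open>q\<close> and the bracket
    is nonpositive by \<open>s6\<close>, \<open>s7\<close> and \<open>s8\<close>.\<close>
  have "q * (2 * \<gamma> * \<epsilon> * (x * z) + 2 * \<gamma> * \<epsilon> * y\<^sup>2 - 2 * \<gamma> * \<mu> * x\<^sup>2 - y\<^sup>2 / c
     + (\<beta> * x\<^sup>2 + 2 * \<beta> * \<gamma> * \<epsilon> * (x * z) + \<beta> * \<gamma> * \<kappa> / \<nu> * x\<^sup>2 + \<beta> * \<epsilon> * (y\<^sup>2 / c))) \<le> q * 0"
    using s6 s7 s8 q(1) by (intro mult_left_mono) (auto simp: algebra_simps)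
  then have s9: "2 * \<gamma> * \<epsilon> * q * (x * z) + (2 * \<gamma> * \<epsilon> * q * y\<^sup>2 - 2 * \<gamma> * \<mu> * q * x\<^sup>2) - q * (y\<^sup>2 / c)
     + q * (\<beta> * x\<^sup>2 + 2 * \<beta> * \<gamma> * \<epsilon> * (x * z) + \<beta> * \<gamma> * \<kappa> / \<nu> * x\<^sup>2 + \<beta> * \<epsilon> * (y\<^sup>2 / c)) \<le> 0"
    by (simp add: algebra_simps)
  have s10: "\<gamma> * (q' * (2 * \<epsilon> * a + b * nn) + q * (2 * \<epsilon> * y\<^sup>2 + 2 * (- b * a - c * x\<^sup>2) + b' * nn + 2 * b * a))
    = \<gamma> * (q' * (2 * \<epsilon> * a + b * nn)) + \<gamma> * (q * (2 * \<epsilon> * y\<^sup>2 + 2 * (- b * a - c * x\<^sup>2) + b' * nn + 2 * b * a))"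
    by (rule distrib_left)
  show ?thesis unfolding s2 s10 using s1 s3 s4 s5 s9 qy by linarith
qed

text \<open>Here \<open>v\<close> and \<open>w\<close> are the first and second derivatives of
  \<open>u\<close>. Since all three stay in the range of \<open>P N\<close>, the operators act on
  them as bounded ones. The global bounds on \<open>m\<close> are supplied later by clipping its
  argument.\<close>

locale truncated_solution = coercive_sqrt D DS A S P \<nu>
  for D DS :: "'h::{real_inner,complete_space} set" and A S P \<nu> +
  fixes N :: nat and m :: "real \<Rightarrow> real" and \<mu> M L \<epsilon> :: real and b b' :: "real \<Rightarrow> real"
    and u v w :: "real \<Rightarrow> 'h"
  assumes m: "\<mu> \<le> m \<sigma>" "m \<sigma> \<le> M" and mL: "\<bar>m \<sigma> - m \<tau>\<bar> \<le> L * \<bar>\<sigma> - \<tau>\<bar>"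
    and pos: "0 < \<mu>" "0 \<le> L" "0 < \<epsilon>"
    and b: "0 \<le> t \<Longrightarrow> 0 < b t" "0 \<le> t \<Longrightarrow> b t \<le> 1" "0 \<le> t \<Longrightarrow> b' t \<le> 0"
    and db: "0 \<le> t \<Longrightarrow> (b has_real_derivative b' t) (at t within {0..})"
    and PN: "0 \<le> t \<Longrightarrow> P N (u t) = u t" "0 \<le> t \<Longrightarrow> P N (v t) = v t" "0 \<le> t \<Longrightarrow> P N (w t) = w t"
    and du: "0 \<le> t \<Longrightarrow> (u has_vector_derivative v t) (at t within {0..})"
    and dv: "0 \<le> t \<Longrightarrow> (v has_vector_derivative w t) (at t within {0..})"
    and eq: "0 \<le> t \<Longrightarrow> \<epsilon> *\<^sub>R w t + b t *\<^sub>R v t + m ((norm (S (u t)))\<^sup>2) *\<^sub>R A (u t) = 0"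
begin

definition "c t = m ((norm (S (u t)))\<^sup>2)"

lemma c_bounds: "\<mu> \<le> c t" "c t \<le> M" "0 < c t"
  using m pos unfolding c_def by (auto intro: less_le_trans)

lemma inD: "0 \<le> t \<Longrightarrow> u t \<in> D" "0 \<le> t \<Longrightarrow> v t \<in> D" "0 \<le> t \<Longrightarrow> w t \<in> D"
  using PN P_D by metis+

lemma inDS: "0 \<le> t \<Longrightarrow> u t \<in> DS" "0 \<le> t \<Longrightarrow> v t \<in> DS" "0 \<le> t \<Longrightarrow> w t \<in> DS"
  using inD DDS by blast+

lemma deriv_op:
  assumes B: "bounded_linear (\<lambda>x. B (P N x))" and f: "\<And>t. 0 \<le> t \<Longrightarrow> P N (f t) = f t" "P N f' = f'"
    and d: "(f has_vector_derivative f') (at t within {0..})" and t: "0 \<le> t"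
  shows "((\<lambda>t. B (f t)) has_vector_derivative B f') (at t within {0..})"
proof -
  have "((\<lambda>t. B (P N (f t))) has_vector_derivative B (P N f')) (at t within {0..})"
    by (rule bounded_linear.has_vector_derivative[OF B d])
  then show ?thesis unfolding f(2)
    by (rule has_vector_derivative_transform[rotated 2]) (use t f(1) in auto)
qed

lemma dSu: "0 \<le> t \<Longrightarrow> ((\<lambda>t. S (u t)) has_vector_derivative S (v t)) (at t within {0..})"
  by (rule deriv_op[OF SP_bl PN(1) PN(2) du])
lemma dAu: "0 \<le> t \<Longrightarrow> ((\<lambda>t. A (u t)) has_vector_derivative A (v t)) (at t within {0..})"
  by (rule deriv_op[OF AP_bl PN(1) PN(2) du])
lemma dSv: "0 \<le> t \<Longrightarrow> ((\<lambda>t. S (v t)) has_vector_derivative S (w t)) (at t within {0..})"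
  by (rule deriv_op[OF SP_bl PN(2) PN(3) dv])

lemma dk: "0 \<le> t \<Longrightarrow> ((\<lambda>t. (norm (S (u t)))\<^sup>2) has_real_derivative 2 * (A (u t) \<bullet> v t)) (at t within {0..})"
  using norm_sq_has_real_derivative[OF dSu] A_inner[OF inD(1) inDS(2)] by simp

lemma cont_of_deriv: "(\<And>t. 0 \<le> t \<Longrightarrow> (f has_vector_derivative f' t) (at t within {0..})) \<Longrightarrow> continuous_on {0..} f"
  unfolding continuous_on_eq_continuous_within by (auto intro: has_vector_derivative_continuous)

lemma m_cont: "continuous_on UNIV m"
proof -
  have "L-lipschitz_on UNIV m" by (rule lipschitz_onI) (use mL pos in \<open>auto simp: dist_real_def\<close>)
  then show ?thesis by (rule lipschitz_on_continuous_on)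
qed

lemma c_cont: "continuous_on {0..} c"
  unfolding c_def[abs_def]
  by (rule continuous_on_compose2[OF m_cont]) (auto intro!: continuous_intros cont_of_deriv[OF dSu])

lemma inv_c_cont: "continuous_on {0..T} (\<lambda>t. 1 / c t)"
proof -
  have "c t \<noteq> 0" for t using c_bounds(3)[of t] by simp
  then have "continuous_on {0..} (\<lambda>t. 1 / c t)" by (intro continuous_intros c_cont) simp
  then show ?thesis by (rule continuous_on_subset) auto
qed

text \<open>Bounds \<open>\<epsilon> |c'| / c\<close> by the damping.\<close>

definition "rate T \<longleftrightarrow> (\<forall>t. 0 \<le> t \<longrightarrow> t < T \<longrightarrow> 2 * \<epsilon> * L * (norm (A (u t)) * norm (v t)) \<le> \<mu> * b t)"

text \<open>The difference of reciprocals is a difference of \<open>c\<close> divided by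
  \<open>c s * c t\<close>. Only \<open>c s\<close> is replaced by its lower bound, so that the
  factor \<open>1 / c t\<close> matches the dissipation at time \<open>t\<close>.\<close>

lemma inv_c_lip: "1 / c s \<le> 1 / c t + L / (\<mu> * c t) * \<bar>(norm (S (u s)))\<^sup>2 - (norm (S (u t)))\<^sup>2\<bar>"
proof -
  let ?d = "L * \<bar>(norm (S (u s)))\<^sup>2 - (norm (S (u t)))\<^sup>2\<bar>"
  have "c t \<le> c s + ?d" using mL[of "(norm (S (u t)))\<^sup>2" "(norm (S (u s)))\<^sup>2"] unfolding c_def
    by (simp add: abs_minus_commute)
  then have "1 / c s * (c t / c t) \<le> 1 / c s * ((c s + ?d) / c t)"
    using c_bounds(3)[of s] c_bounds(3)[of t] by (intro mult_left_mono divide_right_mono) auto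
  then have "1 / c s \<le> 1 / c t + (1 / c s) * (?d / c t)"
    using c_bounds(3)[of s] c_bounds(3)[of t] by (simp add: add_divide_distrib distrib_left)
  also have "(1 / c s) * (?d / c t) \<le> (1 / \<mu>) * (?d / c t)"
    using c_bounds(1)[of s] c_bounds(3)[of t] pos by (intro mult_right_mono divide_left_mono) (auto intro!: mult_pos_pos less_le_trans[OF pos(1)])
  finally show ?thesis by (simp add: mult_ac)
qed

text \<open>\<open>\<theta> = 0\<close> gives the energy of the solution, \<open>\<theta> = 1\<close> that of its high frequencies.\<close>

definition "Z \<theta> j x = x - \<theta> *\<^sub>R P j x"
definition "F \<theta> j t = (norm (A (Z \<theta> j (u t))))\<^sup>2 + (1 / c t) * (\<epsilon> * (norm (S (Z \<theta> j (v t))))\<^sup>2)"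

lemma Z_bl: "bounded_linear (Z \<theta> j)"
  unfolding Z_def[abs_def] by (intro bounded_linear_intros P_bl)

lemma Z_PN: "P N x = x \<Longrightarrow> P N (Z \<theta> j x) = Z \<theta> j x"
  unfolding Z_def using linear_diff[OF P_linear] linear_scale[OF P_linear] P_P[of N j] P_P[of j N]
  by (metis min.commute)

lemma Z_D: "x \<in> D \<Longrightarrow> Z \<theta> j x \<in> D" and Z_A: "x \<in> D \<Longrightarrow> A (Z \<theta> j x) = Z \<theta> j (A x)"
  using A_lin[of x "P j x" "-\<theta>"] P_D unfolding Z_def by (simp_all add: AP)

text \<open>\<open>Z\<close> commutes with \<open>A\<close>, so the filtered functions satisfy the
  equation with the same scalar coefficient, which still depends on the whole of \<open>u\<close>.
  The terms \<open>A u \<bullet> A v\<close> cancel, and half of the damping pays for the variation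
  of \<open>1 / c\<close>.\<close>

lemma F_nonincreasing:
  assumes T: "0 \<le> T" and H: "rate T"
  shows "F \<theta> j T \<le> F \<theta> j 0"
proof -
  let ?z = "Z \<theta> j"
  have dz: "((\<lambda>t. ?z (f t)) has_vector_derivative ?z f') (at t within {0..})"
    if "(f has_vector_derivative f') (at t within {0..})" for f f' t
    by (rule bounded_linear.has_vector_derivative[OF Z_bl that])
  have dA: "((\<lambda>t. A (?z (u t))) has_vector_derivative A (?z (v t))) (at t within {0..})" if "0 \<le> t" for t
    by (rule deriv_op[OF AP_bl Z_PN[OF PN(1)] Z_PN[OF PN(2)] dz[OF du]]) (use that in auto)
  have dS: "((\<lambda>t. S (?z (v t))) has_vector_derivative S (?z (w t))) (at t within {0..})" if "0 \<le> t" for t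
    by (rule deriv_op[OF SP_bl Z_PN[OF PN(2)] Z_PN[OF PN(3)] dz[OF dv]]) (use that in auto)
  have "((norm (A (?z (u T))))\<^sup>2 + (1 / c T) * (\<epsilon> * (norm (S (?z (v T))))\<^sup>2)) * 1
      \<le> ((norm (A (?z (u 0))))\<^sup>2 + (1 / c 0) * (\<epsilon> * (norm (S (?z (v 0))))\<^sup>2)) * 1"
  proof (rule energy_nonincreasing[OF T, where k="\<lambda>t. (norm (S (u t)))\<^sup>2" and lp="\<lambda>t. L / (\<mu> * c t)" and \<phi>="\<lambda>t. 1"
      and ga="\<lambda>t. (norm (A (?z (u t))))\<^sup>2" and gb="\<lambda>t. \<epsilon> * (norm (S (?z (v t))))\<^sup>2" and \<psi>="\<lambda>t. 1 / c t" and \<phi>'="\<lambda>t. 0"])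
    fix t :: real assume t: "0 \<le> t"
    show "((\<lambda>t. (norm (A (?z (u t))))\<^sup>2) has_real_derivative 2 * (A (?z (u t)) \<bullet> A (?z (v t)))) (at t within {0..})"
      by (rule norm_sq_has_real_derivative[OF dA[OF t]])
    show "((\<lambda>t. \<epsilon> * (norm (S (?z (v t))))\<^sup>2) has_real_derivative \<epsilon> * (2 * (S (?z (v t)) \<bullet> S (?z (w t))))) (at t within {0..})"
      by (rule DERIV_cmult[OF norm_sq_has_real_derivative[OF dS[OF t]]])
    show "((\<lambda>t. (norm (S (u t)))\<^sup>2) has_real_derivative 2 * (A (u t) \<bullet> v t)) (at t within {0..})" by (rule dk[OF t])
    show "((\<lambda>t. 1) has_real_derivative 0) (at t within {0..})" by simp
    show "0 \<le> \<epsilon> * (norm (S (?z (v t))))\<^sup>2" using pos by simp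
    show "(0::real) < 1" by simp
    show "1 / c s \<le> 1 / c t + L / (\<mu> * c t) * \<bar>(norm (S (u s)))\<^sup>2 - (norm (S (u t)))\<^sup>2\<bar>" for s by (rule inv_c_lip)
  next
    show "continuous_on {0..T} (\<lambda>t. 1 / c t)" by (rule inv_c_cont)
  next
    fix t assume t: "0 \<le> t" "t < T"
    let ?Av = "A (?z (v t))" and ?Au = "A (?z (u t))"
    have "\<epsilon> *\<^sub>R w t = - (b t *\<^sub>R v t + c t *\<^sub>R A (u t))"
      using eq[OF t(1)] unfolding c_def by (simp only: add.assoc eq_neg_iff_add_eq_0)
    then have "?z (\<epsilon> *\<^sub>R w t) = - (b t *\<^sub>R ?z (v t) + c t *\<^sub>R ?z (A (u t)))"
      using bounded_linear.linear[OF Z_bl[of \<theta> j]] by (simp add: linear_neg linear_add linear_scale linear_diff)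
    then have ez: "\<epsilon> *\<^sub>R ?z (w t) = - (b t *\<^sub>R ?z (v t) + c t *\<^sub>R ?Au)"
      using bounded_linear.linear[OF Z_bl[of \<theta> j]] Z_A[OF inD(1)[OF t(1)]] by (simp add: linear_scale)
    have "\<epsilon> * (S (?z (v t)) \<bullet> S (?z (w t))) = \<epsilon> * (?Av \<bullet> ?z (w t))"
      using A_inner[OF Z_D[OF inD(2)[OF t(1)]] DDS[OF Z_D[OF inD(3)[OF t(1)]]]] by simp
    also have "\<dots> = ?Av \<bullet> (\<epsilon> *\<^sub>R ?z (w t))" by simp
    also have "\<dots> = - b t * (?Av \<bullet> ?z (v t)) - c t * (?Av \<bullet> ?Au)" unfolding ez by (simp add: inner_add_right inner_diff_right)
    also have "?Av \<bullet> ?z (v t) = (norm (S (?z (v t))))\<^sup>2"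
      unfolding A_inner[OF Z_D[OF inD(2)[OF t(1)]] DDS[OF Z_D[OF inD(2)[OF t(1)]]]] by (rule power2_norm_eq_inner[symmetric])
    finally have S1: "\<epsilon> * (S (?z (v t)) \<bullet> S (?z (w t))) = - b t * (norm (S (?z (v t))))\<^sup>2 - c t * (?Av \<bullet> ?Au)" .
    let ?y = "(norm (S (?z (v t))))\<^sup>2"
    have cp: "0 < c t" by (rule c_bounds)
    \<comment> \<open>The only use of the rate condition: without it this term has no sign.\<close>
    have "L / (\<mu> * c t) * \<bar>2 * (A (u t) \<bullet> v t)\<bar> * (\<epsilon> * ?y) \<le> b t * ?y / c t"
    proof -
      have "2 * \<epsilon> * L * \<bar>A (u t) \<bullet> v t\<bar> \<le> 2 * \<epsilon> * L * (norm (A (u t)) * norm (v t))"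
        using pos by (intro mult_left_mono inner_le_norms) auto
      also have "\<dots> \<le> \<mu> * b t" using H t unfolding rate_def by blast
      finally have "2 * \<epsilon> * L * \<bar>A (u t) \<bullet> v t\<bar> / \<mu> \<le> b t" using pos by (simp add: divide_le_eq mult.commute)
      then have "2 * \<epsilon> * L * \<bar>A (u t) \<bullet> v t\<bar> / \<mu> * (?y / c t) \<le> b t * (?y / c t)"
        using cp by (intro mult_right_mono) auto
      then show ?thesis by (simp add: abs_mult mult_ac)
    qed
    moreover have "0 \<le> b t * ?y / c t" using b(1)[OF t(1)] cp by simp
    moreover have "1 / c t * (\<epsilon> * (2 * (S (?z (v t)) \<bullet> S (?z (w t))))) = - 2 * (b t * ?y / c t) - 2 * (?Au \<bullet> ?Av)"
    proof -
      have "1 / c t * (\<epsilon> * (2 * (S (?z (v t)) \<bullet> S (?z (w t))))) = 1 / c t * (2 * (- b t * ?y - c t * (?Av \<bullet> ?Au)))"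
        unfolding S1[symmetric] by simp
      also have "\<dots> = - 2 * (b t * ?y / c t) - 2 * (?Au \<bullet> ?Av)" using cp by (simp add: field_simps inner_commute)
      finally show ?thesis .
    qed
    ultimately show "(2 * (?Au \<bullet> ?Av) + 1 / c t * (\<epsilon> * (2 * (S (?z (v t)) \<bullet> S (?z (w t)))))
        + L / (\<mu> * c t) * \<bar>2 * (A (u t) \<bullet> v t)\<bar> * (\<epsilon> * ?y)) * 1 + ((norm ?Au)\<^sup>2 + 1 / c t * (\<epsilon> * ?y)) * 0 \<le> 0" by simp
  qed
  then show ?thesis by (simp add: F_def)
qed

lemma F_0: "F 0 j t = (norm (A (u t)))\<^sup>2 + (1 / c t) * (\<epsilon> * (norm (S (v t)))\<^sup>2)"
  by (simp add: F_def Z_def)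

lemma v_le: "0 \<le> t \<Longrightarrow> (norm (v t))\<^sup>2 \<le> (norm (S (v t)))\<^sup>2 / \<nu>"
  by (rule norm_le_S[OF inDS(2)])

text \<open>Young's inequality and the bound of \<open>v\<close> by \<open>S v\<close> leave a term
  of order \<open>\<epsilon>\<^sup>2\<close>, which the smallness of \<open>\<epsilon>\<close>
  places below half of the second part of \<open>F\<close>. Thus adding the multiplier keeps the
  energy comparable with \<open>F\<close>.\<close>

lemma cross_bound:
  assumes g: "0 < \<gamma>" and e: "4 * \<gamma>\<^sup>2 * \<epsilon> * M \<le> \<nu>" and t: "0 \<le> t" and q: "0 \<le> q" "q \<le> 1"
  shows "\<bar>\<gamma> * (q * (2 * \<epsilon> * (A (u t) \<bullet> v t)))\<bar> \<le> F 0 j t / 2"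
proof -
  let ?x = "norm (A (u t))" and ?z = "norm (v t)" and ?y = "norm (S (v t))"
  have cM: "0 < c t" "c t \<le> M" by (rule c_bounds)+
  have "\<bar>\<gamma> * (q * (2 * \<epsilon> * (A (u t) \<bullet> v t)))\<bar> = q * (2 * \<gamma> * \<epsilon> * \<bar>A (u t) \<bullet> v t\<bar>)"
    using g q pos by (simp add: abs_mult)
  also have "\<dots> \<le> 1 * (2 * \<gamma> * \<epsilon> * (?x * ?z))"
    using g q pos by (intro mult_mono mult_left_mono inner_le_norms) auto
  also have "\<dots> \<le> ?x\<^sup>2 / 2 + 2 * \<gamma>\<^sup>2 * \<epsilon>\<^sup>2 * ?z\<^sup>2"
    using zero_le_power2[of "?x - 2 * \<gamma> * \<epsilon> * ?z"] by (simp add: power2_eq_square algebra_simps)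
  also have "2 * \<gamma>\<^sup>2 * \<epsilon>\<^sup>2 * ?z\<^sup>2 \<le> 2 * \<gamma>\<^sup>2 * \<epsilon>\<^sup>2 * (?y\<^sup>2 / \<nu>)"
    by (intro mult_left_mono v_le t) auto
  also have "\<dots> \<le> (1 / c t) * (\<epsilon> * ?y\<^sup>2) / 2"
  proof -
    have "4 * \<gamma>\<^sup>2 * \<epsilon> * c t \<le> 4 * \<gamma>\<^sup>2 * \<epsilon> * M" using cM pos by (intro mult_left_mono) auto
    then have "4 * \<gamma>\<^sup>2 * \<epsilon> * c t \<le> \<nu>" using e by linarith
    then have "4 * \<gamma>\<^sup>2 * \<epsilon> / \<nu> \<le> 1 / c t" using cM nu_pos by (simp add: field_simps)
    then have "(4 * \<gamma>\<^sup>2 * \<epsilon> / \<nu>) * (\<epsilon> * ?y\<^sup>2 / 2) \<le> (1 / c t) * (\<epsilon> * ?y\<^sup>2 / 2)"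
      using pos by (intro mult_right_mono) auto
    then show ?thesis by (simp add: power2_eq_square mult_ac)
  qed
  finally show ?thesis unfolding F_0 by simp
qed

text \<open>\<open>energy_nonincreasing\<close> applied to \<open>F\<close> plus the multiplier,
  weighted by \<open>exp (\<beta> * Q t)\<close>. After substituting the equation the required sign
  is \<open>decay_inequality\<close>; the final constant only compares this functional with
  \<open>F\<close> at both ends.\<close>

lemma F_decay:
  assumes T: "0 \<le> T" and H: "rate T"
    and q: "\<And>t. 0 \<le> t \<Longrightarrow> 0 < q t" "\<And>t. 0 \<le> t \<Longrightarrow> q t \<le> b t" "\<And>t. 0 \<le> t \<Longrightarrow> b t * q t \<le> \<kappa>"
      "\<And>t. 0 \<le> t \<Longrightarrow> q' t \<le> 0" "\<And>t. 0 \<le> t \<Longrightarrow> - q t \<le> q' t"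
    and dq: "\<And>t. 0 \<le> t \<Longrightarrow> (q has_real_derivative q' t) (at t within {0..})"
    and dQ: "\<And>t. 0 \<le> t \<Longrightarrow> (Q has_real_derivative q t) (at t within {0..})" and Q0: "Q 0 = 0"
    and par: "0 \<le> \<beta>" "0 < \<gamma>" "0 < \<eta>"
    and gm: "\<beta> * (1 + \<gamma> * \<kappa> / \<nu>) + \<eta> \<le> 2 * \<gamma> * \<mu>"
    and e1: "\<epsilon> \<le> 1" and e2: "\<epsilon> * (2 * \<gamma> * M + \<beta> + M * (\<gamma> * (1 + \<beta>))\<^sup>2 / (\<eta> * \<nu>)) \<le> 1"
    and e3: "4 * \<gamma>\<^sup>2 * \<epsilon> * M \<le> \<nu>"
  shows "F 0 j T * exp (\<beta> * Q T) \<le> 2 * (2 + \<gamma> / \<nu>) * F 0 j 0"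
proof -
  let ?a = "\<lambda>t. A (u t) \<bullet> v t" and ?nn = "\<lambda>t. (norm (S (u t)))\<^sup>2"
  let ?G = "\<lambda>t. (norm (A (u t)))\<^sup>2 + \<gamma> * (q t * (2 * \<epsilon> * ?a t + b t * ?nn t))"
  let ?y = "\<lambda>t. (norm (S (v t)))\<^sup>2"
  have mono: "(?G T + (1 / c T) * (\<epsilon> * ?y T)) * exp (\<beta> * Q T) \<le> (?G 0 + (1 / c 0) * (\<epsilon> * ?y 0)) * exp (\<beta> * Q 0)"
  proof (rule energy_nonincreasing[OF T, where k="?nn" and lp="\<lambda>t. L / (\<mu> * c t)" and \<phi>="\<lambda>t. exp (\<beta> * Q t)"
      and ga="?G" and gb="\<lambda>t. \<epsilon> * ?y t" and \<psi>="\<lambda>t. 1 / c t"])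
    fix t :: real assume t: "0 \<le> t"
    have da: "(?a has_real_derivative (A (u t) \<bullet> w t + A (v t) \<bullet> v t)) (at t within {0..})"
      by (rule inner_has_real_derivative[OF dAu[OF t] dv[OF t]])
    show "(?G has_real_derivative 2 * (A (u t) \<bullet> A (v t)) + \<gamma> * (q' t * (2 * \<epsilon> * ?a t + b t * ?nn t)
        + q t * (2 * \<epsilon> * (A (u t) \<bullet> w t + A (v t) \<bullet> v t) + (b' t * ?nn t + b t * (2 * ?a t))))) (at t within {0..})"
    proof -
      have gen: "((\<lambda>t. f t + \<gamma> * (q t * (2 * \<epsilon> * g t + b t * h t))) has_real_derivative f' + \<gamma> * (q' t * (2 * \<epsilon> * g t + b t * h t)
        + q t * (2 * \<epsilon> * g' + (b' t * h t + b t * h')))) (at t within {0..})"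
        if "(f has_real_derivative f') (at t within {0..})" "(g has_real_derivative g') (at t within {0..})"
          "(h has_real_derivative h') (at t within {0..})" for f g h f' g' h'
        by (auto intro!: derivative_eq_intros that dq[OF t] db[OF t] simp: algebra_simps)
      show ?thesis by (rule gen[OF norm_sq_has_real_derivative[OF dAu[OF t]] da dk[OF t]])
    qed
    show "((\<lambda>t. \<epsilon> * ?y t) has_real_derivative \<epsilon> * (2 * (S (v t) \<bullet> S (w t)))) (at t within {0..})"
      by (rule DERIV_cmult[OF norm_sq_has_real_derivative[OF dSv[OF t]]])
    show "(?nn has_real_derivative 2 * ?a t) (at t within {0..})" by (rule dk[OF t])
    show "((\<lambda>t. exp (\<beta> * Q t)) has_real_derivative exp (\<beta> * Q t) * (\<beta> * q t)) (at t within {0..})"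
      by (auto intro!: derivative_eq_intros dQ[OF t])
    show "0 \<le> \<epsilon> * ?y t" using pos by simp
    show "0 < exp (\<beta> * Q t)" by simp
    show "1 / c s \<le> 1 / c t + L / (\<mu> * c t) * \<bar>?nn s - ?nn t\<bar>" for s by (rule inv_c_lip)
  next
    show "continuous_on {0..T} (\<lambda>t. 1 / c t)" by (rule inv_c_cont)
  next
    fix t assume t: "0 \<le> t" "t < T"
    have ew: "\<epsilon> *\<^sub>R w t = - (b t *\<^sub>R v t + c t *\<^sub>R A (u t))"
      using eq[OF t(1)] unfolding c_def by (simp only: add.assoc eq_neg_iff_add_eq_0)
    have vy: "A (v t) \<bullet> v t = ?y t"
      unfolding A_inner[OF inD(2)[OF t(1)] inDS(2)[OF t(1)]] by (rule power2_norm_eq_inner[symmetric])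
    have "\<epsilon> * (A (u t) \<bullet> w t) = A (u t) \<bullet> (\<epsilon> *\<^sub>R w t)" by simp
    also have "\<dots> = - b t * ?a t - c t * (norm (A (u t)))\<^sup>2"
      unfolding ew by (simp add: inner_add_right inner_diff_right power2_norm_eq_inner)
    finally have aw: "\<epsilon> * (A (u t) \<bullet> w t) = - b t * ?a t - c t * (norm (A (u t)))\<^sup>2" .
    have "\<epsilon> * (S (v t) \<bullet> S (w t)) = A (v t) \<bullet> (\<epsilon> *\<^sub>R w t)"
      using A_inner[OF inD(2)[OF t(1)] inDS(3)[OF t(1)]] by simp
    also have "\<dots> = - b t * ?y t - c t * (A (u t) \<bullet> A (v t))"
      unfolding ew using vy by (simp add: inner_add_right inner_diff_right inner_commute)
    finally have sw: "\<epsilon> * (S (v t) \<bullet> S (w t)) = - b t * ?y t - c t * (A (u t) \<bullet> A (v t))" .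
    let ?E1 = "(2 * (A (u t) \<bullet> A (v t)) + \<gamma> * (q' t * (2 * \<epsilon> * ?a t + b t * ?nn t)
        + q t * (2 * \<epsilon> * ?y t + 2 * (- b t * ?a t - c t * (norm (A (u t)))\<^sup>2) + b' t * ?nn t + 2 * b t * ?a t)))
        + (1 / c t) * (2 * (- b t * ?y t - c t * (A (u t) \<bullet> A (v t)))) + (L / (\<mu> * c t)) * \<bar>2 * ?a t\<bar> * (\<epsilon> * ?y t)"
    let ?E2 = "(norm (A (u t)))\<^sup>2 + \<gamma> * (q t * (2 * \<epsilon> * ?a t + b t * ?nn t)) + (1 / c t) * (\<epsilon> * ?y t)"
    have Ht: "2 * \<epsilon> * L * (norm (A (u t)) * norm (v t)) \<le> \<mu> * b t" using H t unfolding rate_def by blast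
    have "?E1 + \<beta> * q t * ?E2 \<le> 0"
      by (rule decay_inequality[where z="norm (v t)"])
         (use pos par nu_pos inner_le_norms S_le_A[OF inD(1)[OF t(1)]] v_le[OF t(1)] q[OF t(1)] b[OF t(1)] c_bounds Ht gm e1 e2 in simp_all)
    then have neg: "(?E1 + \<beta> * q t * ?E2) * exp (\<beta> * Q t) \<le> 0" by (rule mult_nonpos_nonneg) simp
    have gen: "x * e + y * (e * k) \<le> 0" if "(x + k * y) * e \<le> 0" for x y k e :: real
      using that by (simp add: algebra_simps)
    have E1:  "(2 * (A (u t) \<bullet> A (v t)) + \<gamma> * (q' t * (2 * \<epsilon> * ?a t + b t * ?nn t)
        + q t * (2 * \<epsilon> * (A (u t) \<bullet> w t + A (v t) \<bullet> v t) + (b' t * ?nn t + b t * (2 * ?a t)))))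
        + 1 / c t * (\<epsilon> * (2 * (S (v t) \<bullet> S (w t)))) + L / (\<mu> * c t) * \<bar>2 * ?a t\<bar> * (\<epsilon> * ?y t) = ?E1"
    proof -
      have "2 * \<epsilon> * (A (u t) \<bullet> w t + A (v t) \<bullet> v t) = 2 * \<epsilon> * ?y t + 2 * (\<epsilon> * (A (u t) \<bullet> w t))"
        unfolding vy by (simp add: distrib_left)
      moreover have "\<epsilon> * (2 * (S (v t) \<bullet> S (w t))) = 2 * (\<epsilon> * (S (v t) \<bullet> S (w t)))" by simp
      ultimately show ?thesis unfolding aw sw by (simp add: add.assoc)
    qed
    show "(2 * (A (u t) \<bullet> A (v t)) + \<gamma> * (q' t * (2 * \<epsilon> * ?a t + b t * ?nn t)
        + q t * (2 * \<epsilon> * (A (u t) \<bullet> w t + A (v t) \<bullet> v t) + (b' t * ?nn t + b t * (2 * ?a t))))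
        + 1 / c t * (\<epsilon> * (2 * (S (v t) \<bullet> S (w t)))) + L / (\<mu> * c t) * \<bar>2 * ?a t\<bar> * (\<epsilon> * ?y t)) * exp (\<beta> * Q t)
        + (?G t + 1 / c t * (\<epsilon> * ?y t)) * (exp (\<beta> * Q t) * (\<beta> * q t)) \<le> 0"
      unfolding E1 by (rule gen[OF neg])
  qed
  have q1: "0 \<le> q t" "q t \<le> 1" if "0 \<le> t" for t using q(1,2)[OF that] b(2)[OF that] by auto
  have split: "?G t + (1 / c t) * (\<epsilon> * ?y t) = F 0 j t + \<gamma> * (q t * (2 * \<epsilon> * ?a t)) + \<gamma> * (q t * b t) * ?nn t" for t
    unfolding F_0 by (simp add: algebra_simps)
  \<comment> \<open>The term with the norm of \<open>S u\<close> is nonnegative, and the cross term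
    costs at most half of \<open>F\<close>; hence the factor 2 in the result.\<close>
  have low: "F 0 j T / 2 \<le> ?G T + (1 / c T) * (\<epsilon> * ?y T)"
  proof -
    have "0 \<le> \<gamma> * (q T * b T) * ?nn T" using par q1[OF T] b(1)[OF T] by simp
    then show ?thesis unfolding split using cross_bound[OF par(2) e3 T q1[OF T], of j] by linarith
  qed
  \<comment> \<open>The cross term contributes at most half of \<open>F\<close>, rounded up to
    \<open>F\<close>, and the term with \<open>S u\<close> at most \<open>\<gamma> / \<nu>\<close>
    times \<open>F\<close>.\<close>
  have up: "?G 0 + (1 / c 0) * (\<epsilon> * ?y 0) \<le> (2 + \<gamma> / \<nu>) * F 0 j 0"
  proof -
    have z: "(0::real) \<le> 0" by simp
    have Fx: "(norm (A (u 0)))\<^sup>2 \<le> F 0 j 0" unfolding F_0 using c_bounds(3)[of 0] pos by simp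
    then have F0: "0 \<le> F 0 j 0" using zero_le_power2 order_trans by blast
    have "?nn 0 \<le> F 0 j 0 / \<nu>"
      using S_le_A[OF inD(1)[OF z]] divide_right_mono[OF Fx, of \<nu>] nu_pos by linarith
    moreover have "q 0 * b 0 \<le> 1" using q1[OF z] b(1,2)[OF z] by (simp add: mult_le_one)
    ultimately have "(q 0 * b 0) * ?nn 0 \<le> 1 * (F 0 j 0 / \<nu>)" by (intro mult_mono) auto
    then have "\<gamma> * ((q 0 * b 0) * ?nn 0) \<le> \<gamma> * (1 * (F 0 j 0 / \<nu>))" using par by (intro mult_left_mono) auto
    then have "\<gamma> * (q 0 * b 0) * ?nn 0 \<le> \<gamma> / \<nu> * F 0 j 0" by (simp add: mult_ac)
    then show ?thesis unfolding split using cross_bound[OF par(2) e3 z q1[OF z], of j] F0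
      by (simp add: distrib_right)
  qed
  have "F 0 j T / 2 * exp (\<beta> * Q T) \<le> (?G T + (1 / c T) * (\<epsilon> * ?y T)) * exp (\<beta> * Q T)"
    by (rule mult_right_mono[OF low]) simp
  also note mono
  also have "(?G 0 + (1 / c 0) * (\<epsilon> * ?y 0)) * exp (\<beta> * Q 0) = ?G 0 + (1 / c 0) * (\<epsilon> * ?y 0)"
    using Q0 by simp
  also note up
  finally have "F 0 j T / 2 * exp (\<beta> * Q T) \<le> (2 + \<gamma> / \<nu>) * F 0 j 0" .
  then have "2 * (F 0 j T / 2 * exp (\<beta> * Q T)) \<le> 2 * ((2 + \<gamma> / \<nu>) * F 0 j 0)" by (rule mult_left_mono) simp
  moreover have "2 * (F 0 j T / 2 * exp (\<beta> * Q T)) = F 0 j T * exp (\<beta> * Q T)" by simp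
  ultimately show ?thesis by (simp only: mult.assoc)
qed

text \<open>Reads the equation as a first-order one for \<open>v\<close>, forced by
  \<open>c * A u\<close>. In equilibrium \<open>v\<close> has the size of the forcing divided by
  \<open>b\<close>, which explains the weight \<open>(b T)\<^sup>2\<close>. Half of the damping
  absorbs the growth of \<open>exp (\<beta> * Q t)\<close> because
  \<open>\<beta> * \<epsilon> \<le> 1 / 2\<close>.\<close>

lemma v_decay:
  assumes T: "0 \<le> T"
    and q: "\<And>t. 0 \<le> t \<Longrightarrow> 0 < q t" "\<And>t. 0 \<le> t \<Longrightarrow> q t \<le> b t"
    and dQ: "\<And>t. 0 \<le> t \<Longrightarrow> (Q has_real_derivative q t) (at t within {0..})" and Q0: "Q 0 = 0"
    and dB: "\<And>t. 0 \<le> t \<Longrightarrow> (B has_real_derivative b t) (at t within {0..})" and B: "B 0 \<le> B T"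
    and beta: "0 \<le> \<beta>" "\<beta> * \<epsilon> \<le> 1 / 2"
    and C: "\<And>t. 0 \<le> t \<Longrightarrow> t < T \<Longrightarrow> (norm (A (u t)))\<^sup>2 * exp (\<beta> * Q t) \<le> C"
    and C0: "0 \<le> C"
  shows "(norm (v T))\<^sup>2 * (b T)\<^sup>2 * exp (\<beta> * Q T) \<le> 2 * M\<^sup>2 * C + (norm (v 0))\<^sup>2"
proof -
  \<comment> \<open>The subtracted constant is the equilibrium level of the inequality; with the
    integrating factor \<open>?f\<close> for the remaining damping rate
    \<open>b / (2 * \<epsilon>)\<close> the product does not increase.\<close>
  let ?G = "\<lambda>t. (norm (v t))\<^sup>2 * (b t)\<^sup>2 * exp (\<beta> * Q t) - 2 * M\<^sup>2 * C"
  let ?f = "\<lambda>t. exp (B t / (2 * \<epsilon>))"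
  have M0: "0 \<le> M" using c_bounds[of 0] by simp
  have "(?G T + 0 * 0) * ?f T \<le> (?G 0 + 0 * 0) * ?f 0"
  proof (rule energy_nonincreasing[OF T, where ga="?G" and gb="\<lambda>t. 0" and \<psi>="\<lambda>t. 0" and lp="\<lambda>t. 0"
      and k="\<lambda>t. 0" and \<phi>="?f" and k'="\<lambda>t. 0" and gb'="\<lambda>t. 0"])
    fix t :: real assume t: "0 \<le> t"
    show "(?G has_real_derivative (2 * (v t \<bullet> w t) * (b t)\<^sup>2 + (norm (v t))\<^sup>2 * (2 * b t * b' t)) * exp (\<beta> * Q t)
       + (norm (v t))\<^sup>2 * (b t)\<^sup>2 * (exp (\<beta> * Q t) * (\<beta> * q t))) (at t within {0..})"
    proof -
      have gen: "((\<lambda>t. f t * (b t)\<^sup>2 * exp (\<beta> * Q t) - 2 * M\<^sup>2 * C) has_real_derivative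
         (f' * (b t)\<^sup>2 + f t * (2 * b t * b' t)) * exp (\<beta> * Q t) + f t * (b t)\<^sup>2 * (exp (\<beta> * Q t) * (\<beta> * q t))) (at t within {0..})"
        if "(f has_real_derivative f') (at t within {0..})" for f f'
        by (auto intro!: derivative_eq_intros that dQ[OF t] db[OF t] simp: algebra_simps)
      show ?thesis by (rule gen[OF norm_sq_has_real_derivative[OF dv[OF t]]])
    qed
    show "(?f has_real_derivative ?f t * (b t / (2 * \<epsilon>))) (at t within {0..})"
      using pos by (auto intro!: derivative_eq_intros dB[OF t])
  next
    fix t assume t: "0 \<le> t" "t < T"
    let ?e = "exp (\<beta> * Q t)" and ?z = "norm (v t)" and ?x = "norm (A (u t))"
    have bt: "0 < b t" "b t \<le> 1" "b' t \<le> 0" by (rule b[OF t(1)])+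
    have ew: "\<epsilon> *\<^sub>R w t = - (b t *\<^sub>R v t + c t *\<^sub>R A (u t))"
      using eq[OF t(1)] unfolding c_def by (simp only: add.assoc eq_neg_iff_add_eq_0)
    have "\<epsilon> * (v t \<bullet> w t) = v t \<bullet> (\<epsilon> *\<^sub>R w t)" by simp
    also have "\<dots> = - b t * ?z\<^sup>2 - c t * (v t \<bullet> A (u t))"
      unfolding ew by (simp add: inner_add_right inner_diff_right power2_norm_eq_inner)
    also have "\<dots> \<le> - b t * ?z\<^sup>2 + M * (?z * ?x)"
    proof -
      have "- (c t * (v t \<bullet> A (u t))) \<le> \<bar>c t\<bar> * \<bar>v t \<bullet> A (u t)\<bar>" by (metis abs_ge_minus_self abs_mult)
      also have "\<dots> \<le> M * (?z * ?x)" using c_bounds[of t] by (intro mult_mono inner_le_norms) auto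
      finally show ?thesis by simp
    qed
    also have "M * (?z * ?x) \<le> b t * ?z\<^sup>2 / 2 + M\<^sup>2 * ?x\<^sup>2 / (2 * b t)"
    proof -
      have "0 \<le> (b t * ?z - M * ?x)\<^sup>2 / (2 * b t)" using bt by simp
      also have "\<dots> = b t * ?z\<^sup>2 / 2 + M\<^sup>2 * ?x\<^sup>2 / (2 * b t) - M * (?z * ?x)"
        using bt by (simp add: power2_eq_square field_simps)
      finally show ?thesis by simp
    qed
    finally have vw: "\<epsilon> * (v t \<bullet> w t) \<le> - b t * ?z\<^sup>2 / 2 + M\<^sup>2 * ?x\<^sup>2 / (2 * b t)" by simp
    have "2 * (\<epsilon> * (v t \<bullet> w t)) * ((b t)\<^sup>2 * ?e) \<le> 2 * (- b t * ?z\<^sup>2 / 2 + M\<^sup>2 * ?x\<^sup>2 / (2 * b t)) * ((b t)\<^sup>2 * ?e)"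
      using vw by (intro mult_right_mono mult_left_mono) auto
    also have "\<dots> = - b t * (?z\<^sup>2 * (b t)\<^sup>2 * ?e) + b t * (M\<^sup>2 * (?x\<^sup>2 * ?e))"
      using bt by (simp add: power2_eq_square field_simps)
    also have "b t * (M\<^sup>2 * (?x\<^sup>2 * ?e)) \<le> b t * (M\<^sup>2 * C)"
      using bt C[OF t] by (intro mult_left_mono) auto
    finally have 1: "2 * (\<epsilon> * (v t \<bullet> w t)) * ((b t)\<^sup>2 * ?e) \<le> - b t * (?z\<^sup>2 * (b t)\<^sup>2 * ?e) + b t * (M\<^sup>2 * C)" by simp
    have 2: "\<epsilon> * (?z\<^sup>2 * (2 * b t * b' t) * ?e) \<le> 0"
      using bt pos by (intro mult_nonneg_nonpos mult_nonpos_nonneg) (auto intro!: mult_nonneg_nonpos)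
    have 3: "\<epsilon> * (?z\<^sup>2 * (b t)\<^sup>2 * (?e * (\<beta> * q t))) \<le> b t / 2 * (?z\<^sup>2 * (b t)\<^sup>2 * ?e)"
    proof -
      have "(\<beta> * \<epsilon>) * q t \<le> 1 / 2 * b t" using beta q[OF t(1)] pos by (intro mult_mono) auto
      then have "((\<beta> * \<epsilon>) * q t) * (?z\<^sup>2 * (b t)\<^sup>2 * ?e) \<le> (1 / 2 * b t) * (?z\<^sup>2 * (b t)\<^sup>2 * ?e)"
        by (rule mult_right_mono) simp
      then show ?thesis by (simp add: mult_ac)
    qed
    let ?D = "(2 * (v t \<bullet> w t) * (b t)\<^sup>2 + ?z\<^sup>2 * (2 * b t * b' t)) * ?e + ?z\<^sup>2 * (b t)\<^sup>2 * (?e * (\<beta> * q t))"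
    have "\<epsilon> * ?D = 2 * (\<epsilon> * (v t \<bullet> w t)) * ((b t)\<^sup>2 * ?e) + \<epsilon> * (?z\<^sup>2 * (2 * b t * b' t) * ?e)
       + \<epsilon> * (?z\<^sup>2 * (b t)\<^sup>2 * (?e * (\<beta> * q t)))"
      by (simp add: distrib_left distrib_right mult_ac)
    moreover have "b t / 2 * ?G t = b t / 2 * (?z\<^sup>2 * (b t)\<^sup>2 * ?e) - b t * (M\<^sup>2 * C)"
      by (simp add: right_diff_distrib)
    ultimately have "\<epsilon> * ?D + b t / 2 * ?G t \<le> 0" using 1 2 3 by linarith
    then have "(\<epsilon> * ?D + b t / 2 * ?G t) / \<epsilon> \<le> 0" using pos by (simp add: divide_le_0_iff)
    moreover have "(\<epsilon> * ?D + b t / 2 * ?G t) / \<epsilon> = ?D + b t / (2 * \<epsilon>) * ?G t"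
      using pos by (simp add: add_divide_distrib)
    ultimately have "(?D + b t / (2 * \<epsilon>) * ?G t) * ?f t \<le> 0" by (intro mult_nonpos_nonneg) auto
    then show "(?D + 0 * 0 + 0 * \<bar>0\<bar> * 0) * ?f t + (?G t + 0 * 0) * (?f t * (b t / (2 * \<epsilon>))) \<le> 0"
      by (simp add: algebra_simps)
  qed auto
  then have le: "?G T * ?f T \<le> ?G 0 * ?f 0" by simp
  \<comment> \<open>The integrating factor has increased, so it may be dropped if
    \<open>?G T\<close> is positive; otherwise the claim is immediate.\<close>
  have "?G T \<le> (norm (v 0))\<^sup>2"
  proof (cases "?G T \<le> 0")
    case True
    then show ?thesis using zero_le_power2 order_trans by blast
  next
    case False
    have z: "(0::real) \<le> 0" by simp
    have ff: "?f 0 \<le> ?f T" using B pos by (simp add: divide_right_mono)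
    have "?G T * ?f 0 \<le> ?G T * ?f T" using False ff by (intro mult_left_mono) auto
    also note le
    finally have "?G T \<le> ?G 0" by simp
    also have "\<dots> \<le> (norm (v 0))\<^sup>2 * (b 0)\<^sup>2" using C0 Q0 by simp
    also have "\<dots> \<le> (norm (v 0))\<^sup>2 * 1"
      using b(1,2)[OF z] by (intro mult_left_mono) (auto simp: power_le_one)
    finally show ?thesis by simp
  qed
  then show ?thesis by simp
qed

end

section \<open>Continuous dependence on the initial data\<close>

context coercive_sqrt begin

text \<open>Gronwall's argument for the energy of the difference with the coefficient taken along
  \<open>u1\<close>. The bounds on \<open>m\<close> are asked only on \<open>[0, r\<^sup>2]\<close>,
  so the estimate serves both the convergence of truncated solutions and uniqueness for the original
  \<open>m\<close>.\<close>

lemma difference_estimate: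
  fixes b m :: "real \<Rightarrow> real" and u1 v1 w1 u2 v2 w2 :: "real \<Rightarrow> 'h"
  assumes T: "0 \<le> T" and pos: "0 < \<epsilon>" "0 < \<mu>" "0 \<le> L" "0 \<le> r" "0 \<le> K" and b: "\<And>t. 0 \<le> t \<Longrightarrow> 0 \<le> b t"
    and mu: "\<And>\<sigma>. 0 \<le> \<sigma> \<Longrightarrow> \<sigma> \<le> r\<^sup>2 \<Longrightarrow> \<mu> \<le> m \<sigma>"
    and mL: "\<And>\<sigma> \<tau>. 0 \<le> \<sigma> \<Longrightarrow> \<sigma> \<le> r\<^sup>2 \<Longrightarrow> 0 \<le> \<tau> \<Longrightarrow> \<tau> \<le> r\<^sup>2 \<Longrightarrow> \<bar>m \<sigma> - m \<tau>\<bar> \<le> L * \<bar>\<sigma> - \<tau>\<bar>"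
    and D: "\<And>t. 0 \<le> t \<Longrightarrow> u1 t \<in> D" "\<And>t. 0 \<le> t \<Longrightarrow> u2 t \<in> D" "\<And>t. 0 \<le> t \<Longrightarrow> v1 t \<in> DS" "\<And>t. 0 \<le> t \<Longrightarrow> v2 t \<in> DS"
    and dS: "\<And>t. 0 \<le> t \<Longrightarrow> ((\<lambda>t. S (u1 t)) has_vector_derivative S (v1 t)) (at t within {0..})"
      "\<And>t. 0 \<le> t \<Longrightarrow> ((\<lambda>t. S (u2 t)) has_vector_derivative S (v2 t)) (at t within {0..})"
    and dv: "\<And>t. 0 \<le> t \<Longrightarrow> (v1 has_vector_derivative w1 t) (at t within {0..})"
      "\<And>t. 0 \<le> t \<Longrightarrow> (v2 has_vector_derivative w2 t) (at t within {0..})"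
    and eq: "\<And>t. 0 \<le> t \<Longrightarrow> \<epsilon> *\<^sub>R w1 t + b t *\<^sub>R v1 t + m ((norm (S (u1 t)))\<^sup>2) *\<^sub>R A (u1 t) = 0"
      "\<And>t. 0 \<le> t \<Longrightarrow> \<epsilon> *\<^sub>R w2 t + b t *\<^sub>R v2 t + m ((norm (S (u2 t)))\<^sup>2) *\<^sub>R A (u2 t) = 0"
    and r: "\<And>t. 0 \<le> t \<Longrightarrow> t \<le> T \<Longrightarrow> norm (S (u1 t)) \<le> r" "\<And>t. 0 \<le> t \<Longrightarrow> t \<le> T \<Longrightarrow> norm (S (u2 t)) \<le> r"
    and K: "\<And>t. 0 \<le> t \<Longrightarrow> t \<le> T \<Longrightarrow> norm (A (u1 t)) \<le> K" "\<And>t. 0 \<le> t \<Longrightarrow> t \<le> T \<Longrightarrow> norm (A (u2 t)) \<le> K"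
      "\<And>t. 0 \<le> t \<Longrightarrow> t \<le> T \<Longrightarrow> norm (v1 t) \<le> K"
  shows "\<epsilon> * (norm (v1 T - v2 T))\<^sup>2 + \<mu> * (norm (S (u1 T) - S (u2 T)))\<^sup>2
    \<le> exp ((2 * L * r * K + 2 * L * K\<^sup>2) * (1 / \<epsilon> + 1 / \<mu>) * T)
       * (\<epsilon> * (norm (v1 0 - v2 0))\<^sup>2 + m ((norm (S (u1 0)))\<^sup>2) * (norm (S (u1 0) - S (u2 0)))\<^sup>2)"
proof -
  define k1 where "k1 t = (norm (S (u1 t)))\<^sup>2" for t
  define k2 where "k2 t = (norm (S (u2 t)))\<^sup>2" for t
  let ?c = "\<lambda>t. m (k1 t)"
  let ?z = "\<lambda>t. v1 t - v2 t" and ?s = "\<lambda>t. S (u1 t) - S (u2 t)"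
  \<comment> \<open>The summand with \<open>r\<close> comes from the difference of the two
    coefficients, the other from the variation of \<open>m (k1 t)\<close>; the last factor converts
    plain squared norms into the energy.\<close>
  define \<kappa> where "\<kappa> = (2 * L * r * K + 2 * L * K\<^sup>2) * (1 / \<epsilon> + 1 / \<mu>)"
  have kr: "0 \<le> k1 t" "k1 t \<le> r\<^sup>2" "0 \<le> k2 t" "k2 t \<le> r\<^sup>2" if "0 \<le> t" "t \<le> T" for t
    using r[OF that] by (auto simp: k1_def k2_def intro!: power_mono)
  have dk: "(k1 has_real_derivative 2 * (A (u1 t) \<bullet> v1 t)) (at t within {0..})" if "0 \<le> t" for t
    using norm_sq_has_real_derivative[OF dS(1)[OF that]] unfolding A_inner[OF D(1,3)[OF that]] k1_def[abs_def] .
  have "continuous_on {0..} k1"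
    unfolding continuous_on_eq_continuous_within using DERIV_continuous[OF dk] by auto
  then have k1c: "continuous_on {0..T} k1" by (rule continuous_on_subset) auto
  have mc: "continuous_on {0..r\<^sup>2} m"
  proof -
    have "L-lipschitz_on {0..r\<^sup>2} m" by (rule lipschitz_onI) (use mL pos in \<open>auto simp: dist_real_def\<close>)
    then show ?thesis by (rule lipschitz_on_continuous_on)
  qed
  have main: "(\<epsilon> * (norm (?z T))\<^sup>2 + ?c T * (norm (?s T))\<^sup>2) * exp (- \<kappa> * T)
     \<le> (\<epsilon> * (norm (?z 0))\<^sup>2 + ?c 0 * (norm (?s 0))\<^sup>2) * exp (- \<kappa> * 0)"
  proof (rule energy_nonincreasing[OF T, where k=k1 and lp="\<lambda>t. L" and \<phi>="\<lambda>t. exp (- \<kappa> * t)"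
      and ga="\<lambda>t. \<epsilon> * (norm (?z t))\<^sup>2" and gb="\<lambda>t. (norm (?s t))\<^sup>2" and \<psi>="?c"])
    fix t :: real assume t: "0 \<le> t"
    show "((\<lambda>t. \<epsilon> * (norm (?z t))\<^sup>2) has_real_derivative \<epsilon> * (2 * (?z t \<bullet> (w1 t - w2 t)))) (at t within {0..})"
      by (rule DERIV_cmult[OF norm_sq_has_real_derivative[OF has_vector_derivative_diff[OF dv(1)[OF t] dv(2)[OF t]]]])
    show "((\<lambda>t. (norm (?s t))\<^sup>2) has_real_derivative 2 * (?s t \<bullet> (S (v1 t) - S (v2 t)))) (at t within {0..})"
      by (rule norm_sq_has_real_derivative[OF has_vector_derivative_diff[OF dS(1)[OF t] dS(2)[OF t]]])
    show "(k1 has_real_derivative 2 * (A (u1 t) \<bullet> v1 t)) (at t within {0..})" by (rule dk[OF t])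
    show "((\<lambda>t. exp (- \<kappa> * t)) has_real_derivative exp (- \<kappa> * t) * (- \<kappa>)) (at t within {0..})"
      by (auto intro!: derivative_eq_intros)
    show "0 \<le> (norm (?s t))\<^sup>2" by simp
    show "0 < exp (- \<kappa> * t)" by simp
    fix s assume s: "t \<le> s" "s \<le> T"
    then have ts: "0 \<le> s" "t \<le> T" using t by auto
    have "\<bar>m (k1 s) - m (k1 t)\<bar> \<le> L * \<bar>k1 s - k1 t\<bar>" using kr ts t s by (intro mL) auto
    then show "m (k1 s) \<le> m (k1 t) + L * \<bar>k1 s - k1 t\<bar>" by linarith
  next
    show "continuous_on {0..T} ?c"
      by (rule continuous_on_compose2[OF mc k1c]) (use kr in auto)
  next
    fix t assume t: "0 \<le> t" "t < T"
    then have tT: "t \<le> T" by simp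
    let ?x = "u1 t - u2 t"
    have xD: "?x \<in> D" "A ?x = A (u1 t) - A (u2 t)" by (rule A_diff[OF D(1,2)[OF t(1)]])+
    have zD: "?z t \<in> DS" "S (?z t) = S (v1 t) - S (v2 t)" by (rule S_diff[OF D(3,4)[OF t(1)]])+
    have Sx: "S ?x = ?s t" by (rule S_diff(2)[OF DDS[OF D(1)[OF t(1)]] DDS[OF D(2)[OF t(1)]]])
    let ?n = "norm (?s t)" and ?nz = "norm (?z t)"
    have ew12: "\<epsilon> *\<^sub>R w1 t = - (b t *\<^sub>R v1 t + ?c t *\<^sub>R A (u1 t))" "\<epsilon> *\<^sub>R w2 t = - (b t *\<^sub>R v2 t + m (k2 t) *\<^sub>R A (u2 t))"
      using eq[OF t(1)] unfolding k1_def k2_def by (simp_all only: add.assoc eq_neg_iff_add_eq_0)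
    \<comment> \<open>Subtracting the equations with the coefficient of \<open>u1\<close> in front
      of the difference leaves an error that multiplies \<open>A (u2 t)\<close>, hence the bound
      \<open>K\<close> on it.\<close>
    have ew: "\<epsilon> *\<^sub>R (w1 t - w2 t) = - (b t *\<^sub>R ?z t) - ?c t *\<^sub>R A ?x - (?c t - m (k2 t)) *\<^sub>R A (u2 t)"
      unfolding xD(2) scaleR_diff_right ew12 by (simp add: algebra_simps)
    have "\<epsilon> * (?z t \<bullet> (w1 t - w2 t)) = ?z t \<bullet> (\<epsilon> *\<^sub>R (w1 t - w2 t))" by simp
    also have "\<dots> = - b t * ?nz\<^sup>2 - ?c t * (A ?x \<bullet> ?z t) - (?c t - m (k2 t)) * (?z t \<bullet> A (u2 t))"
      unfolding ew by (simp add: inner_diff_right power2_norm_eq_inner inner_commute)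
    also have "A ?x \<bullet> ?z t = ?s t \<bullet> (S (v1 t) - S (v2 t))"
      unfolding A_inner[OF xD(1) zD(1)] Sx zD(2) ..
    finally have e1: "\<epsilon> * (?z t \<bullet> (w1 t - w2 t)) + ?c t * (?s t \<bullet> (S (v1 t) - S (v2 t)))
       = - b t * ?nz\<^sup>2 - (?c t - m (k2 t)) * (?z t \<bullet> A (u2 t))" by simp
    have "\<bar>?c t - m (k2 t)\<bar> \<le> L * \<bar>k1 t - k2 t\<bar>" using kr[OF t(1) tT] by (intro mL)
    also have "\<bar>k1 t - k2 t\<bar> = \<bar>norm (S (u1 t)) - norm (S (u2 t))\<bar> * (norm (S (u1 t)) + norm (S (u2 t)))"
      unfolding k1_def k2_def by (simp add: power2_eq_square square_diff_square_factored abs_mult)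
    also have "\<dots> \<le> ?n * (r + r)"
      using r[OF t(1) tT] by (intro mult_mono add_mono norm_triangle_ineq3) auto
    finally have dc: "\<bar>?c t - m (k2 t)\<bar> \<le> L * (?n * (r + r))" using pos by (simp add: mult_left_mono)
    have "- ((?c t - m (k2 t)) * (?z t \<bullet> A (u2 t))) \<le> \<bar>?c t - m (k2 t)\<bar> * \<bar>?z t \<bullet> A (u2 t)\<bar>"
      by (metis abs_ge_minus_self abs_mult)
    also have "\<dots> \<le> (L * (?n * (r + r))) * (?nz * K)"
    proof (rule mult_mono[OF dc])
      show "\<bar>?z t \<bullet> A (u2 t)\<bar> \<le> ?nz * K"
        by (rule order_trans[OF inner_le_norms mult_left_mono[OF K(2)[OF t(1) tT]]]) simp
    qed (use pos in auto)
    also have "\<dots> = (L * r * K) * (2 * ?n * ?nz)" by simp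
    also have "\<dots> \<le> (L * r * K) * (?n\<^sup>2 + ?nz\<^sup>2)"
      using pos sum_squares_bound[of ?n ?nz] by (intro mult_left_mono) auto
    finally have e2: "- ((?c t - m (k2 t)) * (?z t \<bullet> A (u2 t))) \<le> (L * r * K) * (?n\<^sup>2 + ?nz\<^sup>2)" .
    have "\<bar>A (u1 t) \<bullet> v1 t\<bar> \<le> K * K"
      using K(1,3)[OF t(1) tT] pos by (intro order_trans[OF inner_le_norms] mult_mono) auto
    then have "L * \<bar>A (u1 t) \<bullet> v1 t\<bar> \<le> L * (K * K)" using pos by (intro mult_left_mono) auto
    then have "L * \<bar>2 * (A (u1 t) \<bullet> v1 t)\<bar> \<le> 2 * L * K\<^sup>2" by (simp add: abs_mult power2_eq_square mult_ac)
    then have e3: "L * \<bar>2 * (A (u1 t) \<bullet> v1 t)\<bar> * ?n\<^sup>2 \<le> 2 * L * K\<^sup>2 * ?n\<^sup>2"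
      by (intro mult_right_mono) auto
    have b0: "0 \<le> b t * ?nz\<^sup>2" using b[OF t(1)] by simp
    have c: "\<mu> \<le> ?c t" using kr[OF t(1) tT] by (intro mu)
    let ?R = "2 * L * r * K + 2 * L * K\<^sup>2"
    have R0: "0 \<le> ?R" using pos by simp
    have lhs: "\<epsilon> * (2 * (?z t \<bullet> (w1 t - w2 t))) + ?c t * (2 * (?s t \<bullet> (S (v1 t) - S (v2 t)))) + L * \<bar>2 * (A (u1 t) \<bullet> v1 t)\<bar> * ?n\<^sup>2
        \<le> ?R * (?nz\<^sup>2 + ?n\<^sup>2)"
    proof -
      have "0 \<le> 2 * L * K\<^sup>2 * ?nz\<^sup>2" using pos by simp
      then show ?thesis using e1 e2 e3 b0 by (simp add: algebra_simps)
    qed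
    also have "\<dots> \<le> \<kappa> * (\<epsilon> * ?nz\<^sup>2 + ?c t * ?n\<^sup>2)"
    proof -
      have "?nz\<^sup>2 + ?n\<^sup>2 = (1 / \<epsilon>) * (\<epsilon> * ?nz\<^sup>2) + (1 / \<mu>) * (\<mu> * ?n\<^sup>2)" using pos by simp
      also have "\<dots> \<le> (1 / \<epsilon> + 1 / \<mu>) * (\<epsilon> * ?nz\<^sup>2) + (1 / \<epsilon> + 1 / \<mu>) * (?c t * ?n\<^sup>2)"
        using pos c by (intro add_mono mult_mono mult_right_mono) auto
      finally have "?nz\<^sup>2 + ?n\<^sup>2 \<le> (1 / \<epsilon> + 1 / \<mu>) * (\<epsilon> * ?nz\<^sup>2 + ?c t * ?n\<^sup>2)" by (simp add: distrib_left)
      then have "?R * (?nz\<^sup>2 + ?n\<^sup>2) \<le> ?R * ((1 / \<epsilon> + 1 / \<mu>) * (\<epsilon> * ?nz\<^sup>2 + ?c t * ?n\<^sup>2))"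
        using R0 by (rule mult_left_mono)
      then show ?thesis by (simp only: \<kappa>_def mult.assoc)
    qed
    finally have "(\<epsilon> * (2 * (?z t \<bullet> (w1 t - w2 t))) + ?c t * (2 * (?s t \<bullet> (S (v1 t) - S (v2 t)))) + L * \<bar>2 * (A (u1 t) \<bullet> v1 t)\<bar> * ?n\<^sup>2
       - \<kappa> * (\<epsilon> * ?nz\<^sup>2 + ?c t * ?n\<^sup>2)) * exp (- \<kappa> * t) \<le> 0" by (intro mult_nonpos_nonneg) auto
    then show "(\<epsilon> * (2 * (?z t \<bullet> (w1 t - w2 t))) + ?c t * (2 * (?s t \<bullet> (S (v1 t) - S (v2 t)))) + L * \<bar>2 * (A (u1 t) \<bullet> v1 t)\<bar> * ?n\<^sup>2) * exp (- \<kappa> * t)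
       + (\<epsilon> * ?nz\<^sup>2 + ?c t * ?n\<^sup>2) * (exp (- \<kappa> * t) * - \<kappa>) \<le> 0" by (simp add: algebra_simps)
  qed
  have "\<mu> * (norm (?s T))\<^sup>2 \<le> ?c T * (norm (?s T))\<^sup>2"
    using kr[OF T order_refl] by (intro mult_right_mono mu) auto
  then have "\<epsilon> * (norm (?z T))\<^sup>2 + \<mu> * (norm (?s T))\<^sup>2
     \<le> exp (\<kappa> * T) * ((\<epsilon> * (norm (?z T))\<^sup>2 + ?c T * (norm (?s T))\<^sup>2) * exp (- \<kappa> * T))"
    by (simp add: exp_minus field_simps)
  also have "\<dots> \<le> exp (\<kappa> * T) * ((\<epsilon> * (norm (?z 0))\<^sup>2 + ?c 0 * (norm (?s 0))\<^sup>2) * exp (- \<kappa> * 0))"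
    by (rule mult_left_mono[OF main]) simp
  finally show ?thesis unfolding \<kappa>_def k1_def by simp
qed

end

section \<open>Existence of spectrally truncated solutions\<close>

context coercive_sqrt begin

text \<open>The product of a Lipschitz coefficient with an unbounded linear term is globally
  Lipschitz because \<open>m\<close> is constant beyond \<open>R\<^sup>2\<close>. With
  \<open>y\<close> the argument of smaller \<open>S\<close>-norm, the coefficients can differ only
  if that norm is below \<open>R\<close>, and then \<open>A (P n y)\<close> is bounded.\<close>

lemma truncated_nonlinearity_lipschitz:
  assumes m: "\<And>\<sigma>. \<bar>m \<sigma>\<bar> \<le> M" and mL: "\<And>\<sigma> \<tau>. \<bar>m \<sigma> - m \<tau>\<bar> \<le> L * \<bar>\<sigma> - \<tau>\<bar>" and L: "0 \<le> L"
    and mR: "\<And>\<sigma>. R\<^sup>2 \<le> \<sigma> \<Longrightarrow> m \<sigma> = m (R\<^sup>2)" and R: "0 \<le> R"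
  shows "\<exists>K\<ge>0. \<forall>x y. norm (m ((norm (S (P n x)))\<^sup>2) *\<^sub>R A (P n x) - m ((norm (S (P n y)))\<^sup>2) *\<^sub>R A (P n y)) \<le> K * norm (x - y)"
proof -
  obtain a where a: "\<And>x. norm (A (P n x)) \<le> norm x * a" and a0: "0 \<le> a"
    using bounded_linear.nonneg_bounded[OF AP_bl] by blast
  obtain s where s: "\<And>x. norm (S (P n x)) \<le> norm x * s" and s0: "0 \<le> s"
    using bounded_linear.nonneg_bounded[OF SP_bl] by blast
  have M0: "0 \<le> M" using m[of 0] by simp
  define K where "K = M * a + 2 * L * R * s * (R * s)"
  have K0: "0 \<le> K" using M0 a0 s0 L R by (simp add: K_def)
  \<comment> \<open>Since \<open>S\<close> commutes with \<open>P n\<close>, \<open>A\<close> is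
    \<open>S\<close> applied twice within the range of \<open>P n\<close>, so a bound on
    \<open>S (P n y)\<close> bounds \<open>A (P n y)\<close>.\<close>
  have AS: "norm (A (P n y)) \<le> norm (S (P n y)) * s" for y
  proof -
    have "A (P n y) = S (P n (S (P n y)))"
      using SP[OF subsetD[OF D_DS P_D], of n n y] by (simp add: P_P SSP)
    then show ?thesis using s[of "S (P n y)"] by simp
  qed
  have *: "norm (m ((norm (S (P n x)))\<^sup>2) *\<^sub>R A (P n x) - m ((norm (S (P n y)))\<^sup>2) *\<^sub>R A (P n y)) \<le> K * norm (x - y)"
    if le: "norm (S (P n y)) \<le> norm (S (P n x))" for x y
  proof -
    let ?mx = "m ((norm (S (P n x)))\<^sup>2)" and ?my = "m ((norm (S (P n y)))\<^sup>2)"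
    have Ad: "A (P n x) - A (P n y) = A (P n (x - y))"
      using linear_diff[OF bounded_linear.linear[OF AP_bl[of n]], of x y] by simp
    have Sd: "S (P n x) - S (P n y) = S (P n (x - y))"
      using linear_diff[OF bounded_linear.linear[OF SP_bl[of n]], of x y] by simp
    have "?mx *\<^sub>R A (P n x) - ?my *\<^sub>R A (P n y) = ?mx *\<^sub>R A (P n (x - y)) + (?mx - ?my) *\<^sub>R A (P n y)"
      unfolding Ad[symmetric] by (simp add: algebra_simps)
    then have "norm (?mx *\<^sub>R A (P n x) - ?my *\<^sub>R A (P n y)) \<le> \<bar>?mx\<bar> * norm (A (P n (x - y))) + \<bar>?mx - ?my\<bar> * norm (A (P n y))"
      using norm_triangle_ineq[of "?mx *\<^sub>R A (P n (x - y))" "(?mx - ?my) *\<^sub>R A (P n y)"] by simp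
    also have "\<bar>?mx\<bar> * norm (A (P n (x - y))) \<le> M * (norm (x - y) * a)"
      using m a M0 by (intro mult_mono) auto
    also have "\<bar>?mx - ?my\<bar> * norm (A (P n y)) \<le> 2 * L * R * s * (R * s) * norm (x - y)"
    proof (cases "R \<le> norm (S (P n y))")
      case True
      then have "R\<^sup>2 \<le> (norm (S (P n y)))\<^sup>2" "R\<^sup>2 \<le> (norm (S (P n x)))\<^sup>2" using le R by (auto intro!: power_mono)
      then have "?mx = ?my" by (rule trans[OF mR[OF _] sym[OF mR], rotated])
      then show ?thesis using L R s0 by simp
    next
      case False
      \<comment> \<open>Cutting the larger norm at \<open>R\<close> does not change the coefficient
        and makes the difference of squares linear in \<open>x - y\<close>.\<close>
      define \<xi> where "\<xi> = min (norm (S (P n x))) R"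
      have xi: "0 \<le> \<xi>" "\<xi> \<le> R" "norm (S (P n y)) \<le> \<xi>" "\<xi> \<le> norm (S (P n x))" using R le False by (auto simp: \<xi>_def)
      have "?mx = m (\<xi>\<^sup>2)"
      proof (cases "norm (S (P n x)) \<le> R")
        case True then show ?thesis by (simp add: \<xi>_def)
      next
        case F: False
        then have "R\<^sup>2 \<le> (norm (S (P n x)))\<^sup>2" using R by (intro power_mono) auto
        from mR[OF this] have "?mx = m (R\<^sup>2)" .
        moreover have "\<xi> = R" using F by (simp add: \<xi>_def)
        ultimately show ?thesis by simp
      qed
      then have "\<bar>?mx - ?my\<bar> \<le> L * \<bar>\<xi>\<^sup>2 - (norm (S (P n y)))\<^sup>2\<bar>" using mL by simp
      also have "\<bar>\<xi>\<^sup>2 - (norm (S (P n y)))\<^sup>2\<bar> = (\<xi> - norm (S (P n y))) * (\<xi> + norm (S (P n y)))"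
        using xi by (simp add: power2_eq_square square_diff_square_factored mult.commute abs_mult)
      also have "\<dots> \<le> norm (S (P n (x - y))) * (R + R)"
      proof (intro mult_mono add_mono)
        show "\<xi> - norm (S (P n y)) \<le> norm (S (P n (x - y)))"
          using xi norm_triangle_ineq2[of "S (P n x)" "S (P n y)"] unfolding Sd by linarith
      qed (use xi R False in auto)
      also have "\<dots> \<le> (norm (x - y) * s) * (R + R)" using s R by (intro mult_right_mono) auto
      finally have d: "\<bar>?mx - ?my\<bar> \<le> L * ((norm (x - y) * s) * (R + R))" using L by (simp add: mult_left_mono)
      have "norm (A (P n y)) \<le> R * s" using AS[of y] mult_right_mono[of "norm (S (P n y))" R s] False s0 by linarith
      then have "\<bar>?mx - ?my\<bar> * norm (A (P n y)) \<le> (L * ((norm (x - y) * s) * (R + R))) * (R * s)"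
        by (intro mult_mono d) (use L R s0 in auto)
      then show ?thesis by (simp add: mult_ac)
    qed
    finally show ?thesis by (simp add: K_def algebra_simps)
  qed
  show ?thesis
  proof (intro exI[of _ K] conjI allI K0)
    fix x y
    show "norm (m ((norm (S (P n x)))\<^sup>2) *\<^sub>R A (P n x) - m ((norm (S (P n y)))\<^sup>2) *\<^sub>R A (P n y)) \<le> K * norm (x - y)"
    proof (cases "norm (S (P n y)) \<le> norm (S (P n x))")
      case True then show ?thesis by (rule *)
    next
      case False
      then have "norm (m ((norm (S (P n y)))\<^sup>2) *\<^sub>R A (P n y) - m ((norm (S (P n x)))\<^sup>2) *\<^sub>R A (P n x)) \<le> K * norm (y - x)"
        by (intro *) simp
      then show ?thesis by (simp add: norm_minus_commute)
    qed
  qed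
qed

text \<open>Inserting \<open>P n\<close> makes the first-order system globally Lipschitz on the
  product space. Its solution is in the range of \<open>P n\<close> because the vector field and the
  initial data are.\<close>

theorem truncated_solution_exists:
  assumes m: "\<And>\<sigma>. \<mu> \<le> m \<sigma>" "\<And>\<sigma>. m \<sigma> \<le> M" and mL: "\<And>\<sigma> \<tau>. \<bar>m \<sigma> - m \<tau>\<bar> \<le> L * \<bar>\<sigma> - \<tau>\<bar>"
    and pos: "0 < \<mu>" "0 \<le> L" "0 < \<epsilon>"
    and mR: "\<And>\<sigma>. R\<^sup>2 \<le> \<sigma> \<Longrightarrow> m \<sigma> = m (R\<^sup>2)" and R: "0 \<le> R"
    and b: "\<And>t. 0 \<le> t \<Longrightarrow> 0 < b t" "\<And>t. 0 \<le> t \<Longrightarrow> b t \<le> 1" "\<And>t. 0 \<le> t \<Longrightarrow> b' t \<le> 0"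
    and db: "\<And>t. 0 \<le> t \<Longrightarrow> (b has_real_derivative b' t) (at t within {0..})"
  shows "\<exists>u v w. truncated_solution D DS A S P \<nu> n m \<mu> M L \<epsilon> b b' u v w \<and> u 0 = P n u0 \<and> v 0 = P n v0"
proof -
  have mabs: "\<bar>m \<sigma>\<bar> \<le> M" for \<sigma> using m[of \<sigma>] pos by simp
  define f where "f x = m ((norm (S (P n x)))\<^sup>2) *\<^sub>R A (P n x)" for x
  obtain K where K: "0 \<le> K" "\<And>x y. norm (f x - f y) \<le> K * norm (x - y)"
    using truncated_nonlinearity_lipschitz[OF mabs mL pos(2) mR R, of n] unfolding f_def by blast
  define G where "G t z = (P n (snd z), (- 1 / \<epsilon>) *\<^sub>R (b t *\<^sub>R P n (snd z) + f (fst z)))" for t and z :: "'h \<times> 'h"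
  have fK: "K-lipschitz_on UNIV f" by (rule lipschitz_onI) (use K in \<open>auto simp: dist_norm\<close>)
  have fc: "continuous_on UNIV f" by (rule lipschitz_on_continuous_on[OF fK])
  have bc: "continuous_on {0..} b" unfolding continuous_on_eq_continuous_within using DERIV_continuous[OF db] by auto
  have Pd: "P n x - P n y = P n (x - y)" for x y using linear_diff[OF P_linear] by simp
  have f0: "f 0 = 0" using linear_0[OF bounded_linear.linear[OF AP_bl[of n]]] by (simp add: f_def)
  have "\<exists>z. z 0 = (P n u0, P n v0) \<and> (\<forall>t\<ge>0. (z has_vector_derivative G t (z t)) (at t within {0..}))"
  proof (rule picard_lindelof_global[where ?g0.0=0 and \<Lambda>="1 + (1 + K) / \<epsilon>"])
    have "continuous_on ({0..} \<times> UNIV) (\<lambda>z. f (fst (snd z)))"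
      by (rule continuous_on_compose2[OF fc]) (auto intro!: continuous_intros)
    moreover have "continuous_on ({0..} \<times> UNIV) (\<lambda>z. b (fst z))"
      by (rule continuous_on_compose2[OF bc]) (auto intro!: continuous_intros)
    ultimately show "continuous_on ({0..} \<times> UNIV) (\<lambda>(t, z). G t z)"
      unfolding G_def case_prod_beta'
      by (intro continuous_intros bounded_linear.continuous_on[OF P_bl])
    show "0 < 1 + (1 + K) / \<epsilon>" using K pos by (simp add: add_pos_nonneg)
    fix t :: real assume t: "0 \<le> t"
    show "norm (G t 0) \<le> 0" by (simp add: G_def f0 linear_0[OF P_linear] zero_prod_def)
    fix x y :: "'h \<times> 'h"
    have nz: "norm (fst x - fst y) \<le> norm (x - y)" "norm (snd x - snd y) \<le> norm (x - y)"
      using norm_fst_le[of "fst (x - y)" "snd (x - y)"] norm_snd_le[of "snd (x - y)" "fst (x - y)"]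
      unfolding prod.collapse by (simp_all only: fst_diff snd_diff)
    have p: "norm (P n (snd x) - P n (snd y)) \<le> norm (x - y)"
      unfolding Pd by (rule order_trans[OF P_norm nz(2)])
    have "G t x - G t y = (P n (snd x) - P n (snd y), (- 1 / \<epsilon>) *\<^sub>R (b t *\<^sub>R (P n (snd x) - P n (snd y)) + (f (fst x) - f (fst y))))"
      unfolding G_def by (simp add: algebra_simps)
    then have "norm (G t x - G t y) \<le> norm (P n (snd x) - P n (snd y)) + norm ((- 1 / \<epsilon>) *\<^sub>R (b t *\<^sub>R (P n (snd x) - P n (snd y)) + (f (fst x) - f (fst y))))"
      by (simp only:) (rule norm_Pair_le)
    also have "norm ((- 1 / \<epsilon>) *\<^sub>R (b t *\<^sub>R (P n (snd x) - P n (snd y)) + (f (fst x) - f (fst y))))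
       \<le> (1 / \<epsilon>) * (norm (x - y) + K * norm (x - y))"
    proof -
      have "norm (b t *\<^sub>R (P n (snd x) - P n (snd y)) + (f (fst x) - f (fst y))) \<le> norm (x - y) + K * norm (x - y)"
      proof (rule norm_triangle_mono)
        have "b t * norm (P n (snd x) - P n (snd y)) \<le> 1 * norm (x - y)"
          using b(1,2)[OF t] p by (intro mult_mono) auto
        then show "norm (b t *\<^sub>R (P n (snd x) - P n (snd y))) \<le> norm (x - y)" using b(1)[OF t] by simp
        show "norm (f (fst x) - f (fst y)) \<le> K * norm (x - y)"
          by (rule order_trans[OF K(2) mult_left_mono[OF nz(1) K(1)]])
      qed
      then show ?thesis using pos by (simp add: divide_right_mono)
    qed
    finally show "norm (G t x - G t y) \<le> (1 + (1 + K) / \<epsilon>) * norm (x - y)"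
      using p by (simp add: algebra_simps add_divide_distrib)
  qed
  then obtain z where z0: "z 0 = (P n u0, P n v0)"
    and z: "\<And>t. 0 \<le> t \<Longrightarrow> (z has_vector_derivative G t (z t)) (at t within {0..})" by blast
  define u where "u t = fst (z t)" for t
  define v where "v t = snd (z t)" for t
  define w where "w t = (- 1 / \<epsilon>) *\<^sub>R (b t *\<^sub>R v t + m ((norm (S (u t)))\<^sup>2) *\<^sub>R A (u t))" for t
  have du: "(u has_vector_derivative P n (v t)) (at t within {0..})" if "0 \<le> t" for t
    using bounded_linear.has_vector_derivative[OF bounded_linear_fst z[OF that]] unfolding G_def u_def[abs_def] v_def by simp
  have dv: "(v has_vector_derivative (- 1 / \<epsilon>) *\<^sub>R (b t *\<^sub>R P n (v t) + f (u t))) (at t within {0..})" if "0 \<le> t" for t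
    using bounded_linear.has_vector_derivative[OF bounded_linear_snd z[OF that]] unfolding G_def v_def[abs_def] u_def by simp
  have Pf: "P n (f x) = f x" for x
    unfolding f_def linear_scale[OF P_linear] AP[OF P_D, symmetric] by (simp add: P_P)
  \<comment> \<open>The component \<open>g t - P n (g t)\<close> has derivative zero and vanishes at
    time 0.\<close>
  have PN: "P n (g t) = g t" if g: "\<And>t. 0 \<le> t \<Longrightarrow> (g has_vector_derivative g' t) (at t within {0..})"
    "\<And>t. P n (g' t) = g' t" "P n (g 0) = g 0" and t: "0 \<le> t" for g g' t
  proof -
    have d0: "((\<lambda>t. g t - P n (g t)) has_vector_derivative 0) (at t within {0..})" if t: "t \<in> {0..}" for t
    proof -
      have "((\<lambda>t. g t - P n (g t)) has_vector_derivative (g' t - P n (g' t))) (at t within {0..})"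
        using t by (intro has_vector_derivative_diff bounded_linear.has_vector_derivative[OF P_bl] g(1)) auto
      then show ?thesis using g(2) by simp
    qed
    obtain c where c: "\<And>t. t \<in> {0..} \<Longrightarrow> g t - P n (g t) = c"
    proof (rule has_vector_derivative_zero_constant)
      show "convex {0::real..}" by simp
      show "((\<lambda>t. g t - P n (g t)) has_vector_derivative 0) (at t within {0..})" if "t \<in> {0..}" for t by (rule d0[OF that])
      fix c assume "\<And>t. t \<in> {0..} \<Longrightarrow> g t - P n (g t) = c"
      then show thesis by (rule that)
    qed
    have "c = 0" using c[of 0] g(3) by simp
    then show ?thesis using c[of t] t by simp
  qed
  have Pu: "P n (u t) = u t" if "0 \<le> t" for t
    by (rule PN[OF du _ _ that]) (simp_all add: P_P u_def z0)
  have Pv: "P n (v t) = v t" if "0 \<le> t" for t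
  proof (rule PN[OF dv _ _ that])
    show "P n ((- 1 / \<epsilon>) *\<^sub>R (b t *\<^sub>R P n (v t) + f (u t))) = (- 1 / \<epsilon>) *\<^sub>R (b t *\<^sub>R P n (v t) + f (u t))" for t
      by (simp only: linear_scale[OF P_linear] linear_add[OF P_linear] Pf P_P min.idem)
  qed (simp_all add: P_P v_def z0)
  have wf: "w t = (- 1 / \<epsilon>) *\<^sub>R (b t *\<^sub>R P n (v t) + f (u t))" if "0 \<le> t" for t
    unfolding w_def f_def by (simp only: Pu[OF that] Pv[OF that])
  have "truncated_solution D DS A S P \<nu> n m \<mu> M L \<epsilon> b b' u v w"
  proof (rule truncated_solution.intro[OF coercive_sqrt_axioms], rule truncated_solution_axioms.intro)
    fix t :: real assume t: "0 \<le> t"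
    show "P n (u t) = u t" by (rule Pu[OF t])
    show "P n (v t) = v t" by (rule Pv[OF t])
    show "P n (w t) = w t" unfolding wf[OF t]
      by (simp only: linear_scale[OF P_linear] linear_add[OF P_linear] Pf P_P min.idem)
    show "(u has_vector_derivative v t) (at t within {0..})" using du[OF t] unfolding Pv[OF t] .
    show "(v has_vector_derivative w t) (at t within {0..})" using dv[OF t] unfolding wf[OF t] .
    show "\<epsilon> *\<^sub>R w t + b t *\<^sub>R v t + m ((norm (S (u t)))\<^sup>2) *\<^sub>R A (u t) = 0"
      unfolding w_def using pos by simp
  qed (use m mL pos b db in auto)
  moreover have "u 0 = P n u0" "v 0 = P n v0" by (simp_all add: u_def v_def z0)
  ultimately show ?thesis by blast
qed

end

section \<open>Locally uniform Cauchy sequences\<close>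

definition locally_uniformly_Cauchy :: "(nat \<Rightarrow> real \<Rightarrow> 'b::real_normed_vector) \<Rightarrow> bool" where
  "locally_uniformly_Cauchy f \<longleftrightarrow> (\<forall>T\<ge>0. \<forall>e>0. \<exists>N. \<forall>n\<ge>N. \<forall>k\<ge>N. \<forall>t. 0 \<le> t \<longrightarrow> t \<le> T \<longrightarrow> norm (f n t - f k t) \<le> e)"

lemma locally_uniformly_CauchyD:
  assumes "locally_uniformly_Cauchy f" "0 \<le> T" "0 < e"
  shows "\<exists>N. \<forall>n\<ge>N. \<forall>k\<ge>N. \<forall>t. 0 \<le> t \<longrightarrow> t \<le> T \<longrightarrow> norm (f n t - f k t) \<le> e"
  using assms unfolding locally_uniformly_Cauchy_def by simp

lemma locally_uniformly_Cauchy_dominated: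
  assumes g: "locally_uniformly_Cauchy g" and h: "locally_uniformly_Cauchy h" and c: "0 \<le> c" "0 \<le> d"
    and le: "\<And>n k t. 0 \<le> t \<Longrightarrow> norm (f n t - f k t) \<le> c * norm (g n t - g k t) + d * norm (h n t - h k t)"
  shows "locally_uniformly_Cauchy f"
  unfolding locally_uniformly_Cauchy_def
proof (intro allI impI)
  fix T e :: real assume T: "0 \<le> T" and e: "0 < e"
  define e' where "e' = e / (c + d + 1)"
  have e': "0 < e'" using e c by (simp add: e'_def add_nonneg_pos)
  obtain N1 where N1: "\<forall>n\<ge>N1. \<forall>k\<ge>N1. \<forall>t. 0 \<le> t \<longrightarrow> t \<le> T \<longrightarrow> norm (g n t - g k t) \<le> e'"
    using locally_uniformly_CauchyD[OF g T e'] by (elim exE)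
  obtain N2 where N2: "\<forall>n\<ge>N2. \<forall>k\<ge>N2. \<forall>t. 0 \<le> t \<longrightarrow> t \<le> T \<longrightarrow> norm (h n t - h k t) \<le> e'"
    using locally_uniformly_CauchyD[OF h T e'] by (elim exE)
  have "norm (f n t - f k t) \<le> e" if "n \<ge> max N1 N2" "k \<ge> max N1 N2" "0 \<le> t" "t \<le> T" for n k t
  proof -
    have "norm (f n t - f k t) \<le> c * e' + d * e'"
      using le[OF that(3), of n k] mult_left_mono[OF N1[rule_format, of n k t] c(1)] mult_left_mono[OF N2[rule_format, of n k t] c(2)] that by auto
    also have "\<dots> \<le> (c + d + 1) * e'" using e' by (simp add: algebra_simps)
    also have "\<dots> = e" using c by (simp add: e'_def)
    finally show ?thesis .
  qed
  then show "\<exists>N. \<forall>n\<ge>N. \<forall>k\<ge>N. \<forall>t. 0 \<le> t \<longrightarrow> t \<le> T \<longrightarrow> norm (f n t - f k t) \<le> e" by blast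
qed

lemma locally_uniformly_Cauchy_limit:
  fixes f :: "nat \<Rightarrow> real \<Rightarrow> 'b::{real_normed_vector,complete_space}"
  assumes f: "locally_uniformly_Cauchy f"
  shows "\<exists>g. \<forall>T\<ge>0. uniform_limit {0..T} f g sequentially"
proof (intro exI[of _ "\<lambda>t. lim (\<lambda>n. f n t)"] allI impI)
  fix T :: real assume T: "0 \<le> T"
  have "uniformly_Cauchy_on {0..T} f"
  proof (rule uniformly_Cauchy_onI)
    fix e :: real assume e: "0 < e"
    then have e2: "0 < e / 2" by simp
    obtain N where N: "\<forall>n\<ge>N. \<forall>k\<ge>N. \<forall>t. 0 \<le> t \<longrightarrow> t \<le> T \<longrightarrow> norm (f n t - f k t) \<le> e / 2"
      using locally_uniformly_CauchyD[OF f T e2] by (elim exE)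
    have "dist (f n t) (f k t) < e" if "n \<ge> N" "k \<ge> N" "t \<in> {0..T}" for n k t
      using N[rule_format, of n k t] that e unfolding dist_norm by auto
    then show "\<exists>M. \<forall>x\<in>{0..T}. \<forall>m\<ge>M. \<forall>n\<ge>M. dist (f m x) (f n x) < e" by blast
  qed
  then show "uniform_limit {0..T} f (\<lambda>t. lim (\<lambda>n. f n t)) sequentially"
    using Cauchy_uniformly_convergent uniformly_convergent_uniform_limit_iff by blast
qed

lemma uniform_limit_pointwise:
  assumes "\<And>T. 0 \<le> T \<Longrightarrow> uniform_limit {0..T} f g sequentially" "0 \<le> (t::real)"
  shows "(\<lambda>n. f n t) \<longlonglongrightarrow> g t"
  by (rule tendsto_uniform_limitI[OF assms(1)[OF assms(2)]]) (use assms(2) in simp)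

lemma at_within_half_line: "0 \<le> (t::real) \<Longrightarrow> at t within {0..t+1} = at t within {0..}"
  by (rule at_within_nhd[of _ "{t-1<..<t+1}"]) auto

lemma uniform_limit_continuous_half_line:
  fixes f :: "nat \<Rightarrow> real \<Rightarrow> 'b::metric_space"
  assumes l: "\<And>T. 0 \<le> T \<Longrightarrow> uniform_limit {0..T} f g sequentially" and c: "\<And>n. continuous_on {0..} (f n)"
  shows "continuous_on {0..} g"
  unfolding continuous_on_def
proof
  fix t :: real assume "t \<in> {0..}"
  then have t: "0 \<le> t" by simp
  have "continuous_on {0..t+1} (f n)" for n by (rule continuous_on_subset[OF c]) auto
  then have "continuous_on {0..t+1} g"
    by (intro uniform_limit_theorem[OF always_eventually l]) (use t in simp_all)
  then have "(g \<longlongrightarrow> g t) (at t within {0..t+1})" using t unfolding continuous_on_def by simp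
  then show "(g \<longlongrightarrow> g t) (at t within {0..})" unfolding at_within_half_line[OF t] .
qed

text \<open>Term-by-term differentiation on the interval \<open>[0, t + 1]\<close> in the isometric
  copy \<open>bcopy\<close>; at \<open>t\<close> the derivatives within this interval and within the
  half-line coincide.\<close>

lemma has_vector_derivative_uniform_limit:
  fixes f :: "nat \<Rightarrow> real \<Rightarrow> 'b::{real_normed_vector,complete_space}"
  assumes d: "\<And>n t. 0 \<le> t \<Longrightarrow> (f n has_vector_derivative f' n t) (at t within {0..})"
    and l: "\<And>T. 0 \<le> T \<Longrightarrow> uniform_limit {0..T} f' g' sequentially"
    and p: "\<And>t. 0 \<le> t \<Longrightarrow> (\<lambda>n. f n t) \<longlonglongrightarrow> g t" and t: "0 \<le> t"
  shows "(g has_vector_derivative g' t) (at t within {0..})"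
proof -
  let ?S = "{0..t+1}"
  have "\<exists>h. \<forall>x\<in>?S. (\<lambda>n. Abs_bcopy (f n x)) \<longlonglongrightarrow> h x \<and> (h has_derivative (\<lambda>s. s *\<^sub>R Abs_bcopy (g' x))) (at x within ?S)"
  proof (rule has_derivative_sequence[where f'="\<lambda>n x s. s *\<^sub>R Abs_bcopy (f' n x)" and ?x0.0=0 and l="Abs_bcopy (g 0)"])
    show "convex ?S" by simp
    fix n x assume "x \<in> ?S"
    then have "(f n has_vector_derivative f' n x) (at x within ?S)"
      by (intro has_vector_derivative_within_subset[OF d]) auto
    from bounded_linear.has_vector_derivative[OF bounded_linear_Abs_bcopy this]
    show "((\<lambda>x. Abs_bcopy (f n x)) has_derivative (\<lambda>s. s *\<^sub>R Abs_bcopy (f' n x))) (at x within ?S)"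
      unfolding has_vector_derivative_def .
  next
    fix e :: real assume e: "0 < e"
    have "eventually (\<lambda>n. \<forall>x\<in>?S. dist (f' n x) (g' x) < e) sequentially"
      using l[of "t+1"] t e unfolding uniform_limit_iff by simp
    then show "eventually (\<lambda>n. \<forall>x\<in>?S. \<forall>h. norm (h *\<^sub>R Abs_bcopy (f' n x) - h *\<^sub>R Abs_bcopy (g' x)) \<le> e * norm h) sequentially"
    proof (rule eventually_mono, intro ballI allI)
      fix n x h assume *: "\<forall>x\<in>?S. dist (f' n x) (g' x) < e" and x: "x \<in> ?S"
      have "norm (Abs_bcopy (f' n x) - Abs_bcopy (g' x)) = dist (f' n x) (g' x)"
        by (simp add: norm_bcopy_def minus_bcopy_def dist_norm)
      then have "\<bar>h\<bar> * norm (Abs_bcopy (f' n x) - Abs_bcopy (g' x)) \<le> \<bar>h\<bar> * e"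
        using * x by (intro mult_left_mono) (auto intro: less_imp_le)
      then show "norm (h *\<^sub>R Abs_bcopy (f' n x) - h *\<^sub>R Abs_bcopy (g' x)) \<le> e * norm h"
        unfolding scaleR_diff_right[symmetric] by (simp add: mult.commute)
    qed
  next
    show "0 \<in> ?S" using t by simp
    show "(\<lambda>n. Abs_bcopy (f n 0)) \<longlonglongrightarrow> Abs_bcopy (g 0)"
      by (rule bounded_linear.tendsto[OF bounded_linear_Abs_bcopy p]) simp
  qed
  then obtain h where h: "\<And>x. x \<in> ?S \<Longrightarrow> (\<lambda>n. Abs_bcopy (f n x)) \<longlonglongrightarrow> h x"
     "\<And>x. x \<in> ?S \<Longrightarrow> (h has_vector_derivative Abs_bcopy (g' x)) (at x within ?S)"
    unfolding has_vector_derivative_def by blast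
  have hg: "Rep_bcopy (h x) = g x" if "x \<in> ?S" for x
  proof -
    have "(\<lambda>n. Rep_bcopy (Abs_bcopy (f n x))) \<longlonglongrightarrow> Rep_bcopy (h x)"
      by (rule bounded_linear.tendsto[OF bounded_linear_Rep_bcopy h(1)[OF that]])
    then have r: "(\<lambda>n. f n x) \<longlonglongrightarrow> Rep_bcopy (h x)" by simp
    have "0 \<le> x" using that by simp
    from LIMSEQ_unique[OF r p[OF this]] show ?thesis .
  qed
  have tS: "t \<in> ?S" using t by simp
  have "((\<lambda>x. Rep_bcopy (h x)) has_vector_derivative Rep_bcopy (Abs_bcopy (g' t))) (at t within ?S)"
    by (rule bounded_linear.has_vector_derivative[OF bounded_linear_Rep_bcopy h(2)[OF tS]])
  then have "((\<lambda>x. Rep_bcopy (h x)) has_vector_derivative g' t) (at t within ?S)" by simp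
  then have "(g has_vector_derivative g' t) (at t within ?S)"
    by (rule has_vector_derivative_transform[OF tS, rotated]) (rule hg[symmetric])
  then show ?thesis unfolding at_within_half_line[OF t] .
qed

section \<open>Passage to the limit\<close>

locale galerkin_sequence = coercive_sqrt D DS A S P \<nu>
  for D DS :: "'h::{real_inner,complete_space} set" and A S P \<nu> +
  fixes m :: "real \<Rightarrow> real" and \<mu> M L \<epsilon> :: real and b b' :: "real \<Rightarrow> real"
    and u0 v0 :: 'h and U V W :: "nat \<Rightarrow> real \<Rightarrow> 'h"
  assumes sol: "truncated_solution D DS A S P \<nu> n m \<mu> M L \<epsilon> b b' (U n) (V n) (W n)"
    and init: "U n 0 = P n u0" "V n 0 = P n v0" and u0: "u0 \<in> D" and v0: "v0 \<in> DS"
    and rate: "0 \<le> t \<Longrightarrow> 2 * \<epsilon> * L * (norm (A (U n t)) * norm (V n t)) \<le> \<mu> * b t"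
begin

sublocale sol: truncated_solution D DS A S P \<nu> n m \<mu> M L \<epsilon> b b' "U n" "V n" "W n" for n
  by (rule sol)

lemma rate': "sol.rate n T" unfolding sol.rate_def using rate by blast

lemmas pos = sol.pos
lemmas m_bounds = sol.m

text \<open>A bound, uniform in \<open>n\<close>, for the initial filtered energies:
  \<open>1 / c\<close> is at most \<open>1 / \<mu>\<close> and \<open>P n\<close> is a contraction
  commuting with the filter.\<close>

definition "E0 \<theta> j = (norm (A u0 - \<theta> *\<^sub>R P j (A u0)))\<^sup>2 + \<epsilon> / \<mu> * (norm (S v0 - \<theta> *\<^sub>R P j (S v0)))\<^sup>2"

lemma M_pos: "0 < M" using m_bounds(1)[of 0] m_bounds(2)[of 0] pos by linarith

lemma F_initial: "sol.F n \<theta> j 0 \<le> E0 \<theta> j"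
proof -
  have zA: "A (sol.Z \<theta> j (P n u0)) = P n (A u0 - \<theta> *\<^sub>R P j (A u0))"
  proof -
    have "A (sol.Z \<theta> j (P n u0)) = P n (A u0) - \<theta> *\<^sub>R P j (P n (A u0))"
      unfolding sol.Z_A[OF P_D] unfolding AP[OF u0] sol.Z_def ..
    also have "P j (P n (A u0)) = P n (P j (A u0))" unfolding P_P by (simp only: min.commute)
    finally show ?thesis by (simp add: linear_diff[OF P_linear] linear_scale[OF P_linear])
  qed
  have zS: "S (sol.Z \<theta> j (P n v0)) = P n (S v0 - \<theta> *\<^sub>R P j (S v0))"
  proof -
    have "S (sol.Z \<theta> j (P n v0)) = S (P n v0) + (- \<theta>) *\<^sub>R S (P j (P n v0))"
      unfolding sol.Z_def using S_lin(2)[OF DDS[OF P_D] DDS[OF P_D], of n v0 "- \<theta>" j "P n v0"] by simp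
    also have "\<dots> = P n (S v0) - \<theta> *\<^sub>R P j (P n (S v0))"
      unfolding SP[OF DDS[OF P_D]] SP[OF v0] by simp
    also have "P j (P n (S v0)) = P n (P j (S v0))" unfolding P_P by (simp only: min.commute)
    finally show ?thesis by (simp add: linear_diff[OF P_linear] linear_scale[OF P_linear])
  qed
  have "1 / sol.c n 0 * (\<epsilon> * (norm (S (sol.Z \<theta> j (P n v0))))\<^sup>2) \<le> 1 / \<mu> * (\<epsilon> * (norm (S v0 - \<theta> *\<^sub>R P j (S v0)))\<^sup>2)"
    unfolding zS using sol.c_bounds[of n 0] pos
    by (intro mult_mono divide_left_mono power_mono P_norm) auto
  moreover have "(norm (A (sol.Z \<theta> j (P n u0))))\<^sup>2 \<le> (norm (A u0 - \<theta> *\<^sub>R P j (A u0)))\<^sup>2"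
    unfolding zA by (intro power_mono P_norm) simp
  moreover have "1 / \<mu> * (\<epsilon> * (norm (S v0 - \<theta> *\<^sub>R P j (S v0)))\<^sup>2) = \<epsilon> / \<mu> * (norm (S v0 - \<theta> *\<^sub>R P j (S v0)))\<^sup>2" by simp
  ultimately show ?thesis unfolding sol.F_def init E0_def by linarith
qed

lemma F_bound:
  assumes t: "0 \<le> t"
  shows "(norm (A (sol.Z \<theta> j (U n t))))\<^sup>2 \<le> E0 \<theta> j" "(norm (S (sol.Z \<theta> j (V n t))))\<^sup>2 \<le> M / \<epsilon> * E0 \<theta> j"
proof -
  have F: "sol.F n \<theta> j t \<le> E0 \<theta> j"
    using sol.F_nonincreasing[OF t rate'] F_initial order_trans by blast
  let ?a = "(norm (A (sol.Z \<theta> j (U n t))))\<^sup>2" and ?y = "(norm (S (sol.Z \<theta> j (V n t))))\<^sup>2"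
  have c: "0 < sol.c n t" "sol.c n t \<le> M" by (rule sol.c_bounds)+
  have y: "0 \<le> 1 / sol.c n t * (\<epsilon> * ?y)" using c pos by simp
  show "?a \<le> E0 \<theta> j" using F y unfolding sol.F_def by simp
  have "1 / M * (\<epsilon> * ?y) \<le> 1 / sol.c n t * (\<epsilon> * ?y)"
    using c pos by (intro mult_right_mono divide_left_mono) auto
  also have "\<dots> \<le> E0 \<theta> j" using F unfolding sol.F_def using zero_le_power2[of "norm (A (sol.Z \<theta> j (U n t)))"] by linarith
  finally have "M / \<epsilon> * (1 / M * (\<epsilon> * ?y)) \<le> M / \<epsilon> * E0 \<theta> j" using M_pos pos by (intro mult_left_mono) auto
  then show "?y \<le> M / \<epsilon> * E0 \<theta> j" using M_pos pos by simp
qed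

lemma tail_small: assumes e: "0 < e" shows "\<exists>j. E0 1 j < e"
proof -
  have "(\<lambda>j. E0 1 j) \<longlonglongrightarrow> (norm (A u0 - 1 *\<^sub>R A u0))\<^sup>2 + \<epsilon> / \<mu> * (norm (S v0 - 1 *\<^sub>R S v0))\<^sup>2"
    unfolding E0_def by (intro tendsto_intros P_lim)
  then have "(\<lambda>j. E0 1 j) \<longlonglongrightarrow> 0" by simp
  from order_tendstoD(2)[OF this e] show ?thesis unfolding eventually_sequentially by blast
qed

definition "K = sqrt (E0 0 0) + sqrt (E0 0 0 / \<nu>) + sqrt (M / \<epsilon> * E0 0 0 / \<nu>)"

lemma bounds:
  assumes t: "0 \<le> t"
  shows "norm (A (U n t)) \<le> K" "norm (S (U n t)) \<le> K" "norm (V n t) \<le> K" "0 \<le> K"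
proof -
  have Z0: "sol.Z 0 0 x = x" for x by (simp add: sol.Z_def)
  have a: "(norm (A (U n t)))\<^sup>2 \<le> E0 0 0" "(norm (S (V n t)))\<^sup>2 \<le> M / \<epsilon> * E0 0 0"
    using F_bound[OF t, of 0 0 n] unfolding Z0 by blast+
  have "(norm (S (U n t)))\<^sup>2 \<le> (norm (A (U n t)))\<^sup>2 / \<nu>" by (rule S_le_A[OF sol.inD(1)[OF t]])
  also have "\<dots> \<le> E0 0 0 / \<nu>" using a nu_pos by (simp add: divide_right_mono)
  finally have s: "(norm (S (U n t)))\<^sup>2 \<le> E0 0 0 / \<nu>" .
  have "(norm (V n t))\<^sup>2 \<le> (norm (S (V n t)))\<^sup>2 / \<nu>" by (rule norm_le_S[OF sol.inDS(2)[OF t]])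
  also have "\<dots> \<le> M / \<epsilon> * E0 0 0 / \<nu>" using a nu_pos by (intro divide_right_mono) auto
  finally have v: "(norm (V n t))\<^sup>2 \<le> M / \<epsilon> * E0 0 0 / \<nu>" .
  have E: "0 \<le> E0 0 0" "0 \<le> E0 0 0 / \<nu>" "0 \<le> M / \<epsilon> * E0 0 0 / \<nu>" using a(1) s v zero_le_power2 order_trans by blast+
  have sq: "norm (A (U n t)) \<le> sqrt (E0 0 0)" "norm (S (U n t)) \<le> sqrt (E0 0 0 / \<nu>)"
    "norm (V n t) \<le> sqrt (M / \<epsilon> * E0 0 0 / \<nu>)"
    by (rule real_le_rsqrt[OF a(1)], rule real_le_rsqrt[OF s], rule real_le_rsqrt[OF v])
  note nn = E[THEN real_sqrt_ge_zero]
  show "norm (A (U n t)) \<le> K" "norm (S (U n t)) \<le> K" "norm (V n t) \<le> K" "0 \<le> K"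
    unfolding K_def using sq nn by linarith+
qed

lemma m_bounded_diff:
  "\<bar>sol.c n t - sol.c k t\<bar> \<le> L * (norm (S (U n t) - S (U k t)) * (2 * K))" if t: "0 \<le> t"
proof -
  have "\<bar>(norm (S (U n t)))\<^sup>2 - (norm (S (U k t)))\<^sup>2\<bar> = \<bar>norm (S (U n t)) - norm (S (U k t))\<bar> * (norm (S (U n t)) + norm (S (U k t)))"
    by (simp add: power2_eq_square square_diff_square_factored abs_mult)
  also have "\<dots> \<le> norm (S (U n t) - S (U k t)) * (2 * K)"
    using bounds(2)[OF t, of n] bounds(2)[OF t, of k] by (intro mult_mono norm_triangle_ineq3) auto
  finally show ?thesis
    unfolding sol.c_def using order_trans[OF sol.mL mult_left_mono[OF _ pos(2)]] by blast
qed

text \<open>\<open>difference_estimate\<close> for two truncation levels with the uniform bound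
  \<open>K\<close>; the initial differences tend to 0 because \<open>P n\<close> converges strongly.
  This controls only the lower-order norms of \<open>V\<close> and \<open>S U\<close>.\<close>

lemma V_SU_Cauchy: "locally_uniformly_Cauchy V" "locally_uniformly_Cauchy (\<lambda>n t. S (U n t))"
proof -
  define \<kappa> where "\<kappa> = (2 * L * K * K + 2 * L * K\<^sup>2) * (1 / \<epsilon> + 1 / \<mu>)"
  have K0: "0 \<le> K" using bounds(4)[of 0] by simp
  have k0: "0 \<le> \<kappa>" using pos K0 unfolding \<kappa>_def by simp
  have est: "\<epsilon> * (norm (V n t - V k t))\<^sup>2 + \<mu> * (norm (S (U n t) - S (U k t)))\<^sup>2
     \<le> exp (\<kappa> * T) * (\<epsilon> * (norm (P n v0 - P k v0))\<^sup>2 + M * (norm (P n (S u0) - P k (S u0)))\<^sup>2)"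
    if t: "0 \<le> t" "t \<le> T" for n k t T
  proof -
    let ?d = "\<epsilon> * (norm (P n v0 - P k v0))\<^sup>2"
    have "\<epsilon> * (norm (V n t - V k t))\<^sup>2 + \<mu> * (norm (S (U n t) - S (U k t)))\<^sup>2
      \<le> exp (\<kappa> * t) * (\<epsilon> * (norm (V n 0 - V k 0))\<^sup>2 + m ((norm (S (U n 0)))\<^sup>2) * (norm (S (U n 0) - S (U k 0)))\<^sup>2)"
      unfolding \<kappa>_def
      by (rule difference_estimate[OF t(1) pos(3,1,2) K0 K0, where b=b and ?w1.0="W n" and ?w2.0="W k"])
         (use sol.b(1) m_bounds sol.mL sol.inD sol.inDS sol.dSu sol.dv sol.eq bounds in \<open>simp_all add: less_imp_le\<close>)
    also have "\<epsilon> * (norm (V n 0 - V k 0))\<^sup>2 + m ((norm (S (U n 0)))\<^sup>2) * (norm (S (U n 0) - S (U k 0)))\<^sup>2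
       \<le> ?d + M * (norm (P n (S u0) - P k (S u0)))\<^sup>2"
      unfolding init SP[OF DDS[OF u0]] using m_bounds by (intro add_left_mono mult_right_mono) auto
    also have "exp (\<kappa> * t) * (?d + M * (norm (P n (S u0) - P k (S u0)))\<^sup>2) \<le> exp (\<kappa> * T) * (?d + M * (norm (P n (S u0) - P k (S u0)))\<^sup>2)"
      using k0 t pos M_pos by (intro mult_right_mono) (auto intro: mult_left_mono)
    finally show ?thesis by simp
  qed
  have main: "\<exists>N. \<forall>n\<ge>N. \<forall>k\<ge>N. \<forall>t. 0 \<le> t \<longrightarrow> t \<le> T \<longrightarrow>
     \<epsilon> * (norm (V n t - V k t))\<^sup>2 + \<mu> * (norm (S (U n t) - S (U k t)))\<^sup>2 \<le> e" if T: "0 \<le> T" and e: "0 < e" for T e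
  proof -
    \<comment> \<open>Chosen so that squared initial differences of size \<open>d\<close> are
      amplified by the Gronwall factor to exactly \<open>e\<close>.\<close>
    define d where "d = e / (exp (\<kappa> * T) * (\<epsilon> + M))"
    have d: "0 < d" using e pos M_pos by (simp add: d_def)
    then have sd: "0 < sqrt d" by simp
    have "Cauchy (\<lambda>n. P n v0)" "Cauchy (\<lambda>n. P n (S u0))" using P_lim LIMSEQ_imp_Cauchy by blast+
    then obtain N1 N2 where N1: "\<And>n k. n \<ge> N1 \<Longrightarrow> k \<ge> N1 \<Longrightarrow> norm (P n v0 - P k v0) < sqrt d"
      and N2: "\<And>n k. n \<ge> N2 \<Longrightarrow> k \<ge> N2 \<Longrightarrow> norm (P n (S u0) - P k (S u0)) < sqrt d"
      using CauchyD[OF _ sd] by metis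
    show ?thesis
    proof (intro exI[of _ "max N1 N2"] allI impI)
      fix n k t assume nk: "max N1 N2 \<le> n" "max N1 N2 \<le> k" and t: "0 \<le> t" "t \<le> T"
      have sq: "(norm x)\<^sup>2 \<le> d" if "norm x < sqrt d" for x :: 'h
        using power_mono[OF less_imp_le[OF that], of 2] d by simp
      have "\<epsilon> * (norm (P n v0 - P k v0))\<^sup>2 + M * (norm (P n (S u0) - P k (S u0)))\<^sup>2 \<le> \<epsilon> * d + M * d"
        using nk pos M_pos by (intro add_mono mult_left_mono sq N1 N2) auto
      then have "exp (\<kappa> * T) * (\<epsilon> * (norm (P n v0 - P k v0))\<^sup>2 + M * (norm (P n (S u0) - P k (S u0)))\<^sup>2) \<le> exp (\<kappa> * T) * (\<epsilon> * d + M * d)"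
        by (rule mult_left_mono) simp
      also have "exp (\<kappa> * T) * (\<epsilon> * d + M * d) = (exp (\<kappa> * T) * (\<epsilon> + M)) * d" by (simp add: algebra_simps)
      also have "\<dots> = e" using pos M_pos by (simp add: d_def)
      finally show "\<epsilon> * (norm (V n t - V k t))\<^sup>2 + \<mu> * (norm (S (U n t) - S (U k t)))\<^sup>2 \<le> e"
        using est[OF t, of n k] by linarith
    qed
  qed
  show "locally_uniformly_Cauchy V" "locally_uniformly_Cauchy (\<lambda>n t. S (U n t))"
    unfolding locally_uniformly_Cauchy_def
  proof (safe)
    fix T e :: real assume T: "0 \<le> T" and e: "0 < e"
    have e1: "0 < \<epsilon> * e\<^sup>2" and e2: "0 < \<mu> * e\<^sup>2" using e pos by simp_all
    obtain N where N: "\<forall>n\<ge>N. \<forall>k\<ge>N. \<forall>t. 0 \<le> t \<longrightarrow> t \<le> T \<longrightarrow>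
       \<epsilon> * (norm (V n t - V k t))\<^sup>2 + \<mu> * (norm (S (U n t) - S (U k t)))\<^sup>2 \<le> \<epsilon> * e\<^sup>2" using main[OF T e1] by (elim exE)
    have "norm (V n t - V k t) \<le> e" if "n \<ge> N" "k \<ge> N" "0 \<le> t" "t \<le> T" for n k t
    proof (rule power2_le_imp_le)
      have "0 \<le> \<mu> * (norm (S (U n t) - S (U k t)))\<^sup>2" using pos by simp
      then have "\<epsilon> * (norm (V n t - V k t))\<^sup>2 \<le> \<epsilon> * e\<^sup>2" using N[rule_format, OF that] by linarith
      then show "(norm (V n t - V k t))\<^sup>2 \<le> e\<^sup>2" using pos by simp
    qed (use e in simp)
    then show "\<exists>N. \<forall>n\<ge>N. \<forall>k\<ge>N. \<forall>t\<ge>0. t \<le> T \<longrightarrow> norm (V n t - V k t) \<le> e" by blast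
    obtain N where N: "\<forall>n\<ge>N. \<forall>k\<ge>N. \<forall>t. 0 \<le> t \<longrightarrow> t \<le> T \<longrightarrow>
       \<epsilon> * (norm (V n t - V k t))\<^sup>2 + \<mu> * (norm (S (U n t) - S (U k t)))\<^sup>2 \<le> \<mu> * e\<^sup>2" using main[OF T e2] by (elim exE)
    have "norm (S (U n t) - S (U k t)) \<le> e" if "n \<ge> N" "k \<ge> N" "0 \<le> t" "t \<le> T" for n k t
    proof (rule power2_le_imp_le)
      have "0 \<le> \<epsilon> * (norm (V n t - V k t))\<^sup>2" using pos by simp
      then have "\<mu> * (norm (S (U n t) - S (U k t)))\<^sup>2 \<le> \<mu> * e\<^sup>2" using N[rule_format, OF that] by linarith
      then show "(norm (S (U n t) - S (U k t)))\<^sup>2 \<le> e\<^sup>2" using pos by simp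
    qed (use e in simp)
    then show "\<exists>N. \<forall>n\<ge>N. \<forall>k\<ge>N. \<forall>t\<ge>0. t \<le> T \<longrightarrow> norm (S (U n t) - S (U k t)) \<le> e" by blast
  qed
qed

lemma U_Cauchy: "locally_uniformly_Cauchy U"
proof (rule locally_uniformly_Cauchy_dominated[OF V_SU_Cauchy(2) V_SU_Cauchy(2), of "1 / sqrt \<nu>" 0])
  fix n k and t :: real assume t: "0 \<le> t"
  have dS: "U n t - U k t \<in> DS" "S (U n t - U k t) = S (U n t) - S (U k t)"
    by (rule S_diff[OF sol.inDS(1)[OF t] sol.inDS(1)[OF t]])+
  have "norm (U n t - U k t) \<le> sqrt ((norm (S (U n t - U k t)))\<^sup>2 / \<nu>)"
    by (rule real_le_rsqrt[OF norm_le_S[OF dS(1)]])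
  then show "norm (U n t - U k t) \<le> 1 / sqrt \<nu> * norm (S (U n t) - S (U k t)) + 0 * norm (S (U n t) - S (U k t))"
    unfolding dS(2) by (simp add: real_sqrt_divide)
qed (use nu_pos in simp_all)

text \<open>Upgrades convergence by one operator \<open>B\<close>. The part above level
  \<open>j\<close> is small uniformly in \<open>n\<close> by conservation of the filtered energy,
  and below \<open>j\<close> the operator is bounded, so convergence of \<open>f\<close>
  suffices.\<close>

lemma tail_Cauchy:
  assumes B: "\<And>j. bounded_linear (\<lambda>x. B (P j x))" and f: "locally_uniformly_Cauchy f"
    and split: "\<And>n k t j. 0 \<le> t \<Longrightarrow> norm (B (f n t) - B (f k t)) \<le>
        norm (B (sol.Z 1 j (f n t))) + norm (B (sol.Z 1 j (f k t))) + norm (B (P j (f n t - f k t)))"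
    and tail: "\<And>n t j. 0 \<le> t \<Longrightarrow> (norm (B (sol.Z 1 j (f n t))))\<^sup>2 \<le> C * E0 1 j" and C: "0 < C"
  shows "locally_uniformly_Cauchy (\<lambda>n t. B (f n t))"
  unfolding locally_uniformly_Cauchy_def
proof (intro allI impI)
  fix T e :: real assume T: "0 \<le> T" and e: "0 < e"
  \<comment> \<open>The two high-frequency parts receive \<open>e / 4\<close> each, the
    low-frequency difference \<open>e / 2\<close>.\<close>
  have "0 < (e / 4)\<^sup>2 / C" using e C by simp
  then obtain j where j: "E0 1 j < (e / 4)\<^sup>2 / C" using tail_small by blast
  then have j: "C * E0 1 j < (e / 4)\<^sup>2" using C by (simp add: less_divide_eq mult.commute)
  obtain a where a: "\<And>x. norm (B (P j x)) \<le> norm x * a" and a0: "0 \<le> a"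
    using bounded_linear.nonneg_bounded[OF B] by blast
  have e': "0 < e / (2 * (a + 1))" using e a0 by simp
  obtain N where N: "\<forall>n\<ge>N. \<forall>k\<ge>N. \<forall>t. 0 \<le> t \<longrightarrow> t \<le> T \<longrightarrow> norm (f n t - f k t) \<le> e / (2 * (a + 1))"
    using locally_uniformly_CauchyD[OF f T e'] by (elim exE)
  have Zs: "norm (B (sol.Z 1 j (f n t))) \<le> e / 4" if "0 \<le> t" for n t
  proof (rule power2_le_imp_le)
    show "(norm (B (sol.Z 1 j (f n t))))\<^sup>2 \<le> (e / 4)\<^sup>2" using tail[OF that, of j n] j by linarith
  qed (use e in simp)
  have "norm (B (f n t) - B (f k t)) \<le> e" if "n \<ge> N" "k \<ge> N" "0 \<le> t" "t \<le> T" for n k t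
  proof -
    have "norm (B (P j (f n t - f k t))) \<le> norm (f n t - f k t) * a" by (rule a)
    also have "\<dots> \<le> norm (f n t - f k t) * (a + 1)" by (intro mult_left_mono) auto
    also have "\<dots> \<le> e / (2 * (a + 1)) * (a + 1)" using N that a0 by (intro mult_right_mono) auto
    also have "\<dots> = e / 2"
    proof -
      have "e / (2 * x) * x = e / 2" if "0 < x" for x using that by simp
      then show ?thesis using a0 by (metis add_nonneg_pos zero_less_one)
    qed
    finally show ?thesis using split[OF that(3), of n k j] Zs[OF that(3), of n] Zs[OF that(3), of k] by linarith
  qed
  then show "\<exists>N. \<forall>n\<ge>N. \<forall>k\<ge>N. \<forall>t. 0 \<le> t \<longrightarrow> t \<le> T \<longrightarrow> norm (B (f n t) - B (f k t)) \<le> e" by blast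
qed

lemma AU_Cauchy: "locally_uniformly_Cauchy (\<lambda>n t. A (U n t))"
proof (rule tail_Cauchy[OF AP_bl U_Cauchy])
  fix n k j and t :: real assume t: "0 \<le> t"
  have e: "A (U n t) = A (sol.Z 1 j (U n t)) + A (P j (U n t))" for n
    using A_lin(2)[OF sol.Z_D[OF sol.inD(1)[OF t]] P_D, of 1 j n 1 j "U n t"] by (simp add: sol.Z_def)
  have "A (P j (U n t)) - A (P j (U k t)) = A (P j (U n t - U k t))"
    using linear_diff[OF bounded_linear.linear[OF AP_bl[of j]], of "U n t" "U k t"] by simp
  then have "A (U n t) - A (U k t) = (A (sol.Z 1 j (U n t)) - A (sol.Z 1 j (U k t))) + A (P j (U n t - U k t))"
    unfolding e[of n] e[of k] by (simp add: algebra_simps)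
  then show "norm (A (U n t) - A (U k t)) \<le> norm (A (sol.Z 1 j (U n t))) + norm (A (sol.Z 1 j (U k t))) + norm (A (P j (U n t - U k t)))"
    using norm_triangle_ineq[of "A (sol.Z 1 j (U n t)) - A (sol.Z 1 j (U k t))" "A (P j (U n t - U k t))"]
      norm_triangle_ineq4[of "A (sol.Z 1 j (U n t))" "A (sol.Z 1 j (U k t))"] by simp
  show "(norm (A (sol.Z 1 j (U n t))))\<^sup>2 \<le> 1 * E0 1 j" using F_bound(1)[OF t] by simp
qed simp

lemma SV_Cauchy: "locally_uniformly_Cauchy (\<lambda>n t. S (V n t))"
proof (rule tail_Cauchy[OF SP_bl V_SU_Cauchy(1)])
  fix n k j and t :: real assume t: "0 \<le> t"
  have e: "S (V n t) = S (sol.Z 1 j (V n t)) + S (P j (V n t))" for n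
    using S_lin(2)[OF DDS[OF sol.Z_D[OF sol.inD(2)[OF t]]] DDS[OF P_D], of 1 j n 1 j "V n t"] by (simp add: sol.Z_def)
  have "S (P j (V n t)) - S (P j (V k t)) = S (P j (V n t - V k t))"
    using linear_diff[OF bounded_linear.linear[OF SP_bl[of j]], of "V n t" "V k t"] by simp
  then have "S (V n t) - S (V k t) = (S (sol.Z 1 j (V n t)) - S (sol.Z 1 j (V k t))) + S (P j (V n t - V k t))"
    unfolding e[of n] e[of k] by (simp add: algebra_simps)
  then show "norm (S (V n t) - S (V k t)) \<le> norm (S (sol.Z 1 j (V n t))) + norm (S (sol.Z 1 j (V k t))) + norm (S (P j (V n t - V k t)))"
    using norm_triangle_ineq[of "S (sol.Z 1 j (V n t)) - S (sol.Z 1 j (V k t))" "S (P j (V n t - V k t))"]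
      norm_triangle_ineq4[of "S (sol.Z 1 j (V n t))" "S (sol.Z 1 j (V k t))"] by simp
  show "(norm (S (sol.Z 1 j (V n t))))\<^sup>2 \<le> M / \<epsilon> * E0 1 j" by (rule F_bound(2)[OF t])
qed (use M_pos pos in simp)

lemma W_eq: "0 \<le> t \<Longrightarrow> W n t = (- 1 / \<epsilon>) *\<^sub>R (b t *\<^sub>R V n t + sol.c n t *\<^sub>R A (U n t))"
proof -
  assume t: "0 \<le> t"
  have "\<epsilon> *\<^sub>R W n t = - (b t *\<^sub>R V n t + sol.c n t *\<^sub>R A (U n t))"
    using sol.eq[OF t, of n] unfolding sol.c_def by (simp only: add.assoc eq_neg_iff_add_eq_0)
  then have "(1 / \<epsilon>) *\<^sub>R (\<epsilon> *\<^sub>R W n t) = (1 / \<epsilon>) *\<^sub>R (- (b t *\<^sub>R V n t + sol.c n t *\<^sub>R A (U n t)))" by (rule arg_cong)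
  moreover have "(1 / \<epsilon>) *\<^sub>R (\<epsilon> *\<^sub>R W n t) = W n t" using pos by simp
  ultimately show ?thesis
    by (simp only: minus_divide_left[symmetric] scaleR_minus_left scaleR_minus_right)
qed

lemma cAU_Cauchy: "locally_uniformly_Cauchy (\<lambda>n t. sol.c n t *\<^sub>R A (U n t))"
proof (rule locally_uniformly_Cauchy_dominated[OF AU_Cauchy V_SU_Cauchy(2), of M "L * (2 * K) * K"])
  have K0: "0 \<le> K" using bounds(4)[of 0] by simp
  show "0 \<le> M" "0 \<le> L * (2 * K) * K" using M_pos pos K0 by simp_all
  fix n k and t :: real assume t: "0 \<le> t"
  have "sol.c n t *\<^sub>R A (U n t) - sol.c k t *\<^sub>R A (U k t) = sol.c n t *\<^sub>R (A (U n t) - A (U k t)) + (sol.c n t - sol.c k t) *\<^sub>R A (U k t)"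
    by (simp add: algebra_simps)
  then have "norm (sol.c n t *\<^sub>R A (U n t) - sol.c k t *\<^sub>R A (U k t)) \<le> \<bar>sol.c n t\<bar> * norm (A (U n t) - A (U k t)) + \<bar>sol.c n t - sol.c k t\<bar> * norm (A (U k t))"
    using norm_triangle_ineq[of "sol.c n t *\<^sub>R (A (U n t) - A (U k t))" "(sol.c n t - sol.c k t) *\<^sub>R A (U k t)"] by simp
  also have "\<dots> \<le> M * norm (A (U n t) - A (U k t)) + (L * (norm (S (U n t) - S (U k t)) * (2 * K))) * K"
    using sol.c_bounds[of n t] pos K0 by (intro add_mono mult_mono m_bounded_diff bounds t) auto
  finally show "norm (sol.c n t *\<^sub>R A (U n t) - sol.c k t *\<^sub>R A (U k t)) \<le> M * norm (A (U n t) - A (U k t)) + L * (2 * K) * K * norm (S (U n t) - S (U k t))"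
    by (simp only: mult_ac)
qed

lemma W_Cauchy: "locally_uniformly_Cauchy W"
proof (rule locally_uniformly_Cauchy_dominated[OF V_SU_Cauchy(1) cAU_Cauchy, of "1 / \<epsilon>" "1 / \<epsilon>"])
  fix n k and t :: real assume t: "0 \<le> t"
  let ?x = "b t *\<^sub>R (V n t - V k t)" and ?y = "sol.c n t *\<^sub>R A (U n t) - sol.c k t *\<^sub>R A (U k t)"
  have "W n t - W k t = (- 1 / \<epsilon>) *\<^sub>R (?x + ?y)" unfolding W_eq[OF t] by (simp add: algebra_simps)
  then have "norm (W n t - W k t) = (1 / \<epsilon>) * norm (?x + ?y)" using pos by simp
  also have "\<dots> \<le> (1 / \<epsilon>) * (norm ?x + norm ?y)" using pos by (intro mult_left_mono norm_triangle_ineq) auto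
  also have "\<dots> \<le> (1 / \<epsilon>) * (norm (V n t - V k t) + norm ?y)"
  proof (intro mult_left_mono add_right_mono)
    have "\<bar>b t\<bar> * norm (V n t - V k t) \<le> 1 * norm (V n t - V k t)"
      using sol.b(1,2)[OF t] by (intro mult_right_mono) auto
    then show "norm ?x \<le> norm (V n t - V k t)" unfolding norm_scaleR by simp
  qed (use pos in simp)
  finally show "norm (W n t - W k t) \<le> 1 / \<epsilon> * norm (V n t - V k t) + 1 / \<epsilon> * norm ?y"
    using pos by (simp add: distrib_left)
qed (use pos in simp_all)

text \<open>Closedness of \<open>A\<close> and \<open>S\<close> identifies the limits of
  \<open>A U\<close>, \<open>S U\<close> and \<open>S V\<close> with the operators applied to the
  limits of \<open>U\<close> and \<open>V\<close>. The second derivatives converge because the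
  equation expresses them through quantities already under control.\<close>

theorem limit_solution:
  obtains u v w where
    "\<And>t. 0 \<le> t \<Longrightarrow> u t \<in> D" "\<And>t. 0 \<le> t \<Longrightarrow> v t \<in> DS"
    "\<And>t. 0 \<le> t \<Longrightarrow> (u has_vector_derivative v t) (at t within {0..})"
    "\<And>t. 0 \<le> t \<Longrightarrow> ((\<lambda>t. S (u t)) has_vector_derivative S (v t)) (at t within {0..})"
    "\<And>t. 0 \<le> t \<Longrightarrow> (v has_vector_derivative w t) (at t within {0..})"
    "continuous_on {0..} (\<lambda>t. A (u t))" "continuous_on {0..} (\<lambda>t. S (v t))" "continuous_on {0..} w"
    "\<And>t. 0 \<le> t \<Longrightarrow> \<epsilon> *\<^sub>R w t + b t *\<^sub>R v t + m ((norm (S (u t)))\<^sup>2) *\<^sub>R A (u t) = 0"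
    "u 0 = u0" "v 0 = v0"
    "\<And>t. 0 \<le> t \<Longrightarrow> (\<lambda>n. A (U n t)) \<longlonglongrightarrow> A (u t)" "\<And>t. 0 \<le> t \<Longrightarrow> (\<lambda>n. V n t) \<longlonglongrightarrow> v t"
    "\<And>t. 0 \<le> t \<Longrightarrow> (\<lambda>n. S (V n t)) \<longlonglongrightarrow> S (v t)"
proof -
  obtain u where u: "\<And>T. 0 \<le> T \<Longrightarrow> uniform_limit {0..T} U u sequentially"
    using locally_uniformly_Cauchy_limit[OF U_Cauchy] by blast
  obtain su where su: "\<And>T. 0 \<le> T \<Longrightarrow> uniform_limit {0..T} (\<lambda>n t. S (U n t)) su sequentially"
    using locally_uniformly_Cauchy_limit[OF V_SU_Cauchy(2)] by blast
  obtain au where au: "\<And>T. 0 \<le> T \<Longrightarrow> uniform_limit {0..T} (\<lambda>n t. A (U n t)) au sequentially"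
    using locally_uniformly_Cauchy_limit[OF AU_Cauchy] by blast
  obtain v where v: "\<And>T. 0 \<le> T \<Longrightarrow> uniform_limit {0..T} V v sequentially"
    using locally_uniformly_Cauchy_limit[OF V_SU_Cauchy(1)] by blast
  obtain sv where sv: "\<And>T. 0 \<le> T \<Longrightarrow> uniform_limit {0..T} (\<lambda>n t. S (V n t)) sv sequentially"
    using locally_uniformly_Cauchy_limit[OF SV_Cauchy] by blast
  obtain w where w: "\<And>T. 0 \<le> T \<Longrightarrow> uniform_limit {0..T} W w sequentially"
    using locally_uniformly_Cauchy_limit[OF W_Cauchy] by blast
  note lim = uniform_limit_pointwise
  have uD: "u t \<in> D" "A (u t) = au t" if t: "0 \<le> t" for t
  proof -
    show "u t \<in> D" by (rule D_closed(1)[OF sol.inD(1)[OF t] lim[OF u t] lim[OF au t]])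
    show "A (u t) = au t" by (rule D_closed(2)[OF sol.inD(1)[OF t] lim[OF u t] lim[OF au t]])
  qed
  have su_eq: "S (u t) = su t" if t: "0 \<le> t" for t
    by (rule DS_closed(2)[OF sol.inDS(1)[OF t] lim[OF u t] lim[OF su t]])
  have vD: "v t \<in> DS" "S (v t) = sv t" if t: "0 \<le> t" for t
  proof -
    show "v t \<in> DS" by (rule DS_closed(1)[OF sol.inDS(2)[OF t] lim[OF v t] lim[OF sv t]])
    show "S (v t) = sv t" by (rule DS_closed(2)[OF sol.inDS(2)[OF t] lim[OF v t] lim[OF sv t]])
  qed
  show ?thesis
  proof (rule that)
    fix t :: real assume t: "0 \<le> t"
    show "u t \<in> D" by (rule uD(1)[OF t])
    show "v t \<in> DS" by (rule vD(1)[OF t])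
    show "(u has_vector_derivative v t) (at t within {0..})"
      by (rule has_vector_derivative_uniform_limit[OF sol.du v lim[OF u] t])
    have "(su has_vector_derivative sv t) (at t within {0..})"
      by (rule has_vector_derivative_uniform_limit[OF sol.dSu sv lim[OF su] t])
    then have "((\<lambda>t. S (u t)) has_vector_derivative sv t) (at t within {0..})"
      by (rule has_vector_derivative_transform[rotated 2]) (use t su_eq in auto)
    then show "((\<lambda>t. S (u t)) has_vector_derivative S (v t)) (at t within {0..})" unfolding vD[OF t] .
    show "(v has_vector_derivative w t) (at t within {0..})"
      by (rule has_vector_derivative_uniform_limit[OF sol.dv w lim[OF v] t])
    show "(\<lambda>n. A (U n t)) \<longlonglongrightarrow> A (u t)" unfolding uD[OF t] by (rule lim[OF au t])
    show "(\<lambda>n. V n t) \<longlonglongrightarrow> v t" by (rule lim[OF v t])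
    show "(\<lambda>n. S (V n t)) \<longlonglongrightarrow> S (v t)" unfolding vD[OF t] by (rule lim[OF sv t])
    have "(\<lambda>n. sol.c n t) \<longlonglongrightarrow> m ((norm (S (u t)))\<^sup>2)"
      unfolding sol.c_def
    proof (rule isCont_tendsto_compose[where g=m])
      show "isCont m ((norm (S (u t)))\<^sup>2)" using sol.m_cont by (simp add: continuous_on_eq_continuous_at)
      show "(\<lambda>n. (norm (S (U n t)))\<^sup>2) \<longlonglongrightarrow> (norm (S (u t)))\<^sup>2"
        unfolding su_eq[OF t] by (intro tendsto_intros lim[OF su t])
    qed
    then have "(\<lambda>n. \<epsilon> *\<^sub>R W n t + b t *\<^sub>R V n t + sol.c n t *\<^sub>R A (U n t)) \<longlonglongrightarrow> \<epsilon> *\<^sub>R w t + b t *\<^sub>R v t + m ((norm (S (u t)))\<^sup>2) *\<^sub>R A (u t)"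
      unfolding uD(2)[OF t] by (intro tendsto_intros lim[OF w t] lim[OF v t] lim[OF au t])
    moreover have "\<epsilon> *\<^sub>R W n t + b t *\<^sub>R V n t + sol.c n t *\<^sub>R A (U n t) = 0" for n
      using sol.eq[OF t] unfolding sol.c_def .
    ultimately show "\<epsilon> *\<^sub>R w t + b t *\<^sub>R v t + m ((norm (S (u t)))\<^sup>2) *\<^sub>R A (u t) = 0" by (simp add: LIMSEQ_const_iff)
  next
    have c: "continuous_on {0..} au" by (rule uniform_limit_continuous_half_line[OF au sol.cont_of_deriv[OF sol.dAu]])
    show "continuous_on {0..} (\<lambda>t. A (u t))" using c by (rule continuous_on_eq) (use uD in auto)
    have c: "continuous_on {0..} sv" by (rule uniform_limit_continuous_half_line[OF sv sol.cont_of_deriv[OF sol.dSv]])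
    show "continuous_on {0..} (\<lambda>t. S (v t))" using c by (rule continuous_on_eq) (use vD in auto)
    show "continuous_on {0..} w"
    proof (rule uniform_limit_continuous_half_line[OF w])
      fix n
      have bc: "continuous_on {0..} b" unfolding continuous_on_eq_continuous_within using DERIV_continuous[OF sol.db] by auto
      have "continuous_on {0..} (\<lambda>t. (- 1 / \<epsilon>) *\<^sub>R (b t *\<^sub>R V n t + sol.c n t *\<^sub>R A (U n t)))"
        by (intro continuous_intros bc sol.c_cont sol.cont_of_deriv[OF sol.dv] sol.cont_of_deriv[OF sol.dAu])
      then show "continuous_on {0..} (W n)" by (rule continuous_on_eq) (use W_eq in auto)
    qed
    have z: "(0::real) \<le> 0" by simp
    show "u 0 = u0" using lim[OF u z] P_lim[of u0] LIMSEQ_unique unfolding init by blast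
    show "v 0 = v0" using lim[OF v z] P_lim[of v0] LIMSEQ_unique unfolding init by blast
  qed
qed

end

section \<open>The decay rates\<close>

text \<open>With \<open>K = 1\<close> this is the damping coefficient. A larger \<open>K\<close>
  keeps the behaviour at infinity but lowers the starting value to \<open>K powr (- p)\<close>,
  which is arbitrarily small for \<open>p > 0\<close>; the multiplier uses this delayed
  weight.\<close>

definition rate_weight :: "real \<Rightarrow> real \<Rightarrow> real \<Rightarrow> real" where
  "rate_weight K p t = (K + t) powr (- p)"

definition rate_weight' :: "real \<Rightarrow> real \<Rightarrow> real \<Rightarrow> real" where
  "rate_weight' K p t = - p * (K + t) powr (- p - 1)"

definition rate_primitive :: "real \<Rightarrow> real \<Rightarrow> real \<Rightarrow> real" where
  "rate_primitive K p t = (if p = 1 then ln (K + t) - ln K else ((K + t) powr (1 - p) - K powr (1 - p)) / (1 - p))"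

lemma powr_shift_derivative:
  assumes "0 < K + t"
  shows "((\<lambda>t. (K + t) powr a) has_real_derivative a * (K + t) powr (a - 1)) (at t)"
proof -
  have "DERIV (\<lambda>t. K + t) t :> 1" by (auto intro!: derivative_eq_intros)
  from DERIV_fun_powr[OF this assms, of a] show ?thesis by simp
qed

context
  fixes K p :: real assumes K: "1 \<le> K" and p: "0 \<le> p" "p \<le> 1"
begin

lemma rate_weight_pos: "0 \<le> t \<Longrightarrow> 0 < rate_weight K p t" using K by (simp add: rate_weight_def)

lemma rate_weight_le: "0 \<le> t \<Longrightarrow> rate_weight K p t \<le> rate_weight 1 p t"
  unfolding rate_weight_def using K p by (intro powr_mono2') auto

lemma rate_weight_le_start: "0 \<le> t \<Longrightarrow> rate_weight K p t \<le> K powr (- p)"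
  unfolding rate_weight_def using K p by (intro powr_mono2') auto

lemma rate_weight_le_1: "0 \<le> t \<Longrightarrow> rate_weight 1 p t \<le> 1"
  unfolding rate_weight_def using powr_mono2'[of "-p" 1 "1 + t"] p by simp

lemma rate_weight'_nonpos: "rate_weight' K p t \<le> 0"
  using p by (simp add: rate_weight'_def mult_nonpos_nonneg)

lemma rate_weight'_ge: assumes t: "0 \<le> t" shows "- rate_weight K p t \<le> rate_weight' K p t"
proof -
  have "(K + t) powr (- p - 1) \<le> (K + t) powr (- p)" using K t by (intro powr_mono) auto
  then have "p * (K + t) powr (- p - 1) \<le> 1 * (K + t) powr (- p)" using p by (intro mult_mono) auto
  then show ?thesis by (simp add: rate_weight_def rate_weight'_def)
qed

lemma rate_weight_derivative:
  assumes t: "0 \<le> t"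
  shows "(rate_weight K p has_real_derivative rate_weight' K p t) (at t within {0..})"
proof -
  have "0 < K + t" using K t by simp
  then show ?thesis unfolding rate_weight_def[abs_def] rate_weight'_def
    by (rule has_field_derivative_at_within[OF powr_shift_derivative])
qed

lemma rate_primitive_derivative_at:
  assumes t: "0 \<le> t" shows "(rate_primitive K p has_real_derivative rate_weight K p t) (at t)"
proof (cases "p = 1")
  case True
  have "((\<lambda>t. ln (K + t) - ln K) has_real_derivative 1 / (K + t)) (at t)"
    using K t by (auto intro!: derivative_eq_intros)
  then show ?thesis using True K t by (simp add: rate_primitive_def[abs_def] rate_weight_def powr_minus_divide)
next
  case False
  have "((\<lambda>t. ((K + t) powr (1 - p) - K powr (1 - p)) / (1 - p)) has_real_derivative ((1 - p) * (K + t) powr (1 - p - 1) - 0) / (1 - p)) (at t)"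
    using K t by (intro DERIV_cdivide DERIV_diff powr_shift_derivative DERIV_const) auto
  then show ?thesis using False by (simp add: rate_primitive_def[abs_def] rate_weight_def)
qed

lemma rate_primitive_derivative:
  "0 \<le> t \<Longrightarrow> (rate_primitive K p has_real_derivative rate_weight K p t) (at t within {0..})"
  by (rule has_field_derivative_at_within[OF rate_primitive_derivative_at])

lemma rate_primitive_0: "rate_primitive K p 0 = 0" by (simp add: rate_primitive_def)

lemma rate_primitive_nonneg: assumes t: "0 \<le> t" shows "0 \<le> rate_primitive K p t"
proof -
  have "rate_primitive K p 0 \<le> rate_primitive K p t"
    by (rule DERIV_nonneg_imp_nondecreasing[OF t])
       (use rate_primitive_derivative_at rate_weight_pos in \<open>blast intro: less_imp_le\<close>)
  then show ?thesis by (simp add: rate_primitive_0)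
qed

text \<open>Compares derivatives: \<open>K + x\<close> is at least 1 and \<open>p\<close> at most 1.
  Exponentials of the primitive therefore grow at least linearly, enough to beat powers of
  \<open>1 + t\<close> with exponent \<open>p\<close>.\<close>

lemma rate_primitive_ge_ln: assumes t: "0 \<le> t" shows "ln (K + t) - ln K \<le> rate_primitive K p t"
proof -
  let ?h = "\<lambda>t. rate_primitive K p t - (ln (K + t) - ln K)"
  have "?h 0 \<le> ?h t"
  proof (rule DERIV_nonneg_imp_nondecreasing[OF t])
    fix x assume x: "0 \<le> x" "x \<le> t"
    have "(?h has_real_derivative rate_weight K p x - 1 / (K + x)) (at x)"
    proof (rule DERIV_diff[OF rate_primitive_derivative_at[OF x(1)]])
      show "((\<lambda>t. ln (K + t) - ln K) has_real_derivative 1 / (K + x)) (at x)"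
        using K x by (auto intro!: derivative_eq_intros)
    qed
    moreover have "1 / (K + x) \<le> rate_weight K p x"
      using powr_mono[of "-1" "-p" "K + x"] K x p by (simp add: rate_weight_def powr_minus_divide)
    ultimately show "\<exists>y. (?h has_real_derivative y) (at x) \<and> 0 \<le> y" by fastforce
  qed
  then show ?thesis by (simp add: rate_primitive_0)
qed

lemma exp_rate_primitive_ge: assumes t: "0 \<le> t" shows "(1 + t) / K \<le> exp (rate_primitive K p t)"
proof -
  have "(1 + t) / K \<le> (K + t) / K" using K by (intro divide_right_mono) auto
  also have "\<dots> = exp (ln (K + t) - ln K)" using K t by (simp add: exp_diff)
  also have "\<dots> \<le> exp (rate_primitive K p t)" using rate_primitive_ge_ln[OF t] by simp
  finally show ?thesis .
qed

lemma inverse_rate_weight_le: assumes t: "0 \<le> t" shows "1 / rate_weight 1 p t \<le> K * exp (rate_primitive K p t)"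
proof -
  have "1 / rate_weight 1 p t = (1 + t) powr p" by (simp add: rate_weight_def powr_minus_divide)
  also have "\<dots> \<le> (1 + t) powr 1" using t p by (intro powr_mono) auto
  also have "\<dots> = K * ((1 + t) / K)" using t K by simp
  also have "\<dots> \<le> K * exp (rate_primitive K p t)" using exp_rate_primitive_ge[OF t] K by (intro mult_left_mono) auto
  finally show ?thesis .
qed

end

context
  fixes K p :: real assumes K: "1 \<le> K" and p: "0 \<le> p" "p \<le> 1"
begin

text \<open>Each unit of rate compensates one factor \<open>1 / rate_weight 1 p t\<close> at the
  cost of \<open>K\<close>, so two units remove the square.\<close>

lemma exp_rate_absorbs_weight:
  assumes t: "0 \<le> t" and C: "0 \<le> C"
  shows "C * exp (- (a + 2) * rate_primitive K p t) / (rate_weight 1 p t)\<^sup>2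
    \<le> C * K\<^sup>2 * exp (- a * rate_primitive K p t)"
proof -
  let ?Q = "rate_primitive K p t" and ?b = "rate_weight 1 p t"
  have b: "0 < ?b" by (rule rate_weight_pos[OF order_refl p t])
  have "(1 / ?b)\<^sup>2 \<le> (K * exp ?Q)\<^sup>2" using b by (intro power_mono inverse_rate_weight_le[OF K p t]) simp
  then have "C * exp (- (a + 2) * ?Q) * (1 / ?b)\<^sup>2 \<le> C * exp (- (a + 2) * ?Q) * (K * exp ?Q)\<^sup>2"
    using C by (intro mult_left_mono) auto
  also have "\<dots> = C * K\<^sup>2 * exp (- (a + 2) * ?Q + (?Q + ?Q))"
    unfolding exp_add by (simp add: power2_eq_square mult_ac)
  also have "- (a + 2) * ?Q + (?Q + ?Q) = - a * ?Q" by (simp add: algebra_simps)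
  finally show ?thesis by (simp add: power_divide)
qed

text \<open>The factor \<open>1 - p\<close> cancels the denominator of the primitive, and the delay
  \<open>K\<close> costs only a constant factor.\<close>

lemma exp_rate_primitive_stretched:
  assumes t: "0 \<le> t" and p1: "p < 1" and \<beta>: "0 \<le> \<beta>"
  shows "exp (- (\<beta> * (1 - p)) * rate_primitive K p t) \<le> exp (\<beta> * K powr (1 - p)) * exp (- \<beta> * (1 + t) powr (1 - p))"
proof -
  have "(1 - p) * rate_primitive K p t = (K + t) powr (1 - p) - K powr (1 - p)"
    using p1 by (simp add: rate_primitive_def)
  moreover have "(1 + t) powr (1 - p) \<le> (K + t) powr (1 - p)" using K t p1 by (intro powr_mono2) auto
  ultimately have "\<beta> * ((1 + t) powr (1 - p) - K powr (1 - p)) \<le> \<beta> * ((1 - p) * rate_primitive K p t)"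
    using \<beta> by (intro mult_left_mono) auto
  then have "- (\<beta> * (1 - p)) * rate_primitive K p t \<le> \<beta> * K powr (1 - p) + - \<beta> * (1 + t) powr (1 - p)"
    by (simp add: algebra_simps)
  then show ?thesis unfolding exp_add[symmetric] by simp
qed

end

lemma exp_rate_primitive_power:
  assumes K: "1 \<le> K" and t: "0 \<le> t" and \<beta>: "0 \<le> \<beta>"
  shows "exp (- \<beta> * rate_primitive K 1 t) \<le> K powr \<beta> / (1 + t) powr \<beta>"
proof -
  have "exp (- \<beta> * rate_primitive K 1 t) = exp (\<beta> * ln K - \<beta> * ln (K + t))"
    by (simp add: rate_primitive_def algebra_simps)
  also have "\<dots> = K powr \<beta> / (K + t) powr \<beta>" using K t by (simp add: exp_diff powr_def)
  also have "\<dots> \<le> K powr \<beta> / (1 + t) powr \<beta>" using K t \<beta> by (intro divide_left_mono powr_mono2) auto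
  finally show ?thesis .
qed

text \<open>Solves the condition \<open>gm\<close> of \<open>decay_inequality\<close> with margin 1
  and \<open>\<kappa> = K powr (- p)\<close>; this is where the threshold of the case
  \<open>p = 0\<close> originates.\<close>

lemma decay_parameters_exist:
  fixes p \<mu> \<nu> \<beta> :: real
  assumes p: "0 \<le> p" "p \<le> 1" and pos: "0 < \<mu>" "0 < \<nu>" "0 \<le> \<beta>" and beta: "p = 0 \<Longrightarrow> \<beta> < 2 * \<mu> * \<nu>"
  shows "\<exists>\<gamma>>0. \<exists>K\<ge>1. \<beta> * (1 + \<gamma> * K powr (- p) / \<nu>) + 1 \<le> 2 * \<gamma> * \<mu>"
proof (cases "p = 0")
  case True
  have d: "0 < 2 * \<mu> - \<beta> / \<nu>" using beta[OF True] pos by (simp add: field_simps)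
  \<comment> \<open>For \<open>p = 0\<close> the delay has no effect and the condition reads
    \<open>\<gamma> * (2 * \<mu> - \<beta> / \<nu>) \<ge> \<beta> + 1\<close>; equality is
    taken.\<close>
  define \<gamma> where "\<gamma> = (\<beta> + 1) / (2 * \<mu> - \<beta> / \<nu>)"
  have g: "0 < \<gamma>" using d pos by (simp add: \<gamma>_def)
  have "\<gamma> * (2 * \<mu> - \<beta> / \<nu>) = \<beta> + 1" using d by (simp add: \<gamma>_def)
  then have "\<beta> * (1 + \<gamma> * 1 / \<nu>) + 1 \<le> 2 * \<gamma> * \<mu>" by (simp add: algebra_simps)
  then show ?thesis using g True by (intro exI[of _ \<gamma>] conjI exI[of _ 1]) auto
next
  case False
  \<comment> \<open>A large \<open>K\<close> pushes the term with \<open>K powr (- p)\<close> below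
    1, and \<open>2 * \<gamma> * \<mu> = 2 * \<beta> + 2\<close> covers the remaining
    \<open>\<beta> + 2\<close>.\<close>
  define \<gamma> where "\<gamma> = (\<beta> + 1) / \<mu>"
  have g: "0 < \<gamma>" using pos by (simp add: \<gamma>_def)
  have "((\<lambda>K::real. K powr (- p)) \<longlongrightarrow> 0) at_top"
    by (rule tendsto_neg_powr) (use False p in \<open>auto simp: filterlim_ident\<close>)
  moreover have "0 < \<nu> / (\<beta> * \<gamma> + 1)" using pos g by (simp add: add_nonneg_pos)
  ultimately have "eventually (\<lambda>K. K powr (- p) < \<nu> / (\<beta> * \<gamma> + 1)) at_top" by (rule order_tendstoD(2))
  then have "eventually (\<lambda>K. K powr (- p) < \<nu> / (\<beta> * \<gamma> + 1) \<and> 1 \<le> K) at_top"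
    using eventually_ge_at_top[of 1] by eventually_elim simp
  then obtain K where K: "K powr (- p) < \<nu> / (\<beta> * \<gamma> + 1)" "1 \<le> K"
    using eventually_happens[of _ "at_top :: real filter"] by auto
  have "(\<beta> * \<gamma>) * (K powr (- p) / \<nu>) \<le> (\<beta> * \<gamma> + 1) * (1 / (\<beta> * \<gamma> + 1))"
  proof (rule mult_mono)
    have "K powr (- p) / \<nu> \<le> (\<nu> / (\<beta> * \<gamma> + 1)) / \<nu>" using K pos by (intro divide_right_mono) auto
    then show "K powr (- p) / \<nu> \<le> 1 / (\<beta> * \<gamma> + 1)" using pos by simp
  qed (use pos g in auto)
  also have "\<dots> \<le> 1" by simp
  finally have "\<beta> * (1 + \<gamma> * K powr (- p) / \<nu>) + 1 \<le> \<beta> + 1 + 1" by (simp add: algebra_simps)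
  also have "\<dots> \<le> 2 * \<gamma> * \<mu>" using pos by (simp add: \<gamma>_def)
  finally show ?thesis using g K(2) by blast
qed

text \<open>Compactness of the interval, with a dummy time parameter ranging over
  \<open>{0}\<close>.\<close>

lemma lipschitz_on_interval:
  assumes "locally_lipschitz_on {0..} m"
  shows "\<exists>L\<ge>0. \<forall>\<sigma>\<in>{0..c}. \<forall>\<tau>\<in>{0..c}. \<bar>m \<sigma> - m \<tau>\<bar> \<le> L * \<bar>\<sigma> - \<tau>\<bar>"
proof -
  have "local_lipschitz {0::real} {0..c} (\<lambda>_. m)"
  proof (rule local_lipschitzI)
    fix t x :: real assume x: "x \<in> {0..c}"
    then obtain r L where r: "0 < r" "L-lipschitz_on (cball x r \<inter> {0..}) m"
      using assms unfolding locally_lipschitz_on_def by (meson atLeastAtMost_iff atLeast_iff)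
    have "L-lipschitz_on (cball x r \<inter> {0..c}) m" by (rule lipschitz_on_subset[OF r(2)]) auto
    then show "\<exists>u>0. \<exists>L. \<forall>t\<in>cball t u \<inter> {0}. L-lipschitz_on (cball x u \<inter> {0..c}) m" using r(1) by blast
  qed
  then obtain L where L: "L-lipschitz_on {0..c} m"
    by (rule local_lipschitz_compact_implies_lipschitz[of "{0}" "{0..c}"]) auto
  show ?thesis
    using lipschitz_on_nonneg[OF L] lipschitz_onD[OF L] by (intro exI[of _ L]) (auto simp: dist_real_def)
qed

section \<open>Solutions of the Cauchy problem\<close>

lemma half_line_nontrivial: "0 \<le> (t::real) \<Longrightarrow> at t within {0..} \<noteq> bot"
proof -
  assume t: "0 \<le> t"
  have "at_right t \<le> at t within {0..}" by (rule at_le) (use t in auto)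
  then show ?thesis using trivial_limit_at_right_real[of t] by (auto simp: bot_unique)
qed

lemma dt_eq: "0 \<le> t \<Longrightarrow> (f has_vector_derivative f') (at t within {0..}) \<Longrightarrow> dt f t = f'"
  unfolding dt_def by (rule vector_derivative_within[OF half_line_nontrivial])

text \<open>Puts vector differentiability into the form used by \<open>C1_graph\<close>, so that
  convergence in the graph norm becomes differentiability of \<open>u\<close> and of
  \<open>S u\<close>.\<close>

lemma difference_quotient_tendsto_iff:
  "(f has_vector_derivative f') (at t within X) \<longleftrightarrow> ((\<lambda>s. norm ((f s - f t) /\<^sub>R (s - t) - f')) \<longlongrightarrow> 0) (at t within X)"
proof -
  have "(f has_vector_derivative f') (at t within X) \<longleftrightarrow>
      ((\<lambda>s. norm ((f s - f t) - (s - t) *\<^sub>R f') / norm (s - t)) \<longlongrightarrow> 0) (at t within X)"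
    unfolding has_vector_derivative_def has_derivative_iff_norm by (simp add: bounded_linear_scaleR_left)
  also have "\<dots> \<longleftrightarrow> ((\<lambda>s. norm ((f s - f t) /\<^sub>R (s - t) - f')) \<longlongrightarrow> 0) (at t within X)"
  proof (rule tendsto_cong)
    have "norm ((f s - f t) - (s - t) *\<^sub>R f') / norm (s - t) = norm ((f s - f t) /\<^sub>R (s - t) - f')" if "s \<noteq> t" for s
    proof -
      have "(f s - f t) /\<^sub>R (s - t) - f' = (1 / (s - t)) *\<^sub>R ((f s - f t) - (s - t) *\<^sub>R f')"
        using that by (simp add: scaleR_diff_right divide_inverse)
      then show ?thesis by simp
    qed
    then show "eventually (\<lambda>s. norm ((f s - f t) - (s - t) *\<^sub>R f') / norm (s - t) = norm ((f s - f t) /\<^sub>R (s - t) - f')) (at t within X)"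
      unfolding eventually_at by (intro exI[of _ 1]) simp
  qed
  finally show ?thesis .
qed

lemma graph_norm_bounds: "0 \<le> graph_norm B x" "norm x \<le> graph_norm B x" "norm (B x) \<le> graph_norm B x" "graph_norm B x \<le> norm x + norm (B x)"
  unfolding graph_norm_def
  by (simp, rule real_le_rsqrt, simp, rule real_le_rsqrt, simp, rule sqrt_sum_squares_le_sum, auto)

lemma graph_norm_tendsto_iff:
  "((\<lambda>s. graph_norm B (f s)) \<longlongrightarrow> 0) F \<longleftrightarrow> ((\<lambda>s. norm (f s)) \<longlongrightarrow> 0) F \<and> ((\<lambda>s. norm (B (f s))) \<longlongrightarrow> 0) F"
proof
  assume g: "((\<lambda>s. graph_norm B (f s)) \<longlongrightarrow> 0) F"
  show "((\<lambda>s. norm (f s)) \<longlongrightarrow> 0) F \<and> ((\<lambda>s. norm (B (f s))) \<longlongrightarrow> 0) F"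
    by (intro conjI tendsto_sandwich[OF _ _ tendsto_const g] always_eventually allI norm_ge_zero graph_norm_bounds)
next
  assume "((\<lambda>s. norm (f s)) \<longlongrightarrow> 0) F \<and> ((\<lambda>s. norm (B (f s))) \<longlongrightarrow> 0) F"
  then have g: "((\<lambda>s. norm (f s) + norm (B (f s))) \<longlongrightarrow> 0 + 0) F" by (intro tendsto_add) auto
  show "((\<lambda>s. graph_norm B (f s)) \<longlongrightarrow> 0) F"
    by (rule tendsto_sandwich[OF _ _ tendsto_const g[simplified]]) (auto intro!: always_eventually graph_norm_bounds)
qed

lemma tendsto_norm_cong:
  assumes t: "0 \<le> t" and eq: "\<And>s. 0 \<le> s \<Longrightarrow> s \<noteq> t \<Longrightarrow> f s = g s"
  shows "((\<lambda>s. norm (f s)) \<longlongrightarrow> 0) (at t within {0::real..}) \<longleftrightarrow> ((\<lambda>s. norm (g s)) \<longlongrightarrow> 0) (at t within {0..})"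
proof (rule tendsto_cong)
  show "eventually (\<lambda>s. norm (f s) = norm (g s)) (at t within {0..})"
    unfolding eventually_at by (rule exI[of _ 1]) (simp add: eq)
qed

locale kirchhoff = coercive_sqrt D DS A S P \<nu>
  for D DS :: "'h::{real_inner,complete_space} set" and A S P \<nu> +
  assumes DS: "DS = op_sqrt_dom D A" and S: "S = op_sqrt D A"
begin

lemma S_quotient:
  assumes "x \<in> DS" "y \<in> DS" "z \<in> DS"
  shows "S ((x - y) /\<^sub>R r - z) = (S x - S y) /\<^sub>R r - S z"
proof -
  have "0 \<in> DS" "S 0 = 0" using S_diff[OF assms(1) assms(1)] by simp_all
  then have "inverse r *\<^sub>R (x - y) \<in> DS" "S (inverse r *\<^sub>R (x - y)) = inverse r *\<^sub>R S (x - y)"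
    using S_lin[of 0 "x - y" "inverse r"] S_diff(1)[OF assms(1,2)] by simp_all
  then show ?thesis using S_diff(2)[OF _ assms(3), of "inverse r *\<^sub>R (x - y)"] S_diff(2)[OF assms(1,2)] by simp
qed

lemma kirchhoff_solutionI:
  assumes uD: "\<And>t. 0 \<le> t \<Longrightarrow> u t \<in> D" and vD: "\<And>t. 0 \<le> t \<Longrightarrow> v t \<in> DS"
    and du: "\<And>t. 0 \<le> t \<Longrightarrow> (u has_vector_derivative v t) (at t within {0..})"
    and dSu: "\<And>t. 0 \<le> t \<Longrightarrow> ((\<lambda>t. S (u t)) has_vector_derivative S (v t)) (at t within {0..})"
    and dv: "\<And>t. 0 \<le> t \<Longrightarrow> (v has_vector_derivative w t) (at t within {0..})"
    and Ac: "continuous_on {0..} (\<lambda>t. A (u t))" and Sc: "continuous_on {0..} (\<lambda>t. S (v t))" and wc: "continuous_on {0..} w"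
    and eq: "\<And>t. 0 \<le> t \<Longrightarrow> \<epsilon> *\<^sub>R w t + rate_weight 1 p t *\<^sub>R v t + m ((norm (S (u t)))\<^sup>2) *\<^sub>R A (u t) = 0"
    and init: "u 0 = u0" "v 0 = u1"
  shows "kirchhoff_solution D A m p u0 u1 \<epsilon> u" "\<And>t. 0 \<le> t \<Longrightarrow> dt u t = v t"
proof -
  show d1: "dt u t = v t" if "0 \<le> t" for t by (rule dt_eq[OF that du[OF that]])
  have ddu: "(dt u has_vector_derivative w t) (at t within {0..})" if t: "0 \<le> t" for t
    by (rule has_vector_derivative_transform[OF _ _ dv[OF t]]) (use t d1 in auto)
  have d2: "dt (dt u) t = w t" if "0 \<le> t" for t by (rule dt_eq[OF that ddu[OF that]])
  have C2: "C2_half_line u"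
    unfolding C2_half_line_def
  proof (intro conjI allI impI)
    show "u differentiable at t within {0..}" if "0 \<le> t" for t
      using du[OF that] by (rule differentiableI_vector)
    show "dt u differentiable at t within {0..}" if "0 \<le> t" for t
      using ddu[OF that] by (rule differentiableI_vector)
    show "continuous_on {0..} (dt (dt u))" using wc by (rule continuous_on_eq) (use d2 in auto)
  qed
  have cont0: "((\<lambda>s. norm (f s - f t)) \<longlongrightarrow> 0) (at t within {0..})" if "continuous_on {0..} f" "0 \<le> t"
    for f :: "real \<Rightarrow> 'h" and t
  proof -
    have "(f \<longlongrightarrow> f t) (at t within {0..})" using that unfolding continuous_on_def by simp
    then show ?thesis by (rule tendsto_norm_zero[OF LIM_zero])
  qed
  have uc: "continuous_on {0..} u" and vc: "continuous_on {0..} v"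
    unfolding continuous_on_eq_continuous_within
    using has_vector_derivative_continuous[OF du] has_vector_derivative_continuous[OF dv] by auto
  have C0A: "C0_graph D A u"
    unfolding C0_graph_def graph_norm_tendsto_iff
  proof (intro conjI allI impI uD)
    fix t :: real assume t: "0 \<le> t"
    show "((\<lambda>s. norm (u s - u t)) \<longlongrightarrow> 0) (at t within {0..})" by (rule cont0[OF uc t])
    show "((\<lambda>s. norm (A (u s - u t))) \<longlongrightarrow> 0) (at t within {0..})"
      using cont0[OF Ac t] by (subst tendsto_norm_cong[OF t]) (use A_diff(2)[OF uD uD] t in auto)
  qed
  have C0S: "C0_graph DS S v"
    unfolding C0_graph_def graph_norm_tendsto_iff
  proof (intro conjI allI impI vD)
    fix t :: real assume t: "0 \<le> t"
    show "((\<lambda>s. norm (v s - v t)) \<longlongrightarrow> 0) (at t within {0..})" by (rule cont0[OF vc t])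
    show "((\<lambda>s. norm (S (v s - v t))) \<longlongrightarrow> 0) (at t within {0..})"
      using cont0[OF Sc t] by (subst tendsto_norm_cong[OF t]) (use S_diff(2)[OF vD vD] t in auto)
  qed
  have "C1_graph DS S u"
    unfolding C1_graph_def graph_norm_tendsto_iff
  proof (intro conjI allI impI exI[of _ v] C0S)
    fix t :: real assume t: "0 \<le> t"
    show "u t \<in> DS" by (rule DDS[OF uD[OF t]])
    show "((\<lambda>s. norm ((u s - u t) /\<^sub>R (s - t) - v t)) \<longlongrightarrow> 0) (at t within {0..})"
      using du[OF t] unfolding difference_quotient_tendsto_iff .
    show "((\<lambda>s. norm (S ((u s - u t) /\<^sub>R (s - t) - v t))) \<longlongrightarrow> 0) (at t within {0..})"
      using dSu[OF t] unfolding difference_quotient_tendsto_iff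
      by (subst tendsto_norm_cong[OF t]) (use S_quotient[OF DDS[OF uD] DDS[OF uD] vD] t in auto)
  qed
  then show "kirchhoff_solution D A m p u0 u1 \<epsilon> u"
    unfolding kirchhoff_solution_def DS[symmetric] S[symmetric]
    using C2 C0A init d1 d2 eq by (auto simp: rate_weight_def powr_minus_divide)
qed

text \<open>Unpacks a solution into the hypotheses of \<open>difference_estimate\<close>; in
  particular \<open>S u\<close> is differentiable with derivative \<open>S\<close> applied to
  \<open>dt u\<close>.\<close>

lemma kirchhoff_solutionD:
  assumes "kirchhoff_solution D A m p u0 u1 \<epsilon> u" and t: "0 \<le> t"
  shows "u t \<in> D" "dt u t \<in> DS" "(u has_vector_derivative dt u t) (at t within {0..})"
    "((\<lambda>t. S (u t)) has_vector_derivative S (dt u t)) (at t within {0..})"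
    "(dt u has_vector_derivative dt (dt u) t) (at t within {0..})"
    "((\<lambda>t. A (u t)) \<longlongrightarrow> A (u t)) (at t within {0..})"
    "\<epsilon> *\<^sub>R dt (dt u) t + rate_weight 1 p t *\<^sub>R dt u t + m ((norm (S (u t)))\<^sup>2) *\<^sub>R A (u t) = 0"
    "u 0 = u0" "dt u 0 = u1"
proof -
  note ks = assms(1)[unfolded kirchhoff_solution_def DS[symmetric] S[symmetric]]
  have C0: "C0_graph D A u" and C1: "C1_graph DS S u" and C2: "C2_half_line u" using ks by blast+
  have uD: "\<And>t. 0 \<le> t \<Longrightarrow> u t \<in> D" using C0 unfolding C0_graph_def by blast
  then show "u t \<in> D" using t by blast
  obtain v where v: "C0_graph DS S v"
    "\<And>t. 0 \<le> t \<Longrightarrow> ((\<lambda>s. graph_norm S ((u s - u t) /\<^sub>R (s - t) - v t)) \<longlongrightarrow> 0) (at t within {0..})"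
    using C1 unfolding C1_graph_def by blast
  have vD: "v t \<in> DS" using v(1) t unfolding C0_graph_def by blast
  note v2 = v(2)[OF t, unfolded graph_norm_tendsto_iff]
  have du: "(u has_vector_derivative v t) (at t within {0..})"
    using v2 unfolding difference_quotient_tendsto_iff by blast
  \<comment> \<open>The witness hidden in \<open>C1_graph\<close> is also a derivative in the weaker
    norm, and derivatives on the half-line are unique.\<close>
  have dv: "dt u t = v t" by (rule dt_eq[OF t du])
  show "dt u t \<in> DS" using vD dv by simp
  show "(u has_vector_derivative dt u t) (at t within {0..})" using du dv by simp
  have "((\<lambda>s. norm (S ((u s - u t) /\<^sub>R (s - t) - v t))) \<longlongrightarrow> 0) (at t within {0..})" using v2 by blast
  then have "((\<lambda>t. S (u t)) has_vector_derivative S (v t)) (at t within {0..})"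
    unfolding difference_quotient_tendsto_iff
    by (subst (asm) tendsto_norm_cong[OF t]) (use S_quotient[OF DDS[OF uD] DDS[OF uD] vD] t in auto)
  then show "((\<lambda>t. S (u t)) has_vector_derivative S (dt u t)) (at t within {0..})" using dv by simp
  show "(dt u has_vector_derivative dt (dt u) t) (at t within {0..})"
    using C2 t unfolding C2_half_line_def dt_def[of "dt u"] by (simp add: vector_derivative_works)
  have "((\<lambda>s. norm (A (u s - u t))) \<longlongrightarrow> 0) (at t within {0..})"
    using C0 t unfolding C0_graph_def graph_norm_tendsto_iff by blast
  then have "((\<lambda>s. norm (A (u s) - A (u t))) \<longlongrightarrow> 0) (at t within {0..})"
    by (subst (asm) tendsto_norm_cong[OF t]) (use A_diff(2)[OF uD uD] t in auto)
  then show "((\<lambda>t. A (u t)) \<longlongrightarrow> A (u t)) (at t within {0..})"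
    using tendsto_norm_zero_iff LIM_zero_iff by blast
  show "\<epsilon> *\<^sub>R dt (dt u) t + rate_weight 1 p t *\<^sub>R dt u t + m ((norm (S (u t)))\<^sup>2) *\<^sub>R A (u t) = 0"
    using ks t by (simp add: rate_weight_def powr_minus_divide)
  show "u 0 = u0" "dt u 0 = u1" using ks by blast+
qed

lemma norm_bounded_on_interval:
  fixes f :: "real \<Rightarrow> 'h"
  assumes "\<And>t. 0 \<le> t \<Longrightarrow> (f \<longlongrightarrow> f t) (at t within {0..})"
  shows "\<exists>c\<ge>0. \<forall>t\<in>{0..T}. norm (f t) \<le> c"
proof -
  have "continuous_on {0..} f" using assms unfolding continuous_on_def by simp
  then have "continuous_on {0..T} f" by (rule continuous_on_subset) auto
  then have "bounded (f ` {0..T})" by (intro compact_imp_bounded compact_continuous_image) auto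
  then obtain c where "\<forall>x\<in>f ` {0..T}. norm x \<le> c" unfolding bounded_iff by blast
  then show ?thesis by (intro exI[of _ "max c 0"]) (auto simp: le_max_iff_disj)
qed

text \<open>On \<open>[0, T]\<close> continuity bounds both solutions, so \<open>m\<close> matters
  only on a compact interval, where it is Lipschitz. Equal initial data make the right-hand side of
  \<open>difference_estimate\<close> vanish.\<close>

theorem kirchhoff_unique:
  assumes m: "locally_lipschitz_on {0..} m" "\<And>\<sigma>. 0 \<le> \<sigma> \<Longrightarrow> \<mu> \<le> m \<sigma>" "0 < \<mu>" and eps: "0 < \<epsilon>"
    and u: "kirchhoff_solution D A m p u0 u1 \<epsilon> u" and v: "kirchhoff_solution D A m p u0 u1 \<epsilon> v" and T: "0 \<le> T"
  shows "v T = u T"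
proof -
  note uD = kirchhoff_solutionD[OF u] and vD = kirchhoff_solutionD[OF v]
  have vd: "(f \<longlongrightarrow> f t) (at t within {0..})" if "(f has_vector_derivative f') (at t within {0..})" for f f' t
    using has_vector_derivative_continuous[OF that] by (simp add: continuous_within)
  obtain c1 where c1: "0 \<le> c1" "\<forall>t\<in>{0..T}. norm (A (u t)) \<le> c1" using norm_bounded_on_interval[OF uD(6), of T] by auto
  obtain c2 where c2: "0 \<le> c2" "\<forall>t\<in>{0..T}. norm (A (v t)) \<le> c2" using norm_bounded_on_interval[OF vD(6), of T] by auto
  obtain c3 where c3: "0 \<le> c3" "\<forall>t\<in>{0..T}. norm (dt u t) \<le> c3" using norm_bounded_on_interval[OF vd[OF uD(5)], of T] by auto
  obtain c4 where c4: "0 \<le> c4" "\<forall>t\<in>{0..T}. norm (S (u t)) \<le> c4" using norm_bounded_on_interval[OF vd[OF uD(4)], of T] by auto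
  obtain c5 where c5: "0 \<le> c5" "\<forall>t\<in>{0..T}. norm (S (v t)) \<le> c5" using norm_bounded_on_interval[OF vd[OF vD(4)], of T] by auto
  define K where "K = c1 + c2 + c3"
  define r where "r = c4 + c5"
  obtain L where L: "0 \<le> L" "\<forall>\<sigma>\<in>{0..r\<^sup>2}. \<forall>\<tau>\<in>{0..r\<^sup>2}. \<bar>m \<sigma> - m \<tau>\<bar> \<le> L * \<bar>\<sigma> - \<tau>\<bar>"
    using lipschitz_on_interval[OF m(1)] by blast
  have bound: "norm x \<le> a + b" if "norm x \<le> a" "0 \<le> b" for x :: 'h and a b using that by linarith
  have Kb: "norm (A (u t)) \<le> K" "norm (A (v t)) \<le> K" "norm (dt u t) \<le> K" "norm (S (u t)) \<le> r" "norm (S (v t)) \<le> r" if "0 \<le> t" "t \<le> T" for t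
  proof -
    have t: "t \<in> {0..T}" using that by simp
    show "norm (A (u t)) \<le> K" "norm (A (v t)) \<le> K" "norm (dt u t) \<le> K" "norm (S (u t)) \<le> r" "norm (S (v t)) \<le> r"
      using bspec[OF c1(2) t] bspec[OF c2(2) t] bspec[OF c3(2) t] bspec[OF c4(2) t] bspec[OF c5(2) t] c1(1) c2(1) c3(1) c4(1) c5(1)
      unfolding K_def r_def by linarith+
  qed
  have K0: "0 \<le> K" "0 \<le> r" using c1 c2 c3 c4 c5 by (simp_all add: K_def r_def)
  have z: "(0::real) \<le> 0" by simp
  have "\<epsilon> * (norm (dt u T - dt v T))\<^sup>2 + \<mu> * (norm (S (u T) - S (v T)))\<^sup>2
    \<le> exp ((2 * L * r * K + 2 * L * K\<^sup>2) * (1 / \<epsilon> + 1 / \<mu>) * T)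
       * (\<epsilon> * (norm (dt u 0 - dt v 0))\<^sup>2 + m ((norm (S (u 0)))\<^sup>2) * (norm (S (u 0) - S (v 0)))\<^sup>2)"
  proof (rule difference_estimate[OF T eps m(3) L(1) K0(2) K0(1), where b="rate_weight 1 p" and ?w1.0="dt (dt u)" and ?w2.0="dt (dt v)"])
    show "0 \<le> rate_weight 1 p t" for t by (simp add: rate_weight_def)
    show "\<mu> \<le> m \<sigma>" if "0 \<le> \<sigma>" "\<sigma> \<le> r\<^sup>2" for \<sigma> by (rule m(2)[OF that(1)])
    show "\<bar>m \<sigma> - m \<tau>\<bar> \<le> L * \<bar>\<sigma> - \<tau>\<bar>" if "0 \<le> \<sigma>" "\<sigma> \<le> r\<^sup>2" "0 \<le> \<tau>" "\<tau> \<le> r\<^sup>2" for \<sigma> \<tau>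
      using L(2)[rule_format, of \<sigma> \<tau>] that by simp
  qed (fact uD vD Kb)+
  also have "\<dots> = 0" using uD(8,9)[OF z] vD(8,9)[OF z] by simp
  finally have "\<epsilon> * (norm (dt u T - dt v T))\<^sup>2 + \<mu> * (norm (S (u T) - S (v T)))\<^sup>2 \<le> 0" .
  moreover have "0 \<le> \<epsilon> * (norm (dt u T - dt v T))\<^sup>2" using eps by simp
  ultimately have "\<mu> * (norm (S (u T) - S (v T)))\<^sup>2 \<le> 0" by linarith
  then have "(norm (S (u T) - S (v T)))\<^sup>2 \<le> 0" using m(3) by (simp add: mult_le_0_iff)
  then have Sz: "S (u T) - S (v T) = 0" by simp
  have dS: "u T - v T \<in> DS" "S (u T - v T) = 0"
    using S_diff[OF DDS[OF uD(1)[OF T]] DDS[OF vD(1)[OF T]]] Sz by simp_all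
  have "\<nu> * (norm (u T - v T))\<^sup>2 \<le> 0" using S_lower[OF dS(1)] dS(2) by simp
  then have "(norm (u T - v T))\<^sup>2 \<le> 0" using nu_pos by (simp add: mult_le_0_iff)
  then show ?thesis by simp
qed

text \<open>Bounds valid as long as the rate condition has held before \<open>T\<close>, with
  constants independent of \<open>n\<close> and of epsilon. The single hypothesis
  \<open>small\<close> bundles all smallness conditions of \<open>F_decay\<close>, with margin
  \<open>\<eta> = 1\<close>, and of \<open>v_decay\<close>.\<close>

lemma truncated_decay:
  assumes ts: "truncated_solution D DS A S P \<nu> n m \<mu> M L \<epsilon> (rate_weight 1 p) (rate_weight' 1 p) u v w"
    and init: "u 0 = P n u0" "v 0 = P n u1" and u0: "u0 \<in> D" and u1: "u1 \<in> DS"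
    and p: "0 \<le> p" "p \<le> 1" and K: "1 \<le> K" and par: "0 \<le> \<beta>" "0 < \<gamma>"
    and gm: "\<beta> * (1 + \<gamma> * K powr (- p) / \<nu>) + 1 \<le> 2 * \<gamma> * \<mu>"
    and small: "\<epsilon> * (1 + 2 * \<gamma> * M + \<beta> + M * (\<gamma> * (1 + \<beta>))\<^sup>2 / \<nu> + 4 * \<gamma>\<^sup>2 * M / \<nu> + 2 * \<beta>) \<le> 1"
    and T: "0 \<le> T"
    and rate: "\<And>t. 0 \<le> t \<Longrightarrow> t < T \<Longrightarrow> 2 * \<epsilon> * L * (norm (A (u t)) * norm (v t)) \<le> \<mu> * rate_weight 1 p t"
    and E: "E = (norm (A u0))\<^sup>2 + (norm (S u1))\<^sup>2 / \<mu>"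
    and C1: "C1 = 2 * (2 + \<gamma> / \<nu>) * E" and C2: "C2 = 2 * M\<^sup>2 * C1 + (norm u1)\<^sup>2"
  shows "(norm (A (u T)))\<^sup>2 \<le> C1 * exp (- \<beta> * rate_primitive K p T)"
    "\<epsilon> * (norm (S (v T)))\<^sup>2 \<le> M * C1 * exp (- \<beta> * rate_primitive K p T)"
    "(norm (v T))\<^sup>2 \<le> C2 * exp (- \<beta> * rate_primitive K p T) / (rate_weight 1 p T)\<^sup>2"
proof -
  interpret ts: truncated_solution D DS A S P \<nu> n m \<mu> M L \<epsilon> "rate_weight 1 p" "rate_weight' 1 p" u v w by (rule ts)
  note pos = ts.pos
  have M: "0 < M" using ts.c_bounds[of 0] by linarith
  let ?Q = "rate_primitive K p"
  have nn: "0 \<le> 2 * \<gamma> * M" "0 \<le> M * (\<gamma> * (1 + \<beta>))\<^sup>2 / \<nu>" "0 \<le> 4 * \<gamma>\<^sup>2 * M / \<nu>" "0 \<le> \<beta>"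
    using M par nu_pos by simp_all
  \<comment> \<open>Every required smallness condition concerns a part of the sum in
    \<open>small\<close>, whose summands are nonnegative.\<close>
  have sm: "\<epsilon> * x \<le> 1" if "x \<le> 1 + 2 * \<gamma> * M + \<beta> + M * (\<gamma> * (1 + \<beta>))\<^sup>2 / \<nu> + 4 * \<gamma>\<^sup>2 * M / \<nu> + 2 * \<beta>" for x
    using mult_left_mono[OF that, of \<epsilon>] pos small by linarith
  have e1: "\<epsilon> \<le> 1" using sm[of 1] nn by simp
  have e2: "\<epsilon> * (2 * \<gamma> * M + \<beta> + M * (\<gamma> * (1 + \<beta>))\<^sup>2 / (1 * \<nu>)) \<le> 1" using nn by (intro sm) simp
  have e3: "4 * \<gamma>\<^sup>2 * \<epsilon> * M \<le> \<nu>"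
  proof -
    have "\<epsilon> * (4 * \<gamma>\<^sup>2 * M / \<nu>) \<le> 1" using nn by (intro sm) linarith
    then show ?thesis using nu_pos by (simp add: field_simps)
  qed
  have "\<epsilon> * (2 * \<beta>) \<le> 1" using nn by (intro sm) linarith
  then have e4: "\<beta> * \<epsilon> \<le> 1 / 2" using mult.commute[of \<beta> \<epsilon>] by linarith
  have bq: "rate_weight 1 p t * rate_weight K p t \<le> K powr (- p)" if t: "0 \<le> t" for t
  proof -
    have "rate_weight 1 p t * rate_weight K p t \<le> 1 * K powr (- p)"
      using rate_weight_le_1[OF K p t] rate_weight_le_start[OF K p t] rate_weight_pos[OF K p t] by (intro mult_mono) auto
    then show ?thesis by simp
  qed
  have rT: "ts.rate t" if "t \<le> T" for t unfolding ts.rate_def using rate that by simp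
  have F0: "ts.F 0 0 0 \<le> E"
  proof -
    have "1 / ts.c 0 * (\<epsilon> * (norm (S (P n u1)))\<^sup>2) \<le> 1 / \<mu> * (1 * (norm (S u1))\<^sup>2)"
      unfolding SP[OF u1] using ts.c_bounds[of 0] pos e1
      by (intro mult_mono divide_left_mono power_mono P_norm) auto
    moreover have "(norm (A (P n u0)))\<^sup>2 \<le> (norm (A u0))\<^sup>2" unfolding AP[OF u0] by (intro power_mono P_norm) simp
    ultimately have "(norm (A (P n u0)))\<^sup>2 + 1 / ts.c 0 * (\<epsilon> * (norm (S (P n u1)))\<^sup>2) \<le> (norm (A u0))\<^sup>2 + 1 / \<mu> * (1 * (norm (S u1))\<^sup>2)"
      by (rule add_mono[rotated])
    then show ?thesis unfolding ts.F_0 init E by simp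
  qed
  have Fd: "ts.F 0 0 t * exp (\<beta> * ?Q t) \<le> C1" if t: "0 \<le> t" "t \<le> T" for t
  proof -
    have "ts.F 0 0 t * exp (\<beta> * ?Q t) \<le> 2 * (2 + \<gamma> / \<nu>) * ts.F 0 0 0"
      by (rule ts.F_decay[OF t(1) rT[OF t(2)] rate_weight_pos[OF K p] rate_weight_le[OF K p] bq
          rate_weight'_nonpos[OF K p] rate_weight'_ge[OF K p] rate_weight_derivative[OF K p]
          rate_primitive_derivative[OF K p] rate_primitive_0[OF K p] par(1,2) zero_less_one gm e1 e2 e3])
    also have "\<dots> \<le> C1" unfolding C1 using F0 par nu_pos by (intro mult_left_mono) (auto intro: add_nonneg_nonneg)
    finally show ?thesis .
  qed
  have part: "(norm (A (u t)))\<^sup>2 \<le> ts.F 0 0 t" "\<epsilon> * (norm (S (v t)))\<^sup>2 \<le> M * ts.F 0 0 t" for t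
  proof -
    have c: "0 < ts.c t" "ts.c t \<le> M" by (rule ts.c_bounds)+
    have y: "0 \<le> 1 / ts.c t * (\<epsilon> * (norm (S (v t)))\<^sup>2)" using c pos by simp
    show "(norm (A (u t)))\<^sup>2 \<le> ts.F 0 0 t" unfolding ts.F_0 using y by simp
    have "\<epsilon> * (norm (S (v t)))\<^sup>2 = ts.c t * (1 / ts.c t * (\<epsilon> * (norm (S (v t)))\<^sup>2))" using c by simp
    also have "\<dots> \<le> M * (1 / ts.c t * (\<epsilon> * (norm (S (v t)))\<^sup>2))" using c y by (intro mult_right_mono) auto
    also have "\<dots> \<le> M * ts.F 0 0 t" unfolding ts.F_0 using M by (intro mult_left_mono) auto
    finally show "\<epsilon> * (norm (S (v t)))\<^sup>2 \<le> M * ts.F 0 0 t" .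
  qed
  have toexp: "x \<le> c * exp (- \<beta> * ?Q t)" if "x * exp (\<beta> * ?Q t) \<le> c" for x c t
    using that by (simp add: exp_minus field_simps)
  have FT: "ts.F 0 0 T \<le> C1 * exp (- \<beta> * ?Q T)" by (rule toexp[OF Fd[OF T order_refl]])
  show "(norm (A (u T)))\<^sup>2 \<le> C1 * exp (- \<beta> * ?Q T)" using part(1) FT by (rule order_trans)
  have "M * ts.F 0 0 T \<le> M * (C1 * exp (- \<beta> * ?Q T))" using FT M by (intro mult_left_mono) auto
  then show "\<epsilon> * (norm (S (v T)))\<^sup>2 \<le> M * C1 * exp (- \<beta> * ?Q T)" using part(2)[of T] by (simp add: mult.assoc)
  have E0: "0 \<le> E" unfolding E using pos by simp
  have C10: "0 \<le> C1" unfolding C1 using E0 par nu_pos by (intro mult_nonneg_nonneg add_nonneg_nonneg) auto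
  have one: "(1::real) \<le> 1" by simp
  have "(norm (v T))\<^sup>2 * (rate_weight 1 p T)\<^sup>2 * exp (\<beta> * ?Q T) \<le> 2 * M\<^sup>2 * C1 + (norm (v 0))\<^sup>2"
  \<comment> \<open>The integrating factor needs a primitive of the damping itself, hence
    \<open>rate_primitive 1 p\<close>, while the decay is measured with the delayed
    \<open>K\<close>.\<close>
  proof (rule ts.v_decay[OF T rate_weight_pos[OF K p] rate_weight_le[OF K p] rate_primitive_derivative[OF K p]
        rate_primitive_0[OF K p] rate_primitive_derivative[OF one p] _ par(1) e4 _ C10])
    show "rate_primitive 1 p 0 \<le> rate_primitive 1 p T"
      using rate_primitive_nonneg[OF one p T] rate_primitive_0[OF one p] by simp
    fix t assume t: "0 \<le> t" "t < T"
    have "(norm (A (u t)))\<^sup>2 * exp (\<beta> * ?Q t) \<le> ts.F 0 0 t * exp (\<beta> * ?Q t)" by (rule mult_right_mono[OF part(1)]) simp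
    also have "\<dots> \<le> C1" using t by (intro Fd) auto
    finally show "(norm (A (u t)))\<^sup>2 * exp (\<beta> * ?Q t) \<le> C1" .
  qed
  also have "\<dots> \<le> C2" unfolding C2 init by (intro add_left_mono power_mono P_norm) simp
  finally have "(norm (v T))\<^sup>2 * (rate_weight 1 p T)\<^sup>2 \<le> C2 * exp (- \<beta> * ?Q T)" by (rule toexp)
  then show "(norm (v T))\<^sup>2 \<le> C2 * exp (- \<beta> * ?Q T) / (rate_weight 1 p T)\<^sup>2"
    using rate_weight_pos[OF one p T] by (simp add: le_divide_eq)
qed

text \<open>Decay like \<open>exp (- 2 Q)\<close> already dominates the square of the damping, since \<open>exp (- Q) \<le> K (1 + t)\<^bsup>-p\<^esup>\<close>.\<close>

lemma truncated_rate:
  assumes ts: "truncated_solution D DS A S P \<nu> n m \<mu> M L \<epsilon> (rate_weight 1 p) (rate_weight' 1 p) u v w"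
    and init: "u 0 = P n u0" "v 0 = P n u1" and u0: "u0 \<in> D" and u1: "u1 \<in> DS"
    and p: "0 \<le> p" "p \<le> 1" and K: "1 \<le> K" and par: "0 \<le> \<beta>" "0 < \<gamma>" "p \<noteq> 0 \<Longrightarrow> \<beta> = 2"
    and gm: "\<beta> * (1 + \<gamma> * K powr (- p) / \<nu>) + 1 \<le> 2 * \<gamma> * \<mu>"
    and small: "\<epsilon> * (1 + 2 * \<gamma> * M + \<beta> + M * (\<gamma> * (1 + \<beta>))\<^sup>2 / \<nu> + 4 * \<gamma>\<^sup>2 * M / \<nu> + 2 * \<beta>) \<le> 1"
    and E: "E = (norm (A u0))\<^sup>2 + (norm (S u1))\<^sup>2 / \<mu>"
    and C1: "C1 = 2 * (2 + \<gamma> / \<nu>) * E" and C2: "C2 = 2 * M\<^sup>2 * C1 + (norm u1)\<^sup>2"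
    and small2: "\<epsilon> * (2 * L * sqrt (C1 * C2) * K\<^sup>2 / \<mu>) < 1"
    and t: "0 \<le> t"
  shows "2 * \<epsilon> * L * (norm (A (u t)) * norm (v t)) < \<mu> * rate_weight 1 p t"
proof -
  interpret ts: truncated_solution D DS A S P \<nu> n m \<mu> M L \<epsilon> "rate_weight 1 p" "rate_weight' 1 p" u v w by (rule ts)
  note pos = ts.pos
  have one: "(1::real) \<le> 1" by simp
  let ?b = "rate_weight 1 p" and ?Q = "rate_primitive K p"
  show ?thesis
  proof (rule continuation_principle[where h="\<lambda>t. 2 * \<epsilon> * L * (norm (A (u t)) * norm (v t))" and k="\<lambda>t. \<mu> * ?b t", OF _ _ _ t])
    show "continuous_on {0..} (\<lambda>t. 2 * \<epsilon> * L * (norm (A (u t)) * norm (v t)))"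
      by (intro continuous_intros ts.cont_of_deriv[OF ts.dAu] ts.cont_of_deriv[OF ts.dv])
    have "continuous_on {0..} ?b" unfolding continuous_on_eq_continuous_within using DERIV_continuous[OF ts.db] by auto
    then show "continuous_on {0..} (\<lambda>t. \<mu> * ?b t)" by (intro continuous_intros)
    fix T :: real assume T: "0 \<le> T" and H: "\<And>t. 0 \<le> t \<Longrightarrow> t < T \<Longrightarrow> 2 * \<epsilon> * L * (norm (A (u t)) * norm (v t)) \<le> \<mu> * ?b t"
    note dec = truncated_decay[OF ts init u0 u1 p K par(1,2) gm small T H E C1 C2]
    let ?e = "exp (- \<beta> * ?Q T)"
    have b: "0 < ?b T" by (rule rate_weight_pos[OF one p T])
    have C10: "0 \<le> C1" using dec(1) zero_le_power2[of "norm (A (u T))"] by (metis exp_gt_zero order_trans zero_le_mult_iff not_less)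
    have C20: "0 \<le> C2" unfolding C2 using C10 by simp
    have "(norm (A (u T)) * norm (v T))\<^sup>2 \<le> (C1 * ?e) * (C2 * ?e / (?b T)\<^sup>2)"
      unfolding power_mult_distrib using dec(1,3) by (intro mult_mono) (auto intro: order_trans[OF zero_le_power2])
    also have "\<dots> = (sqrt (C1 * C2) * ?e / ?b T)\<^sup>2"
      using C10 C20 by (simp add: power_mult_distrib power_divide power2_eq_square)
    finally have prod: "norm (A (u T)) * norm (v T) \<le> sqrt (C1 * C2) * ?e / ?b T"
      by (rule power2_le_imp_le) (use C10 C20 b in simp)
    \<comment> \<open>For \<open>p = 0\<close> the damping is 1 and any nonnegative rate will do;
      for \<open>p > 0\<close> the rate 2 is exactly what dominates the square of the
      damping.\<close>
    have eb: "?e \<le> K\<^sup>2 * (?b T)\<^sup>2"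
    proof (cases "p = 0")
      case True
      have "?e \<le> 1" using par(1) rate_primitive_nonneg[OF K p T] by simp
      also have "1 \<le> K\<^sup>2 * (?b T)\<^sup>2" using K T True by (simp add: rate_weight_def one_le_power)
      finally show ?thesis .
    next
      case False
      have "1 / ?b T \<le> K * exp (?Q T)" by (rule inverse_rate_weight_le[OF K p T])
      then have "exp (- ?Q T) \<le> K * ?b T" using b by (simp add: exp_minus field_simps)
      then have "(exp (- ?Q T))\<^sup>2 \<le> (K * ?b T)\<^sup>2" by (rule power_mono) simp
      moreover have "(exp (- ?Q T))\<^sup>2 = ?e" using par(3)[OF False] by (simp add: exp_double[symmetric])
      ultimately show ?thesis by (simp add: power_mult_distrib)
    qed
    \<comment> \<open>The decay gains two factors of the damping and \<open>v_decay\<close> loses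
      one, so one factor is left to compare with the right-hand side of the rate condition.\<close>
    have "2 * \<epsilon> * L * (norm (A (u T)) * norm (v T)) \<le> 2 * \<epsilon> * L * (sqrt (C1 * C2) * (K\<^sup>2 * (?b T)\<^sup>2) / ?b T)"
    proof (intro mult_left_mono order_trans[OF prod])
      show "sqrt (C1 * C2) * ?e / ?b T \<le> sqrt (C1 * C2) * (K\<^sup>2 * (?b T)\<^sup>2) / ?b T"
        using eb b C10 C20 by (intro divide_right_mono mult_left_mono) auto
    qed (use pos in simp)
    also have "\<dots> = (\<epsilon> * (2 * L * sqrt (C1 * C2) * K\<^sup>2 / \<mu>)) * (\<mu> * ?b T)"
      using b pos by (simp add: power2_eq_square)
    also have "\<dots> < 1 * (\<mu> * ?b T)" using small2 b pos by (intro mult_strict_right_mono) auto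
    finally show "2 * \<epsilon> * L * (norm (A (u T)) * norm (v T)) < \<mu> * ?b T" by simp
  qed
qed

text \<open>The energy bound confines \<open>|A\<^bsup>1/2\<^esup>u|\<^sup>2\<close> to \<open>[0, R\<^sup>2]\<close>, so \<open>m\<close> may be replaced by its composition with
  the projection onto this interval, which is globally Lipschitz.\<close>

theorem global_solution_decay:
  assumes u0: "u0 \<in> D" and u1: "u1 \<in> DS" and p: "0 \<le> p" "p \<le> 1"
    and m: "locally_lipschitz_on {0..} m" "\<And>\<sigma>. 0 \<le> \<sigma> \<Longrightarrow> \<mu> \<le> m \<sigma>" "0 < \<mu>"
    and beta: "0 \<le> \<beta>" "p = 0 \<Longrightarrow> \<beta> < 2 * \<mu> * \<nu>"
  shows "\<exists>K\<ge>1. \<exists>C\<ge>0. \<exists>\<epsilon>1>0. \<forall>\<epsilon>\<in>{0<..<\<epsilon>1}. \<exists>u. kirchhoff_solution D A m p u0 u1 \<epsilon> u \<and>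
     (\<forall>t\<ge>0. Gamma_energy D A \<epsilon> u t \<le> C * exp (- \<beta> * rate_primitive K p t) / (rate_weight 1 p t)\<^sup>2)"
proof -
  \<comment> \<open>Bounds the initial energy for all \<open>\<epsilon> \<le> 1\<close> without
    depending on \<open>\<epsilon>\<close>; then \<open>E / \<nu>\<close> bounds the argument of
    \<open>m\<close> at all times.\<close>
  define E where "E = (norm (A u0))\<^sup>2 + (norm (S u1))\<^sup>2 / \<mu>"
  have E0: "0 \<le> E" unfolding E_def using m(3) by simp
  define R where "R = sqrt (E / \<nu>)"
  have R: "0 \<le> R" "R\<^sup>2 = E / \<nu>" unfolding R_def using E0 nu_pos by simp_all
  obtain L where L: "0 \<le> L" "\<forall>\<sigma>\<in>{0..R\<^sup>2}. \<forall>\<tau>\<in>{0..R\<^sup>2}. \<bar>m \<sigma> - m \<tau>\<bar> \<le> L * \<bar>\<sigma> - \<tau>\<bar>"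
    using lipschitz_on_interval[OF m(1)] by blast
  define clip where "clip \<sigma> = min (max \<sigma> 0) (R\<^sup>2)" for \<sigma>
  have clip: "0 \<le> clip \<sigma>" "clip \<sigma> \<le> R\<^sup>2" "\<bar>clip \<sigma> - clip \<tau>\<bar> \<le> \<bar>\<sigma> - \<tau>\<bar>" for \<sigma> \<tau>
    unfolding clip_def by (auto simp: min_def max_def)
  define mR where "mR \<sigma> = m (clip \<sigma>)" for \<sigma>
  define M where "M = m 0 + L * R\<^sup>2"
  have mR1: "\<mu> \<le> mR \<sigma>" for \<sigma> unfolding mR_def by (rule m(2)[OF clip(1)])
  have mRL: "\<bar>mR \<sigma> - mR \<tau>\<bar> \<le> L * \<bar>\<sigma> - \<tau>\<bar>" for \<sigma> \<tau>
  proof -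
    have "\<bar>mR \<sigma> - mR \<tau>\<bar> \<le> L * \<bar>clip \<sigma> - clip \<tau>\<bar>" unfolding mR_def using L(2) clip(1,2) by simp
    also have "\<dots> \<le> L * \<bar>\<sigma> - \<tau>\<bar>" by (rule mult_left_mono[OF clip(3) L(1)])
    finally show ?thesis .
  qed
  have mR2: "mR \<sigma> \<le> M" for \<sigma>
  proof -
    have "\<bar>m (clip \<sigma>) - m 0\<bar> \<le> L * \<bar>clip \<sigma> - 0\<bar>"
      by (rule L(2)[rule_format]) (use clip(1,2)[of \<sigma>] in auto)
    also have "\<dots> \<le> L * R\<^sup>2" using clip(1,2)[of \<sigma>] L(1) by (intro mult_left_mono) auto
    finally show ?thesis unfolding mR_def M_def by linarith
  qed
  have mR3: "mR \<sigma> = mR (R\<^sup>2)" if "R\<^sup>2 \<le> \<sigma>" for \<sigma>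
  proof -
    have "0 \<le> \<sigma>" using that zero_le_power2 order_trans by blast
    then show ?thesis using that unfolding mR_def clip_def by (simp add: max_def min_def)
  qed
  have mR4: "mR \<sigma> = m \<sigma>" if "0 \<le> \<sigma>" "\<sigma> \<le> R\<^sup>2" for \<sigma>
    using that unfolding mR_def clip_def by (simp add: max_def min_def)
  have M: "0 < M" using mR1[of 0] mR2[of 0] m(3) by linarith
  \<comment> \<open>The rate used for existence only: half of the threshold if \<open>p = 0\<close>,
    otherwise the value 2 demanded by \<open>truncated_rate\<close>.\<close>
  define \<beta>0 where "\<beta>0 = (if p = 0 then \<mu> * \<nu> else 2)"
  have b0: "0 \<le> \<beta>0" "p = 0 \<Longrightarrow> \<beta>0 < 2 * \<mu> * \<nu>" "p \<noteq> 0 \<Longrightarrow> \<beta>0 = 2" using m(3) nu_pos by (simp_all add: \<beta>0_def)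
  obtain \<gamma>0 K0 where g0: "0 < \<gamma>0" "1 \<le> K0" "\<beta>0 * (1 + \<gamma>0 * K0 powr (- p) / \<nu>) + 1 \<le> 2 * \<gamma>0 * \<mu>"
    using decay_parameters_exist[OF p m(3) nu_pos b0(1,2)] by blast
  obtain \<gamma> K where g: "0 < \<gamma>" "1 \<le> K" "\<beta> * (1 + \<gamma> * K powr (- p) / \<nu>) + 1 \<le> 2 * \<gamma> * \<mu>"
    using decay_parameters_exist[OF p m(3) nu_pos beta] by blast
  define \<Theta> where "\<Theta> \<gamma> \<beta> = 1 + 2 * \<gamma> * M + \<beta> + M * (\<gamma> * (1 + \<beta>))\<^sup>2 / \<nu> + 4 * \<gamma>\<^sup>2 * M / \<nu> + 2 * \<beta>" for \<gamma> \<beta>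
  have Th: "1 \<le> \<Theta> \<gamma> \<beta>" if "0 < \<gamma>" "0 \<le> \<beta>" for \<gamma> \<beta>
  proof -
    have "0 \<le> 2 * \<gamma> * M" "0 \<le> M * (\<gamma> * (1 + \<beta>))\<^sup>2 / \<nu>" "0 \<le> 4 * \<gamma>\<^sup>2 * M / \<nu>" using M that nu_pos by simp_all
    then show ?thesis unfolding \<Theta>_def using that by linarith
  qed
  define C1 where "C1 \<gamma> = 2 * (2 + \<gamma> / \<nu>) * E" for \<gamma>
  define C2 where "C2 \<gamma> = 2 * M\<^sup>2 * C1 \<gamma> + (norm u1)\<^sup>2" for \<gamma>
  have C10: "0 \<le> C1 \<gamma>" if "0 < \<gamma>" for \<gamma> unfolding C1_def using E0 nu_pos that by (intro mult_nonneg_nonneg add_nonneg_nonneg) auto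
  have C20: "0 \<le> C2 \<gamma>" if "0 < \<gamma>" for \<gamma> unfolding C2_def using C10[OF that] by simp
  define \<Xi> where "\<Xi> = 2 * L * sqrt (C1 \<gamma>0 * C2 \<gamma>0) * K0\<^sup>2 / \<mu>"
  have Xi: "0 \<le> \<Xi>" unfolding \<Xi>_def using L(1) C10[OF g0(1)] C20[OF g0(1)] m(3) by simp
  \<comment> \<open>The summands are nonnegative, so for \<open>\<epsilon> < \<epsilon>1\<close>
    each of them times \<open>\<epsilon>\<close> is below 1; one condition serves both rates and the
    continuation argument.\<close>
  define \<epsilon>1 where "\<epsilon>1 = 1 / (\<Theta> \<gamma>0 \<beta>0 + \<Theta> \<gamma> \<beta> + \<Xi>)"
  have den: "0 < \<Theta> \<gamma>0 \<beta>0 + \<Theta> \<gamma> \<beta> + \<Xi>" using Th[OF g0(1) b0(1)] Th[OF g(1) beta(1)] Xi by linarith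
  \<comment> \<open>The summands in the bracket account for \<open>u\<close>, \<open>S u\<close>,
    \<open>A u\<close> and \<open>S v\<close>, all controlled by \<open>C1\<close>; the norm of
    \<open>v\<close> is controlled by \<open>C2\<close>.\<close>
  define C where "C = (1 / \<nu>\<^sup>2 + 1 / \<nu> + 1 + M) * C1 \<gamma> + C2 \<gamma>"
  have C0: "0 \<le> C" unfolding C_def using C10[OF g(1)] C20[OF g(1)] M nu_pos by (intro add_nonneg_nonneg mult_nonneg_nonneg) auto
  have one: "(1::real) \<le> 1" by simp
  have sol: "\<exists>u. kirchhoff_solution D A m p u0 u1 \<epsilon> u \<and>
     (\<forall>t\<ge>0. Gamma_energy D A \<epsilon> u t \<le> C * exp (- \<beta> * rate_primitive K p t) / (rate_weight 1 p t)\<^sup>2)"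
    if eps: "0 < \<epsilon>" "\<epsilon> < \<epsilon>1" for \<epsilon>
  proof -
    have "\<epsilon> * (\<Theta> \<gamma>0 \<beta>0 + \<Theta> \<gamma> \<beta> + \<Xi>) < 1" using eps(2) den by (simp add: \<epsilon>1_def less_divide_eq)
    then have sm: "\<epsilon> * x < 1" if "x \<le> \<Theta> \<gamma>0 \<beta>0 + \<Theta> \<gamma> \<beta> + \<Xi>" for x using mult_left_mono[OF that, of \<epsilon>] eps(1) by linarith
    have s1: "\<epsilon> * \<Theta> \<gamma>0 \<beta>0 \<le> 1" using Th[OF g(1) beta(1)] Xi by (intro less_imp_le sm) linarith
    have s2: "\<epsilon> * \<Theta> \<gamma> \<beta> \<le> 1" using Th[OF g0(1) b0(1)] Xi by (intro less_imp_le sm) linarith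
    have s3: "\<epsilon> * \<Xi> < 1" using Th[OF g0(1) b0(1)] Th[OF g(1) beta(1)] by (intro sm) linarith
    have e1: "\<epsilon> \<le> 1" using mult_left_mono[OF Th[OF g(1) beta(1)], of \<epsilon>] eps s2 by linarith
    have "\<forall>n. \<exists>u v w. truncated_solution D DS A S P \<nu> n mR \<mu> M L \<epsilon> (rate_weight 1 p) (rate_weight' 1 p) u v w \<and> u 0 = P n u0 \<and> v 0 = P n u1"
      by (intro allI truncated_solution_exists[OF mR1 mR2 mRL m(3) L(1) eps(1) mR3 R(1) rate_weight_pos[OF one p]
          rate_weight_le_1[OF one p] rate_weight'_nonpos[OF one p] rate_weight_derivative[OF one p]])
    then obtain U V W where ts: "\<And>n. truncated_solution D DS A S P \<nu> n mR \<mu> M L \<epsilon> (rate_weight 1 p) (rate_weight' 1 p) (U n) (V n) (W n)"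
      and init: "\<And>n. U n 0 = P n u0" "\<And>n. V n 0 = P n u1" by metis
    \<comment> \<open>Obtained with the parameters \<open>\<beta>0\<close>,
      \<open>\<gamma>0\<close>, \<open>K0\<close>. Once the rate condition is known for all times,
      \<open>truncated_decay\<close> can be reused with the wanted \<open>\<beta>\<close>.\<close>
    have rate: "2 * \<epsilon> * L * (norm (A (U n t)) * norm (V n t)) \<le> \<mu> * rate_weight 1 p t" if "0 \<le> t" for n t
      by (rule less_imp_le[OF truncated_rate[OF ts init u0 u1 p g0(2) b0(1) g0(1) b0(3) g0(3) s1[unfolded \<Theta>_def]
          E_def C1_def C2_def s3[unfolded \<Xi>_def] that]])
    interpret gs: galerkin_sequence D DS A S P \<nu> mR \<mu> M L \<epsilon> "rate_weight 1 p" "rate_weight' 1 p" u0 u1 U V W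
      by (rule galerkin_sequence.intro[OF coercive_sqrt_axioms], rule galerkin_sequence_axioms.intro)
         (fact ts init u0 u1 rate)+
    obtain u v w where lim: "\<And>t. 0 \<le> t \<Longrightarrow> u t \<in> D" "\<And>t. 0 \<le> t \<Longrightarrow> v t \<in> DS"
      "\<And>t. 0 \<le> t \<Longrightarrow> (u has_vector_derivative v t) (at t within {0..})"
      "\<And>t. 0 \<le> t \<Longrightarrow> ((\<lambda>t. S (u t)) has_vector_derivative S (v t)) (at t within {0..})"
      "\<And>t. 0 \<le> t \<Longrightarrow> (v has_vector_derivative w t) (at t within {0..})"
      "continuous_on {0..} (\<lambda>t. A (u t))" "continuous_on {0..} (\<lambda>t. S (v t))" "continuous_on {0..} w"
      "\<And>t. 0 \<le> t \<Longrightarrow> \<epsilon> *\<^sub>R w t + rate_weight 1 p t *\<^sub>R v t + mR ((norm (S (u t)))\<^sup>2) *\<^sub>R A (u t) = 0"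
      "u 0 = u0" "v 0 = u1"
      and conv: "\<And>t. 0 \<le> t \<Longrightarrow> (\<lambda>n. A (U n t)) \<longlonglongrightarrow> A (u t)" "\<And>t. 0 \<le> t \<Longrightarrow> (\<lambda>n. V n t) \<longlonglongrightarrow> v t"
      "\<And>t. 0 \<le> t \<Longrightarrow> (\<lambda>n. S (V n t)) \<longlonglongrightarrow> S (v t)"
      by (rule gs.limit_solution, rule that, assumption+)
    have AE: "(norm (A (u t)))\<^sup>2 \<le> E" if t: "0 \<le> t" for t
    proof (rule LIMSEQ_le_const2[OF tendsto_power[OF tendsto_norm[OF conv(1)[OF t]]]])
      have "(norm (A (U n t)))\<^sup>2 \<le> E" for n
      proof -
        have "(norm (A (U n t)))\<^sup>2 \<le> (norm (A u0))\<^sup>2 + \<epsilon> / \<mu> * (norm (S u1))\<^sup>2"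
          using gs.F_bound(1)[OF t, of 0 0 n] by (simp add: gs.sol.Z_def gs.E0_def)
        also have "\<epsilon> / \<mu> * (norm (S u1))\<^sup>2 \<le> 1 / \<mu> * (norm (S u1))\<^sup>2"
          using e1 m(3) by (intro mult_right_mono divide_right_mono) auto
        finally show ?thesis by (simp add: E_def)
      qed
      then show "\<exists>N. \<forall>n\<ge>N. (norm (A (U n t)))\<^sup>2 \<le> E" by blast
    qed
    \<comment> \<open>The energy bound keeps the argument where clipping has no effect, so the limit
      solves the original equation.\<close>
    have mRm: "mR ((norm (S (u t)))\<^sup>2) = m ((norm (S (u t)))\<^sup>2)" if t: "0 \<le> t" for t
    proof (rule mR4)
      have "(norm (S (u t)))\<^sup>2 \<le> (norm (A (u t)))\<^sup>2 / \<nu>" by (rule S_le_A[OF lim(1)[OF t]])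
      also have "\<dots> \<le> R\<^sup>2" unfolding R(2) using AE[OF t] nu_pos by (intro divide_right_mono) auto
      finally show "(norm (S (u t)))\<^sup>2 \<le> R\<^sup>2" .
    qed simp
    have eq: "\<epsilon> *\<^sub>R w t + rate_weight 1 p t *\<^sub>R v t + m ((norm (S (u t)))\<^sup>2) *\<^sub>R A (u t) = 0" if "0 \<le> t" for t
      using lim(9)[OF that] unfolding mRm[OF that] .
    have ks: "kirchhoff_solution D A m p u0 u1 \<epsilon> u" "\<And>t. 0 \<le> t \<Longrightarrow> dt u t = v t"
      by (rule kirchhoff_solutionI[OF lim(1-8) eq lim(10,11)], assumption+)+
    have "Gamma_energy D A \<epsilon> u t \<le> C * exp (- \<beta> * rate_primitive K p t) / (rate_weight 1 p t)\<^sup>2" if t: "0 \<le> t" for t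
    proof -
      let ?X = "exp (- \<beta> * rate_primitive K p t)" and ?b = "rate_weight 1 p t"
      have rate': "2 * \<epsilon> * L * (norm (A (U n s)) * norm (V n s)) \<le> \<mu> * rate_weight 1 p s" if "0 \<le> s" "s < t" for n s
        by (rule rate[OF that(1)])
      have dec: "(norm (A (U n t)))\<^sup>2 \<le> C1 \<gamma> * ?X" "\<epsilon> * (norm (S (V n t)))\<^sup>2 \<le> M * C1 \<gamma> * ?X"
        "(norm (V n t))\<^sup>2 \<le> C2 \<gamma> * ?X / ?b\<^sup>2" for n
        by (rule truncated_decay[OF ts[of n] init u0 u1 p g(2) beta(1) g(1,3) s2[unfolded \<Theta>_def] t rate'[of _ n] E_def C1_def C2_def], assumption+)+
      have a: "(norm (A (u t)))\<^sup>2 \<le> C1 \<gamma> * ?X"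
        by (rule LIMSEQ_le_const2[OF tendsto_power[OF tendsto_norm[OF conv(1)[OF t]]]]) (use dec(1) in blast)
      have s: "\<epsilon> * (norm (S (v t)))\<^sup>2 \<le> M * C1 \<gamma> * ?X"
        by (rule LIMSEQ_le_const2[OF tendsto_mult_left[OF tendsto_power[OF tendsto_norm[OF conv(3)[OF t]]]]]) (use dec(2) in blast)
      have v: "(norm (v t))\<^sup>2 \<le> C2 \<gamma> * ?X / ?b\<^sup>2"
        by (rule LIMSEQ_le_const2[OF tendsto_power[OF tendsto_norm[OF conv(2)[OF t]]]]) (use dec(3) in blast)
      have su: "(norm (S (u t)))\<^sup>2 \<le> (norm (A (u t)))\<^sup>2 / \<nu>" by (rule S_le_A[OF lim(1)[OF t]])
      have "(norm (u t))\<^sup>2 \<le> (norm (S (u t)))\<^sup>2 / \<nu>" by (rule norm_le_S[OF DDS[OF lim(1)[OF t]]])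
      also have "\<dots> \<le> (norm (A (u t)))\<^sup>2 / \<nu> / \<nu>" using su nu_pos by (intro divide_right_mono) auto
      finally have uu: "(norm (u t))\<^sup>2 \<le> (norm (A (u t)))\<^sup>2 / \<nu>\<^sup>2" by (simp add: power2_eq_square)
      have "(norm (u t))\<^sup>2 + (norm (S (u t)))\<^sup>2 + (norm (A (u t)))\<^sup>2 \<le> (1 / \<nu>\<^sup>2 + 1 / \<nu> + 1) * (norm (A (u t)))\<^sup>2"
        using uu su by (simp add: distrib_right)
      also have "\<dots> \<le> (1 / \<nu>\<^sup>2 + 1 / \<nu> + 1) * (C1 \<gamma> * ?X)"
        using a nu_pos by (intro mult_left_mono) auto
      finally have 1: "(norm (u t))\<^sup>2 + (norm (S (u t)))\<^sup>2 + (norm (A (u t)))\<^sup>2 + \<epsilon> * (norm (S (v t)))\<^sup>2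
         \<le> (1 / \<nu>\<^sup>2 + 1 / \<nu> + 1 + M) * C1 \<gamma> * ?X" using s by (simp add: algebra_simps)
      have b: "0 < ?b" "?b \<le> 1" using rate_weight_pos[OF one p t] rate_weight_le_1[OF one p t] by auto
      \<comment> \<open>Only the bound for \<open>v\<close> carries the inverse square of the
        damping; the other terms are enlarged to the same form.\<close>
      then have "1 \<le> 1 / ?b\<^sup>2" by (simp add: power_le_one)
      then have "(1 / \<nu>\<^sup>2 + 1 / \<nu> + 1 + M) * C1 \<gamma> * ?X * 1 \<le> (1 / \<nu>\<^sup>2 + 1 / \<nu> + 1 + M) * C1 \<gamma> * ?X * (1 / ?b\<^sup>2)"
        using C10[OF g(1)] M nu_pos by (intro mult_left_mono mult_nonneg_nonneg add_nonneg_nonneg) auto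
      then have 2: "(1 / \<nu>\<^sup>2 + 1 / \<nu> + 1 + M) * C1 \<gamma> * ?X + C2 \<gamma> * ?X / ?b\<^sup>2 \<le> C * ?X / ?b\<^sup>2"
        unfolding C_def by (simp add: distrib_right add_divide_distrib)
      have "Gamma_energy D A \<epsilon> u t = (norm (u t))\<^sup>2 + (norm (S (u t)))\<^sup>2 + (norm (A (u t)))\<^sup>2 + (norm (v t))\<^sup>2 + \<epsilon> * (norm (S (v t)))\<^sup>2"
        unfolding Gamma_energy_def S[symmetric] ks(2)[OF t] ..
      then show ?thesis using 1 2 v by linarith
    qed
    then show ?thesis using ks(1) by blast
  qed
  have "0 < \<epsilon>1" using den by (simp add: \<epsilon>1_def)
  then show ?thesis using g(2) C0 sol by (intro exI[of _ K] conjI exI[of _ C] exI[of _ \<epsilon>1]) auto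
qed

end

section \<open>Transfer to the hypotheses and the conclusion as stated\<close>

lemma dt_cong:
  assumes eq: "\<And>t. 0 \<le> t \<Longrightarrow> v t = u t" and t: "0 \<le> t"
  shows "dt v t = dt u t"
proof -
  have "(v has_vector_derivative f') (at t within {0..}) \<longleftrightarrow> (u has_vector_derivative f') (at t within {0..})" for f'
    using has_vector_derivative_transform[of t "{0..}" u v f'] has_vector_derivative_transform[of t "{0..}" v u f'] eq t by auto
  then show ?thesis unfolding dt_def vector_derivative_def by simp
qed

text \<open>Solutions are unique only on the half-line, and the energy there sees nothing else,
  since \<open>dt\<close> is a derivative within it.\<close>

lemma Gamma_energy_cong:
  assumes "\<And>t. 0 \<le> t \<Longrightarrow> v t = u t" and "0 \<le> t"
  shows "Gamma_energy D A \<epsilon> v t = Gamma_energy D A \<epsilon> u t"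
proof -
  have "dt v t = dt u t" by (rule dt_cong[OF assms])
  then show ?thesis unfolding Gamma_energy_def by (simp add: assms)
qed

lemma coercive_from_numerical_range:
  assumes sa: "self_adjoint_operator D A"
    and le: "ereal \<nu>0 \<le> (INF u\<in>{u\<in>D. norm u = 1}. ereal (A u \<bullet> u))" and x: "x \<in> D"
  shows "\<nu>0 * (x \<bullet> x) \<le> A x \<bullet> x"
proof (cases "x = 0")
  case True then show ?thesis by simp
next
  case False
  have lin: "subspace D" "A (c *\<^sub>R x) = c *\<^sub>R A x" for c
    using sa x unfolding self_adjoint_operator_def linear_operator_on_def by simp_all
  let ?y = "(1 / norm x) *\<^sub>R x"
  have "?y \<in> {u\<in>D. norm u = 1}" using subspace_mul[OF lin(1) x] False by simp
  then have "(INF u\<in>{u\<in>D. norm u = 1}. ereal (A u \<bullet> u)) \<le> ereal (A ?y \<bullet> ?y)" by (rule INF_lower)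
  with le have "ereal \<nu>0 \<le> ereal (A ?y \<bullet> ?y)" by (rule order_trans)
  then have "\<nu>0 \<le> A ?y \<bullet> ?y" by simp
  also have "\<dots> = (A x \<bullet> x) / (x \<bullet> x)" unfolding lin(2) by (simp add: dot_square_norm power2_eq_square)
  finally show ?thesis using False by (simp add: pos_le_divide_eq)
qed

lemma kirchhoff_exists:
  assumes "self_adjoint_operator D A" "0 < \<nu>0"
    and "ereal \<nu>0 \<le> (INF u\<in>{u\<in>D. norm u = 1}. ereal (A u \<bullet> u))"
  shows "\<exists>P. kirchhoff D (op_sqrt_dom D A) A (op_sqrt D A) P \<nu>0"
proof -
  have "coercive_operator D A \<nu>0"
    by (rule coercive_operator.intro[OF assms(1,2) coercive_from_numerical_range[OF assms(1,3)]])
  from coercive_operator.coercive_sqrt_exists[OF this]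
  obtain P where "coercive_sqrt D (op_sqrt_dom D A) A (op_sqrt D A) P \<nu>0" by blast
  then have "kirchhoff D (op_sqrt_dom D A) A (op_sqrt D A) P \<nu>0"
    by (intro kirchhoff.intro kirchhoff_axioms.intro refl)
  then show ?thesis by blast
qed

text \<open>The infimum \<open>\<nu>\<close> is infinite when \<open>D\<close> contains no unit
  vector, so a finite coercivity constant has to be selected, large enough for the threshold on
  \<open>\<beta>\<close>.\<close>

lemma real_below_ereal:
  assumes "0 < \<mu>" "0 < \<nu>" "ereal \<beta> < 2 * ereal \<mu> * \<nu>"
  shows "\<exists>\<nu>0>0. ereal \<nu>0 \<le> \<nu> \<and> \<beta> < 2 * \<mu> * \<nu>0"
proof (cases \<nu>)
  case (real r)
  have "2 * ereal \<mu> * \<nu> = ereal (2 * \<mu> * r)" using real by simp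
  then show ?thesis using assms real by (intro exI[of _ r]) auto
next
  case PInf
  have "\<beta> < 2 * \<mu> * ((\<bar>\<beta>\<bar> + 1) / \<mu>)" using assms(1) by simp
  moreover have "0 < (\<bar>\<beta>\<bar> + 1) / \<mu>" using assms(1) by simp
  ultimately show ?thesis using PInf by (intro exI[of _ "(\<bar>\<beta>\<bar> + 1) / \<mu>"]) auto
next
  case MInf then show ?thesis using assms by simp
qed

theorem theorem2p2:
  fixes D :: "'h::{real_inner,complete_space} set" and A :: "'h \<Rightarrow> 'h"
    and u0 u1 :: 'h and p \<mu> :: real and \<nu> :: ereal and m :: "real \<Rightarrow> real"
  assumes "self_adjoint_operator D A"
    and "u0 \<in> D" and "u1 \<in> op_sqrt_dom D A"
    and "0 \<le> p" and "p \<le> 1"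
    and "\<And>\<sigma>. \<sigma> \<ge> 0 \<Longrightarrow> m \<sigma> > 0" and "locally_lipschitz_on {0..} m"
    and "\<mu> = (INF \<sigma>\<in>{0..}. m \<sigma>)" and "\<mu> > 0"
    and "\<nu> = (INF u\<in>{u\<in>D. norm u = 1}. ereal (A u \<bullet> u))" and "\<nu> > 0"
  shows "\<exists>\<epsilon>0>0. \<exists>u :: real \<Rightarrow> real \<Rightarrow> 'h.
    (\<forall>\<epsilon>\<in>{0<..<\<epsilon>0}.
       kirchhoff_solution D A m p u0 u1 \<epsilon> (u \<epsilon>) \<and>
       (\<forall>v. kirchhoff_solution D A m p u0 u1 \<epsilon> v \<longrightarrow> (\<forall>t\<ge>0. v t = u \<epsilon> t))) \<and>
    (p = 0 \<longrightarrow> (\<forall>\<beta>::real. ereal \<beta> < 2 * ereal \<mu> * \<nu> \<longrightarrow>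
       (\<exists>\<epsilon>1\<in>{0<..\<epsilon>0}. \<exists>C. \<forall>\<epsilon>\<in>{0<..<\<epsilon>1}. \<forall>t\<ge>0.
          Gamma_energy D A \<epsilon> (u \<epsilon>) t \<le> C * exp (- \<beta> * t)))) \<and>
    (0 < p \<and> p < 1 \<longrightarrow> (\<forall>\<beta>>0.
       (\<exists>\<epsilon>1\<in>{0<..\<epsilon>0}. \<exists>C. \<forall>\<epsilon>\<in>{0<..<\<epsilon>1}. \<forall>t\<ge>0.
          Gamma_energy D A \<epsilon> (u \<epsilon>) t \<le> C * exp (- \<beta> * (1 + t) powr (1 - p))))) \<and>
    (p = 1 \<longrightarrow> (\<forall>\<beta>>0.
       (\<exists>\<epsilon>1\<in>{0<..\<epsilon>0}. \<exists>C. \<forall>\<epsilon>\<in>{0<..<\<epsilon>1}. \<forall>t\<ge>0.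
          Gamma_energy D A \<epsilon> (u \<epsilon>) t \<le> C / (1 + t) powr \<beta>)))"
proof -
  let ?sol = "kirchhoff_solution D A m p u0 u1"
  note p = assms(4,5)
  have mu: "\<mu> \<le> m \<sigma>" if "0 \<le> \<sigma>" for \<sigma>
  proof -
    have "bdd_below (m ` {0..})" by (rule bdd_belowI2[of _ 0]) (use assms(6) in \<open>simp add: less_imp_le\<close>)
    then show ?thesis unfolding assms(8) using that by (intro cINF_lower) auto
  qed
  have mn: "0 < 2 * ereal \<mu> * \<nu>" using assms(9,11) by (cases \<nu>) auto
  have decay: "\<exists>K\<ge>1. \<exists>C\<ge>0. \<exists>\<epsilon>1>0. \<forall>\<epsilon>\<in>{0<..<\<epsilon>1}. \<exists>u. ?sol \<epsilon> u \<and>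
     (\<forall>t\<ge>0. Gamma_energy D A \<epsilon> u t \<le> C * exp (- \<beta> * rate_primitive K p t) / (rate_weight 1 p t)\<^sup>2)"
    if \<beta>: "0 \<le> \<beta>" "p = 0 \<Longrightarrow> ereal \<beta> < 2 * ereal \<mu> * \<nu>" for \<beta>
  proof -
    have "ereal (if p = 0 then \<beta> else 0) < 2 * ereal \<mu> * \<nu>" using \<beta>(2) mn by (simp add: zero_ereal_def)
    from real_below_ereal[OF assms(9,11) this]
    obtain \<nu>0 where n: "0 < \<nu>0" "ereal \<nu>0 \<le> \<nu>" "(if p = 0 then \<beta> else 0) < 2 * \<mu> * \<nu>0" by blast
    obtain P where P: "kirchhoff D (op_sqrt_dom D A) A (op_sqrt D A) P \<nu>0"
      using kirchhoff_exists[OF assms(1) n(1) n(2)[unfolded assms(10)]] by blast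
    have b: "p = 0 \<Longrightarrow> \<beta> < 2 * \<mu> * \<nu>0" using n(3) by simp
    show ?thesis by (rule kirchhoff.global_solution_decay[OF P assms(2,3) p assms(7) mu assms(9) \<beta>(1) b])
  qed
  have unique: "v t = u t" if "0 < \<epsilon>" "?sol \<epsilon> u" "?sol \<epsilon> v" "0 \<le> t" for \<epsilon> u v t
  proof -
    obtain \<nu>0 where n: "0 < \<nu>0" "ereal \<nu>0 \<le> \<nu>"
      using real_below_ereal[OF assms(9,11), of 0] mn by (auto simp: zero_ereal_def)
    obtain P where P: "kirchhoff D (op_sqrt_dom D A) A (op_sqrt D A) P \<nu>0"
      using kirchhoff_exists[OF assms(1) n(1) n(2)[unfolded assms(10)]] by blast
    show ?thesis by (rule kirchhoff.kirchhoff_unique[OF P assms(7) mu assms(9) that])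
  qed
  \<comment> \<open>Existence is read off from the rate 0, which is admissible for every
    \<open>p\<close>.\<close>
  obtain \<epsilon>0 where e0: "0 < \<epsilon>0" "\<And>\<epsilon>. \<epsilon> \<in> {0<..<\<epsilon>0} \<Longrightarrow> \<exists>u. ?sol \<epsilon> u"
    using decay[of 0] mn by (force simp: zero_ereal_def)
  \<comment> \<open>Chosen before any \<open>\<beta>\<close>, so that one family of solutions
    carries all decay rates.\<close>
  define u where "u \<epsilon> = (SOME u. ?sol \<epsilon> u)" for \<epsilon>
  have u: "?sol \<epsilon> (u \<epsilon>)" if "\<epsilon> \<in> {0<..<\<epsilon>0}" for \<epsilon> unfolding u_def by (rule someI_ex[OF e0(2)[OF that]])
  \<comment> \<open>Each \<open>\<beta>\<close> comes with its own solutions; uniqueness identifies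
    them with the fixed family for \<open>\<epsilon>\<close> below both bounds.\<close>
  have rate: "\<exists>K\<ge>1. \<exists>C\<ge>0. \<exists>\<epsilon>1\<in>{0<..\<epsilon>0}. \<forall>\<epsilon>\<in>{0<..<\<epsilon>1}. \<forall>t\<ge>0.
     Gamma_energy D A \<epsilon> (u \<epsilon>) t \<le> C * exp (- \<beta> * rate_primitive K p t) / (rate_weight 1 p t)\<^sup>2"
    if \<beta>: "0 \<le> \<beta>" "p = 0 \<Longrightarrow> ereal \<beta> < 2 * ereal \<mu> * \<nu>" for \<beta>
  proof -
    obtain K C \<epsilon>1 where K: "1 \<le> K" "0 \<le> C" "0 < \<epsilon>1" and ex: "\<forall>\<epsilon>\<in>{0<..<\<epsilon>1}. \<exists>u. ?sol \<epsilon> u \<and>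
     (\<forall>t\<ge>0. Gamma_energy D A \<epsilon> u t \<le> C * exp (- \<beta> * rate_primitive K p t) / (rate_weight 1 p t)\<^sup>2)"
      using decay[OF \<beta>] by blast
    have "Gamma_energy D A \<epsilon> (u \<epsilon>) t \<le> C * exp (- \<beta> * rate_primitive K p t) / (rate_weight 1 p t)\<^sup>2"
      if eps: "\<epsilon> \<in> {0<..<min \<epsilon>0 \<epsilon>1}" and t: "0 \<le> t" for \<epsilon> t
    proof -
      have "\<epsilon> \<in> {0<..<\<epsilon>1}" using eps by simp
      from bspec[OF ex this] obtain v where "?sol \<epsilon> v \<and>
        (\<forall>t\<ge>0. Gamma_energy D A \<epsilon> v t \<le> C * exp (- \<beta> * rate_primitive K p t) / (rate_weight 1 p t)\<^sup>2)" by (rule exE)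
      note v = conjunct1[OF this] conjunct2[OF this]
      have pos: "0 < \<epsilon>" and e: "\<epsilon> \<in> {0<..<\<epsilon>0}" using eps by auto
      have "Gamma_energy D A \<epsilon> (u \<epsilon>) t = Gamma_energy D A \<epsilon> v t"
      proof (rule Gamma_energy_cong[OF _ t])
        fix s :: real assume "0 \<le> s"
        then show "u \<epsilon> s = v s" by (rule unique[OF pos v(1) u[OF e]])
      qed
      then show ?thesis using v(2)[rule_format, OF t] by simp
    qed
    then have "\<forall>\<epsilon>\<in>{0<..<min \<epsilon>0 \<epsilon>1}. \<forall>t\<ge>0.
        Gamma_energy D A \<epsilon> (u \<epsilon>) t \<le> C * exp (- \<beta> * rate_primitive K p t) / (rate_weight 1 p t)\<^sup>2" by blast
    moreover have "min \<epsilon>0 \<epsilon>1 \<in> {0<..\<epsilon>0}" using K(3) e0(1) by simp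
    ultimately show ?thesis using K(1,2) by blast
  qed
  have p0: "\<exists>\<epsilon>1\<in>{0<..\<epsilon>0}. \<exists>C. \<forall>\<epsilon>\<in>{0<..<\<epsilon>1}. \<forall>t\<ge>0. Gamma_energy D A \<epsilon> (u \<epsilon>) t \<le> C * exp (- \<beta> * t)"
    if p0: "p = 0" and b: "ereal \<beta> < 2 * ereal \<mu> * \<nu>" for \<beta>
  proof -
    \<comment> \<open>Here \<open>\<beta>\<close> may be negative, whereas \<open>rate\<close>
      requires a nonnegative exponent.\<close>
    have "ereal (max \<beta> 0) < 2 * ereal \<mu> * \<nu>" using b mn by (simp add: max_def zero_ereal_def)
    then obtain K C \<epsilon>1 where K: "1 \<le> K" "0 \<le> C" "\<epsilon>1 \<in> {0<..\<epsilon>0}" and G: "\<forall>\<epsilon>\<in>{0<..<\<epsilon>1}. \<forall>t\<ge>0.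
        Gamma_energy D A \<epsilon> (u \<epsilon>) t \<le> C * exp (- max \<beta> 0 * rate_primitive K p t) / (rate_weight 1 p t)\<^sup>2"
      using rate[of "max \<beta> 0"] by auto
    have bound: "C * exp (- max \<beta> 0 * rate_primitive K p t) / (rate_weight 1 p t)\<^sup>2 \<le> C * exp (- \<beta> * t)" if t: "0 \<le> t" for t
    proof -
      have "\<beta> * t \<le> max \<beta> 0 * t" using t by (intro mult_right_mono) auto
      then have "C * exp (- max \<beta> 0 * t) \<le> C * exp (- \<beta> * t)" using K(2) by (intro mult_left_mono) auto
      then show ?thesis using t K(1) by (simp add: rate_primitive_def rate_weight_def p0)
    qed
    show ?thesis
    proof (intro bexI[OF _ K(3)] exI[of _ "C"] ballI allI impI)
      fix \<epsilon> t :: real assume "\<epsilon> \<in> {0<..<\<epsilon>1}" and t: "0 \<le> t"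
      note G[rule_format, OF this(1) t]
      also note bound[OF t]
      finally show "Gamma_energy D A \<epsilon> (u \<epsilon>) t \<le> C * exp (- \<beta> * t)" .
    qed
  qed
  have p1: "\<exists>\<epsilon>1\<in>{0<..\<epsilon>0}. \<exists>C. \<forall>\<epsilon>\<in>{0<..<\<epsilon>1}. \<forall>t\<ge>0. Gamma_energy D A \<epsilon> (u \<epsilon>) t \<le> C * exp (- \<beta> * (1 + t) powr (1 - p))"
    if pp: "0 < p" "p < 1" and b: "0 < \<beta>" for \<beta>
  proof -
    \<comment> \<open>The factor \<open>1 - p\<close> converts the primitive into
      \<open>(1 + t) powr (1 - p)\<close> up to a constant, and the 2 pays for the inverse square of
      the damping.\<close>
    have "0 \<le> \<beta> * (1 - p) + 2" using pp b by simp
    then obtain K C \<epsilon>1 where K: "1 \<le> K" "0 \<le> C" "\<epsilon>1 \<in> {0<..\<epsilon>0}" and G: "\<forall>\<epsilon>\<in>{0<..<\<epsilon>1}. \<forall>t\<ge>0.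
        Gamma_energy D A \<epsilon> (u \<epsilon>) t \<le> C * exp (- (\<beta> * (1 - p) + 2) * rate_primitive K p t) / (rate_weight 1 p t)\<^sup>2"
      using rate[of "\<beta> * (1 - p) + 2"] pp by blast
    let ?C = "C * K\<^sup>2 * exp (\<beta> * K powr (1 - p))"
    have bound: "C * exp (- (\<beta> * (1 - p) + 2) * rate_primitive K p t) / (rate_weight 1 p t)\<^sup>2 \<le> ?C * exp (- \<beta> * (1 + t) powr (1 - p))" if t: "0 \<le> t" for t
    proof -
      note exp_rate_absorbs_weight[OF K(1) p t K(2), of "\<beta> * (1 - p)"]
      also have "C * K\<^sup>2 * exp (- (\<beta> * (1 - p)) * rate_primitive K p t)
          \<le> C * K\<^sup>2 * (exp (\<beta> * K powr (1 - p)) * exp (- \<beta> * (1 + t) powr (1 - p)))"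
        using K(2) b by (intro mult_left_mono exp_rate_primitive_stretched[OF K(1) p t pp(2)]) auto
      finally show ?thesis by (simp only: mult.assoc)
    qed
    show ?thesis
    proof (intro bexI[OF _ K(3)] exI[of _ "?C"] ballI allI impI)
      fix \<epsilon> t :: real assume "\<epsilon> \<in> {0<..<\<epsilon>1}" and t: "0 \<le> t"
      note G[rule_format, OF this(1) t]
      also note bound[OF t]
      finally show "Gamma_energy D A \<epsilon> (u \<epsilon>) t \<le> ?C * exp (- \<beta> * (1 + t) powr (1 - p))" .
    qed
  qed
  have p2: "\<exists>\<epsilon>1\<in>{0<..\<epsilon>0}. \<exists>C. \<forall>\<epsilon>\<in>{0<..<\<epsilon>1}. \<forall>t\<ge>0. Gamma_energy D A \<epsilon> (u \<epsilon>) t \<le> C / (1 + t) powr \<beta>"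
    if pp: "p = 1" and b: "0 < \<beta>" for \<beta>
  proof -
    \<comment> \<open>Again two units are reserved for the weight; the primitive is now logarithmic,
      so the rest becomes a power of \<open>1 + t\<close>.\<close>
    have "0 \<le> \<beta> + 2" using b by simp
    then obtain K C \<epsilon>1 where K: "1 \<le> K" "0 \<le> C" "\<epsilon>1 \<in> {0<..\<epsilon>0}" and G: "\<forall>\<epsilon>\<in>{0<..<\<epsilon>1}. \<forall>t\<ge>0.
        Gamma_energy D A \<epsilon> (u \<epsilon>) t \<le> C * exp (- (\<beta> + 2) * rate_primitive K p t) / (rate_weight 1 p t)\<^sup>2"
      using rate[of "\<beta> + 2"] pp by auto
    let ?C = "C * K\<^sup>2 * K powr \<beta>"
    have bound: "C * exp (- (\<beta> + 2) * rate_primitive K p t) / (rate_weight 1 p t)\<^sup>2 \<le> ?C / (1 + t) powr \<beta>" if t: "0 \<le> t" for t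
    proof -
      note exp_rate_absorbs_weight[OF K(1) p t K(2), of \<beta>]
      also have "C * K\<^sup>2 * exp (- \<beta> * rate_primitive K p t) \<le> C * K\<^sup>2 * (K powr \<beta> / (1 + t) powr \<beta>)"
        unfolding pp using K(2) b by (intro mult_left_mono exp_rate_primitive_power[OF K(1) t]) auto
      finally show ?thesis by simp
    qed
    show ?thesis
    proof (intro bexI[OF _ K(3)] exI[of _ "?C"] ballI allI impI)
      fix \<epsilon> t :: real assume "\<epsilon> \<in> {0<..<\<epsilon>1}" and t: "0 \<le> t"
      note G[rule_format, OF this(1) t]
      also note bound[OF t]
      finally show "Gamma_energy D A \<epsilon> (u \<epsilon>) t \<le> ?C / (1 + t) powr \<beta>" .
    qed
  qed
  show ?thesis
  proof (rule exI[of _ \<epsilon>0], rule conjI[OF e0(1)], rule exI[of _ u], intro conjI ballI allI impI)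
    fix \<epsilon> assume eps: "\<epsilon> \<in> {0<..<\<epsilon>0}"
    show "?sol \<epsilon> (u \<epsilon>)" by (rule u[OF eps])
    fix v t assume "?sol \<epsilon> v" "0 \<le> (t::real)"
    then show "v t = u \<epsilon> t" using unique[OF _ u[OF eps]] eps by simp
  qed (use p0 p1 p2 in blast)+
qed

end
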